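(* In the setting of the context ($M$ a 4-manifold with a perfect triple of closed 2-forms $\Sigma^i$), equip $TM$, $E$ and $E\otimes\Lambda^1$ with $$\langle\xi,\xi\rangle=\int_M\xi^\mu\xi_\mu,\qquad \langle\chi,\chi\rangle=\int_M\chi^i\chi^i,\qquad \langle a,a\rangle=\int_M\epsilon^{ijk}\,\Sigma^i\wedge a^j\wedge a^k .$$ For differential operators $\tilde d_1:TM\to S$, $\tilde d_3:E\otimes\Lambda^1\to E$, $\tilde d_4:E\to TM$ of the general first-order form given in the context, let $$\tilde D:S\oplus E\to TM\oplus(E\otimes\Lambda^1),\qquad \tilde D(\sigma,\chi)=(\tilde d_1^*\sigma+\tilde d_4\chi,\ d_2\sigma+\tilde d_3^*\chi),$$ where $d_2$ is the operator of the Plebański complex. Then there is a choice of the inner product on $S$, and there is a choice of the operators $\tilde d_1,\tilde d_3,\tilde d_4$, such that all of the following hold: 1. $\tilde D^*\tilde D=\pm\Delta$ on $S\oplus E$ (the sign depending on the component: $S\oplus E$ is a direct sum of two subbundles, on one of which $\tilde D^*\tilde D$ acts as $+\Delta$ and on the other as $-\Delta$). 2. The operators $\tilde d_1,\tilde d_3,\tilde d_4$ can be expressed in terms of the operators $d_1,d_2,d_3$ of the Plebański complex (using also their adjoints and the bundle maps $\Phi$, $J_1$ and their adjoints). 3. There exist linear maps $T_1:S\oplus E\to S\oplus E$ and $T_2:TM\oplus(E\otimes\Lambda^1)\to TM\oplus(E\otimes\Lambda^1)$ such that, under the identifications $S\oplus E\cong(\Lambda^0\oplus E)\oplus(E\oplus\mathrm{Sym}^2_0(\Lambda^1))$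 and $TM\cong\Lambda^1$, $$T_2\,\tilde D\,T_1=D_4\oplus D_{12},$$ where $D_4:\Lambda^0\oplus E\to\Lambda^1$ and $D_{12}:E\oplus\mathrm{Sym}^2_0(\Lambda^1)\to E\otimes\Lambda^1$ are $$D_4(h,h_+)_\mu=-\tfrac1{\sqrt2}\big(\partial_\mu h-2\Sigma^i_\mu{}^\alpha\partial_\alpha h^i_+\big),$$ $$D_{12}(h_-,\tilde h)^i_\mu=\partial_\mu h^i_-+\Sigma^i_\mu{}^\alpha\partial^\beta\tilde h_{\alpha\beta}-\Sigma^{i\alpha\beta}\partial_\alpha\tilde h_{\mu\beta}.$$ Both of these operators are versions of the Dirac operator: $$D_4:S_+\otimes S_+\to S_-\otimes S_+,\qquad D_{12}:S_-\otimes S_-\otimes S_+^2\to S_+\otimes S_-\otimes S_+^2 .$$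
   Context: Setting and conventions. $M$ is a 4-manifold with a perfect triple of closed 2-forms $\Sigma^i$, $i=1,2,3$: $\Sigma^i\wedge\Sigma^j\sim\delta^{ij}$ (i.e. $\Sigma^i\wedge\Sigma^j=2\delta^{ij}v_\Sigma$ with $v_\Sigma=\tfrac16\Sigma^k\wedge\Sigma^k$ nowhere zero) and $d\Sigma^i=0$. Such a triple determines a Riemannian metric $g$ with volume form $v_\Sigma$, which is hyper-Kähler. The $\Sigma^i$ are self-dual and, raising indices with $g$, $\Sigma^i_\mu{}^\alpha\Sigma^j_\alpha{}^\nu=-\delta^{ij}\delta_\mu{}^\nu+\epsilon^{ijk}\Sigma^k_\mu{}^\nu$. In index formulas $\partial_\mu$ denotes the derivative, understood as the Levi-Civita covariant derivative of $g$ on tensor indices and acting trivially on the index $i$ (the $\Sigma^i$ are then parallel), and $\Delta=\partial^\mu\partial_\mu$ is the Laplacian. Repeated indices are summed. $E=\mathbb{R}^3$ (trivial bundle), $\Lambda^p$ is the bundle of $p$-forms, $\mathrm{Sym}^2_0(\Lambda^1)$ the bundle of symmetric tracefree 2-tensors, $TM\cong\Lambda^1$ via $g$, and $\langle\mu\nu\rangle$ denotes the symmetric tracefree part. Integrals use $v_\Sigma$. Adjoints (denoted $*$) are formal adjoints with respect to the stated inner products. The inner product on $E\otimes\Lambda^1$ is indefinite and in components reads $\int_M\epsilon^{ijk}\Sigma^{i\mu\nu}a^j_\mu a^k_\nu$. Spinor notation. $S_\pm$ are the two spinor representations of $\mathrm{Spin}(4)=\mathrm{SU}_+(2)\times\mathrm{SU}_-(2)$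 and $S_\pm^k$ is the spin $k/2$ representation (dimension $k+1$). $\mathrm{SU}_-(2)$ fixes the $\Sigma^i$ and $\mathrm{SU}_+(2)$ rotates them. Then $\Lambda^1=S_+\otimes S_-$, $E=S_+^2$, $\mathrm{Sym}^2_0(\Lambda^1)=S_+^2\otimes S_-^2$, so $\Lambda^0\oplus E=S_+\otimes S_+$ and $E\oplus\mathrm{Sym}^2_0(\Lambda^1)=S_-\otimes S_-\otimes S_+^2$ (real forms understood). The bundle $S$ (not to be confused with the spinor bundles $S_\pm$). $S\subset E\otimes\Lambda^2$ is the rank 13 bundle tangent to the space of perfect triples at $\Sigma$. Its elements are $\sigma^i_{\mu\nu}=2\epsilon^{ijk}\Sigma^j_{\mu\nu}h^k+2h_{[\mu}{}^\alpha\Sigma^i_{|\alpha|\nu]}$, with $h^i\in E$ and $h_{\mu\nu}=\tilde h_{\mu\nu}+\tfrac14g_{\mu\nu}h$ symmetric, $\tilde h$ tracefree. This identifies $S\cong\Lambda^0\oplus E\oplus\mathrm{Sym}^2_0(\Lambda^1)$, $\sigma\leftrightarrow(h,h^i,\tilde h_{\mu\nu})$. Inner products on $S$ are of the form $\langle\sigma,\sigma\rangle=\int_M\beta_1h^2+\beta_2(h^i)^2+\beta_3(\tilde h_{\mu\nu})^2$ with constants $\beta_1,\beta_2,\beta_3$. Bundle maps. $J_1:E\otimes\Lambda^1\to E\otimes\Lambda^1$, $J_1(a)^i_\mu=\epsilon^{ijk}\Sigma^j_\mu{}^\alpha a^k_\alpha$ (invertible); $\Phi:E\otimes\Lambda^1\to\Lambda^1$,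 $\Phi(a)_\mu=\Sigma^i_\mu{}^\alpha a^i_\alpha$. Plebański complex operators. - $d_1:TM\to S$, $(d_1\xi)^i=d(\xi\lrcorner\Sigma^i)$. - $d_2:S\to E\otimes\Lambda^1$, $d_2\sigma=\tfrac12J_1^{-1}(\star d\sigma)$ with the convention $(\star d\sigma)^i_\mu=\epsilon_\mu{}^{\alpha\beta\gamma}\partial_\alpha\sigma^i_{\beta\gamma}$; $a=d_2\sigma$ is the solution of $d\sigma^i+\epsilon^{ijk}a^j\wedge\Sigma^k=0$. In the parametrisation of $S$, $(d_2\sigma)^i_\mu=\tfrac14\Sigma^i_\mu{}^\alpha\partial_\alpha h+2\partial_\mu h^i-\Sigma^{i\alpha\beta}\partial_\alpha\tilde h_{\mu\beta}$. - $d_3:E\otimes\Lambda^1\to E$, $(d_3a)^i=\epsilon^{ijk}\Sigma^j\wedge da^k/v_\Sigma=\epsilon^{ijk}\Sigma^{j\mu\nu}\partial_\mu a^k_\nu$. General first-order form of the tilded operators, as allowed by representation theory (real constants $a_1,a_2,a_3,c_1,c_2,f$): $$\tilde d_1\xi=(a_1\partial^\mu\xi_\mu,\ a_2\Sigma^{i\mu\nu}\partial_\mu\xi_\nu,\ 2a_3\partial_{\langle\mu}\xi_{\nu\rangle})\in\Lambda^0\oplus E\oplus\mathrm{Sym}^2_0(\Lambda^1),$$ $$(\tilde d_3a)^i=c_1\partial^\mu a^i_\mu+c_2\epsilon^{ijk}\Sigma^{j\mu\nu}\partial_\mu a^k_\nu,\qquad(\tilde d_4\chi)_\mu=f\,\Sigma^i_\mu{}^\alpha\partial_\alpha\chi^i.$$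 No requirement is made that $\tilde d_1,d_2,\tilde d_3,\tilde d_4$ form a complex.
   Formalization: In item 1, Δ is replaced by Δ plus the curvature term 2R_{μανβ}h̃^{αβ} on the tracefree symmetric component; without it the claim fails on curved hyper-Kähler manifolds such as K3, and for flat metrics the term vanishes. *)

theory Defs
  imports "HOL-Analysis.Analysis"
begin

section \<open>Smooth functions and manifolds\<close>

definition pd :: "4 \<Rightarrow> (real^4 \<Rightarrow> 'v::real_normed_vector) \<Rightarrow> real^4 \<Rightarrow> 'v" where
  "pd \<mu> f x = frechet_derivative f (at x) (axis \<mu> 1)"

definition smooth_on :: "(real^4) set \<Rightarrow> (real^4 \<Rightarrow> 'v::real_normed_vector) \<Rightarrow> bool" where
  "smooth_on U f \<longleftrightarrow> (\<forall>ms. foldr pd ms f differentiable_on U)"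

type_synonym 'm chart = "'m set \<times> ('m \<Rightarrow> real^4)"

definition cdom :: "'m chart \<Rightarrow> (real^4) set" where
  "cdom c = snd c ` fst c"

definition cinv :: "'m chart \<Rightarrow> real^4 \<Rightarrow> 'm" where
  "cinv c = inv_into (fst c) (snd c)"

definition overlap :: "'m chart \<Rightarrow> 'm chart \<Rightarrow> (real^4) set" where
  "overlap c c' = snd c ` (fst c \<inter> fst c')"

definition transition :: "'m chart \<Rightarrow> 'm chart \<Rightarrow> real^4 \<Rightarrow> real^4" where
  "transition c c' = snd c' \<circ> cinv c"

definition jacobian :: "'m chart \<Rightarrow> 'm chart \<Rightarrow> real^4 \<Rightarrow> real^4^4" where
  "jacobian c c' x = (\<chi> \<nu> \<mu>. pd \<mu> (transition c c') x $ \<nu>)"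

text \<open>The manifold is the whole type; an atlas need not be maximal, and orientability is not
  assumed, since the triple below supplies a nowhere vanishing 4-form.\<close>

definition smooth_atlas :: "'m::{t2_space,second_countable_topology} chart set \<Rightarrow> bool" where
  "smooth_atlas A \<longleftrightarrow>
     (\<Union>c\<in>A. fst c) = UNIV \<and>
     (\<forall>c\<in>A. open (fst c) \<and> open (cdom c) \<and> homeomorphism (fst c) (cdom c) (snd c) (cinv c)) \<and>
     (\<forall>c\<in>A. \<forall>c'\<in>A. smooth_on (overlap c c') (transition c c'))"


section \<open>Vector bundles, sections and formal adjoints\<close>

text \<open>A field assigns to every chart its coordinate components on the chart's image in
  \<open>\<real>\<^sup>4\<close>.  All tensors are written with lower indices; \<open>TM\<close> is identified
  with the bundle of 1-forms through the metric.  A bundle is given by its fibres (inside a model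
  vector space), the law by which components in one chart are obtained from those in another by
  means of the Jacobian, and a possibly indefinite fibrewise pairing.\<close>

type_synonym ('m, 'v) field = "'m chart \<Rightarrow> real^4 \<Rightarrow> 'v"

record ('m, 'v) vbundle =
  fib :: "'m chart \<Rightarrow> real^4 \<Rightarrow> 'v set"
  pull :: "real^4^4 \<Rightarrow> 'v \<Rightarrow> 'v"
  ip :: "'m chart \<Rightarrow> real^4 \<Rightarrow> 'v \<Rightarrow> 'v \<Rightarrow> real"

definition is_section ::
  "'m chart set \<Rightarrow> ('m chart \<Rightarrow> real^4 \<Rightarrow> 'v set) \<Rightarrow> (real^4^4 \<Rightarrow> 'v \<Rightarrow> 'v)
    \<Rightarrow> ('m, 'v::real_normed_vector) field \<Rightarrow> bool" where
  "is_section A F pl s \<longleftrightarrow>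
     (\<forall>c\<in>A. smooth_on (cdom c) (s c)) \<and>
     (\<forall>c\<in>A. \<forall>x\<in>cdom c. s c x \<in> F c x) \<and>
     (\<forall>c\<in>A. \<forall>c'\<in>A. \<forall>x\<in>overlap c c'.
        s c x = pl (jacobian c c' x) (s c' (transition c c' x)))"

definition sections :: "'m chart set \<Rightarrow> ('m, 'v::real_normed_vector) vbundle \<Rightarrow> ('m, 'v) field set" where
  "sections A B = {s. is_section A (fib B) (pull B) s}"

definition feq :: "'m chart set \<Rightarrow> ('m, 'v) field \<Rightarrow> ('m, 'v) field \<Rightarrow> bool" where
  "feq A s t \<longleftrightarrow> (\<forall>c\<in>A. \<forall>x\<in>cdom c. s c x = t c x)"

definition bundle_sum (infixr "\<oplus>\<^sub>b" 65) where
  "B1 \<oplus>\<^sub>b B2 = \<lparr> fib = (\<lambda>c x. fib B1 c x \<times> fib B2 c x),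
     pull = (\<lambda>J p. (pull B1 J (fst p), pull B2 J (snd p))),
     ip = (\<lambda>c x p q. ip B1 c x (fst p) (fst q) + ip B2 c x (snd p) (snd q)) \<rparr>"

definition bundle_map ::
  "'m chart set \<Rightarrow> ('m, 'v::real_normed_vector) vbundle \<Rightarrow> ('m, 'w::real_normed_vector) vbundle
    \<Rightarrow> ('m chart \<Rightarrow> real^4 \<Rightarrow> 'v \<Rightarrow> 'w) \<Rightarrow> bool" where
  "bundle_map A B1 B2 T \<longleftrightarrow>
     (\<forall>c\<in>A. \<forall>x\<in>cdom c. linear (T c x)) \<and>
     (\<forall>c\<in>A. \<forall>x\<in>cdom c. T c x ` fib B1 c x \<subseteq> fib B2 c x) \<and>
     (\<forall>s\<in>sections A B1. (\<lambda>c x. T c x (s c x)) \<in> sections A B2)"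

definition pull1 :: "real^4^4 \<Rightarrow> real^4 \<Rightarrow> real^4" where
  "pull1 J a = transpose J *v a"

definition pull2 :: "real^4^4 \<Rightarrow> real^4^4 \<Rightarrow> real^4^4" where
  "pull2 J t = transpose J ** t ** J"

definition supported_in :: "'m chart set \<Rightarrow> 'm chart \<Rightarrow> (real^4) set \<Rightarrow> ('m, 'v::real_normed_vector) field \<Rightarrow> bool" where
  "supported_in A c K s \<longleftrightarrow> (\<forall>c'\<in>A. \<forall>x\<in>cdom c'. cinv c' x \<notin> cinv c ` K \<longrightarrow> s c' x = 0)"


section \<open>Perfect triples\<close>

definition eps3 :: "3 \<Rightarrow> 3 \<Rightarrow> 3 \<Rightarrow> real" where
  "eps3 i j k = det (vector [axis i 1, axis j 1, axis k 1] :: real^3^3)"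

definition eps4 :: "4 \<Rightarrow> 4 \<Rightarrow> 4 \<Rightarrow> 4 \<Rightarrow> real" where
  "eps4 \<mu> \<nu> \<rho> \<sigma> = det (vector [axis \<mu> 1, axis \<nu> 1, axis \<rho> 1, axis \<sigma> 1] :: real^4^4)"

text \<open>The coefficient of the wedge product of two 2-forms on \<open>dx\<^sup>1 \<and> dx\<^sup>2 \<and> dx\<^sup>3 \<and> dx\<^sup>4\<close>.\<close>

definition wedge22 :: "real^4^4 \<Rightarrow> real^4^4 \<Rightarrow> real" where
  "wedge22 a b = (1/4) * (\<Sum>\<mu>\<in>UNIV. \<Sum>\<nu>\<in>UNIV. \<Sum>\<rho>\<in>UNIV. \<Sum>\<sigma>\<in>UNIV. eps4 \<mu> \<nu> \<rho> \<sigma> * a$\<mu>$\<nu> * b$\<rho>$\<sigma>)"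

definition wedge11 :: "real^4 \<Rightarrow> real^4 \<Rightarrow> real^4^4" where
  "wedge11 a b = (\<chi> \<mu> \<nu>. a$\<mu> * b$\<nu> - a$\<nu> * b$\<mu>)"

type_synonym triple = "real^4^4^3"

definition vS :: "triple \<Rightarrow> real" where
  "vS S = (1/6) * (\<Sum>k\<in>UNIV. wedge22 (S$k) (S$k))"

definition perfect_triple :: "'m chart set \<Rightarrow> ('m, triple) field \<Rightarrow> bool" where
  "perfect_triple A Sg \<longleftrightarrow>
     is_section A (\<lambda>c x. {S. \<forall>i. transpose (S$i) = - (S$i)}) (\<lambda>J S. \<chi> i. pull2 J (S$i)) Sg \<and>
     (\<forall>c\<in>A. \<forall>x\<in>cdom c.
        (\<forall>i j. wedge22 (Sg c x $ i) (Sg c x $ j) = (if i = j then 2 * vS (Sg c x) else 0)) \<and>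
        vS (Sg c x) \<noteq> 0 \<and>
        (\<forall>i \<mu> \<nu> \<rho>. pd \<mu> (\<lambda>y. Sg c y $ i $ \<nu> $ \<rho>) x + pd \<nu> (\<lambda>y. Sg c y $ i $ \<rho> $ \<mu>) x
                   + pd \<rho> (\<lambda>y. Sg c y $ i $ \<mu> $ \<nu>) x = 0))"

text \<open>\<open>mixS S g i\<close> is \<open>\<Sigma>\<^sup>i\<close> with its second index raised,
  \<open>upS S g i\<close> has both indices raised.\<close>

definition mixS :: "triple \<Rightarrow> real^4^4 \<Rightarrow> 3 \<Rightarrow> real^4^4" where
  "mixS S g i = S$i ** matrix_inv g"

definition upS :: "triple \<Rightarrow> real^4^4 \<Rightarrow> 3 \<Rightarrow> real^4^4" where
  "upS S g i = matrix_inv g ** S$i ** matrix_inv g"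

text \<open>The quaternion relations determine \<open>g\<close> uniquely, for instance
  \<open>g = \<Sigma>\<^sup>2 (\<Sigma>\<^sup>3)\<^sup>-\<^sup>1 \<Sigma>\<^sup>1\<close> as matrices;
  their sign fixes the convention for the order of the triple.\<close>

definition triple_metric :: "'m chart set \<Rightarrow> ('m, triple) field \<Rightarrow> ('m, real^4^4) field \<Rightarrow> bool" where
  "triple_metric A Sg g \<longleftrightarrow>
     is_section A (\<lambda>c x. {h. transpose h = h}) pull2 g \<and>
     (\<forall>c\<in>A. \<forall>x\<in>cdom c.
        (\<forall>w. w \<noteq> 0 \<longrightarrow> w \<bullet> (g c x *v w) > 0) \<and>
        det (g c x) = (vS (Sg c x))\<^sup>2 \<and>
        (\<forall>i j. mixS (Sg c x) (g c x) i ** mixS (Sg c x) (g c x) j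
           = (if i = j then - mat 1 else 0) + (\<Sum>k\<in>UNIV. eps3 i j k *\<^sub>R mixS (Sg c x) (g c x) k)))"

text \<open>Pairings are integrated against \<open>v\<^sub>\<Sigma>\<close>, which also orients the manifold.
  Test sections are compactly supported inside the domain of one chart, so that the integral over
  the manifold is the one in that chart; by a partition of unity this is the same as testing
  with all compactly supported sections.  On sections, a formal adjoint with respect to
  nondegenerate pairings is unique.\<close>

definition formal_adjoint ::
  "'m chart set \<Rightarrow> ('m, triple) field
    \<Rightarrow> ('m, 'v::real_normed_vector) vbundle \<Rightarrow> ('m, 'w::real_normed_vector) vbundle
    \<Rightarrow> (('m, 'v) field \<Rightarrow> ('m, 'w) field) \<Rightarrow> (('m, 'w) field \<Rightarrow> ('m, 'v) field) \<Rightarrow> bool" where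
  "formal_adjoint A Sg B1 B2 P Q \<longleftrightarrow>
     (\<forall>t\<in>sections A B2. Q t \<in> sections A B1) \<and>
     (\<forall>s\<in>sections A B1. \<forall>t\<in>sections A B2. \<forall>c\<in>A. \<forall>K.
        compact K \<and> K \<subseteq> cdom c \<and> (supported_in A c K s \<or> supported_in A c K t) \<longrightarrow>
        integral (cdom c) (\<lambda>x. ip B2 c x (P s c x) (t c x) * \<bar>vS (Sg c x)\<bar>)
      = integral (cdom c) (\<lambda>x. ip B1 c x (s c x) (Q t c x) * \<bar>vS (Sg c x)\<bar>))"


section \<open>Levi-Civita connection\<close>

definition christoffel :: "(real^4 \<Rightarrow> real^4^4) \<Rightarrow> real^4 \<Rightarrow> 4 \<Rightarrow> 4 \<Rightarrow> 4 \<Rightarrow> real" where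
  "christoffel g x \<rho> \<mu> \<nu> = (1/2) * (\<Sum>\<sigma>\<in>UNIV. matrix_inv (g x) $ \<rho> $ \<sigma> *
     (pd \<mu> (\<lambda>y. g y $ \<nu> $ \<sigma>) x + pd \<nu> (\<lambda>y. g y $ \<mu> $ \<sigma>) x - pd \<sigma> (\<lambda>y. g y $ \<mu> $ \<nu>) x))"

text \<open>A covariant tensor of rank \<open>r\<close> is a function of index lists of length
  \<open>r\<close>; the covariant derivative puts the derivative index first.\<close>

definition nabla :: "(real^4 \<Rightarrow> real^4^4) \<Rightarrow> (real^4 \<Rightarrow> 4 list \<Rightarrow> real) \<Rightarrow> real^4 \<Rightarrow> 4 list \<Rightarrow> real" where
  "nabla g t x js = pd (hd js) (\<lambda>y. t y (tl js)) x
     - (\<Sum>k<length (tl js). \<Sum>\<rho>\<in>UNIV. christoffel g x \<rho> (hd js) (tl js ! k) * t x ((tl js)[k := \<rho>]))"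

definition laplace :: "(real^4 \<Rightarrow> real^4^4) \<Rightarrow> (real^4 \<Rightarrow> 4 list \<Rightarrow> real) \<Rightarrow> real^4 \<Rightarrow> 4 list \<Rightarrow> real" where
  "laplace g t x js = (\<Sum>\<mu>\<in>UNIV. \<Sum>\<nu>\<in>UNIV. matrix_inv (g x) $ \<mu> $ \<nu> * nabla g (nabla g t) x (\<mu> # \<nu> # js))"

definition ten0 :: "(real^4 \<Rightarrow> real) \<Rightarrow> real^4 \<Rightarrow> 4 list \<Rightarrow> real" where
  "ten0 f = (\<lambda>y js. f y)"

definition ten1 :: "(real^4 \<Rightarrow> real^4) \<Rightarrow> real^4 \<Rightarrow> 4 list \<Rightarrow> real" where
  "ten1 a = (\<lambda>y js. a y $ (js ! 0))"

definition ten2 :: "(real^4 \<Rightarrow> real^4^4) \<Rightarrow> real^4 \<Rightarrow> 4 list \<Rightarrow> real" where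
  "ten2 h = (\<lambda>y js. h y $ (js ! 0) $ (js ! 1))"

text \<open>\<open>riemann g x \<rho> \<sigma> \<mu> \<nu>\<close> is \<open>R\<^sup>\<rho>\<^sub>\<sigma>\<^sub>\<mu>\<^sub>\<nu>\<close>, with
  \<open>[\<nabla>\<^sub>\<mu>, \<nabla>\<^sub>\<nu>] V\<^sup>\<rho> = R\<^sup>\<rho>\<^sub>\<sigma>\<^sub>\<mu>\<^sub>\<nu> V\<^sup>\<sigma>\<close>.\<close>

definition riemann :: "(real^4 \<Rightarrow> real^4^4) \<Rightarrow> real^4 \<Rightarrow> 4 \<Rightarrow> 4 \<Rightarrow> 4 \<Rightarrow> 4 \<Rightarrow> real" where
  "riemann g x \<rho> \<sigma> \<mu> \<nu> =
     pd \<mu> (\<lambda>y. christoffel g y \<rho> \<nu> \<sigma>) x - pd \<nu> (\<lambda>y. christoffel g y \<rho> \<mu> \<sigma>) x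
     + (\<Sum>\<kappa>\<in>UNIV. christoffel g x \<rho> \<mu> \<kappa> * christoffel g x \<kappa> \<nu> \<sigma>
                - christoffel g x \<rho> \<nu> \<kappa> * christoffel g x \<kappa> \<mu> \<sigma>)"


section \<open>The bundles\<close>

type_synonym sfib = "real \<times> (real^3) \<times> (real^4^4)"

definition sym0 :: "real^4^4 \<Rightarrow> (real^4^4) set" where
  "sym0 g = {h. transpose h = h \<and> trace (matrix_inv g ** h) = 0}"

definition inner2 :: "real^4^4 \<Rightarrow> real^4^4 \<Rightarrow> real^4^4 \<Rightarrow> real" where
  "inner2 g h k = (\<Sum>\<mu>\<in>UNIV. \<Sum>\<nu>\<in>UNIV. h$\<mu>$\<nu> * (matrix_inv g ** k ** matrix_inv g)$\<mu>$\<nu>)"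

definition L0_bundle :: "('m, real) vbundle" where
  "L0_bundle = \<lparr> fib = (\<lambda>c x. UNIV), pull = (\<lambda>J h. h), ip = (\<lambda>c x h k. h * k) \<rparr>"

definition E_bundle :: "('m, real^3) vbundle" where
  "E_bundle = \<lparr> fib = (\<lambda>c x. UNIV), pull = (\<lambda>J h. h), ip = (\<lambda>c x h k. h \<bullet> k) \<rparr>"

definition T_bundle :: "('m, real^4^4) field \<Rightarrow> ('m, real^4) vbundle" where
  "T_bundle g = \<lparr> fib = (\<lambda>c x. UNIV), pull = pull1,
     ip = (\<lambda>c x a b. a \<bullet> (matrix_inv (g c x) *v b)) \<rparr>"

text \<open>The pairing on \<open>E \<otimes> \<Lambda>\<^sup>1\<close> is the 4-form
  \<open>\<epsilon>\<^sup>i\<^sup>j\<^sup>k \<Sigma>\<^sup>i \<and> a\<^sup>j \<and> b\<^sup>k\<close> divided by \<open>v\<^sub>\<Sigma>\<close>; it is indefinite.\<close>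

definition EL_bundle :: "('m, triple) field \<Rightarrow> ('m, real^4^3) vbundle" where
  "EL_bundle Sg = \<lparr> fib = (\<lambda>c x. UNIV), pull = (\<lambda>J a. \<chi> i. pull1 J (a$i)),
     ip = (\<lambda>c x a b. (\<Sum>i\<in>UNIV. \<Sum>j\<in>UNIV. \<Sum>k\<in>UNIV.
        eps3 i j k * wedge22 (Sg c x $ i) (wedge11 (a$j) (b$k))) / vS (Sg c x)) \<rparr>"

definition Sym_bundle :: "('m, real^4^4) field \<Rightarrow> ('m, real^4^4) vbundle" where
  "Sym_bundle g = \<lparr> fib = (\<lambda>c x. sym0 (g c x)), pull = pull2,
     ip = (\<lambda>c x h k. inner2 (g c x) h k) \<rparr>"

text \<open>Sections of \<open>S\<close> are represented by their components \<open>(h, h\<^sup>i, ht)\<close>, where \<open>ht\<close> is the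
  trace-free symmetric part; \<open>sigma\<close> is the embedding into \<open>E \<otimes> \<Lambda>\<^sup>2\<close>.\<close>

definition S_bundle :: "('m, real^4^4) field \<Rightarrow> real \<Rightarrow> real \<Rightarrow> real \<Rightarrow> ('m, sfib) vbundle" where
  "S_bundle g \<beta>1 \<beta>2 \<beta>3 = \<lparr> fib = (\<lambda>c x. UNIV \<times> UNIV \<times> sym0 (g c x)),
     pull = (\<lambda>J (h, hi, ht). (h, hi, pull2 J ht)),
     ip = (\<lambda>c x (h, hi, ht) (k, ki, kt).
        \<beta>1 * (h * k) + \<beta>2 * (hi \<bullet> ki) + \<beta>3 * inner2 (g c x) ht kt) \<rparr>"

definition sigma :: "triple \<Rightarrow> real^4^4 \<Rightarrow> sfib \<Rightarrow> real^4^4^3" where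
  "sigma S g = (\<lambda>(h, hi, ht). let H = (ht + (h / 4) *\<^sub>R g) ** matrix_inv g in
     (\<chi> i \<mu> \<nu>. 2 * (\<Sum>j\<in>UNIV. \<Sum>k\<in>UNIV. eps3 i j k * S$j$\<mu>$\<nu> * hi$k)
        + (\<Sum>\<alpha>\<in>UNIV. H$\<mu>$\<alpha> * S$i$\<alpha>$\<nu> - H$\<nu>$\<alpha> * S$i$\<alpha>$\<mu>)))"


section \<open>The operators\<close>

text \<open>Operators are defined in one chart, in terms of the components of the triple, of the
  metric and of the argument; \<open>glob\<close> applies them in every chart.\<close>

type_synonym ('v, 'w) local_op =
  "(real^4 \<Rightarrow> triple) \<Rightarrow> (real^4 \<Rightarrow> real^4^4) \<Rightarrow> (real^4 \<Rightarrow> 'v) \<Rightarrow> real^4 \<Rightarrow> 'w"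

definition glob :: "('v, 'w) local_op \<Rightarrow> ('m, triple) field \<Rightarrow> ('m, real^4^4) field
    \<Rightarrow> ('m, 'v) field \<Rightarrow> ('m, 'w) field" where
  "glob P Sg g s = (\<lambda>c. P (Sg c) (g c) (s c))"

definition J1_fib :: "triple \<Rightarrow> real^4^4 \<Rightarrow> real^4^3 \<Rightarrow> real^4^3" where
  "J1_fib S g a = (\<chi> i \<mu>. \<Sum>j\<in>UNIV. \<Sum>k\<in>UNIV. \<Sum>\<alpha>\<in>UNIV. eps3 i j k * mixS S g j $ \<mu> $ \<alpha> * a$k$\<alpha>)"

definition J1 :: "(real^4^3, real^4^3) local_op" where
  "J1 S g a x = J1_fib (S x) (g x) (a x)"

definition Phi :: "(real^4^3, real^4) local_op" where
  "Phi S g a x = (\<chi> \<mu>. \<Sum>i\<in>UNIV. \<Sum>\<alpha>\<in>UNIV. mixS (S x) (g x) i $ \<mu> $ \<alpha> * a x $ i $ \<alpha>)"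

definition ext1 :: "(real^4 \<Rightarrow> real^4) \<Rightarrow> real^4 \<Rightarrow> real^4^4" where
  "ext1 a x = (\<chi> \<mu> \<nu>. pd \<mu> (\<lambda>y. a y $ \<nu>) x - pd \<nu> (\<lambda>y. a y $ \<mu>) x)"

definition hook :: "triple \<Rightarrow> real^4^4 \<Rightarrow> real^4 \<Rightarrow> 3 \<Rightarrow> real^4" where
  "hook S g \<xi> i = (matrix_inv g *v \<xi>) v* S$i"

definition d1 :: "(real^4, sfib) local_op" where
  "d1 S g \<xi> x = (THE s. snd (snd s) \<in> sym0 (g x) \<and>
     sigma (S x) (g x) s = (\<chi> i. ext1 (\<lambda>y. hook (S y) (g y) (\<xi> y) i) x))"

definition star_d :: "(real^4^4^3, real^4^3) local_op" where
  "star_d S g w x = (\<chi> i \<mu>. \<Sum>\<alpha>\<in>UNIV. \<Sum>\<beta>\<in>UNIV. \<Sum>\<gamma>\<in>UNIV. \<Sum>\<alpha>'\<in>UNIV. \<Sum>\<beta>'\<in>UNIV. \<Sum>\<gamma>'\<in>UNIV.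
     vS (S x) * eps4 \<mu> \<alpha>' \<beta>' \<gamma>' * matrix_inv (g x) $ \<alpha>' $ \<alpha> * matrix_inv (g x) $ \<beta>' $ \<beta>
       * matrix_inv (g x) $ \<gamma>' $ \<gamma> * pd \<alpha> (\<lambda>y. w y $ i $ \<beta> $ \<gamma>) x)"

definition d2 :: "(sfib, real^4^3) local_op" where
  "d2 S g s x = (1/2) *\<^sub>R inv (J1_fib (S x) (g x)) (star_d S g (\<lambda>y. sigma (S y) (g y) (s y)) x)"

definition d3 :: "(real^4^3, real^3) local_op" where
  "d3 S g a x = (\<chi> i. (\<Sum>j\<in>UNIV. \<Sum>k\<in>UNIV.
     eps3 i j k * wedge22 (S x $ j) (ext1 (\<lambda>y. a y $ k) x)) / vS (S x))"

definition dt1 :: "real \<Rightarrow> real \<Rightarrow> real \<Rightarrow> (real^4, sfib) local_op" where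
  "dt1 a1 a2 a3 S g \<xi> x = (let N = (\<chi> \<mu> \<nu>. nabla g (ten1 \<xi>) x [\<mu>, \<nu>]);
        dv = (\<Sum>\<mu>\<in>UNIV. \<Sum>\<nu>\<in>UNIV. matrix_inv (g x) $ \<mu> $ \<nu> * N$\<mu>$\<nu>) in
     (a1 * dv,
      \<chi> i. a2 * (\<Sum>\<mu>\<in>UNIV. \<Sum>\<nu>\<in>UNIV. upS (S x) (g x) i $ \<mu> $ \<nu> * N$\<mu>$\<nu>),
      a3 *\<^sub>R (N + transpose N - (dv / 2) *\<^sub>R g x)))"

definition dt3 :: "real \<Rightarrow> real \<Rightarrow> (real^4^3, real^3) local_op" where
  "dt3 c1 c2 S g a x = (\<chi> i.
     c1 * (\<Sum>\<mu>\<in>UNIV. \<Sum>\<nu>\<in>UNIV. matrix_inv (g x) $ \<mu> $ \<nu> * nabla g (ten1 (\<lambda>y. a y $ i)) x [\<mu>, \<nu>])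
   + c2 * (\<Sum>j\<in>UNIV. \<Sum>k\<in>UNIV. \<Sum>\<mu>\<in>UNIV. \<Sum>\<nu>\<in>UNIV.
       eps3 i j k * upS (S x) (g x) j $ \<mu> $ \<nu> * nabla g (ten1 (\<lambda>y. a y $ k)) x [\<mu>, \<nu>]))"

definition dt4 :: "real \<Rightarrow> (real^3, real^4) local_op" where
  "dt4 f S g \<chi>' x = (\<chi> \<mu>. f * (\<Sum>i\<in>UNIV. \<Sum>\<alpha>\<in>UNIV. mixS (S x) (g x) i $ \<mu> $ \<alpha> * pd \<alpha> (\<lambda>y. \<chi>' y $ i) x))"

definition D4 :: "(real \<times> (real^3), real^4) local_op" where
  "D4 S g u x = (\<chi> \<mu>. - (1 / sqrt 2) * (pd \<mu> (\<lambda>y. fst (u y)) x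
     - 2 * (\<Sum>i\<in>UNIV. \<Sum>\<alpha>\<in>UNIV. mixS (S x) (g x) i $ \<mu> $ \<alpha> * pd \<alpha> (\<lambda>y. snd (u y) $ i) x)))"

definition D12 :: "((real^3) \<times> (real^4^4), real^4^3) local_op" where
  "D12 S g u x = (\<chi> i \<mu>. pd \<mu> (\<lambda>y. fst (u y) $ i) x
     + (\<Sum>\<alpha>\<in>UNIV. \<Sum>\<beta>\<in>UNIV. \<Sum>\<gamma>\<in>UNIV. mixS (S x) (g x) i $ \<mu> $ \<alpha> * matrix_inv (g x) $ \<beta> $ \<gamma>
          * nabla g (ten2 (\<lambda>y. snd (u y))) x [\<gamma>, \<alpha>, \<beta>])
     - (\<Sum>\<alpha>\<in>UNIV. \<Sum>\<beta>\<in>UNIV. upS (S x) (g x) i $ \<alpha> $ \<beta> * nabla g (ten2 (\<lambda>y. snd (u y))) x [\<alpha>, \<mu>, \<beta>]))"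

text \<open>\<open>Dt\<close> takes the formal adjoints of \<open>dt1\<close> and \<open>dt3\<close> as its first two arguments.\<close>

definition Dt ::
  "(('m, sfib) field \<Rightarrow> ('m, real^4) field) \<Rightarrow> (('m, real^3) field \<Rightarrow> ('m, real^4^3) field) \<Rightarrow> real
    \<Rightarrow> ('m, triple) field \<Rightarrow> ('m, real^4^4) field
    \<Rightarrow> ('m, sfib \<times> (real^3)) field \<Rightarrow> ('m, (real^4) \<times> (real^4^3)) field" where
  "Dt dt1_adj dt3_adj f Sg g u = (let s = (\<lambda>c x. fst (u c x)); \<chi>' = (\<lambda>c x. snd (u c x)) in
     (\<lambda>c x. (dt1_adj s c x + glob (dt4 f) Sg g \<chi>' c x, glob d2 Sg g s c x + dt3_adj \<chi>' c x)))"

text \<open>\<open>Lap\<close> is \<open>\<nabla>\<^sup>\<mu> \<nabla>\<^sub>\<mu>\<close> on each component of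
  \<open>S \<oplus> E\<close>.  \<open>Curv\<close> is
  \<open>k\<^sub>\<mu>\<^sub>\<nu> \<mapsto> 2 R\<^sub>\<mu>\<^sub>\<alpha>\<^sub>\<nu>\<^sub>\<beta> k\<^sup>\<alpha>\<^sup>\<beta>\<close>
  on the trace-free symmetric component and zero on the others; it is the contribution of the
  commutator of covariant derivatives and vanishes when the metric is flat.  As the metric is Ricci
  flat, \<open>Lap + Curv\<close> is minus the Lichnerowicz Laplacian; under \<open>sigma\<close> it is also minus
  the Hodge Laplacian of the 2-forms \<open>\<sigma>\<^sup>i\<close>.  The square of a Dirac operator twisted by
  \<open>S\<^sub>-\<close> contains this term: on a K3 surface the anti-self-dual harmonic forms are
  annihilated by the first-order operators, while \<open>\<nabla>\<^sup>\<mu> \<nabla>\<^sub>\<mu>\<close> does not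
  annihilate them.\<close>

definition Lap :: "(sfib \<times> (real^3), sfib \<times> (real^3)) local_op" where
  "Lap S g u x =
     ((laplace g (ten0 (\<lambda>y. fst (fst (u y)))) x [],
       \<chi> i. laplace g (ten0 (\<lambda>y. fst (snd (fst (u y))) $ i)) x [],
       \<chi> \<mu> \<nu>. laplace g (ten2 (\<lambda>y. snd (snd (fst (u y))))) x [\<mu>, \<nu>]),
      \<chi> i. laplace g (ten0 (\<lambda>y. snd (u y) $ i)) x [])"

definition Curv :: "(sfib \<times> (real^3), sfib \<times> (real^3)) local_op" where
  "Curv S g u x = (let hup = matrix_inv (g x) ** snd (snd (fst (u x))) ** matrix_inv (g x) in
     ((0, 0, \<chi> \<mu> \<nu>. 2 * (\<Sum>\<rho>\<in>UNIV. \<Sum>\<alpha>\<in>UNIV. \<Sum>\<beta>\<in>UNIV.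
         g x $ \<mu> $ \<rho> * riemann g x \<rho> \<alpha> \<nu> \<beta> * hup $ \<alpha> $ \<beta>)), 0))"


section \<open>Spinors and the Dirac operator\<close>

text \<open>\<open>quat\<close> identifies \<open>\<real>\<^sup>4\<close> with the quaternions, that is with the real
  form of \<open>Hom(S\<^sub>+, S\<^sub>-)\<close>: it is Clifford multiplication from \<open>S\<^sub>+\<close> to
  \<open>S\<^sub>-\<close>, and its Hermitian conjugate is Clifford multiplication from
  \<open>S\<^sub>-\<close> to \<open>S\<^sub>+\<close>.  Elements of \<open>E\<close> are the imaginary quaternions, on which
  \<open>SU\<^sub>+(2)\<close> acts by conjugation.\<close>

definition quat :: "real^4 \<Rightarrow> complex^2^2" where
  "quat k = vector [vector [Complex (k$4) (k$3), Complex (k$2) (k$1)],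
                    vector [Complex (- (k$2)) (k$1), Complex (k$4) (- (k$3))]]"

definition quat3 :: "real^3 \<Rightarrow> complex^2^2" where
  "quat3 q = quat (vector [q$1, q$2, q$3, 0])"

definition hconj :: "complex^2^2 \<Rightarrow> complex^2^2" where
  "hconj U = (\<chi> i j. cnj (U$j$i))"

definition SU2 :: "(complex^2^2) set" where
  "SU2 = {U. U ** hconj U = mat 1 \<and> det U = 1}"

text \<open>\<open>(U, V)\<close> in \<open>SU\<^sub>+(2) \<times> SU\<^sub>-(2)\<close> acts on \<open>\<Lambda>\<^sup>1\<close>
  by \<open>R\<close> and on \<open>E\<close> by \<open>r\<close>.\<close>

definition spin_action :: "complex^2^2 \<Rightarrow> complex^2^2 \<Rightarrow> real^4^4 \<Rightarrow> real^3^3 \<Rightarrow> bool" where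
  "spin_action U V R r \<longleftrightarrow> U \<in> SU2 \<and> V \<in> SU2 \<and>
     (\<forall>k. quat (R *v k) = V ** quat k ** hconj U) \<and>
     (\<forall>q. quat3 (r *v q) = U ** quat3 q ** hconj U)"

type_synonym spin2 = "complex^(2 \<times> 2)"
type_synonym spin4 = "complex^(2 \<times> 2 \<times> 2 \<times> 2)"

definition act2 :: "complex^2^2 \<Rightarrow> complex^2^2 \<Rightarrow> spin2 \<Rightarrow> spin2" where
  "act2 M1 M2 t = (\<chi> p. case p of (a, b) \<Rightarrow>
     \<Sum>a'\<in>UNIV. \<Sum>b'\<in>UNIV. M1$a$a' * M2$b$b' * t$(a', b'))"

definition act4 :: "complex^2^2 \<Rightarrow> complex^2^2 \<Rightarrow> complex^2^2 \<Rightarrow> complex^2^2 \<Rightarrow> spin4 \<Rightarrow> spin4" where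
  "act4 M1 M2 M3 M4 t = (\<chi> p. case p of (a, b, c, d) \<Rightarrow>
     \<Sum>a'\<in>UNIV. \<Sum>b'\<in>UNIV. \<Sum>c'\<in>UNIV. \<Sum>d'\<in>UNIV.
       M1$a$a' * M2$b$b' * M3$c$c' * M4$d$d' * t$(a', b', c', d'))"

text \<open>\<open>S \<otimes> S' \<otimes> S\<^sub>+\<^sup>2\<close>, the last factor being the symmetric square.\<close>

definition sym_last :: "spin4 set" where
  "sym_last = {t. \<forall>a b c d. t$(a, b, c, d) = t$(a, b, d, c)}"

definition real_form :: "('v::real_vector \<Rightarrow> complex^'n) \<Rightarrow> 'v set \<Rightarrow> (complex^'n) set \<Rightarrow> bool" where
  "real_form \<tau> V W \<longleftrightarrow> linear \<tau> \<and> \<tau> ` V \<subseteq> W \<and>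
     (\<forall>t\<in>W. \<exists>!(v, w). v \<in> V \<and> w \<in> V \<and> t = \<tau> v + \<i> *s \<tau> w)"

text \<open>The components of the triple in an orthonormal frame \<open>e\<close> adapted to
  \<open>quat\<close>: \<open>quat (eta i *v k) = quat k ** quat3 (axis i 1)\<close>.  Row \<open>a\<close> of
  \<open>e\<close> is the frame vector \<open>e\<^sub>a\<close>.\<close>

definition eta :: "3 \<Rightarrow> real^4^4" where
  "eta i = (vector
     [vector [vector [0, 0, 0, 1], vector [0, 0, -1, 0], vector [0, 1, 0, 0], vector [-1, 0, 0, 0]],
      vector [vector [0, 0, 1, 0], vector [0, 0, 0, 1], vector [-1, 0, 0, 0], vector [0, -1, 0, 0]],
      vector [vector [0, -1, 0, 0], vector [1, 0, 0, 0], vector [0, 0, 0, 1], vector [0, 0, -1, 0]]]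
     :: real^4^4^3) $ i"

definition adapted_frame :: "triple \<Rightarrow> real^4^4 \<Rightarrow> real^4^4 \<Rightarrow> bool" where
  "adapted_frame S g e \<longleftrightarrow> e ** g ** transpose e = mat 1 \<and> (\<forall>i. e ** S$i ** transpose e = eta i)"

definition frame_pd :: "real^4^4 \<Rightarrow> 4 \<Rightarrow> (real^4 \<Rightarrow> 'v::real_normed_vector) \<Rightarrow> real^4 \<Rightarrow> 'v" where
  "frame_pd e a f x = (\<Sum>\<mu>\<in>UNIV. e$a$\<mu> *\<^sub>R pd \<mu> f x)"

definition frame_nabla2 :: "(real^4 \<Rightarrow> real^4^4) \<Rightarrow> real^4^4 \<Rightarrow> 4 \<Rightarrow> (real^4 \<Rightarrow> real^4^4) \<Rightarrow> real^4 \<Rightarrow> real^4^4" where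
  "frame_nabla2 g e a h x =
     e ** (\<chi> \<mu> \<nu>. \<Sum>\<rho>\<in>UNIV. e$a$\<rho> * nabla g (ten2 h) x [\<rho>, \<mu>, \<nu>]) ** transpose e"

text \<open>\<open>P\<close> is the Dirac operator \<open>S\<^sub>+ \<otimes> S\<^sub>+ \<rightarrow> S\<^sub>- \<otimes> S\<^sub>+\<close>,
  \<open>\<psi> \<mapsto> \<Sum>\<^sub>a (\<gamma>\<^sup>a \<otimes> 1) \<nabla>\<^sub>a \<psi>\<close>, for Spin(4)-equivariant identifications
  of \<open>\<Lambda>\<^sup>0 \<oplus> E\<close> and \<open>\<Lambda>\<^sup>1\<close> with real forms of these bundles.\<close>

definition dirac_SpSp ::
  "'m chart set \<Rightarrow> ('m, triple) field \<Rightarrow> ('m, real^4^4) field \<Rightarrow> (real \<times> (real^3), real^4) local_op \<Rightarrow> bool" where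
  "dirac_SpSp A Sg g P \<longleftrightarrow>
     (\<exists>(\<tau>1 :: real \<times> (real^3) \<Rightarrow> spin2) (\<tau>2 :: real^4 \<Rightarrow> spin2).
        real_form \<tau>1 UNIV UNIV \<and> real_form \<tau>2 UNIV UNIV \<and>
        (\<forall>U V R r. spin_action U V R r \<longrightarrow>
           (\<forall>h q. \<tau>1 (h, r *v q) = act2 U U (\<tau>1 (h, q))) \<and>
           (\<forall>k. \<tau>2 (R *v k) = act2 V U (\<tau>2 k))) \<and>
        (\<forall>c\<in>A. \<forall>x\<in>cdom c. (\<exists>e. adapted_frame (Sg c x) (g c x) e) \<and>
           (\<forall>e. adapted_frame (Sg c x) (g c x) e \<longrightarrow>
             (\<forall>u\<in>sections A (L0_bundle \<oplus>\<^sub>b E_bundle).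
                \<tau>2 (e *v P (Sg c) (g c) (u c) x)
                  = (\<Sum>a\<in>UNIV. act2 (quat (axis a 1)) (mat 1)
                       (\<tau>1 (frame_pd e a (\<lambda>y. fst (u c y)) x, frame_pd e a (\<lambda>y. snd (u c y)) x)))))))"

text \<open>Likewise for \<open>S\<^sub>- \<otimes> S\<^sub>- \<otimes> S\<^sub>+\<^sup>2 \<rightarrow> S\<^sub>+ \<otimes> S\<^sub>- \<otimes> S\<^sub>+\<^sup>2\<close>.\<close>

definition dirac_SmSmSp2 ::
  "'m chart set \<Rightarrow> ('m, triple) field \<Rightarrow> ('m, real^4^4) field \<Rightarrow> ((real^3) \<times> (real^4^4), real^4^3) local_op \<Rightarrow> bool" where
  "dirac_SmSmSp2 A Sg g P \<longleftrightarrow>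
     (\<exists>(\<tau>3 :: (real^3) \<times> (real^4^4) \<Rightarrow> spin4) (\<tau>4 :: real^4^3 \<Rightarrow> spin4).
        real_form \<tau>3 (UNIV \<times> sym0 (mat 1)) sym_last \<and> real_form \<tau>4 UNIV sym_last \<and>
        (\<forall>U V R r. spin_action U V R r \<longrightarrow>
           (\<forall>q. \<forall>h\<in>sym0 (mat 1). \<tau>3 (r *v q, R ** h ** transpose R) = act4 V V U U (\<tau>3 (q, h))) \<and>
           (\<forall>a. \<tau>4 (r ** a ** transpose R) = act4 U V U U (\<tau>4 a))) \<and>
        (\<forall>c\<in>A. \<forall>x\<in>cdom c. (\<exists>e. adapted_frame (Sg c x) (g c x) e) \<and>
           (\<forall>e. adapted_frame (Sg c x) (g c x) e \<longrightarrow>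
             (\<forall>u\<in>sections A (E_bundle \<oplus>\<^sub>b Sym_bundle g).
                \<tau>4 (P (Sg c) (g c) (u c) x ** transpose e)
                  = (\<Sum>a\<in>UNIV. act4 (hconj (quat (axis a 1))) (mat 1) (mat 1) (mat 1)
                       (\<tau>3 (frame_pd e a (\<lambda>y. fst (u c y)) x, frame_nabla2 (g c) e a (\<lambda>y. snd (u c y)) x)))))))"

end

theory Submission
  imports Defs
begin

text \<open>Three facts make the theorem true.  First, the triple is parallel for the Levi-Civita connection of
\<open>g\<close>: its covariant derivative respects the quaternion relations, so it is an infinitesimal rotation
\<open>\<epsilon>\<^sup>i\<^sup>j\<^sup>k A\<^sup>j \<Sigma>\<^sup>k\<close>, and closedness says that \<open>J1\<close> annihilates \<open>A\<close>, whence \<open>A = 0\<close> as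
\<open>J1\<^sup>2 = J1 + 2\<close> (\<open>parallel_flat\<close>, \<open>pd_S\<close>).  Hence covariant derivatives pass through all contractions with
the triple, and the curvature, which commutes with it, is anti-self-dual and Ricci flat (\<open>curvature_flat\<close>).

Second, every pointwise identity can be checked in one model fibre.  At each point there is a frame in
which \<open>g\<close> is the identity and \<open>\<Sigma>\<^sup>i\<close> is the constant matrix \<open>eta i\<close> (\<open>adapted_frame_exists\<close>); in it,
identities between contractions of first or second covariant derivatives are identities between
components.  This gives formulas for the operators of the complex (\<open>op_d1\<close>, \<open>op_d2\<close>, \<open>op_d3\<close>) and, because
a point has common frames in two charts, it shows that the operators written in a chart are
compatible with changes of coordinates (\<open>chart_change\<close>).

Third, the pairing on \<open>E \<otimes> \<Lambda>\<^sup>1\<close> is \<open>- \<langle>a, J1 b\<rangle>\<close> for the definite pairing of components, and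
\<open>J1\<close> is symmetric.  Adjoints are therefore divergences of \<open>J1 a\<close>: with \<open>b = J1 a\<close>,
\<open>d3\<^sup>* \<chi> = d\<chi>\<close>, \<open>Phi\<^sup>* \<xi> = \<Sigma>\<^sup>i \<xi> / 2\<close>, and \<open>d2\<^sup>* a\<close> consists of the divergence of
\<open>- \<Sigma>\<^sup>i b\<^sup>i\<close>, a quarter of the divergences of the \<open>b\<^sup>i\<close>, and the symmetric trace-free part of \<open>\<Sigma>\<^sup>i \<nabla> b\<^sup>i\<close>.
Each of these formal adjoints follows from a Green identity, in which the difference of the two
pairings is a divergence (\<open>green_dt1\<close>, \<open>green_d2\<close>, \<open>integral_divergence\<close>).

The constants are chosen so that the mixed terms cancel in \<open>D\<^sup>* D\<close>.  With
\<open>(\<beta>1, \<beta>2, \<beta>3) = (1/4, 8, 1)\<close>, \<open>(a1, a2, a3) = (- sqrt 2, 0, 1 / sqrt 2)\<close>, \<open>f = 1\<close> and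
\<open>(c1, c2) = (- sqrt 2, - 1 / sqrt 2)\<close> one finds
\<open>D\<^sup>* D (h, q, t, \<chi>) = (\<Delta> h, - \<Delta> \<chi> / (2 sqrt 2), - \<Delta> t, - 2 sqrt 2 \<Delta> q)\<close>, where \<open>\<Delta> t\<close> includes
the curvature term (\<open>square_at_point\<close>, \<open>square\<close>).  The two copies of \<open>E\<close> are exchanged; the combinations
\<open>\<chi> = - 2 sqrt 2 q\<close> and \<open>\<chi> = 2 sqrt 2 q\<close> are the eigenspaces, with signs \<open>+\<close> and \<open>-\<close>.  The same
combinations are the arguments of the two Dirac operators, up to an invertible mixing of the targets by
\<open>Phi\<close> (\<open>intertwining\<close>).  That these are Dirac operators is a computation with quaternions: a covector is a
quaternion \<open>quat k\<close>, the triple acts by right multiplication with imaginary units, and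
\<open>D4\<close>, \<open>D12\<close> become \<open>\<Sum> quat e\<^sub>a \<partial>\<^sub>a\<close> and its conjugate (\<open>dirac_flat_1\<close>, \<open>dirac_flat_2\<close>).\<close>

section \<open>Partial derivatives\<close>

lemma pd_eqI: "(f has_derivative f') (at x) \<Longrightarrow> pd \<mu> f x = f' (axis \<mu> 1)"
  unfolding pd_def using frechet_derivative_at by metis

lemma has_derivative_frechet:
  "f differentiable (at x) \<Longrightarrow> (f has_derivative frechet_derivative f (at x)) (at x)"
  by (simp add: frechet_derivative_works)

lemma pd_bounded_linear:
  assumes "bounded_linear L" "f differentiable (at x)"
  shows "pd \<mu> (\<lambda>y. L (f y)) x = L (pd \<mu> f x)"
  using pd_eqI[OF bounded_linear.has_derivative[OF assms(1) has_derivative_frechet[OF assms(2)]]]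
  by (simp add: pd_def)

lemma pd_bilinear:
  assumes "bounded_bilinear b" "f differentiable (at x)" "h differentiable (at x)"
  shows "pd \<mu> (\<lambda>y. b (f y) (h y)) x = b (pd \<mu> f x) (h x) + b (f x) (pd \<mu> h x)"
  using pd_eqI[OF bounded_bilinear.FDERIV[OF assms(1) has_derivative_frechet[OF assms(2)]
        has_derivative_frechet[OF assms(3)]]]
  by (simp add: pd_def add.commute)

lemma differentiable_bilinear:
  assumes "bounded_bilinear b" "f differentiable (at x)" "h differentiable (at x)"
  shows "(\<lambda>y. b (f y) (h y)) differentiable (at x)"
  using bounded_bilinear.FDERIV[OF assms(1) has_derivative_frechet[OF assms(2)]
        has_derivative_frechet[OF assms(3)]] differentiable_def by blast

lemma differentiable_linear:
  assumes "bounded_linear L" "f differentiable (at x)"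
  shows "(\<lambda>y. L (f y)) differentiable (at x)"
  using bounded_linear.has_derivative[OF assms(1) has_derivative_frechet[OF assms(2)]]
    differentiable_def by blast

lemma pd_const [simp]: "pd \<mu> (\<lambda>y. c) x = 0"
  by (rule pd_eqI[where f' = "\<lambda>h. 0"]) simp

lemma pd_add:
  "f differentiable (at x) \<Longrightarrow> h differentiable (at x) \<Longrightarrow>
    pd \<mu> (\<lambda>y. f y + h y) x = pd \<mu> f x + pd \<mu> h x"
  using pd_eqI[OF has_derivative_add[OF has_derivative_frechet has_derivative_frechet]]
  by (auto simp: pd_def)

lemma pd_minus:
  "f differentiable (at x) \<Longrightarrow> pd \<mu> (\<lambda>y. - f y) x = - pd \<mu> f x"
  using pd_bounded_linear[OF bounded_linear_minus[OF bounded_linear_ident]] by blast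

lemma pd_diff:
  "f differentiable (at x) \<Longrightarrow> h differentiable (at x) \<Longrightarrow>
    pd \<mu> (\<lambda>y. f y - h y) x = pd \<mu> f x - pd \<mu> h x"
  using pd_eqI[OF has_derivative_diff[OF has_derivative_frechet has_derivative_frechet]]
  by (auto simp: pd_def)

lemma pd_sum:
  "(\<And>i. i \<in> I \<Longrightarrow> f i differentiable (at x)) \<Longrightarrow>
    pd \<mu> (\<lambda>y. \<Sum>i\<in>I. f i y) x = (\<Sum>i\<in>I. pd \<mu> (f i) x)"
  by (subst pd_eqI[OF has_derivative_sum[where f' = "\<lambda>i. frechet_derivative (f i) (at x)"]])
     (auto simp: pd_def intro: has_derivative_frechet)

lemma bounded_linear_lambda_vec: "bounded_linear (\<lambda>r. axis i r :: 'v::real_normed_vector^'n)"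
proof (rule bounded_linear_intro[where K = 1])
  fix r :: 'v
  have "norm (axis i r) \<le> (\<Sum>j\<in>UNIV. norm (axis i r $ j))"
    unfolding norm_vec_def by (rule L2_set_le_sum) simp
  also have "\<dots> = norm r"
    by (simp add: axis_def if_distrib cong: if_cong)
  finally show "norm (axis i r) \<le> norm r * 1" by simp
qed (auto simp: axis_def vec_eq_iff)

lemma pd_nth:
  "f differentiable (at x) \<Longrightarrow> pd \<mu> (\<lambda>y. f y $ i) x = pd \<mu> f x $ i"
  using pd_bounded_linear[OF bounded_linear_vec_nth] by blast

lemma differentiable_nth:
  "f differentiable (at x) \<Longrightarrow> (\<lambda>y. f y $ i) differentiable (at x)"
  using differentiable_linear[OF bounded_linear_vec_nth] by blast

lemma bounded_bilinear_matrix_mult: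
  "bounded_bilinear ((**) :: real^'n^'m \<Rightarrow> real^'p^'n \<Rightarrow> real^'p^'m)"
  unfolding bilinear_conv_bounded_bilinear[symmetric] bilinear_def
  by (auto intro!: linearI simp: matrix_matrix_mult_def vec_eq_iff sum.distrib
      sum_distrib_left sum_distrib_right algebra_simps)

lemma bounded_bilinear_matrix_vector_mult:
  "bounded_bilinear ((*v) :: real^'n^'m \<Rightarrow> real^'n \<Rightarrow> real^'m)"
  unfolding bilinear_conv_bounded_bilinear[symmetric] bilinear_def
  by (auto intro!: linearI simp: matrix_vector_mult_def vec_eq_iff sum.distrib
      sum_distrib_left sum_distrib_right algebra_simps)

lemma bounded_linear_transpose:
  "bounded_linear (transpose :: real^'n^'m \<Rightarrow> real^'m^'n)"
  unfolding linear_conv_bounded_linear[symmetric]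
  by (auto intro!: linearI simp: transpose_def vec_eq_iff)

lemmas pd_matrix_mult = pd_bilinear[OF bounded_bilinear_matrix_mult]
  and pd_matrix_vector_mult = pd_bilinear[OF bounded_bilinear_matrix_vector_mult]
  and pd_scaleR = pd_bilinear[OF bounded_bilinear_scaleR]
  and pd_mult = pd_bilinear[OF bounded_bilinear_mult]
  and pd_transpose = pd_bounded_linear[OF bounded_linear_transpose]
  and differentiable_matrix_mult = differentiable_bilinear[OF bounded_bilinear_matrix_mult]
  and differentiable_matrix_vector_mult = differentiable_bilinear[OF bounded_bilinear_matrix_vector_mult]
  and differentiable_scaleR' = differentiable_bilinear[OF bounded_bilinear_scaleR]
  and differentiable_transpose = differentiable_linear[OF bounded_linear_transpose]

lemma pd_cong_open:
  assumes "open U" "x \<in> U" "\<And>y. y \<in> U \<Longrightarrow> f y = h y"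
  shows "pd \<mu> f x = pd \<mu> h x"
proof -
  have "frechet_derivative f (at x) = frechet_derivative h (at x)"
    using has_derivative_transform_within_open[OF _ assms(1,2)] assms(3)
    unfolding frechet_derivative_def by metis
  then show ?thesis by (simp add: pd_def)
qed

lemma differentiable_cong_open:
  assumes "open U" "x \<in> U" "\<And>y. y \<in> U \<Longrightarrow> f y = h y" "f differentiable (at x)"
  shows "h differentiable (at x)"
proof -
  obtain D where "(f has_derivative D) (at x)" using assms(4) unfolding differentiable_def by blast
  then have "(h has_derivative D) (at x)"
    by (rule has_derivative_transform_within_open[OF _ assms(1,2)]) (use assms(3) in auto)
  then show ?thesis unfolding differentiable_def by blast
qed

text \<open>A derivative is determined by its values on the coordinate axes; the chain rule below follows by
  linearity.\<close>

lemma frechet_eq_sum_pd: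
  assumes "f differentiable (at x)"
  shows "frechet_derivative f (at x) v = (\<Sum>\<mu>\<in>UNIV. v $ \<mu> *\<^sub>R pd \<mu> f x)"
proof -
  have l: "linear (frechet_derivative f (at x))"
    by (rule linear_frechet_derivative[OF assms])
  have "v = (\<Sum>\<mu>\<in>UNIV. v $ \<mu> *\<^sub>R axis \<mu> 1)"
    using basis_expansion[of v] by (simp add: scalar_mult_eq_scaleR)
  then have "frechet_derivative f (at x) v
      = frechet_derivative f (at x) (\<Sum>\<mu>\<in>UNIV. v $ \<mu> *\<^sub>R axis \<mu> 1)" by simp
  also have "\<dots> = (\<Sum>\<mu>\<in>UNIV. v $ \<mu> *\<^sub>R frechet_derivative f (at x) (axis \<mu> 1))"
    by (simp add: linear_sum[OF l] linear_scale[OF l])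
  finally show ?thesis by (simp add: pd_def)
qed

lemma pd_compose:
  fixes f :: "real^4 \<Rightarrow> 'v::real_normed_vector" and T :: "real^4 \<Rightarrow> real^4"
  assumes "f differentiable (at (T x))" "T differentiable (at x)"
  shows "pd \<mu> (\<lambda>y. f (T y)) x = (\<Sum>\<alpha>\<in>UNIV. pd \<mu> T x $ \<alpha> *\<^sub>R pd \<alpha> f (T x))"
proof -
  have "pd \<mu> (\<lambda>y. f (T y)) x = frechet_derivative f (at (T x)) (pd \<mu> T x)"
    using frechet_derivative_compose[OF assms(2,1)] by (simp add: pd_def o_def)
  then show ?thesis by (simp add: frechet_eq_sum_pd[OF assms(1)])
qed


section \<open>Smooth functions on open sets\<close>

text \<open>Closure of smooth functions under bilinear operations and under inversion is proved by
  induction on the number of derivatives taken.\<close>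

definition smooth_upto :: "nat \<Rightarrow> (real^4) set \<Rightarrow> (real^4 \<Rightarrow> 'v::real_normed_vector) \<Rightarrow> bool" where
  "smooth_upto n U f \<longleftrightarrow> (\<forall>ms. length ms \<le> n \<longrightarrow> foldr pd ms f differentiable_on U)"

lemma smooth_on_iff_upto: "smooth_on U f \<longleftrightarrow> (\<forall>n. smooth_upto n U f)"
  unfolding smooth_on_def smooth_upto_def by blast

lemma smooth_upto_0: "smooth_upto 0 U f \<longleftrightarrow> f differentiable_on U"
  by (simp add: smooth_upto_def)

lemma smooth_upto_Suc:
  "smooth_upto (Suc n) U f \<longleftrightarrow> f differentiable_on U \<and> (\<forall>\<mu>. smooth_upto n U (pd \<mu> f))"
proof
  assume a: "smooth_upto (Suc n) U f"
  have "foldr pd ms (pd \<mu> f) differentiable_on U" if "length ms \<le> n" for ms \<mu>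
    using a[unfolded smooth_upto_def, rule_format, of "ms @ [\<mu>]"] that by simp
  then show "f differentiable_on U \<and> (\<forall>\<mu>. smooth_upto n U (pd \<mu> f))"
    using a[unfolded smooth_upto_def, rule_format, of "[]"] by (simp add: smooth_upto_def)
next
  assume a: "f differentiable_on U \<and> (\<forall>\<mu>. smooth_upto n U (pd \<mu> f))"
  have "foldr pd ms f differentiable_on U" if "length ms \<le> Suc n" for ms
  proof (cases ms rule: rev_cases)
    case (snoc ks \<mu>)
    then show ?thesis using a that by (auto simp: smooth_upto_def)
  qed (use a in simp)
  then show "smooth_upto (Suc n) U f" by (simp add: smooth_upto_def)
qed

lemma smooth_upto_mono: "smooth_upto n U f \<Longrightarrow> m \<le> n \<Longrightarrow> smooth_upto m U f"
  by (auto simp: smooth_upto_def)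

lemma smooth_on_pd: "smooth_on U f \<Longrightarrow> smooth_on U (pd \<mu> f)"
  using smooth_upto_Suc unfolding smooth_on_iff_upto by blast

lemma smooth_on_pd': "smooth_on U f \<Longrightarrow> smooth_on U (\<lambda>x. pd \<mu> f x)"
  by (rule smooth_on_pd)

lemma matrix_inv_right_left:
  fixes A :: "real^'n^'n"
  assumes "invertible A"
  shows "A ** matrix_inv A = mat 1" "matrix_inv A ** A = mat 1"
  using someI_ex[OF assms[unfolded invertible_def]] unfolding matrix_inv_def by auto

text \<open>Cramer's rule makes the entries of an inverse matrix rational in those of the matrix, which is why
  inversion preserves smoothness.\<close>

lemma matrix_inv_cramer:
  fixes A :: "real^'n^'n"
  assumes "invertible A"
  shows "matrix_inv A $ k $ l = det (\<chi> i j. if j = k then (if i = l then 1 else 0) else A$i$j) * inverse (det A)"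
proof -
  have d: "det A \<noteq> 0" using assms by (simp add: invertible_det_nz)
  have "A *v (matrix_inv A *v axis l 1) = axis l 1"
    by (simp add: matrix_vector_mul_assoc matrix_inv_right_left[OF assms])
  then have "matrix_inv A *v axis l 1
      = (\<chi> k. det (\<chi> i j. if j = k then axis l 1 $ i else A$i$j) / det A)"
    using cramer[OF d] by blast
  moreover have "matrix_inv A $ k $ l = (matrix_inv A *v axis l 1) $ k"
    by (simp add: matrix_vector_mult_basis column_def)
  ultimately have "matrix_inv A $ k $ l = det (\<chi> i j. if j = k then axis l 1 $ i else A$i$j) / det A"
    by simp
  moreover have "(\<chi> i j. if j = k then axis l 1 $ i else A$i$j)
      = (\<chi> i j. if j = k then (if i = l then 1 else 0) else A$i$j)"
    by (simp add: vec_eq_iff axis_def)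
  ultimately show ?thesis by (simp add: divide_inverse)
qed

context
  fixes U :: "(real^4) set"
  assumes opn: "open U"
begin

lemma differentiable_on_iff_at: "f differentiable_on U \<longleftrightarrow> (\<forall>x\<in>U. f differentiable (at x))"
  by (simp add: differentiable_on_eq_differentiable_at[OF opn])

lemma smooth_on_differentiable: "smooth_on U f \<Longrightarrow> x \<in> U \<Longrightarrow> f differentiable (at x)"
  using differentiable_on_iff_at smooth_on_iff_upto smooth_upto_0 by blast

lemma smooth_upto_cong:
  assumes "\<And>x. x \<in> U \<Longrightarrow> f x = h x" "smooth_upto n U f"
  shows "smooth_upto n U h"
  using assms
proof (induction n arbitrary: f h)
  case 0
  then show ?case
    using differentiable_cong_open[OF opn, of _ f h] by (auto simp: smooth_upto_0 differentiable_on_iff_at)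
next
  case (Suc n)
  have "h differentiable_on U"
    using Suc.prems differentiable_cong_open[OF opn, of _ f h]
    by (auto simp: smooth_upto_Suc differentiable_on_iff_at)
  moreover have "smooth_upto n U (pd \<mu> h)" for \<mu>
    using Suc.IH[of "pd \<mu> f" "pd \<mu> h"] Suc.prems pd_cong_open[OF opn, of _ f h]
    by (auto simp: smooth_upto_Suc)
  ultimately show ?case by (simp add: smooth_upto_Suc)
qed

lemma smooth_on_cong:
  assumes "\<And>x. x \<in> U \<Longrightarrow> f x = h x" "smooth_on U f"
  shows "smooth_on U h"
  using assms smooth_upto_cong unfolding smooth_on_iff_upto by blast

lemma smooth_upto_const: "smooth_upto n U (\<lambda>x. c)"
proof (induction n arbitrary: c)
  case (Suc n)
  have "pd \<mu> (\<lambda>x. c) = (\<lambda>x. 0)" for \<mu> by (simp add: fun_eq_iff)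
  then show ?case using Suc[of 0] by (auto simp: smooth_upto_Suc)
qed (simp add: smooth_upto_0)

lemma smooth_upto_add:
  "smooth_upto n U f \<Longrightarrow> smooth_upto n U h \<Longrightarrow> smooth_upto n U (\<lambda>x. f x + h x)"
proof (induction n arbitrary: f h)
  case 0
  then show ?case by (simp add: smooth_upto_0 differentiable_on_add)
next
  case (Suc n)
  have "smooth_upto n U (pd \<mu> (\<lambda>x. f x + h x))" for \<mu>
    by (rule smooth_upto_cong[of "\<lambda>x. pd \<mu> f x + pd \<mu> h x"])
       (use Suc pd_add[of f _ h] in \<open>auto simp: smooth_upto_Suc differentiable_on_iff_at\<close>)
  then show ?case using Suc.prems by (simp add: smooth_upto_Suc differentiable_on_add)
qed

lemma smooth_upto_linear:
  "bounded_linear L \<Longrightarrow> smooth_upto n U f \<Longrightarrow> smooth_upto n U (\<lambda>x. L (f x))"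
proof (induction n arbitrary: f)
  case 0
  then show ?case using differentiable_linear[of L f] by (auto simp: smooth_upto_0 differentiable_on_iff_at)
next
  case (Suc n)
  have "smooth_upto n U (pd \<mu> (\<lambda>x. L (f x)))" for \<mu>
    by (rule smooth_upto_cong[of "\<lambda>x. L (pd \<mu> f x)"])
       (use Suc pd_bounded_linear[OF Suc.prems(1), of f] in \<open>auto simp: smooth_upto_Suc differentiable_on_iff_at\<close>)
  then show ?case using Suc.prems differentiable_linear[of L f]
    by (auto simp: smooth_upto_Suc differentiable_on_iff_at)
qed

lemma smooth_upto_bilinear:
  "bounded_bilinear b \<Longrightarrow> smooth_upto n U f \<Longrightarrow> smooth_upto n U h
    \<Longrightarrow> smooth_upto n U (\<lambda>x. b (f x) (h x))"
proof (induction n arbitrary: f h)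
  case 0
  then show ?case using differentiable_bilinear[of b f _ h] by (auto simp: smooth_upto_0 differentiable_on_iff_at)
next
  case (Suc n)
  have s: "smooth_upto n U f" "smooth_upto n U h"
    using Suc.prems smooth_upto_mono[of "Suc n" U _ n] by auto
  have "smooth_upto n U (pd \<mu> (\<lambda>x. b (f x) (h x)))" for \<mu>
    by (rule smooth_upto_cong[of "\<lambda>x. b (pd \<mu> f x) (h x) + b (f x) (pd \<mu> h x)"])
       (use Suc s pd_bilinear[OF Suc.prems(1), of f _ h] in
         \<open>auto simp: smooth_upto_Suc differentiable_on_iff_at intro!: smooth_upto_add\<close>)
  then show ?case using Suc.prems differentiable_bilinear[of b f _ h]
    by (auto simp: smooth_upto_Suc differentiable_on_iff_at)
qed

text \<open>The derivative of \<open>1/f\<close> is \<open>- f' (1/f)\<^sup>2\<close>, a product of functions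
  that are already known to have one derivative less.\<close>

lemma smooth_upto_inverse:
  fixes f :: "real^4 \<Rightarrow> real"
  assumes nz: "\<And>x. x \<in> U \<Longrightarrow> f x \<noteq> 0"
  shows "smooth_upto n U f \<Longrightarrow> smooth_upto n U (\<lambda>x. inverse (f x))"
proof (induction n)
  case 0
  then show ?case using nz by (auto simp: smooth_upto_0 differentiable_on_iff_at)
next
  case (Suc n)
  have d: "f differentiable (at x)" "(\<lambda>x. inverse (f x)) differentiable (at x)" if "x \<in> U" for x
    using Suc.prems nz that by (auto simp: smooth_upto_Suc differentiable_on_iff_at)
  have s: "smooth_upto n U (\<lambda>x. inverse (f x))"
    using Suc smooth_upto_mono[of "Suc n" U _ n] by auto
  have e: "- (pd \<mu> f x * (inverse (f x) * inverse (f x))) = pd \<mu> (\<lambda>x. inverse (f x)) x" if "x \<in> U" for x \<mu>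
    using pd_eqI[OF Deriv.has_derivative_inverse[OF nz[OF that] has_derivative_frechet[OF d(1)[OF that]]]]
    by (simp add: pd_def)
  have "smooth_upto n U (pd \<mu> (\<lambda>x. inverse (f x)))" for \<mu>
  proof (rule smooth_upto_cong[OF e])
    show "smooth_upto n U (\<lambda>x. - (pd \<mu> f x * (inverse (f x) * inverse (f x))))"
      using s Suc.prems by (intro smooth_upto_linear[OF bounded_linear_minus[OF bounded_linear_ident]]
          smooth_upto_bilinear[OF bounded_bilinear_mult]) (auto simp: smooth_upto_Suc)
  qed
  then show ?case using d by (auto simp: smooth_upto_Suc differentiable_on_iff_at)
qed

lemma smooth_on_const: "smooth_on U (\<lambda>x. c)"
  using smooth_upto_const by (auto simp: smooth_on_iff_upto)

lemma smooth_on_add: "smooth_on U f \<Longrightarrow> smooth_on U h \<Longrightarrow> smooth_on U (\<lambda>x. f x + h x)"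
  using smooth_upto_add[of _ f h] by (simp add: smooth_on_iff_upto)

lemma smooth_on_linear: "bounded_linear L \<Longrightarrow> smooth_on U f \<Longrightarrow> smooth_on U (\<lambda>x. L (f x))"
  using smooth_upto_linear[of L _ f] by (simp add: smooth_on_iff_upto)

lemma smooth_on_bilinear:
  "bounded_bilinear b \<Longrightarrow> smooth_on U f \<Longrightarrow> smooth_on U h \<Longrightarrow> smooth_on U (\<lambda>x. b (f x) (h x))"
  using smooth_upto_bilinear[of b _ f h] by (simp add: smooth_on_iff_upto)

lemmas smooth_on_minus = smooth_on_linear[OF bounded_linear_minus[OF bounded_linear_ident]]
  and smooth_on_nth = smooth_on_linear[OF bounded_linear_vec_nth]
  and smooth_on_transpose = smooth_on_linear[OF bounded_linear_transpose]
  and smooth_on_fst = smooth_on_linear[OF bounded_linear_fst]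
  and smooth_on_snd = smooth_on_linear[OF bounded_linear_snd]
  and smooth_on_mult = smooth_on_bilinear[OF bounded_bilinear_mult]
  and smooth_on_scaleR = smooth_on_bilinear[OF bounded_bilinear_scaleR]
  and smooth_on_matrix_mult = smooth_on_bilinear[OF bounded_bilinear_matrix_mult]
  and smooth_on_matrix_vector_mult = smooth_on_bilinear[OF bounded_bilinear_matrix_vector_mult]

lemma smooth_on_diff: "smooth_on U f \<Longrightarrow> smooth_on U h \<Longrightarrow> smooth_on U (\<lambda>x. f x - h x)"
  using smooth_on_add[OF _ smooth_on_minus, of f h] by simp

lemma smooth_on_sum:
  "(\<And>i. i \<in> I \<Longrightarrow> smooth_on U (f i)) \<Longrightarrow> smooth_on U (\<lambda>x. \<Sum>i\<in>I. f i x)"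
  by (induction I rule: infinite_finite_induct) (auto intro: smooth_on_const smooth_on_add)

lemma smooth_on_prod:
  fixes f :: "'i \<Rightarrow> real^4 \<Rightarrow> real"
  shows "(\<And>i. i \<in> I \<Longrightarrow> smooth_on U (f i)) \<Longrightarrow> smooth_on U (\<lambda>x. \<Prod>i\<in>I. f i x)"
  by (induction I rule: infinite_finite_induct) (auto intro: smooth_on_const smooth_on_mult)

lemma smooth_on_vec_lambda:
  fixes f :: "'n::finite \<Rightarrow> real^4 \<Rightarrow> 'v::real_normed_vector"
  assumes "\<And>i. smooth_on U (f i)"
  shows "smooth_on U (\<lambda>y. \<chi> i. f i y)"
proof -
  have "(\<lambda>y. \<chi> i. f i y) = (\<lambda>y. \<Sum>i\<in>UNIV. axis i (f i y))"
    by (auto simp: fun_eq_iff vec_eq_iff sum_component axis_def if_distrib cong: if_cong)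
  then show ?thesis
    by (auto intro!: smooth_on_sum smooth_on_linear[OF bounded_linear_lambda_vec] assms)
qed

lemma smooth_on_Pair: "smooth_on U f \<Longrightarrow> smooth_on U h \<Longrightarrow> smooth_on U (\<lambda>x. (f x, h x))"
proof -
  assume a: "smooth_on U f" "smooth_on U h"
  have b: "bounded_linear (\<lambda>x. (x, 0))" "bounded_linear (\<lambda>x. (0, x))"
    by (auto intro!: bounded_linear_Pair bounded_linear_ident bounded_linear_zero)
  show ?thesis
    using smooth_on_add[OF smooth_on_linear[OF b(1) a(1)] smooth_on_linear[OF b(2) a(2)]] by simp
qed

lemma smooth_on_inverse:
  fixes f :: "real^4 \<Rightarrow> real"
  shows "(\<And>x. x \<in> U \<Longrightarrow> f x \<noteq> 0) \<Longrightarrow> smooth_on U f \<Longrightarrow> smooth_on U (\<lambda>x. inverse (f x))"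
  using smooth_upto_inverse[of f] by (simp add: smooth_on_iff_upto)

lemma smooth_on_det:
  fixes A :: "real^4 \<Rightarrow> real^'n^'n"
  assumes "smooth_on U A"
  shows "smooth_on U (\<lambda>x. det (A x))"
  unfolding det_def
  by (intro smooth_on_sum smooth_on_mult smooth_on_const smooth_on_prod smooth_on_nth assms)

lemma smooth_on_matrix_inv:
  fixes A :: "real^4 \<Rightarrow> real^'n^'n"
  assumes "smooth_on U A" and inv: "\<And>x. x \<in> U \<Longrightarrow> invertible (A x)"
  shows "smooth_on U (\<lambda>x. matrix_inv (A x))"
proof (rule smooth_on_cong)
  show "(\<chi> k l. det (\<chi> i j. if j = k then (if i = l then 1 else 0) else A x$i$j) * inverse (det (A x)))
      = matrix_inv (A x)" if "x \<in> U" for x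
    using matrix_inv_cramer[OF inv[OF that]] by (simp add: vec_eq_iff)
  have "smooth_on U (\<lambda>x. if j = k then (if i = l then 1 else 0) else A x$i$j)" for i j k l
    by (cases "j = k") (simp_all add: smooth_on_const smooth_on_nth assms)
  then show "smooth_on U (\<lambda>x. \<chi> k l. det (\<chi> i j. if j = k then (if i = l then 1 else 0) else A x$i$j)
      * inverse (det (A x)))"
    by (intro smooth_on_vec_lambda smooth_on_mult smooth_on_inverse smooth_on_det assms)
       (use inv in \<open>auto simp: invertible_det_nz\<close>)
qed

end

section \<open>Symmetry of second derivatives and the divergence theorem\<close>

lemma has_real_derivative_along_axis:
  fixes f :: "real^4 \<Rightarrow> real"
  assumes "f differentiable (at (q + s *\<^sub>R axis \<mu> 1))"
  shows "((\<lambda>s. f (q + s *\<^sub>R axis \<mu> 1)) has_real_derivative pd \<mu> f (q + s *\<^sub>R axis \<mu> 1)) (at s)"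
proof -
  have 1: "((\<lambda>s. q + s *\<^sub>R axis \<mu> 1) has_derivative (\<lambda>h. h *\<^sub>R axis \<mu> 1)) (at s)"
    by (auto intro!: derivative_eq_intros)
  have 2: "frechet_derivative f (at (q + s *\<^sub>R axis \<mu> 1)) (h *\<^sub>R axis \<mu> 1)
      = h *\<^sub>R pd \<mu> f (q + s *\<^sub>R axis \<mu> 1)" for h
    using linear_scale[OF linear_frechet_derivative[OF assms]] by (simp add: pd_def)
  show ?thesis
    using has_derivative_compose[OF 1 has_derivative_frechet[OF assms]]
    unfolding has_field_derivative_def 2
    by (rule has_derivative_eq_rhs) (simp add: fun_eq_iff)
qed

text \<open>The mean value theorem, applied once along each side of a square of side \<open>h\<close>.\<close>

lemma second_difference:
  fixes f :: "real^4 \<Rightarrow> real"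
  assumes f: "\<And>y. norm (y - x) \<le> 2 * h \<Longrightarrow> f differentiable (at y)"
    and f': "\<And>y. norm (y - x) \<le> 2 * h \<Longrightarrow> pd \<mu> f differentiable (at y)"
    and h: "h > 0"
  obtains p where "norm (p - x) \<le> 2 * h"
    "f (x + h *\<^sub>R axis \<mu> 1 + h *\<^sub>R axis \<nu> 1) - f (x + h *\<^sub>R axis \<mu> 1) - f (x + h *\<^sub>R axis \<nu> 1) + f x
      = h * h * pd \<nu> (pd \<mu> f) p"
proof -
  let ?a = "axis \<mu> 1 :: real^4" and ?b = "axis \<nu> 1 :: real^4"
  have nrm: "norm (s *\<^sub>R ?a + t *\<^sub>R ?b) \<le> 2 * h" if "0 \<le> s" "s \<le> h" "0 \<le> t" "t \<le> h" for s t
    using norm_triangle_ineq[of "s *\<^sub>R ?a" "t *\<^sub>R ?b"] that by simp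
  have d1: "f differentiable (at (x + s *\<^sub>R ?a + t *\<^sub>R ?b))"
    and d2: "pd \<mu> f differentiable (at (x + s *\<^sub>R ?a + t *\<^sub>R ?b))"
    if "0 \<le> s" "s \<le> h" "0 \<le> t" "t \<le> h" for s t
    using f f' nrm[OF that] by (auto simp: add.assoc)
  define k where "k = (\<lambda>s. f (x + h *\<^sub>R ?b + s *\<^sub>R ?a) - f (x + s *\<^sub>R ?a))"
  have "(k has_real_derivative (pd \<mu> f (x + h *\<^sub>R ?b + s *\<^sub>R ?a) - pd \<mu> f (x + s *\<^sub>R ?a))) (at s)"
    if "0 \<le> s" "s \<le> h" for s
    unfolding k_def using d1[OF that, of h] d1[OF that, of 0] h
    by (intro DERIV_diff has_real_derivative_along_axis) (auto simp: ac_simps)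
  then obtain s where s: "0 < s" "s < h"
    "k h - k 0 = h * (pd \<mu> f (x + h *\<^sub>R ?b + s *\<^sub>R ?a) - pd \<mu> f (x + s *\<^sub>R ?a))"
    using MVT2[of 0 h k "\<lambda>s. pd \<mu> f (x + h *\<^sub>R ?b + s *\<^sub>R ?a) - pd \<mu> f (x + s *\<^sub>R ?a)"] h by auto
  have "((\<lambda>t. pd \<mu> f (x + s *\<^sub>R ?a + t *\<^sub>R ?b)) has_real_derivative
      pd \<nu> (pd \<mu> f) (x + s *\<^sub>R ?a + t *\<^sub>R ?b)) (at t)" if "0 \<le> t" "t \<le> h" for t
    using d2[of s t] s that by (intro has_real_derivative_along_axis) auto
  then obtain t where t: "0 < t" "t < h"
    "pd \<mu> f (x + s *\<^sub>R ?a + h *\<^sub>R ?b) - pd \<mu> f (x + s *\<^sub>R ?a + 0 *\<^sub>R ?b)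
      = h * pd \<nu> (pd \<mu> f) (x + s *\<^sub>R ?a + t *\<^sub>R ?b)"
    using MVT2[of 0 h "\<lambda>t. pd \<mu> f (x + s *\<^sub>R ?a + t *\<^sub>R ?b)"
        "\<lambda>t. pd \<nu> (pd \<mu> f) (x + s *\<^sub>R ?a + t *\<^sub>R ?b)"] h by auto
  show ?thesis
  proof (rule that[of "x + s *\<^sub>R ?a + t *\<^sub>R ?b"])
    show "norm (x + s *\<^sub>R ?a + t *\<^sub>R ?b - x) \<le> 2 * h"
      using nrm[of s t] s t by (simp add: add.assoc)
    have "x + h *\<^sub>R ?b + s *\<^sub>R ?a = x + s *\<^sub>R ?a + h *\<^sub>R ?b" "x + h *\<^sub>R ?b + h *\<^sub>R ?a = x + h *\<^sub>R ?a + h *\<^sub>R ?b"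
      by simp_all
    then show "f (x + h *\<^sub>R ?a + h *\<^sub>R ?b) - f (x + h *\<^sub>R ?a) - f (x + h *\<^sub>R ?b) + f x
      = h * h * pd \<nu> (pd \<mu> f) (x + s *\<^sub>R ?a + t *\<^sub>R ?b)"
      using s(3) t(3) by (simp add: k_def algebra_simps)
  qed
qed

text \<open>Both mixed derivatives are limits of the same second difference over a shrinking square, and both
  are continuous.\<close>

lemma pd_commute_real:
  fixes f :: "real^4 \<Rightarrow> real"
  assumes U: "open U" "x \<in> U" and sm: "smooth_on U f"
  shows "pd \<mu> (pd \<nu> f) x = pd \<nu> (pd \<mu> f) x"
proof (rule ccontr)
  assume ne: "pd \<mu> (pd \<nu> f) x \<noteq> pd \<nu> (pd \<mu> f) x"
  define e where "e = dist (pd \<mu> (pd \<nu> f) x) (pd \<nu> (pd \<mu> f) x) / 2"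
  have e: "e > 0" using ne by (simp add: e_def)
  have c: "isCont (pd \<mu> (pd \<nu> f)) x" for \<mu> \<nu>
    using smooth_on_differentiable[OF U(1) smooth_on_pd[OF smooth_on_pd[OF sm]] U(2)]
    by (simp add: differentiable_imp_continuous_within)
  obtain r where r: "r > 0" "ball x r \<subseteq> U" using U openE by blast
  obtain d1 where d1: "d1 > 0" "\<And>y. dist y x < d1 \<Longrightarrow> dist (pd \<mu> (pd \<nu> f) y) (pd \<mu> (pd \<nu> f) x) < e"
    using c[of \<mu> \<nu>] e unfolding continuous_at_eps_delta by blast
  obtain d2 where d2: "d2 > 0" "\<And>y. dist y x < d2 \<Longrightarrow> dist (pd \<nu> (pd \<mu> f) y) (pd \<nu> (pd \<mu> f) x) < e"
    using c[of \<nu> \<mu>] e unfolding continuous_at_eps_delta by blast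
  define h where "h = min r (min d1 d2) / 4"
  have h: "h > 0" "2 * h < r" "2 * h < d1" "2 * h < d2" using r d1 d2 by (auto simp: h_def)
  have inU: "y \<in> U" if "norm (y - x) \<le> 2 * h" for y
  proof -
    have "y \<in> ball x r" using that h by (simp add: dist_norm norm_minus_commute)
    then show ?thesis using r(2) by blast
  qed
  have df: "f differentiable (at y)" "pd \<mu> f differentiable (at y)" "pd \<nu> f differentiable (at y)"
    if "norm (y - x) \<le> 2 * h" for y
    using inU[OF that] smooth_on_differentiable[OF U(1)] sm smooth_on_pd[OF sm] by blast+
  obtain p where p: "norm (p - x) \<le> 2 * h"
    "f (x + h *\<^sub>R axis \<mu> 1 + h *\<^sub>R axis \<nu> 1) - f (x + h *\<^sub>R axis \<mu> 1) - f (x + h *\<^sub>R axis \<nu> 1) + f x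
      = h * h * pd \<nu> (pd \<mu> f) p"
    using second_difference[of x h f \<mu> \<nu>] df h(1) by blast
  obtain q where q: "norm (q - x) \<le> 2 * h"
    "f (x + h *\<^sub>R axis \<nu> 1 + h *\<^sub>R axis \<mu> 1) - f (x + h *\<^sub>R axis \<nu> 1) - f (x + h *\<^sub>R axis \<mu> 1) + f x
      = h * h * pd \<mu> (pd \<nu> f) q"
    using second_difference[of x h f \<nu> \<mu>] df h(1) by blast
  have sw: "x + h *\<^sub>R axis \<nu> 1 + h *\<^sub>R axis \<mu> 1 = x + h *\<^sub>R axis \<mu> 1 + h *\<^sub>R axis \<nu> 1" by simp
  have "h * h * pd \<nu> (pd \<mu> f) p = h * h * pd \<mu> (pd \<nu> f) q"
    using p(2) q(2) unfolding sw by linarith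
  then have eq: "pd \<nu> (pd \<mu> f) p = pd \<mu> (pd \<nu> f) q" using h(1) by simp
  have "dist (pd \<nu> (pd \<mu> f) p) (pd \<nu> (pd \<mu> f) x) < e" "dist (pd \<mu> (pd \<nu> f) q) (pd \<mu> (pd \<nu> f) x) < e"
    using d1 d2 p(1) q(1) h by (auto simp: dist_norm)
  then show False using eq dist_triangle2[of "pd \<mu> (pd \<nu> f) x" "pd \<nu> (pd \<mu> f) x" "pd \<nu> (pd \<mu> f) p"]
    by (simp add: e_def dist_commute)
qed

lemma pd_commute:
  fixes f :: "real^4 \<Rightarrow> 'v::euclidean_space"
  assumes U: "open U" "x \<in> U" and sm: "smooth_on U f"
  shows "pd \<mu> (pd \<nu> f) x = pd \<nu> (pd \<mu> f) x"
proof (rule euclidean_eqI)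
  fix b :: 'v
  have i: "pd \<mu> (\<lambda>y. h y \<bullet> b) y = pd \<mu> h y \<bullet> b" if "smooth_on U h" "y \<in> U" for \<mu> y and h :: "real^4 \<Rightarrow> 'v"
    by (rule pd_bounded_linear[OF bounded_linear_inner_left smooth_on_differentiable[OF U(1) that]])
  have ii: "pd \<mu> (pd \<nu> (\<lambda>y. f y \<bullet> b)) x = pd \<mu> (pd \<nu> f) x \<bullet> b" for \<mu> \<nu>
    using pd_cong_open[OF U i[OF sm, where \<mu> = \<nu>], where \<mu> = \<mu>]
      i[OF smooth_on_pd[OF sm, of \<nu>] U(2), where \<mu> = \<mu>] by simp
  show "pd \<mu> (pd \<nu> f) x \<bullet> b = pd \<nu> (pd \<mu> f) x \<bullet> b"
    using pd_commute_real[OF U smooth_on_linear[OF U(1) bounded_linear_inner_left sm], of \<mu> \<nu> b]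
    by (simp add: ii)
qed

text \<open>The integral of a compactly supported function is unchanged by translations, so
  differentiating it under the integral sign along a coordinate axis gives zero.\<close>

lemma has_integral_pd_zero:
  fixes F :: "real^4 \<Rightarrow> real"
  assumes U: "open U" and K: "compact K" "K \<subseteq> U"
    and d: "\<And>x. x \<in> U \<Longrightarrow> F differentiable (at x)"
    and c: "continuous_on U (pd \<mu> F)"
    and z: "\<And>x. x \<in> U \<Longrightarrow> x \<notin> K \<Longrightarrow> F x = 0"
  shows "(pd \<mu> F has_integral 0) U"
proof -
  \<comment> \<open>The extension by zero is differentiable everywhere, as \<open>U\<close> and the complement of \<open>K\<close> cover the space.\<close>
  define H where "H = (\<lambda>x. if x \<in> U then F x else 0)"
  have opK: "open (- K)" using K(1) by (simp add: compact_imp_closed open_Compl)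
  have HU: "H y = F y" if "y \<in> U" for y using that by (simp add: H_def)
  have HK: "H y = 0" if "y \<in> - K" for y using that z by (simp add: H_def)
  have dH: "H differentiable (at x)" for x
  proof (cases "x \<in> U")
    case True
    then show ?thesis using differentiable_cong_open[OF U True, of F H] d HU by simp
  next
    case False
    then have "x \<in> - K" using K(2) by blast
    then show ?thesis using differentiable_cong_open[OF opK, of x "\<lambda>_. 0" H] HK by simp
  qed
  have pU: "pd \<mu> H x = pd \<mu> F x" if "x \<in> U" for x
    by (rule pd_cong_open[OF U that HU])
  have pK: "pd \<mu> H x = 0" if "x \<in> - K" for x
    using pd_cong_open[OF opK that HK, where \<mu> = \<mu>] by simp
  have "continuous_on (U \<union> - K) (pd \<mu> H)"
  proof (rule continuous_on_open_Un[OF U opK])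
    show "continuous_on U (pd \<mu> H)" using c pU by (simp cong: continuous_on_cong)
    show "continuous_on (- K) (pd \<mu> H)"
      by (rule continuous_on_eq[OF continuous_on_const[of _ 0]]) (simp add: pK)
  qed
  moreover have "U \<union> - K = UNIV" using K(2) by blast
  ultimately have cp: "continuous_on UNIV (pd \<mu> H)" by simp
  have cH: "continuous_on UNIV H"
    using dH differentiable_imp_continuous_on[of H UNIV] by (simp add: differentiable_on_def)
  obtain B where B: "B > 0" "\<And>x. x \<in> K \<Longrightarrow> norm x \<le> B"
    using compact_imp_bounded[OF K(1)] bounded_pos by blast
  \<comment> \<open>A box that still contains \<open>K\<close> after translations by at most 1.\<close>
  define a b :: "real^4" where "a = - (\<chi> i. B + 2)" and "b = (\<chi> i. B + 2)"
  have inbox: "x \<in> cbox a b" if "norm x \<le> B + 2" for x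
  proof -
    have "\<bar>x $ i\<bar> \<le> B + 2" for i using that component_le_norm_cart[of x i] by linarith
    then have "- (B + 2) \<le> x $ i \<and> x $ i \<le> B + 2" for i by (metis abs_le_D1 abs_le_D2 minus_le_iff)
    then show ?thesis by (simp add: a_def b_def mem_box_cart)
  qed
  have outbox: "x \<in> - K" if "x \<notin> cbox a b" for x
  proof
    assume "x \<in> K"
    then have "norm x \<le> B + 2" using B(2)[of x] by simp
    then show False using inbox that by blast
  qed
  let ?e = "axis \<mu> 1 :: real^4"
  have shift: "integral (cbox a b) (\<lambda>x. H (x + t *\<^sub>R ?e)) = integral UNIV H" if t: "t \<in> {-1..1}" for t
  proof -
    have nt: "norm (t *\<^sub>R ?e) \<le> 1" using t by auto
    have 1: "(H has_integral integral (cbox a b) H) (cbox a b)"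
      by (rule integrable_integral, rule integrable_continuous, rule continuous_on_subset[OF cH]) simp
    have "(H has_integral integral (cbox a b) H) UNIV"
      by (rule has_integral_on_superset[OF 1]) (use HK outbox in auto)
    then have u: "integral UNIV H = integral (cbox a b) H" by (rule integral_unique)
    have "(H has_integral integral (cbox a b) H) (cbox (a + t *\<^sub>R ?e) (b + t *\<^sub>R ?e))"
    proof -
      have "H x = 0" if "x \<notin> cbox (a + t *\<^sub>R ?e) (b + t *\<^sub>R ?e)" for x
      proof -
        have "x - t *\<^sub>R ?e \<notin> cbox a b"
          using that unfolding mem_box_cart by (auto simp: algebra_simps)
        then have "norm (x - t *\<^sub>R ?e) > B + 2" using inbox linorder_not_less by blast
        then have "norm x > B"
          using norm_triangle_ineq4[of x "t *\<^sub>R ?e"] nt by linarith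
        then have "x \<notin> K" using B(2) linorder_not_less by blast
        then show ?thesis using HK by simp
      qed
      then have eq: "(\<lambda>x. if x \<in> cbox (a + t *\<^sub>R ?e) (b + t *\<^sub>R ?e) then H x else 0) = H"
        by (auto simp: fun_eq_iff)
      show ?thesis
        using \<open>(H has_integral integral (cbox a b) H) UNIV\<close>
        by (subst has_integral_restrict_UNIV[symmetric], subst eq)
    qed
    then have "((\<lambda>x. H (x + t *\<^sub>R ?e)) has_integral integral (cbox a b) H) (cbox a b)"
      using has_integral_shift_cbox_iff[of H "t *\<^sub>R ?e" _ a b] by (simp add: add.commute o_def)
    then show ?thesis using u by (simp add: integral_unique)
  qed
  have "((\<lambda>t. integral (cbox a b) (\<lambda>x. H (x + t *\<^sub>R ?e))) has_field_derivative
      integral (cbox a b) (\<lambda>x. pd \<mu> H (x + 0 *\<^sub>R ?e))) (at 0 within {-1..1})"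
  proof (rule leibniz_rule_field_derivative)
    show "((\<lambda>t. H (x + t *\<^sub>R ?e)) has_field_derivative pd \<mu> H (x + t *\<^sub>R ?e)) (at t within {-1..1})" for x t
      by (rule has_field_derivative_at_within, rule has_real_derivative_along_axis, rule dH)
    show "(\<lambda>x. H (x + t *\<^sub>R ?e)) integrable_on cbox a b" for t
      by (rule integrable_continuous)
         (intro continuous_on_compose2[OF cH] continuous_intros, auto)
    show "continuous_on ({- 1..1} \<times> cbox a b) (\<lambda>(t, x). pd \<mu> H (x + t *\<^sub>R ?e))"
      unfolding split_beta
      by (intro continuous_on_compose2[OF cp] continuous_intros) auto
  qed auto
  moreover have "((\<lambda>t. integral (cbox a b) (\<lambda>x. H (x + t *\<^sub>R ?e))) has_field_derivative 0) (at 0 within {-1..1})"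
    unfolding has_field_derivative_def
    by (rule has_derivative_transform[where f = "\<lambda>_. integral UNIV H"])
       (use shift in \<open>auto intro!: has_derivative_eq_rhs[OF has_derivative_const]\<close>)
  moreover have at0: "at 0 within {-1..1} = at (0::real)"
    by (rule at_within_interior) simp
  ultimately have i0: "integral (cbox a b) (pd \<mu> H) = 0"
    unfolding at0 using DERIV_unique by fastforce
  have "(pd \<mu> H has_integral 0) (cbox a b)"
    using integrable_integral[OF integrable_continuous[OF continuous_on_subset[OF cp]], of a b] i0 by simp
  then have "(pd \<mu> H has_integral 0) UNIV"
    by (rule has_integral_on_superset) (use pK outbox in auto)
  then have "((\<lambda>x. if x \<in> U then pd \<mu> F x else 0) has_integral 0) UNIV"
    by (rule has_integral_eq[rotated]) (use pU pK K(2) in auto)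
  then show ?thesis by (simp add: has_integral_restrict_UNIV)
qed

section \<open>Explicit components\<close>

lemma vector_4_nth [simp]:
  "(vector [a, b, c, d] :: 'a::zero^4) $ 1 = a" "(vector [a, b, c, d] :: 'a::zero^4) $ 2 = b"
  "(vector [a, b, c, d] :: 'a::zero^4) $ 3 = c" "(vector [a, b, c, d] :: 'a::zero^4) $ 4 = d"
  unfolding vector_def by simp_all

lemma det_4:
  "det (A::'a::comm_ring_1^4^4) =
     A$1$1 * (A$2$2 * A$3$3 * A$4$4 + A$2$3 * A$3$4 * A$4$2 + A$2$4 * A$3$2 * A$4$3
            - A$2$4 * A$3$3 * A$4$2 - A$2$3 * A$3$2 * A$4$4 - A$2$2 * A$3$4 * A$4$3)
   - A$1$2 * (A$2$1 * A$3$3 * A$4$4 + A$2$3 * A$3$4 * A$4$1 + A$2$4 * A$3$1 * A$4$3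
            - A$2$4 * A$3$3 * A$4$1 - A$2$3 * A$3$1 * A$4$4 - A$2$1 * A$3$4 * A$4$3)
   + A$1$3 * (A$2$1 * A$3$2 * A$4$4 + A$2$2 * A$3$4 * A$4$1 + A$2$4 * A$3$1 * A$4$2
            - A$2$4 * A$3$2 * A$4$1 - A$2$2 * A$3$1 * A$4$4 - A$2$1 * A$3$4 * A$4$2)
   - A$1$4 * (A$2$1 * A$3$2 * A$4$3 + A$2$2 * A$3$3 * A$4$1 + A$2$3 * A$3$1 * A$4$2
            - A$2$3 * A$3$2 * A$4$1 - A$2$2 * A$3$1 * A$4$3 - A$2$1 * A$3$3 * A$4$2)"
proof -
  have f: "finite {2, 3, 4::4}" "1 \<notin> {2, 3, 4::4}" "finite {3, 4::4}" "2 \<notin> {3, 4::4}"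
    "finite {4::4}" "3 \<notin> {4::4}" by auto
  show ?thesis
    unfolding det_def UNIV_4
    unfolding sum_over_permutations_insert[OF f(1,2)]
    unfolding sum_over_permutations_insert[OF f(3,4)]
    unfolding sum_over_permutations_insert[OF f(5,6)]
    unfolding permutes_sing
    by (simp add: sign_swap_id permutation_swap_id sign_compose sign_id swap_id_eq permutation_compose algebra_simps)
qed

lemma eps3_simps [simp]:
  "eps3 1 1 1 = 0" "eps3 1 1 2 = 0" "eps3 1 1 3 = 0"
  "eps3 1 2 1 = 0" "eps3 1 2 2 = 0" "eps3 1 2 3 = 1"
  "eps3 1 3 1 = 0" "eps3 1 3 2 = -1" "eps3 1 3 3 = 0"
  "eps3 2 1 1 = 0" "eps3 2 1 2 = 0" "eps3 2 1 3 = -1"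
  "eps3 2 2 1 = 0" "eps3 2 2 2 = 0" "eps3 2 2 3 = 0"
  "eps3 2 3 1 = 1" "eps3 2 3 2 = 0" "eps3 2 3 3 = 0"
  "eps3 3 1 1 = 0" "eps3 3 1 2 = 1" "eps3 3 1 3 = 0"
  "eps3 3 2 1 = -1" "eps3 3 2 2 = 0" "eps3 3 2 3 = 0"
  "eps3 3 3 1 = 0" "eps3 3 3 2 = 0" "eps3 3 3 3 = 0"
  by (simp_all add: eps3_def det_3 axis_def)

lemma eta_simps [simp]:
  "eta 1 $ 1 $ 1 = 0" "eta 1 $ 1 $ 2 = 0" "eta 1 $ 1 $ 3 = 0" "eta 1 $ 1 $ 4 = 1"
  "eta 1 $ 2 $ 1 = 0" "eta 1 $ 2 $ 2 = 0" "eta 1 $ 2 $ 3 = -1" "eta 1 $ 2 $ 4 = 0"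
  "eta 1 $ 3 $ 1 = 0" "eta 1 $ 3 $ 2 = 1" "eta 1 $ 3 $ 3 = 0" "eta 1 $ 3 $ 4 = 0"
  "eta 1 $ 4 $ 1 = -1" "eta 1 $ 4 $ 2 = 0" "eta 1 $ 4 $ 3 = 0" "eta 1 $ 4 $ 4 = 0"
  "eta 2 $ 1 $ 1 = 0" "eta 2 $ 1 $ 2 = 0" "eta 2 $ 1 $ 3 = 1" "eta 2 $ 1 $ 4 = 0"
  "eta 2 $ 2 $ 1 = 0" "eta 2 $ 2 $ 2 = 0" "eta 2 $ 2 $ 3 = 0" "eta 2 $ 2 $ 4 = 1"
  "eta 2 $ 3 $ 1 = -1" "eta 2 $ 3 $ 2 = 0" "eta 2 $ 3 $ 3 = 0" "eta 2 $ 3 $ 4 = 0"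
  "eta 2 $ 4 $ 1 = 0" "eta 2 $ 4 $ 2 = -1" "eta 2 $ 4 $ 3 = 0" "eta 2 $ 4 $ 4 = 0"
  "eta 3 $ 1 $ 1 = 0" "eta 3 $ 1 $ 2 = -1" "eta 3 $ 1 $ 3 = 0" "eta 3 $ 1 $ 4 = 0"
  "eta 3 $ 2 $ 1 = 1" "eta 3 $ 2 $ 2 = 0" "eta 3 $ 2 $ 3 = 0" "eta 3 $ 2 $ 4 = 0"
  "eta 3 $ 3 $ 1 = 0" "eta 3 $ 3 $ 2 = 0" "eta 3 $ 3 $ 3 = 0" "eta 3 $ 3 $ 4 = 1"
  "eta 3 $ 4 $ 1 = 0" "eta 3 $ 4 $ 2 = 0" "eta 3 $ 4 $ 3 = -1" "eta 3 $ 4 $ 4 = 0"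
  by (simp_all add: eta_def)

lemma eps4_simps [simp]:
  "eps4 1 1 1 1 = 0" "eps4 1 1 1 2 = 0" "eps4 1 1 1 3 = 0" "eps4 1 1 1 4 = 0"
  "eps4 1 1 2 1 = 0" "eps4 1 1 2 2 = 0" "eps4 1 1 2 3 = 0" "eps4 1 1 2 4 = 0"
  "eps4 1 1 3 1 = 0" "eps4 1 1 3 2 = 0" "eps4 1 1 3 3 = 0" "eps4 1 1 3 4 = 0"
  "eps4 1 1 4 1 = 0" "eps4 1 1 4 2 = 0" "eps4 1 1 4 3 = 0" "eps4 1 1 4 4 = 0"
  "eps4 1 2 1 1 = 0" "eps4 1 2 1 2 = 0" "eps4 1 2 1 3 = 0" "eps4 1 2 1 4 = 0"
  "eps4 1 2 2 1 = 0" "eps4 1 2 2 2 = 0" "eps4 1 2 2 3 = 0" "eps4 1 2 2 4 = 0"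
  "eps4 1 2 3 1 = 0" "eps4 1 2 3 2 = 0" "eps4 1 2 3 3 = 0" "eps4 1 2 3 4 = 1"
  "eps4 1 2 4 1 = 0" "eps4 1 2 4 2 = 0" "eps4 1 2 4 3 = -1" "eps4 1 2 4 4 = 0"
  "eps4 1 3 1 1 = 0" "eps4 1 3 1 2 = 0" "eps4 1 3 1 3 = 0" "eps4 1 3 1 4 = 0"
  "eps4 1 3 2 1 = 0" "eps4 1 3 2 2 = 0" "eps4 1 3 2 3 = 0" "eps4 1 3 2 4 = -1"
  "eps4 1 3 3 1 = 0" "eps4 1 3 3 2 = 0" "eps4 1 3 3 3 = 0" "eps4 1 3 3 4 = 0"
  "eps4 1 3 4 1 = 0" "eps4 1 3 4 2 = 1" "eps4 1 3 4 3 = 0" "eps4 1 3 4 4 = 0"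
  "eps4 1 4 1 1 = 0" "eps4 1 4 1 2 = 0" "eps4 1 4 1 3 = 0" "eps4 1 4 1 4 = 0"
  "eps4 1 4 2 1 = 0" "eps4 1 4 2 2 = 0" "eps4 1 4 2 3 = 1" "eps4 1 4 2 4 = 0"
  "eps4 1 4 3 1 = 0" "eps4 1 4 3 2 = -1" "eps4 1 4 3 3 = 0" "eps4 1 4 3 4 = 0"
  "eps4 1 4 4 1 = 0" "eps4 1 4 4 2 = 0" "eps4 1 4 4 3 = 0" "eps4 1 4 4 4 = 0"
  "eps4 2 1 1 1 = 0" "eps4 2 1 1 2 = 0" "eps4 2 1 1 3 = 0" "eps4 2 1 1 4 = 0"
  "eps4 2 1 2 1 = 0" "eps4 2 1 2 2 = 0" "eps4 2 1 2 3 = 0" "eps4 2 1 2 4 = 0"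
  "eps4 2 1 3 1 = 0" "eps4 2 1 3 2 = 0" "eps4 2 1 3 3 = 0" "eps4 2 1 3 4 = -1"
  "eps4 2 1 4 1 = 0" "eps4 2 1 4 2 = 0" "eps4 2 1 4 3 = 1" "eps4 2 1 4 4 = 0"
  "eps4 2 2 1 1 = 0" "eps4 2 2 1 2 = 0" "eps4 2 2 1 3 = 0" "eps4 2 2 1 4 = 0"
  "eps4 2 2 2 1 = 0" "eps4 2 2 2 2 = 0" "eps4 2 2 2 3 = 0" "eps4 2 2 2 4 = 0"
  "eps4 2 2 3 1 = 0" "eps4 2 2 3 2 = 0" "eps4 2 2 3 3 = 0" "eps4 2 2 3 4 = 0"
  "eps4 2 2 4 1 = 0" "eps4 2 2 4 2 = 0" "eps4 2 2 4 3 = 0" "eps4 2 2 4 4 = 0"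
  "eps4 2 3 1 1 = 0" "eps4 2 3 1 2 = 0" "eps4 2 3 1 3 = 0" "eps4 2 3 1 4 = 1"
  "eps4 2 3 2 1 = 0" "eps4 2 3 2 2 = 0" "eps4 2 3 2 3 = 0" "eps4 2 3 2 4 = 0"
  "eps4 2 3 3 1 = 0" "eps4 2 3 3 2 = 0" "eps4 2 3 3 3 = 0" "eps4 2 3 3 4 = 0"
  "eps4 2 3 4 1 = -1" "eps4 2 3 4 2 = 0" "eps4 2 3 4 3 = 0" "eps4 2 3 4 4 = 0"
  "eps4 2 4 1 1 = 0" "eps4 2 4 1 2 = 0" "eps4 2 4 1 3 = -1" "eps4 2 4 1 4 = 0"
  "eps4 2 4 2 1 = 0" "eps4 2 4 2 2 = 0" "eps4 2 4 2 3 = 0" "eps4 2 4 2 4 = 0"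
  "eps4 2 4 3 1 = 1" "eps4 2 4 3 2 = 0" "eps4 2 4 3 3 = 0" "eps4 2 4 3 4 = 0"
  "eps4 2 4 4 1 = 0" "eps4 2 4 4 2 = 0" "eps4 2 4 4 3 = 0" "eps4 2 4 4 4 = 0"
  "eps4 3 1 1 1 = 0" "eps4 3 1 1 2 = 0" "eps4 3 1 1 3 = 0" "eps4 3 1 1 4 = 0"
  "eps4 3 1 2 1 = 0" "eps4 3 1 2 2 = 0" "eps4 3 1 2 3 = 0" "eps4 3 1 2 4 = 1"
  "eps4 3 1 3 1 = 0" "eps4 3 1 3 2 = 0" "eps4 3 1 3 3 = 0" "eps4 3 1 3 4 = 0"
  "eps4 3 1 4 1 = 0" "eps4 3 1 4 2 = -1" "eps4 3 1 4 3 = 0" "eps4 3 1 4 4 = 0"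
  "eps4 3 2 1 1 = 0" "eps4 3 2 1 2 = 0" "eps4 3 2 1 3 = 0" "eps4 3 2 1 4 = -1"
  "eps4 3 2 2 1 = 0" "eps4 3 2 2 2 = 0" "eps4 3 2 2 3 = 0" "eps4 3 2 2 4 = 0"
  "eps4 3 2 3 1 = 0" "eps4 3 2 3 2 = 0" "eps4 3 2 3 3 = 0" "eps4 3 2 3 4 = 0"
  "eps4 3 2 4 1 = 1" "eps4 3 2 4 2 = 0" "eps4 3 2 4 3 = 0" "eps4 3 2 4 4 = 0"
  "eps4 3 3 1 1 = 0" "eps4 3 3 1 2 = 0" "eps4 3 3 1 3 = 0" "eps4 3 3 1 4 = 0"
  "eps4 3 3 2 1 = 0" "eps4 3 3 2 2 = 0" "eps4 3 3 2 3 = 0" "eps4 3 3 2 4 = 0"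
  "eps4 3 3 3 1 = 0" "eps4 3 3 3 2 = 0" "eps4 3 3 3 3 = 0" "eps4 3 3 3 4 = 0"
  "eps4 3 3 4 1 = 0" "eps4 3 3 4 2 = 0" "eps4 3 3 4 3 = 0" "eps4 3 3 4 4 = 0"
  "eps4 3 4 1 1 = 0" "eps4 3 4 1 2 = 1" "eps4 3 4 1 3 = 0" "eps4 3 4 1 4 = 0"
  "eps4 3 4 2 1 = -1" "eps4 3 4 2 2 = 0" "eps4 3 4 2 3 = 0" "eps4 3 4 2 4 = 0"
  "eps4 3 4 3 1 = 0" "eps4 3 4 3 2 = 0" "eps4 3 4 3 3 = 0" "eps4 3 4 3 4 = 0"
  "eps4 3 4 4 1 = 0" "eps4 3 4 4 2 = 0" "eps4 3 4 4 3 = 0" "eps4 3 4 4 4 = 0"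
  "eps4 4 1 1 1 = 0" "eps4 4 1 1 2 = 0" "eps4 4 1 1 3 = 0" "eps4 4 1 1 4 = 0"
  "eps4 4 1 2 1 = 0" "eps4 4 1 2 2 = 0" "eps4 4 1 2 3 = -1" "eps4 4 1 2 4 = 0"
  "eps4 4 1 3 1 = 0" "eps4 4 1 3 2 = 1" "eps4 4 1 3 3 = 0" "eps4 4 1 3 4 = 0"
  "eps4 4 1 4 1 = 0" "eps4 4 1 4 2 = 0" "eps4 4 1 4 3 = 0" "eps4 4 1 4 4 = 0"
  "eps4 4 2 1 1 = 0" "eps4 4 2 1 2 = 0" "eps4 4 2 1 3 = 1" "eps4 4 2 1 4 = 0"
  "eps4 4 2 2 1 = 0" "eps4 4 2 2 2 = 0" "eps4 4 2 2 3 = 0" "eps4 4 2 2 4 = 0"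
  "eps4 4 2 3 1 = -1" "eps4 4 2 3 2 = 0" "eps4 4 2 3 3 = 0" "eps4 4 2 3 4 = 0"
  "eps4 4 2 4 1 = 0" "eps4 4 2 4 2 = 0" "eps4 4 2 4 3 = 0" "eps4 4 2 4 4 = 0"
  "eps4 4 3 1 1 = 0" "eps4 4 3 1 2 = -1" "eps4 4 3 1 3 = 0" "eps4 4 3 1 4 = 0"
  "eps4 4 3 2 1 = 1" "eps4 4 3 2 2 = 0" "eps4 4 3 2 3 = 0" "eps4 4 3 2 4 = 0"
  "eps4 4 3 3 1 = 0" "eps4 4 3 3 2 = 0" "eps4 4 3 3 3 = 0" "eps4 4 3 3 4 = 0"
  "eps4 4 3 4 1 = 0" "eps4 4 3 4 2 = 0" "eps4 4 3 4 3 = 0" "eps4 4 3 4 4 = 0"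
  "eps4 4 4 1 1 = 0" "eps4 4 4 1 2 = 0" "eps4 4 4 1 3 = 0" "eps4 4 4 1 4 = 0"
  "eps4 4 4 2 1 = 0" "eps4 4 4 2 2 = 0" "eps4 4 4 2 3 = 0" "eps4 4 4 2 4 = 0"
  "eps4 4 4 3 1 = 0" "eps4 4 4 3 2 = 0" "eps4 4 4 3 3 = 0" "eps4 4 4 3 4 = 0"
  "eps4 4 4 4 1 = 0" "eps4 4 4 4 2 = 0" "eps4 4 4 4 3 = 0" "eps4 4 4 4 4 = 0"
  by (simp_all add: eps4_def det_4 axis_def)

lemma eps4_contract:
  "(\<Sum>\<mu>\<in>UNIV. \<Sum>\<nu>\<in>UNIV. \<Sum>\<rho>\<in>UNIV. \<Sum>\<sigma>\<in>UNIV. eps4 \<mu> \<nu> \<rho> \<sigma> * (a$\<mu> * b$\<nu> * c$\<rho> * d$\<sigma>))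
    = det (vector [a, b, c, d] :: real^4^4)"
  by (simp add: sum_4 det_4 algebra_simps)

lemma wedge22_eq:
  "wedge22 a b = (1/4) * ((a$1$2 - a$2$1) * (b$3$4 - b$4$3) + (a$3$4 - a$4$3) * (b$1$2 - b$2$1)
     - (a$1$3 - a$3$1) * (b$2$4 - b$4$2) - (a$2$4 - a$4$2) * (b$1$3 - b$3$1)
     + (a$1$4 - a$4$1) * (b$2$3 - b$3$2) + (a$2$3 - a$3$2) * (b$1$4 - b$4$1))"
  by (simp add: wedge22_def sum_4 algebra_simps)

lemma eta_quaternion:
  "eta i ** eta j = (if i = j then - mat 1 else 0) + (\<Sum>k\<in>UNIV. eps3 i j k *\<^sub>R eta k)"
proof -
  have "\<forall>i j. eta i ** eta j = (if i = j then - mat 1 else 0) + (\<Sum>k\<in>UNIV. eps3 i j k *\<^sub>R eta k)"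
    by (simp add: forall_3 vec_eq_iff forall_4 matrix_matrix_mult_def sum_4 sum_3 mat_def)
  then show ?thesis by blast
qed

lemma transpose_eta: "transpose (eta i) = - eta i"
proof -
  have "\<forall>i. transpose (eta i) = - eta i"
    by (simp add: forall_3 vec_eq_iff forall_4 transpose_def)
  then show ?thesis by blast
qed

text \<open>The orientation defined by the triple is opposite to the one given by the order of the adapted
  frame; this sign recurs wherever a Hodge dual is computed in the frame.\<close>

lemma vS_eta: "vS (\<chi> i. eta i) = -1"
  by (simp add: vS_def sum_3 wedge22_eq)

lemma wedge22_eta: "wedge22 (eta i) (N - transpose N) = - (\<Sum>\<mu>\<in>UNIV. \<Sum>\<nu>\<in>UNIV. eta i $ \<mu> $ \<nu> * N$\<mu>$\<nu>)"
proof -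
  have "\<forall>i. wedge22 (eta i) (N - transpose N) = - (\<Sum>\<mu>\<in>UNIV. \<Sum>\<nu>\<in>UNIV. eta i $ \<mu> $ \<nu> * N$\<mu>$\<nu>)"
    by (simp add: forall_3 wedge22_eq sum_4 transpose_def algebra_simps)
  then show ?thesis by blast
qed


lemma congruence_nth:
  "(B ** X ** transpose B) $ \<mu> $ \<nu> = (\<Sum>a\<in>UNIV. \<Sum>b\<in>UNIV. B$\<mu>$a * X$a$b * B$\<nu>$b)"
  unfolding matrix_matrix_mult_def transpose_def
  by (simp add: sum_distrib_right) (rule sum.swap)

text \<open>Since \<open>\<epsilon>\<close> is contracted with one column of \<open>B\<close> in each slot, the
  determinant of \<open>B\<close> factors out.\<close>

lemma wedge22_congruence:
  "wedge22 (B ** X ** transpose B) (B ** Y ** transpose B) = det B * wedge22 X Y"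
proof -
  have det: "(\<Sum>\<mu>\<in>UNIV. \<Sum>\<nu>\<in>UNIV. \<Sum>\<rho>\<in>UNIV. \<Sum>\<sigma>\<in>UNIV. eps4 \<mu> \<nu> \<rho> \<sigma> * (B$\<mu>$a * B$\<nu>$b * B$\<rho>$c * B$\<sigma>$d))
      = det B * eps4 a b c d" for a b c d
  proof -
    have "vector [column a B, column b B, column c B, column d B]
        = (vector [axis a 1, axis b 1, axis c 1, axis d 1] :: real^4^4) ** transpose B"
      by (simp add: vec_eq_iff forall_4 column_def matrix_matrix_mult_def transpose_def axis_def
          mult_delta_left)
    then show ?thesis
      using eps4_contract[of "column a B" "column b B" "column c B" "column d B"]
      by (simp add: det_mul eps4_def column_def mult.commute)
  qed
  have prod: "(B ** X ** transpose B)$\<mu>$\<nu> * (B ** Y ** transpose B)$\<rho>$\<sigma>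
      = (\<Sum>a\<in>UNIV. \<Sum>b\<in>UNIV. \<Sum>c\<in>UNIV. \<Sum>d\<in>UNIV. X$a$b * (Y$c$d * (B$\<mu>$a * B$\<nu>$b * B$\<rho>$c * B$\<sigma>$d)))"
    for \<mu> \<nu> \<rho> \<sigma>
    unfolding congruence_nth sum_distrib_right unfolding sum_distrib_left
    by (simp add: ac_simps)
  have "4 * wedge22 (B ** X ** transpose B) (B ** Y ** transpose B)
     = (\<Sum>\<mu>\<in>UNIV. \<Sum>\<nu>\<in>UNIV. \<Sum>\<rho>\<in>UNIV. \<Sum>\<sigma>\<in>UNIV. \<Sum>a\<in>UNIV. \<Sum>b\<in>UNIV. \<Sum>c\<in>UNIV. \<Sum>d\<in>UNIV.
          X$a$b * (Y$c$d * (eps4 \<mu> \<nu> \<rho> \<sigma> * (B$\<mu>$a * B$\<nu>$b * B$\<rho>$c * B$\<sigma>$d))))"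
    unfolding wedge22_def
    by (simp add: mult.assoc prod) (simp add: sum_distrib_left ac_simps)
  also have "\<dots> = (\<Sum>a\<in>UNIV. \<Sum>b\<in>UNIV. \<Sum>c\<in>UNIV. \<Sum>d\<in>UNIV. \<Sum>\<mu>\<in>UNIV. \<Sum>\<nu>\<in>UNIV. \<Sum>\<rho>\<in>UNIV. \<Sum>\<sigma>\<in>UNIV.
          X$a$b * (Y$c$d * (eps4 \<mu> \<nu> \<rho> \<sigma> * (B$\<mu>$a * B$\<nu>$b * B$\<rho>$c * B$\<sigma>$d))))"
    unfolding sum.cartesian_product
    by (rule sum.reindex_bij_witness[of _ "\<lambda>(a, b, c, d, \<mu>, \<nu>, \<rho>, \<sigma>). (\<mu>, \<nu>, \<rho>, \<sigma>, a, b, c, d)"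
          "\<lambda>(\<mu>, \<nu>, \<rho>, \<sigma>, a, b, c, d). (a, b, c, d, \<mu>, \<nu>, \<rho>, \<sigma>)"]) auto
  also have "\<dots> = det B * (4 * wedge22 X Y)"
    by (simp add: sum_distrib_left[symmetric] det) (simp add: wedge22_def sum_distrib_left ac_simps)
  finally show ?thesis by simp
qed

section \<open>Matrices\<close>

text \<open>Tensor calculus is done with matrices, where a contraction is a product; rewriting \<open>transpose
  A *v v\<close> to \<open>v v* A\<close> would hide such products.\<close>

declare transpose_matrix_vector [simp del]

lemma matrix_mult_minus_right: "A ** (- B) = - (A ** B)" for A :: "real^'n^'m" and B :: "real^'p^'n"
  by (simp add: matrix_matrix_mult_def vec_eq_iff sum_negf)

lemma matrix_mult_minus_left: "(- A) ** B = - (A ** B)" for A :: "real^'n^'m" and B :: "real^'p^'n"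
  by (simp add: matrix_matrix_mult_def vec_eq_iff sum_negf)

lemma matrix_vector_minus_left: "(- A) *v v = - (A *v v)" for A :: "real^'n^'m"
  by (simp add: matrix_vector_mult_def vec_eq_iff sum_negf)

lemma matrix_vector_minus_right: "A *v (- v) = - (A *v v)" for A :: "real^'n^'m"
  by (simp add: matrix_vector_mult_def vec_eq_iff sum_negf)

lemma matrix_add_rdistrib': "(A + B) ** C = A ** C + B ** C" for A B :: "real^'n^'m" and C :: "real^'p^'n"
  by (simp add: matrix_matrix_mult_def vec_eq_iff sum.distrib algebra_simps)

lemma matrix_diff_rdistrib: "(A - B) ** C = A ** C - B ** C" for A B :: "real^'n^'m" and C :: "real^'p^'n"
  by (simp add: matrix_matrix_mult_def vec_eq_iff sum_subtractf algebra_simps)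

lemma matrix_diff_ldistrib: "C ** (A - B) = C ** A - C ** B" for A B :: "real^'p^'n" and C :: "real^'n^'m"
  by (simp add: matrix_matrix_mult_def vec_eq_iff sum_subtractf algebra_simps)

lemma matrix_scaleR_left: "(c *\<^sub>R A) ** B = c *\<^sub>R (A ** B)" for A :: "real^'n^'m" and B :: "real^'p^'n"
  by (simp add: matrix_matrix_mult_def vec_eq_iff sum_distrib_left algebra_simps)

lemma matrix_scaleR_right: "A ** (c *\<^sub>R B) = c *\<^sub>R (A ** B)" for A :: "real^'n^'m" and B :: "real^'p^'n"
  by (simp add: matrix_matrix_mult_def vec_eq_iff sum_distrib_left algebra_simps)

lemma matrix_vector_scaleR_left: "(c *\<^sub>R A) *v v = c *\<^sub>R (A *v v)" for A :: "real^'n^'m"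
  by (simp add: matrix_vector_mult_def vec_eq_iff sum_distrib_left algebra_simps)

lemma matrix_vector_scaleR_right: "A *v (c *\<^sub>R v) = c *\<^sub>R (A *v v)" for A :: "real^'n^'m"
  by (simp add: matrix_vector_mult_def vec_eq_iff sum_distrib_left algebra_simps)

lemma transpose_add: "transpose (A + B) = transpose A + transpose B" for A B :: "real^'n^'m"
  by (simp add: transpose_def vec_eq_iff)

lemma transpose_diff: "transpose (A - B) = transpose A - transpose B" for A B :: "real^'n^'m"
  by (simp add: transpose_def vec_eq_iff)

lemma transpose_minus: "transpose (- A) = - transpose A" for A :: "real^'n^'m"
  by (simp add: transpose_def vec_eq_iff)

lemma transpose_scaleR: "transpose (c *\<^sub>R A) = c *\<^sub>R transpose A" for A :: "real^'n^'m"
  by (simp add: transpose_def vec_eq_iff)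

lemma transpose_zero [simp]: "transpose (0 :: real^'n^'m) = 0"
  by (simp add: transpose_def vec_eq_iff)

lemmas matrix_linear_simps = matrix_mult_minus_right matrix_mult_minus_left matrix_vector_minus_left
  matrix_vector_minus_right matrix_add_rdistrib' matrix_add_ldistrib matrix_diff_rdistrib
  matrix_diff_ldistrib matrix_scaleR_left matrix_scaleR_right matrix_vector_scaleR_left
  matrix_vector_scaleR_right transpose_add transpose_diff transpose_minus transpose_scaleR
  matrix_vector_mult_add_rdistrib matrix_vector_right_distrib
  matrix_vector_mult_diff_rdistrib matrix_vector_mult_diff_distrib

lemma matrix_mult_zero [simp]: "A ** (0 :: real^'p^'n) = (0 :: real^'p^'m)" "(0 :: real^'n^'m) ** (C :: real^'p^'n) = 0"
  by (simp_all add: matrix_matrix_mult_def vec_eq_iff)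

lemma matrix_inner_mult_left: "(A ** B) \<bullet> C = B \<bullet> (transpose A ** C)"
  for A :: "real^'n^'m" and B :: "real^'p^'n"
proof -
  have "(A ** B) \<bullet> C = (\<Sum>i\<in>UNIV. \<Sum>j\<in>UNIV. \<Sum>k\<in>UNIV. A$i$k * B$k$j * C$i$j)"
    by (simp add: inner_vec_def matrix_matrix_mult_def sum_distrib_right)
  also have "\<dots> = (\<Sum>i\<in>UNIV. \<Sum>k\<in>UNIV. \<Sum>j\<in>UNIV. A$i$k * B$k$j * C$i$j)"
    by (intro sum.cong refl sum.swap)
  also have "\<dots> = (\<Sum>k\<in>UNIV. \<Sum>i\<in>UNIV. \<Sum>j\<in>UNIV. A$i$k * B$k$j * C$i$j)" by (rule sum.swap)
  also have "\<dots> = (\<Sum>k\<in>UNIV. \<Sum>j\<in>UNIV. \<Sum>i\<in>UNIV. A$i$k * B$k$j * C$i$j)"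
    by (intro sum.cong refl sum.swap)
  also have "\<dots> = B \<bullet> (transpose A ** C)"
    by (simp add: inner_vec_def matrix_matrix_mult_def transpose_def sum_distrib_left ac_simps)
  finally show ?thesis .
qed

lemma matrix_inner_transpose: "transpose A \<bullet> transpose B = A \<bullet> B" for A B :: "real^'n^'m"
  unfolding inner_vec_def transpose_def by (simp, rule sum.swap)

lemma matrix_inner_mult_right: "(A ** B) \<bullet> C = A \<bullet> (C ** transpose B)"
  for A :: "real^'n^'m" and B :: "real^'p^'n"
  using matrix_inner_mult_left[of "transpose B" "transpose A" "transpose C"]
    matrix_inner_transpose[of "A ** B" C] matrix_inner_transpose[of A "C ** transpose B"]
  by (simp add: matrix_transpose_mul)

lemma vector_inner_mult: "(A *v v) \<bullet> w = v \<bullet> (transpose A *v w)" for A :: "real^'n^'m"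
  using dot_lmul_matrix[of w A v] by (simp add: inner_commute transpose_matrix_vector)

lemma matrix_inner_sum: "A \<bullet> B = (\<Sum>\<mu>\<in>UNIV. \<Sum>\<nu>\<in>UNIV. A$\<mu>$\<nu> * B$\<mu>$\<nu>)" for A B :: "real^'n^'m"
  by (simp add: inner_vec_def)

lemma trace_mult_inner: "trace (A ** B) = transpose A \<bullet> B" for A B :: "real^'n^'n"
  unfolding trace_def matrix_matrix_mult_def transpose_def inner_vec_def by (simp, rule sum.swap)

lemma matrix_inv_eqI: "A ** B = mat 1 \<Longrightarrow> matrix_inv A = B" for A B :: "real^'n^'n"
proof -
  assume a: "A ** B = mat 1"
  then have b: "B ** A = mat 1" by (simp add: matrix_left_right_inverse)
  then have "invertible A" using a unfolding invertible_def by blast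
  then have "matrix_inv A = (matrix_inv A ** A) ** B"
    by (metis a matrix_mul_assoc matrix_mul_rid)
  then show ?thesis using matrix_inv_right_left[OF \<open>invertible A\<close>] by simp
qed


section \<open>Quaternion relations and adapted frames\<close>

definition quaternion_relations :: "(3 \<Rightarrow> real^4^4) \<Rightarrow> bool" where
  "quaternion_relations M \<longleftrightarrow>
    (\<forall>i j. M i ** M j = (if i = j then - mat 1 else 0) + (\<Sum>k\<in>UNIV. eps3 i j k *\<^sub>R M k))"

lemma quaternion_products:
  assumes "quaternion_relations M"
  shows "M 1 ** M 1 = - mat 1" "M 2 ** M 2 = - mat 1" "M 3 ** M 3 = - mat 1"
    "M 1 ** M 2 = M 3" "M 2 ** M 3 = M 1" "M 3 ** M 1 = M 2"
    "M 2 ** M 1 = - M 3" "M 3 ** M 2 = - M 1" "M 1 ** M 3 = - M 2"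
  using assms unfolding quaternion_relations_def by (simp_all add: sum_3)

lemma quaternion_products_vector:
  assumes "quaternion_relations M"
  shows "M 1 *v (M 1 *v v) = - v" "M 2 *v (M 2 *v v) = - v" "M 3 *v (M 3 *v v) = - v"
    "M 1 *v (M 2 *v v) = M 3 *v v" "M 2 *v (M 3 *v v) = M 1 *v v" "M 3 *v (M 1 *v v) = M 2 *v v"
    "M 2 *v (M 1 *v v) = - (M 3 *v v)" "M 3 *v (M 2 *v v) = - (M 1 *v v)" "M 1 *v (M 3 *v v) = - (M 2 *v v)"
  by (simp_all add: matrix_vector_mul_assoc quaternion_products[OF assms] matrix_linear_simps)

text \<open>A unit vector \<open>u\<close> and its images under the three complex structures form an adapted
  frame; with \<open>M\<^sup>i\<close> acting on covectors these images are \<open>g\<^sup>-\<^sup>1 \<Sigma>\<^sup>i u\<close>.\<close>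

lemma adapted_frame_exists:
  assumes sym: "transpose g = g" and pos: "\<And>w. w \<noteq> 0 \<Longrightarrow> w \<bullet> (g *v w) > 0"
    and anti: "\<And>i. transpose (S$i) = - (S$i)" and quat: "quaternion_relations (mixS S g)"
  shows "\<exists>e. adapted_frame S g e"
proof -
  have "inj ((*v) g)"
  proof (rule injI)
    fix v w assume "g *v v = g *v w"
    then have "(v - w) \<bullet> (g *v (v - w)) = 0" by (simp add: matrix_vector_mult_diff_distrib)
    then show "v = w" using pos[of "v - w"] by force
  qed
  then have inv: "invertible g"
    using invertible_left_inverse matrix_left_invertible_injective by blast
  note G = matrix_inv_right_left[OF inv]
  define M where "M = mixS S g"
  have M: "quaternion_relations M" using quat by (simp add: M_def)
  have Sg: "S$i = M i ** g" for i
    by (simp add: M_def mixS_def matrix_mul_assoc[symmetric] G)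
  define v :: "real^4" where "v = axis 1 1"
  have n: "v \<bullet> (g *v v) > 0" by (rule pos) (simp add: v_def)
  define u where "u = (1 / sqrt (v \<bullet> (g *v v))) *\<^sub>R v"
  have u1: "u \<bullet> (g *v u) = 1"
  proof -
    have "u \<bullet> (g *v u) = (v \<bullet> (g *v v)) / (sqrt (v \<bullet> (g *v v)))\<^sup>2"
      by (simp add: u_def matrix_linear_simps power2_eq_square)
    then show ?thesis using n by simp
  qed
  have u0: "u \<bullet> (M i *v (g *v u)) = 0" for i
  proof -
    have "u \<bullet> (S$i *v u) = - (u \<bullet> (S$i *v u))"
      using vector_inner_mult[of "S$i" u u] by (simp add: anti matrix_linear_simps inner_commute)
    then show ?thesis by (simp add: Sg matrix_vector_mul_assoc)
  qed
  define f where "f = (\<lambda>i. matrix_inv g *v (S$i *v u))"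
  have gf: "g *v f i = S$i *v u" for i
    by (simp add: f_def matrix_vector_mul_assoc matrix_mul_assoc G)
  have Gt: "transpose (matrix_inv g) = matrix_inv g"
    by (rule matrix_inv_eqI[symmetric]) (metis G(2) sym matrix_transpose_mul transpose_mat)
  have f_inner: "f i \<bullet> w = - (u \<bullet> (M i *v w))" for i w
    unfolding f_def by (simp add: vector_inner_mult Gt anti matrix_linear_simps M_def mixS_def matrix_vector_mul_assoc matrix_transpose_mul)
  have Sf: "S$k *v f j = M k *v (M j *v (g *v u))" for k j
    by (simp add: f_def M_def mixS_def matrix_vector_mul_assoc matrix_mul_assoc[symmetric] G)
  have Su: "S$k *v u = M k *v (g *v u)" for k by (simp add: Sg matrix_vector_mul_assoc)
  \<comment> \<open>The unit vector comes last because \<open>quat\<close> has its real part in the fourth component.\<close>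
  define e :: "real^4^4" where "e = vector [f 1, f 2, f 3, u]"
  have cong: "(e ** X ** transpose e) $ a $ b = (e$a) \<bullet> (X *v (e$b))" for X :: "real^4^4" and a b
    by (simp add: inner_vec_def matrix_vector_mult_def congruence_nth sum_distrib_left mult.assoc)
  have e_row: "e$1 = f 1" "e$2 = f 2" "e$3 = f 3" "e$4 = u" by (simp_all add: e_def)
  note rules = cong forall_4 e_row gf f_inner Sf Su quaternion_products_vector[OF M] matrix_linear_simps u0 u1
  have "e ** g ** transpose e = mat 1"
    by (simp add: vec_eq_iff rules mat_def)
  moreover have "\<forall>i. e ** S$i ** transpose e = eta i"
    by (simp add: vec_eq_iff rules forall_3)
  ultimately show ?thesis unfolding adapted_frame_def by blast
qed

text \<open>The frame index replaces the coordinate indices: covectors become \<open>e v\<close>, covariant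
  2-tensors \<open>e N e\<^sup>T\<close>, and the triple becomes the constant model \<open>eta\<close>.\<close>

locale adapted =
  fixes S :: triple and g e :: "real^4^4"
  assumes adapted: "adapted_frame S g e"
begin

definition B :: "real^4^4" where "B = matrix_inv e"
definition G :: "real^4^4" where "G = matrix_inv g"
definition M :: "3 \<Rightarrow> real^4^4" where "M = mixS S g"
definition K :: "3 \<Rightarrow> real^4^4" where "K = upS S g"

lemma frame_eqs: "e ** g ** transpose e = mat 1" "e ** S$i ** transpose e = eta i"
  using adapted by (auto simp: adapted_frame_def)

lemma e_B: "e ** B = mat 1" "B ** e = mat 1"
proof -
  have "invertible e"
    using frame_eqs(1) by (metis invertible_right_inverse matrix_mul_assoc)
  then show "e ** B = mat 1" "B ** e = mat 1"
    by (simp_all add: B_def matrix_inv_right_left)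
qed

lemma e_B_assoc: "e ** (B ** X) = X" "B ** (e ** X) = X"
  "X ** e ** B = X" "X ** B ** e = X" for X :: "real^4^4"
  by (simp_all add: matrix_mul_assoc e_B) (simp_all add: matrix_mul_assoc[symmetric] e_B)

lemma e_B_transpose: "transpose e ** transpose B = mat 1" "transpose B ** transpose e = mat 1"
  using e_B by (metis matrix_transpose_mul transpose_mat)+

lemma e_B_transpose_assoc: "transpose e ** (transpose B ** X) = X" "transpose B ** (transpose e ** X) = X"
  for X :: "real^4^4"
  by (simp_all add: matrix_mul_assoc e_B_transpose)

lemma e_B_vector: "e *v (B *v v) = v" "B *v (e *v v) = v"
  "transpose e *v (transpose B *v v) = v" "transpose B *v (transpose e *v v) = v"
  by (simp_all add: matrix_vector_mul_assoc e_B e_B_transpose)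

lemmas e_B_simps = e_B e_B_assoc e_B_transpose e_B_transpose_assoc e_B_vector

lemma g_eq: "g = B ** transpose B"
proof -
  have "B ** (e ** g ** transpose e) ** transpose B = B ** transpose B" by (simp add: frame_eqs)
  then show ?thesis by (simp add: matrix_mul_assoc[symmetric] e_B_simps)
qed

lemma S_eq: "S$i = B ** eta i ** transpose B"
proof -
  have "B ** (e ** S$i ** transpose e) ** transpose B = B ** eta i ** transpose B" by (simp add: frame_eqs)
  then show ?thesis by (simp add: matrix_mul_assoc[symmetric] e_B_simps)
qed

lemma G_eq: "G = transpose e ** e"
  unfolding G_def
  by (rule matrix_inv_eqI) (simp add: g_eq matrix_mul_assoc[symmetric] e_B_simps)

lemma M_eq: "M i = B ** eta i ** e"
  unfolding M_def mixS_def G_def[symmetric]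
  by (simp add: S_eq G_eq matrix_mul_assoc[symmetric] e_B_simps)

lemma K_eq: "K i = transpose e ** eta i ** e"
  unfolding K_def upS_def G_def[symmetric]
  by (simp add: S_eq G_eq matrix_mul_assoc[symmetric] e_B_simps)

lemma M_quaternion: "quaternion_relations M"
proof -
  have "M i ** M j = B ** (eta i ** eta j) ** e" for i j
    by (simp add: M_eq matrix_mul_assoc[symmetric] e_B_simps)
  then show ?thesis
    unfolding quaternion_relations_def M_eq eta_quaternion
    by (auto simp: matrix_linear_simps e_B sum_3)
qed

lemma G_g: "G ** g = mat 1" "g ** G = mat 1"
  unfolding G_eq unfolding g_eq by (simp_all add: matrix_mul_assoc[symmetric] e_B_simps)

lemma transpose_G: "transpose G = G"
  by (simp add: G_eq matrix_transpose_mul)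

lemma transpose_g: "transpose g = g"
  by (simp add: g_eq matrix_transpose_mul)

lemma transpose_S: "transpose (S$i) = - (S$i)"
  by (simp add: S_eq matrix_transpose_mul transpose_eta matrix_linear_simps matrix_mul_assoc)

lemma transpose_K: "transpose (K i) = - K i"
  by (simp add: K_eq matrix_transpose_mul transpose_eta matrix_linear_simps matrix_mul_assoc)

lemma S_M_K: "S$i = M i ** g" "M i = S$i ** G" "K i = G ** M i" "M i = g ** K i"
  unfolding S_eq M_eq K_eq G_eq unfolding g_eq
  by (simp_all add: matrix_mul_assoc[symmetric] e_B_simps)

lemma transpose_M: "transpose (M i) = - (G ** S$i)"
  by (simp add: S_M_K(2) matrix_transpose_mul transpose_G transpose_S matrix_linear_simps)

lemma frame_M: "e *v (M i *v v) = eta i *v (e *v v)"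
  by (simp add: M_eq matrix_vector_mul_assoc matrix_mul_assoc[symmetric] e_B_simps)

lemma frame_congruence: "N = B ** (e ** N ** transpose e) ** transpose B"
  by (simp add: matrix_mul_assoc[symmetric] e_B_simps)

lemma frame_eqI: "e *v v = e *v w \<Longrightarrow> v = w"
  by (metis e_B_vector(2))

lemma frame_eqI2: "e ** N ** transpose e = e ** N' ** transpose e \<Longrightarrow> N = N'"
  by (metis frame_congruence)

lemma frame_contract: "(transpose e ** X ** e) \<bullet> N = X \<bullet> (e ** N ** transpose e)"
  using matrix_inner_mult_right[of "transpose e ** X" e N] matrix_inner_mult_left[of "transpose e" X "N ** transpose e"]
  by (simp add: matrix_mul_assoc)

lemma G_contract: "G \<bullet> N = mat 1 \<bullet> (e ** N ** transpose e)"
  using frame_contract[of "mat 1" N] by (simp add: G_eq)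

lemma K_contract: "K i \<bullet> N = eta i \<bullet> (e ** N ** transpose e)"
  using frame_contract[of "eta i" N] by (simp add: K_eq)

lemma vS_frame: "vS S = - det B" "vS S * det e = -1" "vS S \<noteq> 0"
proof -
  have "vS S = det B * vS (\<chi> i. eta i)"
    by (simp add: vS_def S_eq wedge22_congruence sum_distrib_left ac_simps)
  then show 1: "vS S = - det B" by (simp add: vS_eta)
  have "det B * det e = 1" using e_B(2) by (metis det_I det_mul)
  then show "vS S * det e = -1" "vS S \<noteq> 0" using 1 by auto
qed

text \<open>The \<open>\<Sigma>\<^sup>i\<close> are self-dual: wedging with \<open>\<Sigma>\<^sup>i\<close> is contracting with \<open>\<Sigma>\<^sup>i\<close>.\<close>

lemma wedge22_S: "wedge22 (S$i) (N - transpose N) / vS S = K i \<bullet> N"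
proof -
  let ?N = "e ** N ** transpose e"
  have "N - transpose N = B ** (?N - transpose ?N) ** transpose B"
    by (simp add: matrix_transpose_mul matrix_linear_simps matrix_mul_assoc[symmetric] e_B_simps)
  then have "wedge22 (S$i) (N - transpose N) = vS S * (eta i \<bullet> ?N)"
    by (simp only: S_eq wedge22_congruence wedge22_eta vS_frame(1)) (simp add: matrix_inner_sum)
  then show ?thesis using vS_frame(3) by (simp add: K_contract)
qed

end

section \<open>Algebra of the fibres\<close>

lemma mat_1_nth: "(mat 1 :: real^'n^'n) $ a $ b = (if a = b then 1 else 0)"
  by (simp add: mat_def)

lemma symmetric_nth: "transpose X = X \<Longrightarrow> X $ a $ b = X $ b $ a"
  by (drule arg_cong[where f = "\<lambda>Y. Y $ b $ a"]) (simp add: transpose_def)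

subsection \<open>The model fibre\<close>

lemma eta_vector [simp]:
  fixes v :: "real^4"
  shows
  "(eta 1 *v v) $ 1 = v $ 4" "(eta 1 *v v) $ 2 = - v $ 3" "(eta 1 *v v) $ 3 = v $ 2" "(eta 1 *v v) $ 4 = - v $ 1"
  "(eta 2 *v v) $ 1 = v $ 3" "(eta 2 *v v) $ 2 = v $ 4" "(eta 2 *v v) $ 3 = - v $ 1" "(eta 2 *v v) $ 4 = - v $ 2"
  "(eta 3 *v v) $ 1 = - v $ 2" "(eta 3 *v v) $ 2 = v $ 1" "(eta 3 *v v) $ 3 = v $ 4" "(eta 3 *v v) $ 4 = - v $ 3"
  by (simp_all add: matrix_vector_mult_def sum_4)

lemma eta_mult_left [simp]:
  fixes X :: "real^4^4"
  shows
  "(eta 1 ** X) $ 1 $ d = X $ 4 $ d" "(eta 1 ** X) $ 2 $ d = - X $ 3 $ d"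
  "(eta 1 ** X) $ 3 $ d = X $ 2 $ d" "(eta 1 ** X) $ 4 $ d = - X $ 1 $ d"
  "(eta 2 ** X) $ 1 $ d = X $ 3 $ d" "(eta 2 ** X) $ 2 $ d = X $ 4 $ d"
  "(eta 2 ** X) $ 3 $ d = - X $ 1 $ d" "(eta 2 ** X) $ 4 $ d = - X $ 2 $ d"
  "(eta 3 ** X) $ 1 $ d = - X $ 2 $ d" "(eta 3 ** X) $ 2 $ d = X $ 1 $ d"
  "(eta 3 ** X) $ 3 $ d = X $ 4 $ d" "(eta 3 ** X) $ 4 $ d = - X $ 3 $ d"
  by (simp_all add: matrix_matrix_mult_def sum_4)

lemma eta_mult_right [simp]:
  fixes X :: "real^4^4"
  shows
  "(X ** eta 1) $ d $ 1 = - X $ d $ 4" "(X ** eta 1) $ d $ 2 = X $ d $ 3"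
  "(X ** eta 1) $ d $ 3 = - X $ d $ 2" "(X ** eta 1) $ d $ 4 = X $ d $ 1"
  "(X ** eta 2) $ d $ 1 = - X $ d $ 3" "(X ** eta 2) $ d $ 2 = - X $ d $ 4"
  "(X ** eta 2) $ d $ 3 = X $ d $ 1" "(X ** eta 2) $ d $ 4 = X $ d $ 2"
  "(X ** eta 3) $ d $ 1 = X $ d $ 2" "(X ** eta 3) $ d $ 2 = - X $ d $ 1"
  "(X ** eta 3) $ d $ 3 = - X $ d $ 4" "(X ** eta 3) $ d $ 4 = X $ d $ 3"
  by (simp_all add: matrix_matrix_mult_def sum_4)

text \<open>\<open>J1\<close> and the contractions below take the endomorphisms \<open>M\<close> as an argument,
  so that they apply both to the triple and to its model \<open>eta\<close>.\<close>

definition J1_flat :: "(3 \<Rightarrow> real^4^4) \<Rightarrow> real^4^3 \<Rightarrow> real^4^3" where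
  "J1_flat M a = (\<chi> i. \<Sum>j\<in>UNIV. \<Sum>k\<in>UNIV. eps3 i j k *\<^sub>R (M j *v (a$k)))"

lemma J1_flat_nth:
  "J1_flat M a $ 1 = M 2 *v (a$3) - M 3 *v (a$2)"
  "J1_flat M a $ 2 = M 3 *v (a$1) - M 1 *v (a$3)"
  "J1_flat M a $ 3 = M 1 *v (a$2) - M 2 *v (a$1)"
  by (simp_all add: J1_flat_def sum_3)

text \<open>With the quaternion relations, \<open>J1\<close> is a cross product by imaginary units; its
  eigenvalues are \<open>2\<close> and \<open>-1\<close>, so it is invertible.\<close>

lemma J1_flat_square:
  assumes "quaternion_relations M"
  shows "J1_flat M (J1_flat M a) = J1_flat M a + 2 *\<^sub>R a"
proof -
  have "\<forall>i. J1_flat M (J1_flat M a) $ i = (J1_flat M a + 2 *\<^sub>R a) $ i"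
    by (simp add: forall_3 J1_flat_nth quaternion_products_vector[OF assms] scaleR_2
        matrix_vector_right_distrib matrix_vector_mult_diff_distrib matrix_vector_minus_right)
  then show ?thesis by (simp only: vec_eq_iff[of "J1_flat M (J1_flat M a)"] simp_thms)
qed

definition contract3 :: "real^4^4 \<Rightarrow> (4 \<Rightarrow> real^4^4) \<Rightarrow> real^4" where
  "contract3 k T = (\<Sum>\<alpha>\<in>UNIV. \<Sum>\<beta>\<in>UNIV. k$\<alpha>$\<beta> *\<^sub>R (T \<alpha> $ \<beta>))"

definition sigma_form :: "(3 \<Rightarrow> real^4^4) \<Rightarrow> real^4^4 \<Rightarrow> real^3 \<Rightarrow> real^4^4 \<Rightarrow> 3 \<Rightarrow> real^4^4" where
  "sigma_form S G q X i = 2 *\<^sub>R (\<Sum>j\<in>UNIV. \<Sum>k\<in>UNIV. (eps3 i j k * q$k) *\<^sub>R S j) + X ** G ** S i + S i ** G ** X"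

lemma eps4_sum:
  fixes f :: "4 \<Rightarrow> 4 \<Rightarrow> 4 \<Rightarrow> real"
  shows
  "(\<Sum>b\<in>UNIV. \<Sum>c\<in>UNIV. \<Sum>d\<in>UNIV. eps4 1 b c d * f b c d) = f 2 3 4 - f 2 4 3 - f 3 2 4 + f 3 4 2 + f 4 2 3 - f 4 3 2"
  "(\<Sum>b\<in>UNIV. \<Sum>c\<in>UNIV. \<Sum>d\<in>UNIV. eps4 2 b c d * f b c d) = - f 1 3 4 + f 1 4 3 + f 3 1 4 - f 3 4 1 - f 4 1 3 + f 4 3 1"
  "(\<Sum>b\<in>UNIV. \<Sum>c\<in>UNIV. \<Sum>d\<in>UNIV. eps4 3 b c d * f b c d) = f 1 2 4 - f 1 4 2 - f 2 1 4 + f 2 4 1 + f 4 1 2 - f 4 2 1"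
  "(\<Sum>b\<in>UNIV. \<Sum>c\<in>UNIV. \<Sum>d\<in>UNIV. eps4 4 b c d * f b c d) = - f 1 2 3 + f 1 3 2 + f 2 1 3 - f 2 3 1 - f 3 1 2 + f 3 2 1"
  by (simp_all add: sum_4)

lemma sigma_form_flat:
  "sigma_form eta (mat 1) q X i = 2 *\<^sub>R (\<Sum>j\<in>UNIV. \<Sum>k\<in>UNIV. (eps3 i j k * q$k) *\<^sub>R eta j) + X ** eta i + eta i ** X"
  by (simp add: sigma_form_def)

lemma sigma_form_flat_nth:
  "sigma_form eta (mat 1) q X 1 $ 1 $ 1 = - X$1$4 + X$4$1"
  "sigma_form eta (mat 1) q X 1 $ 1 $ 2 = 2 * q$2 + X$1$3 + X$4$2"
  "sigma_form eta (mat 1) q X 1 $ 1 $ 3 = 2 * q$3 - X$1$2 + X$4$3"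
  "sigma_form eta (mat 1) q X 1 $ 1 $ 4 = X$1$1 + X$4$4"
  "sigma_form eta (mat 1) q X 1 $ 2 $ 1 = - 2 * q$2 - X$3$1 - X$2$4"
  "sigma_form eta (mat 1) q X 1 $ 2 $ 2 = X$2$3 - X$3$2"
  "sigma_form eta (mat 1) q X 1 $ 2 $ 3 = - X$2$2 - X$3$3"
  "sigma_form eta (mat 1) q X 1 $ 2 $ 4 = 2 * q$3 + X$2$1 - X$3$4"
  "sigma_form eta (mat 1) q X 1 $ 3 $ 1 = - 2 * q$3 + X$2$1 - X$3$4"
  "sigma_form eta (mat 1) q X 1 $ 3 $ 2 = X$2$2 + X$3$3"
  "sigma_form eta (mat 1) q X 1 $ 3 $ 3 = - X$3$2 + X$2$3"
  "sigma_form eta (mat 1) q X 1 $ 3 $ 4 = - 2 * q$2 + X$3$1 + X$2$4"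
  "sigma_form eta (mat 1) q X 1 $ 4 $ 1 = - X$1$1 - X$4$4"
  "sigma_form eta (mat 1) q X 1 $ 4 $ 2 = - 2 * q$3 - X$1$2 + X$4$3"
  "sigma_form eta (mat 1) q X 1 $ 4 $ 3 = 2 * q$2 - X$1$3 - X$4$2"
  "sigma_form eta (mat 1) q X 1 $ 4 $ 4 = X$4$1 - X$1$4"
  "sigma_form eta (mat 1) q X 2 $ 1 $ 1 = - X$1$3 + X$3$1"
  "sigma_form eta (mat 1) q X 2 $ 1 $ 2 = - 2 * q$1 + X$3$2 - X$1$4"
  "sigma_form eta (mat 1) q X 2 $ 1 $ 3 = X$1$1 + X$3$3"
  "sigma_form eta (mat 1) q X 2 $ 1 $ 4 = - 2 * q$3 + X$1$2 + X$3$4"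
  "sigma_form eta (mat 1) q X 2 $ 2 $ 1 = 2 * q$1 - X$2$3 + X$4$1"
  "sigma_form eta (mat 1) q X 2 $ 2 $ 2 = - X$2$4 + X$4$2"
  "sigma_form eta (mat 1) q X 2 $ 2 $ 3 = 2 * q$3 + X$2$1 + X$4$3"
  "sigma_form eta (mat 1) q X 2 $ 2 $ 4 = X$2$2 + X$4$4"
  "sigma_form eta (mat 1) q X 2 $ 3 $ 1 = - X$1$1 - X$3$3"
  "sigma_form eta (mat 1) q X 2 $ 3 $ 2 = - 2 * q$3 - X$1$2 - X$3$4"
  "sigma_form eta (mat 1) q X 2 $ 3 $ 3 = X$3$1 - X$1$3"
  "sigma_form eta (mat 1) q X 2 $ 3 $ 4 = 2 * q$1 - X$1$4 + X$3$2"
  "sigma_form eta (mat 1) q X 2 $ 4 $ 1 = 2 * q$3 - X$2$1 - X$4$3"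
  "sigma_form eta (mat 1) q X 2 $ 4 $ 2 = - X$2$2 - X$4$4"
  "sigma_form eta (mat 1) q X 2 $ 4 $ 3 = - 2 * q$1 + X$4$1 - X$2$3"
  "sigma_form eta (mat 1) q X 2 $ 4 $ 4 = X$4$2 - X$2$4"
  "sigma_form eta (mat 1) q X 3 $ 1 $ 1 = X$1$2 - X$2$1"
  "sigma_form eta (mat 1) q X 3 $ 1 $ 2 = - X$1$1 - X$2$2"
  "sigma_form eta (mat 1) q X 3 $ 1 $ 3 = - 2 * q$1 - X$2$3 - X$1$4"
  "sigma_form eta (mat 1) q X 3 $ 1 $ 4 = 2 * q$2 - X$2$4 + X$1$3"
  "sigma_form eta (mat 1) q X 3 $ 2 $ 1 = X$1$1 + X$2$2"
  "sigma_form eta (mat 1) q X 3 $ 2 $ 2 = - X$2$1 + X$1$2"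
  "sigma_form eta (mat 1) q X 3 $ 2 $ 3 = - 2 * q$2 + X$1$3 - X$2$4"
  "sigma_form eta (mat 1) q X 3 $ 2 $ 4 = - 2 * q$1 + X$1$4 + X$2$3"
  "sigma_form eta (mat 1) q X 3 $ 3 $ 1 = 2 * q$1 + X$3$2 + X$4$1"
  "sigma_form eta (mat 1) q X 3 $ 3 $ 2 = 2 * q$2 - X$3$1 + X$4$2"
  "sigma_form eta (mat 1) q X 3 $ 3 $ 3 = - X$3$4 + X$4$3"
  "sigma_form eta (mat 1) q X 3 $ 3 $ 4 = X$3$3 + X$4$4"
  "sigma_form eta (mat 1) q X 3 $ 4 $ 1 = - 2 * q$2 + X$4$2 - X$3$1"
  "sigma_form eta (mat 1) q X 3 $ 4 $ 2 = 2 * q$1 - X$4$1 - X$3$2"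
  "sigma_form eta (mat 1) q X 3 $ 4 $ 3 = - X$3$3 - X$4$4"
  "sigma_form eta (mat 1) q X 3 $ 4 $ 4 = X$4$3 - X$3$4"
  by (simp_all add: sigma_form_flat sum_3)

text \<open>The left-hand side is the Hodge dual of \<open>d\<sigma>\<^sup>i\<close> in an adapted frame, so the
  argument of \<open>J1\<close> on the right is what \<open>d2\<close> returns.\<close>

lemma star_sigma_flat:
  assumes sym: "\<And>b. transpose (dt b) = dt b" and tr: "\<And>b. trace (dt b) = 0"
  shows "- (\<Sum>b\<in>UNIV. \<Sum>c\<in>UNIV. \<Sum>d\<in>UNIV. eps4 a b c d * sigma_form eta (mat 1) (dq b) (dt b + (dh$b) *\<^sub>R mat 1) i $ c $ d)
    = 2 * J1_flat eta (\<chi> i. eta i *v dh + 2 *\<^sub>R (\<chi> b. dq b $ i) - contract3 (eta i) dt) $ i $ a"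
proof -
  have s: "dt b $ 2 $ 1 = dt b $ 1 $ 2" "dt b $ 3 $ 1 = dt b $ 1 $ 3" "dt b $ 4 $ 1 = dt b $ 1 $ 4"
    "dt b $ 3 $ 2 = dt b $ 2 $ 3" "dt b $ 4 $ 2 = dt b $ 2 $ 4" "dt b $ 4 $ 3 = dt b $ 3 $ 4" for b
    by (rule symmetric_nth[OF sym])+
  have t: "dt b $ 4 $ 4 = - dt b $ 1 $ 1 - dt b $ 2 $ 2 - dt b $ 3 $ 3" for b
    using tr[of b] by (simp add: trace_def sum_4)
  have "\<forall>i a. - (\<Sum>b\<in>UNIV. \<Sum>c\<in>UNIV. \<Sum>d\<in>UNIV. eps4 a b c d * sigma_form eta (mat 1) (dq b) (dt b + (dh$b) *\<^sub>R mat 1) i $ c $ d)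
    = 2 * J1_flat eta (\<chi> i. eta i *v dh + 2 *\<^sub>R (\<chi> b. dq b $ i) - contract3 (eta i) dt) $ i $ a"
    by (simp add: forall_3 forall_4 eps4_sum J1_flat_nth sigma_form_flat_nth contract3_def sum_4
        mat_1_nth s t)
  then show ?thesis by blast
qed

text \<open>Connection terms that are symmetric in the two lower indices drop out of an exterior
  derivative.\<close>

lemma star_symmetric_flat:
  assumes sym: "\<And>b c. C b $ c = C c $ b"
  shows "(\<Sum>b\<in>UNIV. \<Sum>c\<in>UNIV. \<Sum>d\<in>UNIV. eps4 a b c d * (C b ** w + w ** transpose (C b)) $ c $ d) = 0"
proof -
  have s: "C 2 $ 1 = C 1 $ 2" "C 3 $ 1 = C 1 $ 3" "C 4 $ 1 = C 1 $ 4"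
    "C 3 $ 2 = C 2 $ 3" "C 4 $ 2 = C 2 $ 4" "C 4 $ 3 = C 3 $ 4" by (rule sym)+
  have "\<forall>a. (\<Sum>b\<in>UNIV. \<Sum>c\<in>UNIV. \<Sum>d\<in>UNIV. eps4 a b c d * (C b ** w + w ** transpose (C b)) $ c $ d) = 0"
    by (simp add: forall_4 eps4_sum matrix_matrix_mult_def sum_4 transpose_def s)
  then show ?thesis by blast
qed

text \<open>The two terms of \<open>sigma_form\<close> lie in different summands of \<open>E \<otimes>
  \<Lambda>\<^sup>2\<close>: rotations of the triple are antisymmetric in the \<open>E\<close> indices of the
  self-dual part, whereas the trace of \<open>X\<close> gives its scalar part and the trace-free part of
  \<open>X\<close> turns self-dual forms into anti-self-dual ones.\<close>

lemma sigma_form_flat_inj: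
  assumes sym: "transpose X = X" and z: "\<And>i. sigma_form eta (mat 1) q X i = 0"
  shows "q = 0 \<and> X = 0"
proof -
  have s: "X $ 2 $ 1 = X $ 1 $ 2" "X $ 3 $ 1 = X $ 1 $ 3" "X $ 4 $ 1 = X $ 1 $ 4"
    "X $ 3 $ 2 = X $ 2 $ 3" "X $ 4 $ 2 = X $ 2 $ 4" "X $ 4 $ 3 = X $ 3 $ 4"
    by (rule symmetric_nth[OF sym])+
  have E: "sigma_form eta (mat 1) q X i $ a $ b = 0" for i a b using z by simp
  have "X$1$1 = 0" "X$2$2 = 0" "X$3$3 = 0" "X$4$4 = 0"
    using E[of 1 1 4, unfolded sigma_form_flat_nth s] E[of 1 2 3, unfolded sigma_form_flat_nth s] E[of 2 1 3, unfolded sigma_form_flat_nth s] E[of 2 2 4, unfolded sigma_form_flat_nth s] E[of 3 1 2, unfolded sigma_form_flat_nth s] E[of 3 3 4, unfolded sigma_form_flat_nth s] by linarith+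
  moreover have "q$1 = 0" "X$2$3 = 0" "X$1$4 = 0"
    using E[of 2 1 2, unfolded sigma_form_flat_nth s] E[of 2 3 4, unfolded sigma_form_flat_nth s] E[of 3 1 3, unfolded sigma_form_flat_nth s] E[of 3 2 4, unfolded sigma_form_flat_nth s] by linarith+
  moreover have "q$2 = 0" "X$1$3 = 0" "X$2$4 = 0"
    using E[of 1 1 2, unfolded sigma_form_flat_nth s] E[of 1 3 4, unfolded sigma_form_flat_nth s] E[of 3 1 4, unfolded sigma_form_flat_nth s] E[of 3 2 3, unfolded sigma_form_flat_nth s] by linarith+
  moreover have "q$3 = 0" "X$1$2 = 0" "X$3$4 = 0"
    using E[of 1 1 3, unfolded sigma_form_flat_nth s] E[of 1 2 4, unfolded sigma_form_flat_nth s] E[of 2 1 4, unfolded sigma_form_flat_nth s] E[of 2 2 3, unfolded sigma_form_flat_nth s] by linarith+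
  ultimately show ?thesis by (simp add: vec_eq_iff forall_3 forall_4 s)
qed

text \<open>The self-dual part of the antisymmetric part of \<open>N\<close> rotates the triple, its anti-self-dual
  part commutes with it.\<close>

lemma lie_sigma_flat:
  "N ** eta i + eta i ** transpose N
    = sigma_form eta (mat 1) (\<chi> k. (1/4) * (eta k \<bullet> N)) ((1/2) *\<^sub>R (N + transpose N)) i"
proof -
  have "\<forall>i. N ** eta i + eta i ** transpose N
    = sigma_form eta (mat 1) (\<chi> k. (1/4) * (eta k \<bullet> N)) ((1/2) *\<^sub>R (N + transpose N)) i"
    by (simp add: forall_3 vec_eq_iff forall_4 sigma_form_flat_nth sum_4 transpose_def
        matrix_inner_sum matrix_scaleR_left matrix_scaleR_right matrix_add_rdistrib' matrix_add_ldistrib algebra_simps)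
  then show ?thesis by blast
qed

text \<open>On a symmetric trace-free argument, summing over the three units reproduces the divergence, as
  \<open>\<Sum> eta i \<otimes> eta i\<close> is the projection to self-dual forms up to a multiple of it, and
  only its metric part survives.\<close>

lemma Phi_curl_flat:
  assumes sym: "\<And>b. transpose (T b) = T b" and tr: "\<And>b. trace (T b) = 0"
  shows "(\<Sum>i\<in>UNIV. eta i *v contract3 (eta i) T) = - contract3 (mat 1) T"
proof -
  have s: "T b $ 2 $ 1 = T b $ 1 $ 2" "T b $ 3 $ 1 = T b $ 1 $ 3" "T b $ 4 $ 1 = T b $ 1 $ 4"
    "T b $ 3 $ 2 = T b $ 2 $ 3" "T b $ 4 $ 2 = T b $ 2 $ 4" "T b $ 4 $ 3 = T b $ 3 $ 4" for b
    by (rule symmetric_nth[OF sym])+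
  have t: "T b $ 4 $ 4 = - T b $ 1 $ 1 - T b $ 2 $ 2 - T b $ 3 $ 3" for b
    using tr[of b] by (simp add: trace_def sum_4)
  show ?thesis
    by (simp add: vec_eq_iff forall_4 sum_3 sum_4 contract3_def mat_1_nth s t)
qed

subsection \<open>Parallel triples and curvature in the model fibre\<close>

lemma antisymmetric_nth: "transpose X = - X \<Longrightarrow> X $ a $ b = - X $ b $ a" for X :: "real^'n^'n"
  by (drule arg_cong[where f = "\<lambda>Y. Y $ b $ a"]) (simp add: transpose_def)

lemma antisymmetric_4:
  fixes X :: "real^4^4"
  assumes "transpose X = - X"
  shows "X$1$1 = 0" "X$2$2 = 0" "X$3$3 = 0" "X$4$4 = 0" "X$2$1 = - X$1$2" "X$3$1 = - X$1$3"
    "X$4$1 = - X$1$4" "X$3$2 = - X$2$3" "X$4$2 = - X$2$4" "X$4$3 = - X$3$4"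
  using antisymmetric_nth[OF assms, of 1 1] antisymmetric_nth[OF assms, of 2 2]
    antisymmetric_nth[OF assms, of 3 3] antisymmetric_nth[OF assms, of 4 4]
  by (simp_all add: antisymmetric_nth[OF assms, of 2 1] antisymmetric_nth[OF assms, of 3 1]
      antisymmetric_nth[OF assms, of 4 1] antisymmetric_nth[OF assms, of 3 2]
      antisymmetric_nth[OF assms, of 4 2] antisymmetric_nth[OF assms, of 4 3])

text \<open>An infinitesimal deformation of the triple that respects the quaternion relations is an
  infinitesimal rotation \<open>\<epsilon>\<^sup>i\<^sup>j\<^sup>k A\<^sup>j \<Sigma>\<^sup>k\<close>; that it is closed forces the connection
  \<open>A\<close> to vanish, as \<open>J1\<close> is invertible.\<close>

lemma parallel_flat:
  fixes Y :: "4 \<Rightarrow> 3 \<Rightarrow> real^4^4"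
  assumes anti: "\<And>a i. transpose (Y a i) = - Y a i"
    and quat: "\<And>a i j. Y a i ** eta j + eta i ** Y a j = (\<Sum>k\<in>UNIV. eps3 i j k *\<^sub>R Y a k)"
    and closed: "\<And>i a b c. Y a i $ b $ c + Y b i $ c $ a + Y c i $ a $ b = 0"
  shows "Y a i = 0"
proof -
  note s = antisymmetric_4[OF anti]
  have q: "(Y a i ** eta j + eta i ** Y a j) $ b $ c = (\<Sum>k\<in>UNIV. eps3 i j k * Y a k $ b $ c)" for a i j b c
    by (simp add: quat sum_component)
  have 1: "Y a 1 $ 1 $ 4 = 0" "Y a 1 $ 2 $ 3 = 0" "Y a 1 $ 2 $ 4 = Y a 1 $ 1 $ 3" "Y a 1 $ 3 $ 4 = - Y a 1 $ 1 $ 2" for a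
    using q[of a 1 1 1 1] q[of a 1 1 2 2] q[of a 1 1 1 2] q[of a 1 1 1 3] by (simp_all add: sum_3 s)
  have 2: "Y a 2 $ 1 $ 3 = 0" "Y a 2 $ 2 $ 4 = 0" "Y a 2 $ 2 $ 3 = - Y a 2 $ 1 $ 4" "Y a 2 $ 3 $ 4 = - Y a 2 $ 1 $ 2" for a
    using q[of a 2 2 1 1] q[of a 2 2 2 2] q[of a 2 2 1 2] q[of a 2 2 1 4] by (simp_all add: sum_3 s)
  have 3: "Y a 2 $ 1 $ 4 = - Y a 1 $ 1 $ 3" "Y a 3 $ 1 $ 4 = Y a 1 $ 1 $ 2" "Y a 3 $ 2 $ 3 = - Y a 1 $ 1 $ 2"
    "Y a 3 $ 1 $ 3 = Y a 2 $ 1 $ 2" "Y a 3 $ 2 $ 4 = Y a 2 $ 1 $ 2" "Y a 3 $ 1 $ 2 = 0" "Y a 3 $ 3 $ 4 = 0" for a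
    using q[of a 1 2 1 1] q[of a 1 2 1 4] q[of a 1 2 2 3] q[of a 1 2 1 3] q[of a 1 2 2 4] q[of a 1 2 1 2]
      q[of a 1 2 3 4]
    by (simp_all add: sum_3 s 1 2)
  have c: "Y 1 i $ 2 $ 3 + Y 2 i $ 3 $ 1 + Y 3 i $ 1 $ 2 = 0" "Y 1 i $ 2 $ 4 + Y 2 i $ 4 $ 1 + Y 4 i $ 1 $ 2 = 0"
    "Y 1 i $ 3 $ 4 + Y 3 i $ 4 $ 1 + Y 4 i $ 1 $ 3 = 0" "Y 2 i $ 3 $ 4 + Y 3 i $ 4 $ 2 + Y 4 i $ 2 $ 3 = 0" for i
    by (rule closed)+
  note c' = c[of 1, unfolded s 1 2 3] c[of 2, unfolded s 1 2 3] c[of 3, unfolded s 1 2 3]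
  have "Y 1 1 $ 1 $ 3 = 0" "Y 2 1 $ 1 $ 3 = 0" "Y 3 1 $ 1 $ 3 = 0" "Y 4 1 $ 1 $ 3 = 0"
    "Y 1 1 $ 1 $ 2 = 0" "Y 2 1 $ 1 $ 2 = 0" "Y 3 1 $ 1 $ 2 = 0" "Y 4 1 $ 1 $ 2 = 0"
    "Y 1 2 $ 1 $ 2 = 0" "Y 2 2 $ 1 $ 2 = 0" "Y 3 2 $ 1 $ 2 = 0" "Y 4 2 $ 1 $ 2 = 0"
    using c' by linarith+
  then have "\<forall>a. Y a 1 $ 1 $ 3 = 0 \<and> Y a 1 $ 1 $ 2 = 0 \<and> Y a 2 $ 1 $ 2 = 0"
    by (simp add: forall_4)
  then have "Y a 1 $ 1 $ 3 = 0" "Y a 1 $ 1 $ 2 = 0" "Y a 2 $ 1 $ 2 = 0" by blast+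
  then have "\<forall>i. Y a i = 0"
    by (simp add: forall_3 vec_eq_iff forall_4 s 1 2 3)
  then show ?thesis by blast
qed

text \<open>A curvature tensor that commutes with the triple is anti-self-dual in both pairs of indices;
  what is left of it is a symmetric trace-free matrix, so it is Ricci flat.\<close>

lemma curvature_flat:
  fixes R :: "4 \<Rightarrow> 4 \<Rightarrow> real^4^4"
  assumes anti1: "\<And>a b. R b a = - R a b" and anti2: "\<And>a b. transpose (R a b) = - R a b"
    and comm: "\<And>a b i. R a b ** eta i = eta i ** R a b"
    and bianchi: "\<And>a b c d. R a b $ c $ d + R b c $ a $ d + R c a $ b $ d = 0"
  shows "R a b $ 3 $ 4 = R a b $ 1 $ 2" "R a b $ 1 $ 4 = R a b $ 2 $ 3" "R a b $ 2 $ 4 = - R a b $ 1 $ 3"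
    "R 3 4 $ 1 $ 2 = R 1 2 $ 1 $ 2" "R 3 4 $ 1 $ 3 = R 1 2 $ 1 $ 3" "R 3 4 $ 2 $ 3 = R 1 2 $ 2 $ 3"
    "R 1 4 $ 1 $ 2 = R 1 2 $ 2 $ 3" "R 1 4 $ 1 $ 3 = R 1 3 $ 2 $ 3" "R 1 4 $ 2 $ 3 = - R 1 2 $ 1 $ 2 - R 1 3 $ 1 $ 3"
    "R 2 3 $ 1 $ 2 = R 1 2 $ 2 $ 3" "R 2 3 $ 1 $ 3 = R 1 3 $ 2 $ 3" "R 2 3 $ 2 $ 3 = - R 1 2 $ 1 $ 2 - R 1 3 $ 1 $ 3"
    "R 2 4 $ 1 $ 2 = - R 1 2 $ 1 $ 3" "R 2 4 $ 1 $ 3 = - R 1 3 $ 1 $ 3" "R 2 4 $ 2 $ 3 = - R 1 3 $ 2 $ 3"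
    "R 1 3 $ 1 $ 2 = R 1 2 $ 1 $ 3"
proof -
  note s = antisymmetric_4[OF anti2]
  have q: "(R a b ** eta i) $ c $ d = (eta i ** R a b) $ c $ d" for a b i c d
    by (simp only: comm)
  have 1: "R a b $ 3 $ 4 = R a b $ 1 $ 2" "R a b $ 1 $ 4 = R a b $ 2 $ 3" "R a b $ 2 $ 4 = - R a b $ 1 $ 3" for a b
    using q[of a b 1 1 3] q[of a b 2 1 2] q[of a b 1 1 2] by (simp_all add: s)
  then show "R a b $ 3 $ 4 = R a b $ 1 $ 2" "R a b $ 1 $ 4 = R a b $ 2 $ 3" "R a b $ 2 $ 4 = - R a b $ 1 $ 3" .
  have m: "R 2 1 = - R 1 2" "R 3 1 = - R 1 3" "R 4 1 = - R 1 4" "R 3 2 = - R 2 3" "R 4 2 = - R 2 4" "R 4 3 = - R 3 4"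
    by (rule anti1)+
  have b: "R 1 2 $ 3 $ d + R 2 3 $ 1 $ d - R 1 3 $ 2 $ d = 0" "R 1 2 $ 4 $ d + R 2 4 $ 1 $ d - R 1 4 $ 2 $ d = 0"
    "R 1 3 $ 4 $ d + R 3 4 $ 1 $ d - R 1 4 $ 3 $ d = 0" "R 2 3 $ 4 $ d + R 3 4 $ 2 $ d - R 2 4 $ 3 $ d = 0" for d
    using bianchi[of 1 2 3 d] bianchi[of 1 2 4 d] bianchi[of 1 3 4 d] bianchi[of 2 3 4 d]
    by (simp_all add: m)
  note b' = b[of 1, unfolded s 1] b[of 2, unfolded s 1] b[of 3, unfolded s 1] b[of 4, unfolded s 1]
  show "R 3 4 $ 1 $ 2 = R 1 2 $ 1 $ 2" "R 3 4 $ 1 $ 3 = R 1 2 $ 1 $ 3" "R 3 4 $ 2 $ 3 = R 1 2 $ 2 $ 3"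
    "R 1 4 $ 1 $ 2 = R 1 2 $ 2 $ 3" "R 1 4 $ 1 $ 3 = R 1 3 $ 2 $ 3" "R 1 4 $ 2 $ 3 = - R 1 2 $ 1 $ 2 - R 1 3 $ 1 $ 3"
    "R 2 3 $ 1 $ 2 = R 1 2 $ 2 $ 3" "R 2 3 $ 1 $ 3 = R 1 3 $ 2 $ 3" "R 2 3 $ 2 $ 3 = - R 1 2 $ 1 $ 2 - R 1 3 $ 1 $ 3"
    "R 2 4 $ 1 $ 2 = - R 1 2 $ 1 $ 3" "R 2 4 $ 1 $ 3 = - R 1 3 $ 1 $ 3" "R 2 4 $ 2 $ 3 = - R 1 3 $ 2 $ 3"
    "R 1 3 $ 1 $ 2 = R 1 2 $ 1 $ 3"
    using b' by linarith+
qed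


subsection \<open>Symbols of the second-order operators\<close>

text \<open>Derivatives of a covector field \<open>v\<close> are matrices \<open>N\<close> whose row \<open>\<mu>\<close> is \<open>\<nabla>\<^sub>\<mu> v\<close>.  With
  \<open>r = sqrt 2\<close>, the definitions of \<open>adj_h\<close>, \<open>adj_t\<close> and \<open>adj_c\<close> give components of \<open>D\<^sup>*\<close> applied to \<open>(t, a)\<close>,
  in terms of the derivative of \<open>t\<close> and the derivatives of the three covectors \<open>J1 a\<close>.  The remaining
  component is a quarter of the divergences of these covectors.\<close>

definition JN :: "(3 \<Rightarrow> real^4^4) \<Rightarrow> (3 \<Rightarrow> real^4^4) \<Rightarrow> 3 \<Rightarrow> real^4^4" where
  "JN M N i = (\<Sum>j\<in>UNIV. \<Sum>k\<in>UNIV. eps3 i j k *\<^sub>R (N k ** transpose (M j)))"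

definition symtf :: "real^4^4 \<Rightarrow> real^4^4 \<Rightarrow> real^4^4 \<Rightarrow> real^4^4" where
  "symtf g G X = (1/2) *\<^sub>R (X + transpose X) - ((G \<bullet> X) / 4) *\<^sub>R g"

definition adj_h :: "real \<Rightarrow> (3 \<Rightarrow> real^4^4) \<Rightarrow> real^4^4 \<Rightarrow> real^4^4 \<Rightarrow> (3 \<Rightarrow> real^4^4) \<Rightarrow> real" where
  "adj_h r M G Nt Nb = - (r * (G \<bullet> Nt)) - (\<Sum>i\<in>UNIV. G \<bullet> (Nb i ** transpose (M i)))"

definition adj_t :: "real \<Rightarrow> (3 \<Rightarrow> real^4^4) \<Rightarrow> real^4^4 \<Rightarrow> real^4^4 \<Rightarrow> real^4^4 \<Rightarrow> (3 \<Rightarrow> real^4^4) \<Rightarrow> real^4^4" where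
  "adj_t r M g G Nt Nb = symtf g G (r *\<^sub>R Nt + (\<Sum>i\<in>UNIV. M i ** Nb i))"

definition adj_c :: "real \<Rightarrow> (3 \<Rightarrow> real^4^4) \<Rightarrow> real^4^4 \<Rightarrow> real^4^4 \<Rightarrow> (3 \<Rightarrow> real^4^4) \<Rightarrow> 3 \<Rightarrow> real" where
  "adj_c r M G Nt Nb i = G \<bullet> (Nt ** transpose (M i)) - (r / 2) * (G \<bullet> JN M Nb i)"

lemma JN_eta: "JN eta N i = (\<Sum>j\<in>UNIV. \<Sum>k\<in>UNIV. eps3 i j k *\<^sub>R - (N k ** eta j))"
  by (simp add: JN_def transpose_eta matrix_mult_minus_right)

lemma JN_eta_nth:
  "JN eta N 1 = N 2 ** eta 3 - N 3 ** eta 2" "JN eta N 2 = N 3 ** eta 1 - N 1 ** eta 3"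
  "JN eta N 3 = N 1 ** eta 2 - N 2 ** eta 1"
  by (simp_all add: JN_eta sum_3)

lemma trace_inner: "mat 1 \<bullet> X = X$1$1 + X$2$2 + X$3$3 + X$4$4" for X :: "real^4^4"
  by (simp add: matrix_inner_sum sum_4 mat_1_nth)

context
  fixes r :: real
  assumes r: "r * r = 2"
begin

lemma rr: "r * (r * x) = 2 * x"
  using r by (simp add: mult.assoc[symmetric])

lemma square_scalar_flat:
  fixes H :: "real^4^4"
  assumes sym: "transpose H = H"
  defines "Nb \<equiv> JN eta (\<lambda>i. (1/4) *\<^sub>R (H ** transpose (eta i)))"
  shows "adj_h r eta (mat 1) ((r / 4) *\<^sub>R H) Nb = mat 1 \<bullet> H"
    "mat 1 \<bullet> Nb i = 0" "adj_t r eta (mat 1) (mat 1) ((r / 4) *\<^sub>R H) Nb = 0"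
    "adj_c r eta (mat 1) ((r / 4) *\<^sub>R H) Nb i = 0"
proof -
  have s: "H $ 2 $ 1 = H $ 1 $ 2" "H $ 3 $ 1 = H $ 1 $ 3" "H $ 4 $ 1 = H $ 1 $ 4"
    "H $ 3 $ 2 = H $ 2 $ 3" "H $ 4 $ 2 = H $ 2 $ 4" "H $ 4 $ 3 = H $ 3 $ 4"
    by (rule symmetric_nth[OF sym])+
  have e: "Nb 1 = (1/4) *\<^sub>R - (H ** eta 2 ** eta 3 - H ** eta 3 ** eta 2)"
    "Nb 2 = (1/4) *\<^sub>R - (H ** eta 3 ** eta 1 - H ** eta 1 ** eta 3)"
    "Nb 3 = (1/4) *\<^sub>R - (H ** eta 1 ** eta 2 - H ** eta 2 ** eta 1)"
    by (simp_all add: Nb_def JN_eta_nth transpose_eta matrix_linear_simps algebra_simps)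
  show "adj_h r eta (mat 1) ((r / 4) *\<^sub>R H) Nb = mat 1 \<bullet> H"
    by (simp add: adj_h_def trace_inner sum_3 e transpose_eta matrix_linear_simps s rr field_simps)
  have "\<forall>i. mat 1 \<bullet> Nb i = 0"
    by (simp add: trace_inner forall_3 e s)
  then show "mat 1 \<bullet> Nb i = 0" by blast
  show "adj_t r eta (mat 1) (mat 1) ((r / 4) *\<^sub>R H) Nb = 0"
    by (simp add: adj_t_def symtf_def trace_inner sum_3 e matrix_linear_simps vec_eq_iff forall_4 transpose_def mat_1_nth s rr field_simps)
  have "\<forall>i. adj_c r eta (mat 1) ((r / 4) *\<^sub>R H) Nb i = 0"
    by (simp add: adj_c_def trace_inner forall_3 JN_eta_nth e transpose_eta matrix_linear_simps s)
  then show "adj_c r eta (mat 1) ((r / 4) *\<^sub>R H) Nb i = 0" by blast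
qed

lemma square_E_flat:
  fixes H :: "3 \<Rightarrow> real^4^4"
  assumes sym: "\<And>i. transpose (H i) = H i"
  defines "Nb \<equiv> JN eta (\<lambda>i. 2 *\<^sub>R H i)"
  shows "adj_h r eta (mat 1) 0 Nb = 0"
    "mat 1 \<bullet> Nb i = 0" "adj_t r eta (mat 1) (mat 1) 0 Nb = 0"
    "adj_c r eta (mat 1) 0 Nb i = - (2 * r * (mat 1 \<bullet> H i))"
proof -
  have s: "H i $ 2 $ 1 = H i $ 1 $ 2" "H i $ 3 $ 1 = H i $ 1 $ 3" "H i $ 4 $ 1 = H i $ 1 $ 4"
    "H i $ 3 $ 2 = H i $ 2 $ 3" "H i $ 4 $ 2 = H i $ 2 $ 4" "H i $ 4 $ 3 = H i $ 3 $ 4" for i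
    by (rule symmetric_nth[OF sym])+
  have e: "Nb 1 = 2 *\<^sub>R (H 2 ** eta 3 - H 3 ** eta 2)" "Nb 2 = 2 *\<^sub>R (H 3 ** eta 1 - H 1 ** eta 3)"
    "Nb 3 = 2 *\<^sub>R (H 1 ** eta 2 - H 2 ** eta 1)"
    by (simp_all add: Nb_def JN_eta_nth matrix_linear_simps algebra_simps)
  show "adj_h r eta (mat 1) 0 Nb = 0"
    by (simp add: adj_h_def trace_inner sum_3 e transpose_eta matrix_linear_simps s field_simps)
  have "\<forall>i. mat 1 \<bullet> Nb i = 0"
    by (simp add: trace_inner forall_3 e s)
  then show "mat 1 \<bullet> Nb i = 0" by blast
  show "adj_t r eta (mat 1) (mat 1) 0 Nb = 0"
    by (simp add: adj_t_def symtf_def trace_inner sum_3 e matrix_linear_simps vec_eq_iff forall_4 transpose_def mat_1_nth s field_simps)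
  have "\<forall>i. adj_c r eta (mat 1) 0 Nb i = - (2 * r * (mat 1 \<bullet> H i))"
    by (simp add: adj_c_def trace_inner forall_3 JN_eta_nth e transpose_eta matrix_linear_simps s
        distrib_left right_diff_distrib add_divide_distrib diff_divide_distrib)
  then show "adj_c r eta (mat 1) 0 Nb i = - (2 * r * (mat 1 \<bullet> H i))" by blast
qed

lemma square_chi_flat:
  fixes H :: "3 \<Rightarrow> real^4^4"
  assumes sym: "\<And>i. transpose (H i) = H i"
  defines "Nt \<equiv> (\<Sum>i\<in>UNIV. H i ** transpose (eta i))"
    and "Nb \<equiv> JN eta (\<lambda>i. - (r / 2) *\<^sub>R JN eta H i)"
  shows "adj_h r eta (mat 1) Nt Nb = 0"
    "mat 1 \<bullet> Nb i = - (r * (mat 1 \<bullet> H i))" "adj_t r eta (mat 1) (mat 1) Nt Nb = 0"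
    "adj_c r eta (mat 1) Nt Nb i = 0"
proof -
  have s: "H i $ 2 $ 1 = H i $ 1 $ 2" "H i $ 3 $ 1 = H i $ 1 $ 3" "H i $ 4 $ 1 = H i $ 1 $ 4"
    "H i $ 3 $ 2 = H i $ 2 $ 3" "H i $ 4 $ 2 = H i $ 2 $ 4" "H i $ 4 $ 3 = H i $ 3 $ 4" for i
    by (rule symmetric_nth[OF sym])+
  have t: "Nt = - (H 1 ** eta 1 + H 2 ** eta 2 + H 3 ** eta 3)"
    by (simp add: Nt_def sum_3 transpose_eta matrix_linear_simps)
  have e: "Nb 1 = - (r / 2) *\<^sub>R (JN eta H 2 ** eta 3 - JN eta H 3 ** eta 2)"
    "Nb 2 = - (r / 2) *\<^sub>R (JN eta H 3 ** eta 1 - JN eta H 1 ** eta 3)"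
    "Nb 3 = - (r / 2) *\<^sub>R (JN eta H 1 ** eta 2 - JN eta H 2 ** eta 1)"
    unfolding Nb_def JN_eta_nth[where N = "\<lambda>i. - (r / 2) *\<^sub>R JN eta H i"]
    by (simp_all add: matrix_linear_simps scaleR_right_diff_distrib)
  show "adj_h r eta (mat 1) Nt Nb = 0"
    by (simp add: adj_h_def trace_inner sum_3 t e JN_eta_nth transpose_eta matrix_linear_simps s algebra_simps)
  have "\<forall>i. mat 1 \<bullet> Nb i = - (r * (mat 1 \<bullet> H i))"
    by (simp add: trace_inner forall_3 e JN_eta_nth matrix_linear_simps s field_simps)
  then show "mat 1 \<bullet> Nb i = - (r * (mat 1 \<bullet> H i))" by blast
  show "adj_t r eta (mat 1) (mat 1) Nt Nb = 0"
    by (simp add: adj_t_def symtf_def trace_inner sum_3 t e JN_eta_nth matrix_linear_simps vec_eq_iff forall_4 transpose_def mat_1_nth s field_simps)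
  have "\<forall>i. adj_c r eta (mat 1) Nt Nb i = 0"
    by (simp add: adj_c_def trace_inner forall_3 t e JN_eta_nth transpose_eta matrix_linear_simps s rr field_simps)
  then show "adj_c r eta (mat 1) Nt Nb i = 0" by blast
qed


text \<open>Commuting the two derivatives of the trace-free part produces the curvature term; all other
  commutators cancel because the metric is Ricci flat.\<close>

lemma square_Sym_flat:
  fixes Q R :: "4 \<Rightarrow> 4 \<Rightarrow> real^4^4" and h :: "real^4^4"
  assumes sym: "\<And>a b. transpose (Q a b) = Q a b" and tr: "\<And>a b. trace (Q a b) = 0"
    and hsym: "transpose h = h" and htr: "trace h = 0"
    and Q: "\<And>a b. Q a b - Q b a = - (R a b ** h) - h ** transpose (R a b)"
    and anti1: "\<And>a b. R b a = - R a b" and anti2: "\<And>a b. transpose (R a b) = - R a b"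
    and comm: "\<And>a b i. R a b ** eta i = eta i ** R a b"
    and bianchi: "\<And>a b c d. R a b $ c $ d + R b c $ a $ d + R c a $ b $ d = 0"
  defines "Nt \<equiv> - r *\<^sub>R (\<chi> n. contract3 (mat 1) (Q n))"
    and "Nb \<equiv> JN eta (\<lambda>i. - (\<chi> n. contract3 (eta i) (Q n)))"
  shows "adj_h r eta (mat 1) Nt Nb = 0"
    "mat 1 \<bullet> Nb i = 0"
    "adj_t r eta (mat 1) (mat 1) Nt Nb
      = - (\<Sum>a\<in>UNIV. Q a a) - (\<chi> m n. 2 * (\<Sum>a\<in>UNIV. \<Sum>b\<in>UNIV. R n b $ a $ m * h $ a $ b))"
    "adj_c r eta (mat 1) Nt Nb i = 0"
proof -
  note s = symmetric_nth[OF sym, of _ _ 2 1] symmetric_nth[OF sym, of _ _ 3 1] symmetric_nth[OF sym, of _ _ 4 1]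
    symmetric_nth[OF sym, of _ _ 3 2] symmetric_nth[OF sym, of _ _ 4 2] symmetric_nth[OF sym, of _ _ 4 3]
  have t: "Q a b $ 4 $ 4 = - Q a b $ 1 $ 1 - Q a b $ 2 $ 2 - Q a b $ 3 $ 3" for a b
    using tr[of a b] by (simp add: trace_def sum_4)
  note hs = symmetric_nth[OF hsym, of 2 1] symmetric_nth[OF hsym, of 3 1] symmetric_nth[OF hsym, of 4 1]
    symmetric_nth[OF hsym, of 3 2] symmetric_nth[OF hsym, of 4 2] symmetric_nth[OF hsym, of 4 3]
  have ht: "h $ 4 $ 4 = - h $ 1 $ 1 - h $ 2 $ 2 - h $ 3 $ 3"
    using htr by (simp add: trace_def sum_4)
  have m: "R 2 1 = - R 1 2" "R 3 1 = - R 1 3" "R 4 1 = - R 1 4" "R 3 2 = - R 2 3" "R 4 2 = - R 2 4" "R 4 3 = - R 3 4"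
    by (rule anti1)+
  have m0: "R a a = 0" for a using anti1[of a a] by (simp add: vec_eq_iff)
  note Rs = m m0 antisymmetric_4[OF anti2] curvature_flat[of R, OF anti1 anti2 comm bianchi]
  have c: "Q b a $ c $ d = Q a b $ c $ d + (R a b ** h) $ c $ d - (h ** R a b) $ c $ d" for a b c d
  proof -
    have "Q b a = Q a b + R a b ** h - h ** R a b"
      using Q[of a b] by (simp add: anti2 matrix_mult_minus_right algebra_simps)
    then show ?thesis by simp
  qed
  note cs = c[of 2 1] c[of 3 1] c[of 4 1] c[of 3 2] c[of 4 2] c[of 4 3]
  have e: "Nb 1 = - ((\<chi> n. contract3 (eta 2) (Q n)) ** eta 3 - (\<chi> n. contract3 (eta 3) (Q n)) ** eta 2)"
    "Nb 2 = - ((\<chi> n. contract3 (eta 3) (Q n)) ** eta 1 - (\<chi> n. contract3 (eta 1) (Q n)) ** eta 3)"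
    "Nb 3 = - ((\<chi> n. contract3 (eta 1) (Q n)) ** eta 2 - (\<chi> n. contract3 (eta 2) (Q n)) ** eta 1)"
    unfolding Nb_def JN_eta_nth[where N = "\<lambda>i. - (\<chi> n. contract3 (eta i) (Q n))"]
    by (simp_all add: matrix_linear_simps)
  have C: "contract3 (eta 1) T = T 1 $ 4 - T 4 $ 1 + T 3 $ 2 - T 2 $ 3"
    "contract3 (eta 2) T = T 1 $ 3 - T 3 $ 1 + T 2 $ 4 - T 4 $ 2"
    "contract3 (eta 3) T = T 2 $ 1 - T 1 $ 2 + T 3 $ 4 - T 4 $ 3"
    "contract3 (mat 1) T = T 1 $ 1 + T 2 $ 2 + T 3 $ 3 + T 4 $ 4" for T
    by (simp_all add: contract3_def sum_4 mat_1_nth)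
  note Ms = matrix_matrix_mult_def[of "R _ _" h] matrix_matrix_mult_def[of h "R _ _"]
  show "adj_h r eta (mat 1) Nt Nb = 0"
    by (simp add: adj_h_def trace_inner sum_3 Nt_def e C transpose_eta matrix_linear_simps s t rr)
  have "\<forall>i. mat 1 \<bullet> Nb i = 0"
    by (simp add: trace_inner forall_3 e C s t) (simp add: cs Ms sum_4 s t hs ht Rs algebra_simps)
  then show "mat 1 \<bullet> Nb i = 0" by blast
  have "\<forall>i. adj_c r eta (mat 1) Nt Nb i = 0"
    by (simp add: adj_c_def trace_inner forall_3 JN_eta_nth Nt_def e C transpose_eta matrix_linear_simps s t)
       (simp add: cs Ms sum_4 s t hs ht Rs algebra_simps)
  then show "adj_c r eta (mat 1) Nt Nb i = 0" by blast
  show "adj_t r eta (mat 1) (mat 1) Nt Nb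
      = - (\<Sum>a\<in>UNIV. Q a a) - (\<chi> m n. 2 * (\<Sum>a\<in>UNIV. \<Sum>b\<in>UNIV. R n b $ a $ m * h $ a $ b))"
  proof -
    have rt: "r *\<^sub>R Nt = - 2 *\<^sub>R (\<chi> n. contract3 (mat 1) (Q n))"
      by (simp add: Nt_def r)
    show ?thesis
      unfolding vec_eq_iff adj_t_def rt
      by (simp add: symtf_def trace_inner sum_3 e C matrix_linear_simps forall_4 transpose_def mat_1_nth s t)
         (simp add: cs Ms sum_4 s t hs ht Rs algebra_simps add_divide_distrib diff_divide_distrib)
  qed
qed

end

section \<open>The Levi-Civita connection of a triple\<close>

text \<open>Row \<open>\<nu>\<close> of \<open>Gam g \<mu> x\<close> lists \<open>\<Gamma>\<^sup>\<rho>\<^sub>\<mu>\<^sub>\<nu>\<close>, so that the covariant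
  derivative of a covector field is \<open>\<partial>\<^sub>\<mu> a - Gam \<mu> a\<close> and tensor calculus becomes matrix algebra.\<close>

definition Gam :: "(real^4 \<Rightarrow> real^4^4) \<Rightarrow> 4 \<Rightarrow> real^4 \<Rightarrow> real^4^4" where
  "Gam g \<mu> x = (\<chi> \<nu> \<rho>. christoffel g x \<rho> \<mu> \<nu>)"

definition cov1 :: "(real^4 \<Rightarrow> real^4^4) \<Rightarrow> (real^4 \<Rightarrow> real^4) \<Rightarrow> real^4 \<Rightarrow> real^4^4" where
  "cov1 g a x = (\<chi> \<mu>. pd \<mu> a x - Gam g \<mu> x *v a x)"

definition cov2 :: "(real^4 \<Rightarrow> real^4^4) \<Rightarrow> (real^4 \<Rightarrow> real^4^4) \<Rightarrow> real^4 \<Rightarrow> 4 \<Rightarrow> real^4^4" where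
  "cov2 g h x \<mu> = pd \<mu> h x - Gam g \<mu> x ** h x - h x ** transpose (Gam g \<mu> x)"

definition cov22 :: "(real^4 \<Rightarrow> real^4^4) \<Rightarrow> (real^4 \<Rightarrow> real^4^4) \<Rightarrow> real^4 \<Rightarrow> 4 \<Rightarrow> 4 \<Rightarrow> real^4^4" where
  "cov22 g h x \<mu> \<nu> = pd \<mu> (\<lambda>y. cov2 g h y \<nu>) x - (\<Sum>\<kappa>\<in>UNIV. Gam g \<mu> x $ \<nu> $ \<kappa> *\<^sub>R cov2 g h x \<kappa>)
     - Gam g \<mu> x ** cov2 g h x \<nu> - cov2 g h x \<nu> ** transpose (Gam g \<mu> x)"

definition grad :: "(real^4 \<Rightarrow> real) \<Rightarrow> real^4 \<Rightarrow> real^4" where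
  "grad f x = (\<chi> \<mu>. pd \<mu> f x)"

definition Riem :: "(real^4 \<Rightarrow> real^4^4) \<Rightarrow> real^4 \<Rightarrow> 4 \<Rightarrow> 4 \<Rightarrow> real^4^4" where
  "Riem g x \<mu> \<nu> = pd \<mu> (Gam g \<nu>) x - pd \<nu> (Gam g \<mu>) x + Gam g \<nu> x ** Gam g \<mu> x - Gam g \<mu> x ** Gam g \<nu> x"

lemma nabla_ten0: "nabla g (ten0 f) x [\<mu>] = pd \<mu> f x"
  by (simp add: nabla_def ten0_def)

lemma nabla_ten1:
  assumes "a differentiable (at x)"
  shows "nabla g (ten1 a) x [\<mu>, \<nu>] = cov1 g a x $ \<mu> $ \<nu>"
  by (simp add: nabla_def ten1_def cov1_def Gam_def pd_nth[OF assms] matrix_vector_mult_def)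

lemma nabla_ten2:
  assumes "h differentiable (at x)"
  shows "nabla g (ten2 h) x [\<rho>, \<mu>, \<nu>] = cov2 g h x \<rho> $ \<mu> $ \<nu>"
  by (simp add: nabla_def ten2_def cov2_def Gam_def pd_nth[OF differentiable_nth[OF assms]] pd_nth[OF assms]
      matrix_matrix_mult_def transpose_def lessThan_Suc mult.commute numeral_2_eq_2)

lemma row_matrix_mult: "(A ** C) $ i = A $ i v* C" for A :: "real^'n^'m" and C :: "real^'p^'n"
  by (simp add: vec_eq_iff matrix_matrix_mult_def vector_matrix_mult_def mult.commute)

lemma matrix_vector_transpose: "A *v v = v v* transpose A" for A :: "real^'n^'m"
  by (simp add: vec_eq_iff matrix_vector_mult_def vector_matrix_mult_def transpose_def mult.commute)

lemma sum_rotate: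
  "(\<Sum>\<mu>\<in>A. \<Sum>\<nu>\<in>B. \<Sum>\<rho>\<in>C. f \<mu> \<nu> \<rho>) = (\<Sum>\<rho>\<in>C. \<Sum>\<mu>\<in>A. \<Sum>\<nu>\<in>B. f \<mu> \<nu> \<rho>)" for f :: "_ \<Rightarrow> _ \<Rightarrow> _ \<Rightarrow> 'v::comm_monoid_add"
proof -
  have "(\<Sum>\<mu>\<in>A. \<Sum>\<nu>\<in>B. \<Sum>\<rho>\<in>C. f \<mu> \<nu> \<rho>) = (\<Sum>\<mu>\<in>A. \<Sum>\<rho>\<in>C. \<Sum>\<nu>\<in>B. f \<mu> \<nu> \<rho>)"
    by (intro sum.cong refl sum.swap)
  also have "\<dots> = (\<Sum>\<rho>\<in>C. \<Sum>\<mu>\<in>A. \<Sum>\<nu>\<in>B. f \<mu> \<nu> \<rho>)" by (rule sum.swap)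
  finally show ?thesis .
qed

definition frame3 :: "real^4^4 \<Rightarrow> (4 \<Rightarrow> real^4^4) \<Rightarrow> 4 \<Rightarrow> real^4^4" where
  "frame3 e T a = (\<Sum>\<alpha>\<in>UNIV. e$a$\<alpha> *\<^sub>R (e ** T \<alpha> ** transpose e))"

lemma frame3_nth:
  "frame3 e T a $ b $ c = (\<Sum>\<alpha>\<in>UNIV. \<Sum>\<beta>\<in>UNIV. \<Sum>\<gamma>\<in>UNIV. e$a$\<alpha> * e$b$\<beta> * e$c$\<gamma> * T \<alpha> $ \<beta> $ \<gamma>)"
  by (simp add: frame3_def sum_component congruence_nth sum_distrib_left ac_simps)

lemma frame3_cyclic:
  assumes "\<And>\<alpha> \<beta> \<gamma>. T \<alpha> $ \<beta> $ \<gamma> + T \<beta> $ \<gamma> $ \<alpha> + T \<gamma> $ \<alpha> $ \<beta> = 0"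
  shows "frame3 e T a $ b $ c + frame3 e T b $ c $ a + frame3 e T c $ a $ b = 0"
proof -
  have 1: "frame3 e T b $ c $ a = (\<Sum>\<alpha>\<in>UNIV. \<Sum>\<beta>\<in>UNIV. \<Sum>\<gamma>\<in>UNIV. e$a$\<alpha> * e$b$\<beta> * e$c$\<gamma> * T \<beta> $ \<gamma> $ \<alpha>)"
    unfolding frame3_nth by (subst sum_rotate) (simp add: ac_simps)
  have 2: "frame3 e T c $ a $ b = (\<Sum>\<alpha>\<in>UNIV. \<Sum>\<beta>\<in>UNIV. \<Sum>\<gamma>\<in>UNIV. e$a$\<alpha> * e$b$\<beta> * e$c$\<gamma> * T \<gamma> $ \<alpha> $ \<beta>)"
    unfolding frame3_nth by (subst sum_rotate[symmetric]) (simp add: ac_simps)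
  have "frame3 e T a $ b $ c + frame3 e T b $ c $ a + frame3 e T c $ a $ b
    = (\<Sum>\<alpha>\<in>UNIV. \<Sum>\<beta>\<in>UNIV. \<Sum>\<gamma>\<in>UNIV. e$a$\<alpha> * e$b$\<beta> * e$c$\<gamma> * (T \<alpha> $ \<beta> $ \<gamma> + T \<beta> $ \<gamma> $ \<alpha> + T \<gamma> $ \<alpha> $ \<beta>))"
    unfolding 1 2 unfolding frame3_nth by (simp add: sum.distrib distrib_left)
  then show ?thesis by (simp add: assms)
qed

text \<open>The infinitesimal form of \<open>wedge22_congruence\<close>, from which the logarithmic derivative
  of the volume form is the trace of the connection.\<close>

lemma wedge22_derivation:
  "wedge22 (C ** X + X ** transpose C) Y + wedge22 X (C ** Y + Y ** transpose C) = trace C * wedge22 X Y"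
proof -
  have w: "4 * wedge22 a b = (a$1$2 - a$2$1) * (b$3$4 - b$4$3) + (a$3$4 - a$4$3) * (b$1$2 - b$2$1)
     - (a$1$3 - a$3$1) * (b$2$4 - b$4$2) - (a$2$4 - a$4$2) * (b$1$3 - b$3$1)
     + (a$1$4 - a$4$1) * (b$2$3 - b$3$2) + (a$2$3 - a$3$2) * (b$1$4 - b$4$1)" for a b
    by (simp add: wedge22_eq)
  have "4 * wedge22 (C ** X + X ** transpose C) Y + 4 * wedge22 X (C ** Y + Y ** transpose C)
      = trace C * (4 * wedge22 X Y)"
    unfolding w by (simp add: matrix_matrix_mult_def transpose_def trace_def sum_4 algebra_simps)
  then show ?thesis by simp
qed

lemma bounded_bilinear_wedge22: "bounded_bilinear wedge22"
  unfolding bilinear_conv_bounded_bilinear[symmetric] bilinear_def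
  by (auto intro!: linearI simp: wedge22_def sum.distrib sum_distrib_left algebra_simps add_divide_distrib)

text \<open>What the hypotheses on the triple and its metric say in one chart.\<close>

locale triple_chart =
  fixes U :: "(real^4) set" and S :: "real^4 \<Rightarrow> triple" and g :: "real^4 \<Rightarrow> real^4^4"
  assumes opn: "open U" and smS: "smooth_on U S" and smg: "smooth_on U g"
    and S_anti: "\<And>x i. x \<in> U \<Longrightarrow> transpose (S x $ i) = - (S x $ i)"
    and g_sym: "\<And>x. x \<in> U \<Longrightarrow> transpose (g x) = g x"
    and g_pos: "\<And>x w. x \<in> U \<Longrightarrow> w \<noteq> 0 \<Longrightarrow> w \<bullet> (g x *v w) > 0"
    and quat: "\<And>x. x \<in> U \<Longrightarrow> quaternion_relations (mixS (S x) (g x))"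
    and closed: "\<And>x i \<mu> \<nu> \<rho>. x \<in> U \<Longrightarrow> pd \<mu> (\<lambda>y. S y $ i $ \<nu> $ \<rho>) x + pd \<nu> (\<lambda>y. S y $ i $ \<rho> $ \<mu>) x
                   + pd \<rho> (\<lambda>y. S y $ i $ \<mu> $ \<nu>) x = 0"
begin

definition G :: "real^4 \<Rightarrow> real^4^4" where "G x = matrix_inv (g x)"
definition M :: "3 \<Rightarrow> real^4 \<Rightarrow> real^4^4" where "M i x = mixS (S x) (g x) i"
definition K :: "3 \<Rightarrow> real^4 \<Rightarrow> real^4^4" where "K i x = upS (S x) (g x) i"

lemma ex_adapted: "x \<in> U \<Longrightarrow> \<exists>e. adapted (S x) (g x) e"
  unfolding adapted_def using adapted_frame_exists[OF g_sym g_pos S_anti quat] by blast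

text \<open>In an adapted frame these become identities between the constant matrices \<open>eta
  i\<close>.\<close>

lemma G_g: "x \<in> U \<Longrightarrow> G x ** g x = mat 1" "x \<in> U \<Longrightarrow> g x ** G x = mat 1"
  and transpose_G: "x \<in> U \<Longrightarrow> transpose (G x) = G x"
  and transpose_K: "x \<in> U \<Longrightarrow> transpose (K i x) = - K i x"
  and transpose_M: "x \<in> U \<Longrightarrow> transpose (M i x) = - (G x ** S x $ i)"
  and S_M_K: "x \<in> U \<Longrightarrow> S x $ i = M i x ** g x" "x \<in> U \<Longrightarrow> M i x = S x $ i ** G x"
    "x \<in> U \<Longrightarrow> K i x = G x ** M i x" "x \<in> U \<Longrightarrow> M i x = g x ** K i x"
  and M_quaternion: "x \<in> U \<Longrightarrow> quaternion_relations (\<lambda>i. M i x)"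
  and vS_nz: "x \<in> U \<Longrightarrow> vS (S x) \<noteq> 0"
proof -
  assume x: "x \<in> U"
  then obtain e where "adapted (S x) (g x) e" using ex_adapted by blast
  then interpret a: adapted "S x" "g x" e .
  have eqs: "G x = a.G" "K i x = a.K i" for i by (simp_all add: G_def a.G_def K_def a.K_def)
  have eqs2: "(\<lambda>i. M i x) = a.M" by (simp add: M_def a.M_def fun_eq_iff)
  have eqs3: "M i x = a.M i" for i by (simp add: M_def a.M_def)
  show "G x ** g x = mat 1" "g x ** G x = mat 1" "transpose (G x) = G x" "transpose (K i x) = - K i x"
    "transpose (M i x) = - (G x ** S x $ i)" "S x $ i = M i x ** g x" "M i x = S x $ i ** G x"
    "K i x = G x ** M i x" "M i x = g x ** K i x" "quaternion_relations (\<lambda>i. M i x)" "vS (S x) \<noteq> 0"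
    unfolding eqs eqs2 eqs3
    using a.G_g a.transpose_G a.transpose_K a.transpose_M a.S_M_K a.M_quaternion a.vS_frame by blast+
qed

lemma invertible_g: "x \<in> U \<Longrightarrow> invertible (g x)"
  unfolding invertible_def using G_g by blast

lemmas smooth_rules = smooth_on_const[OF opn] smooth_on_add[OF opn] smooth_on_diff[OF opn] smooth_on_minus[OF opn]
  smooth_on_nth[OF opn] smooth_on_transpose[OF opn] smooth_on_fst[OF opn] smooth_on_snd[OF opn]
  smooth_on_mult[OF opn] smooth_on_scaleR[OF opn]
  smooth_on_matrix_mult[OF opn] smooth_on_matrix_vector_mult[OF opn] smooth_on_sum[OF opn] smooth_on_vec_lambda[OF opn]
  smooth_on_Pair[OF opn] smooth_on_pd'

lemma smooth_G: "smooth_on U G"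
  unfolding G_def[abs_def] by (rule smooth_on_matrix_inv[OF opn smg invertible_g])

lemma smooth_M: "smooth_on U (M i)"
  unfolding M_def[abs_def] mixS_def using smooth_G unfolding G_def[abs_def]
  by (intro smooth_rules smS)

lemma smooth_K: "smooth_on U (K i)"
  unfolding K_def[abs_def] upS_def using smooth_G unfolding G_def[abs_def]
  by (intro smooth_rules smS)

lemma smooth_Gam: "smooth_on U (Gam g \<mu>)"
  unfolding Gam_def[abs_def] christoffel_def using smooth_G unfolding G_def[abs_def]
  by (intro smooth_rules smg)

lemma diff: "smooth_on U f \<Longrightarrow> x \<in> U \<Longrightarrow> f differentiable (at x)"
  by (rule smooth_on_differentiable[OF opn])

lemma pd_cong: "x \<in> U \<Longrightarrow> (\<And>y. y \<in> U \<Longrightarrow> f y = h y) \<Longrightarrow> pd \<mu> f x = pd \<mu> h x"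
  by (rule pd_cong_open[OF opn])

lemma pd_symmetric: "x \<in> U \<Longrightarrow> pd \<sigma> (\<lambda>y. g y $ \<mu> $ \<nu>) x = pd \<sigma> (\<lambda>y. g y $ \<nu> $ \<mu>) x"
  by (rule pd_cong) (simp_all add: symmetric_nth[OF g_sym])

lemma Gam_sym: "x \<in> U \<Longrightarrow> Gam g \<mu> x $ \<nu> = Gam g \<nu> x $ \<mu>"
  unfolding Gam_def christoffel_def vec_eq_iff
  using pd_symmetric[of x _ \<mu> \<nu>] by (simp add: add.commute)

lemma pd_g:
  assumes x: "x \<in> U"
  shows "pd \<mu> g x = Gam g \<mu> x ** g x + g x ** transpose (Gam g \<mu> x)"
proof -
  let ?d = "\<lambda>\<mu> \<nu> \<rho>. pd \<mu> (\<lambda>y. g y $ \<nu> $ \<rho>) x"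
  have n: "pd \<mu> g x $ \<nu> $ \<rho> = ?d \<mu> \<nu> \<rho>" for \<nu> \<rho>
    by (simp add: pd_nth[OF diff[OF smooth_on_nth[OF opn smg] x]] pd_nth[OF diff[OF smg x]])
  have "Gam g \<mu> x = (1/2) *\<^sub>R ((\<chi> \<nu> \<sigma>. ?d \<mu> \<nu> \<sigma> + ?d \<nu> \<mu> \<sigma> - ?d \<sigma> \<mu> \<nu>) ** transpose (G x))"
    by (simp add: vec_eq_iff Gam_def christoffel_def G_def matrix_matrix_mult_def transpose_def mult.commute)
  then have e: "Gam g \<mu> x ** g x = (1/2) *\<^sub>R (\<chi> \<nu> \<sigma>. ?d \<mu> \<nu> \<sigma> + ?d \<nu> \<mu> \<sigma> - ?d \<sigma> \<mu> \<nu>)"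
    by (simp add: matrix_scaleR_left matrix_mul_assoc[symmetric] transpose_G[OF x] G_g[OF x])
  moreover have "g x ** transpose (Gam g \<mu> x) = transpose (Gam g \<mu> x ** g x)"
    by (simp add: matrix_transpose_mul g_sym[OF x])
  ultimately have "(Gam g \<mu> x ** g x + g x ** transpose (Gam g \<mu> x)) $ \<nu> $ \<rho> = pd \<mu> g x $ \<nu> $ \<rho>" for \<nu> \<rho>
    using pd_symmetric[OF x, of \<mu> \<rho> \<nu>] by (simp add: n transpose_def field_simps)
  then show ?thesis by (simp add: vec_eq_iff)
qed

end

lemma row_mult_transpose: "(A ** transpose C) $ i = C *v (A $ i)" for A :: "real^'n^'m" and C :: "real^'n^'p"
  by (simp add: vec_eq_iff matrix_matrix_mult_def matrix_vector_mult_def transpose_def mult.commute)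

lemma matrix_eq_rows: "(\<And>i. A $ i = B $ i) \<Longrightarrow> A = B"
  by (simp add: vec_eq_iff)

context triple_chart
begin

text \<open>The difference of two metric torsion-free connections, with the upper index lowered, is symmetric in
  its first two indices and antisymmetric in the last two, so it vanishes.\<close>

lemma Gam_unique:
  assumes x: "x \<in> U" and sym: "\<And>\<mu> \<nu>. C \<mu> $ \<nu> = C \<nu> $ \<mu>"
    and met: "\<And>\<mu>. pd \<mu> g x = C \<mu> ** g x + g x ** transpose (C \<mu>)"
  shows "Gam g \<mu> x = C \<mu>"
proof -
  define D where "D = (\<lambda>\<mu>. (Gam g \<mu> x - C \<mu>) ** g x)"
  have rows: "D \<mu> $ \<nu> = D \<nu> $ \<mu>" for \<mu> \<nu>
    by (simp add: D_def row_matrix_mult Gam_sym[OF x, of \<mu> \<nu>] sym[of \<mu> \<nu>])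
  have "D \<mu> + transpose (D \<mu>) = 0" for \<mu>
    using met[of \<mu>] pd_g[OF x, of \<mu>]
    by (simp add: D_def matrix_linear_simps matrix_transpose_mul g_sym[OF x] algebra_simps)
  then have anti: "D \<mu> $ \<nu> $ \<rho> = - D \<mu> $ \<rho> $ \<nu>" for \<mu> \<nu> \<rho>
    by (simp add: vec_eq_iff transpose_def eq_neg_iff_add_eq_0)
  have "D \<mu> $ \<nu> $ \<rho> = 0" for \<mu> \<nu> \<rho>
    using rows[of \<mu> \<nu>] rows[of \<rho> \<nu>] rows[of \<mu> \<rho>] anti[of \<mu> \<nu> \<rho>] anti[of \<rho> \<nu> \<mu>] anti[of \<nu> \<rho> \<mu>] by simp
  then have "D \<mu> = 0" by (simp add: vec_eq_iff)
  then have "D \<mu> ** G x = 0" by simp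
  then show ?thesis by (simp add: D_def matrix_mul_assoc[symmetric] G_g[OF x])
qed

lemma pd_G:
  assumes x: "x \<in> U"
  shows "pd \<mu> G x = - (transpose (Gam g \<mu> x) ** G x) - G x ** Gam g \<mu> x"
proof -
  note dG = diff[OF smooth_G x] and dg = diff[OF smg x]
  have "pd \<mu> (\<lambda>y. G y ** g y) x = pd \<mu> (\<lambda>y. mat 1) x"
    by (rule pd_cong[OF x]) (simp add: G_g)
  then have "pd \<mu> G x ** g x = - (G x ** pd \<mu> g x)"
    by (simp add: pd_matrix_mult[OF dG dg] eq_neg_iff_add_eq_0)
  then have "pd \<mu> G x ** g x ** G x = - (G x ** (Gam g \<mu> x ** g x + g x ** transpose (Gam g \<mu> x))) ** G x"
    by (simp add: pd_g[OF x])
  then show ?thesis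
    by (simp add: matrix_linear_simps matrix_mul_assoc[symmetric] G_g[OF x])
       (simp add: matrix_mul_assoc G_g[OF x])
qed

lemma S_products:
  assumes x: "x \<in> U"
  shows "S x $ i ** G x ** S x $ j = (if i = j then - g x else 0) + (\<Sum>k\<in>UNIV. eps3 i j k *\<^sub>R S x $ k)"
proof -
  have "S x $ i ** G x ** S x $ j = M i x ** M j x ** g x"
    by (simp add: S_M_K(2)[OF x] matrix_mul_assoc[symmetric] G_g[OF x])
  also have "\<dots> = (if i = j then - g x else 0) + (\<Sum>k\<in>UNIV. eps3 i j k *\<^sub>R (M k x ** g x))"
    using M_quaternion[OF x] unfolding quaternion_relations_def
    by (simp add: matrix_linear_simps sum_3)
  finally show ?thesis by (simp add: S_M_K(1)[OF x, symmetric])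
qed

text \<open>The triple is parallel. Its covariant derivative \<open>X\<close> satisfies the linearized
  quaternion relations because \<open>g\<close> is parallel, and the cyclic sum of \<open>X\<close> is that of
  the partial derivatives, as the Christoffel symbols are symmetric; in an adapted frame
  \<open>parallel_flat\<close> applies.\<close>

lemma pd_S:
  assumes x: "x \<in> U"
  shows "pd \<mu> (\<lambda>y. S y $ i) x = Gam g \<mu> x ** S x $ i + S x $ i ** transpose (Gam g \<mu> x)"
proof -
  obtain e where "adapted (S x) (g x) e" using ex_adapted[OF x] by blast
  then interpret a: adapted "S x" "g x" e .
  have Ge: "G x = transpose e ** e" using a.G_eq by (simp add: G_def a.G_def)
  have smSi: "smooth_on U (\<lambda>y. S y $ i)" for i by (intro smooth_rules smS)
  note dS = diff[OF smSi x] and dG = diff[OF smooth_G x] and dg = diff[OF smg x]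
  define X where "X = (\<lambda>\<mu> i. pd \<mu> (\<lambda>y. S y $ i) x - Gam g \<mu> x ** S x $ i - S x $ i ** transpose (Gam g \<mu> x))"
  have X: "pd \<mu> (\<lambda>y. S y $ i) x = X \<mu> i + Gam g \<mu> x ** S x $ i + S x $ i ** transpose (Gam g \<mu> x)" for \<mu> i
    by (simp add: X_def)
  define Y where "Y = (\<lambda>a i. frame3 e (\<lambda>\<mu>. X \<mu> i) a)"
  have antiX: "transpose (X \<mu> i) = - X \<mu> i" for \<mu> i
  proof -
    have "transpose (pd \<mu> (\<lambda>y. S y $ i) x) = pd \<mu> (\<lambda>y. transpose (S y $ i)) x"
      by (rule pd_transpose[OF dS, symmetric])
    also have "\<dots> = pd \<mu> (\<lambda>y. - (S y $ i)) x" by (rule pd_cong[OF x S_anti])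
    also have "\<dots> = - pd \<mu> (\<lambda>y. S y $ i) x" by (rule pd_minus[OF dS])
    finally show ?thesis
      by (simp add: X_def transpose_diff matrix_transpose_mul S_anti[OF x] matrix_linear_simps)
  qed
  have antiY: "transpose (Y a i) = - Y a i" for a i
    by (simp add: Y_def frame3_def bounded_linear.linear[OF bounded_linear_transpose, THEN linear_sum]
        matrix_transpose_mul transpose_scaleR antiX matrix_linear_simps sum_negf matrix_mul_assoc)
  have quatX: "X \<mu> i ** G x ** S x $ j + S x $ i ** G x ** X \<mu> j = (\<Sum>k\<in>UNIV. eps3 i j k *\<^sub>R X \<mu> k)" for \<mu> i j
  proof -
    have "pd \<mu> (\<lambda>y. S y $ i ** G y ** S y $ j) x
        = pd \<mu> (\<lambda>y. (if i = j then - g y else 0) + (eps3 i j 1 *\<^sub>R S y $ 1 + eps3 i j 2 *\<^sub>R S y $ 2 + eps3 i j 3 *\<^sub>R S y $ 3)) x"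
      by (rule pd_cong[OF x]) (simp add: S_products sum_3)
    moreover have "pd \<mu> (\<lambda>y. S y $ i ** G y ** S y $ j) x
        = (pd \<mu> (\<lambda>y. S y $ i) x ** G x + S x $ i ** pd \<mu> G x) ** S x $ j + S x $ i ** G x ** pd \<mu> (\<lambda>y. S y $ j) x"
      by (simp add: pd_matrix_mult[OF differentiable_matrix_mult[OF dS dG] dS] pd_matrix_mult[OF dS dG])
    moreover have "pd \<mu> (\<lambda>y. (if i = j then - g y else 0) + (eps3 i j 1 *\<^sub>R S y $ 1 + eps3 i j 2 *\<^sub>R S y $ 2 + eps3 i j 3 *\<^sub>R S y $ 3)) x
        = (if i = j then - pd \<mu> g x else 0) + (\<Sum>k\<in>UNIV. eps3 i j k *\<^sub>R pd \<mu> (\<lambda>y. S y $ k) x)"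
    proof -
      have dg': "(\<lambda>y. if i = j then - g y else 0) differentiable (at x)"
        using dg by (cases "i = j") auto
      have dc: "(\<lambda>y. c *\<^sub>R S y $ k) differentiable (at x)" for c k
        by (rule differentiable_linear[OF bounded_linear_scaleR_right dS])
      have pc: "pd \<mu> (\<lambda>y. c *\<^sub>R S y $ k) x = c *\<^sub>R pd \<mu> (\<lambda>y. S y $ k) x" for c k
        by (rule pd_bounded_linear[OF bounded_linear_scaleR_right dS])
      show ?thesis
        by (simp add: pd_add[OF dg' differentiable_add[OF differentiable_add[OF dc dc] dc]]
            pd_add[OF differentiable_add[OF dc dc] dc] pd_add[OF dc dc] pc sum_3 pd_minus[OF dg])
    qed
    ultimately have "(pd \<mu> (\<lambda>y. S y $ i) x ** G x + S x $ i ** pd \<mu> G x) ** S x $ j + S x $ i ** G x ** pd \<mu> (\<lambda>y. S y $ j) x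
        = (if i = j then - pd \<mu> g x else 0) + (\<Sum>k\<in>UNIV. eps3 i j k *\<^sub>R pd \<mu> (\<lambda>y. S y $ k) x)" by simp
    then have "X \<mu> i ** G x ** S x $ j + S x $ i ** G x ** X \<mu> j
        + Gam g \<mu> x ** (S x $ i ** G x ** S x $ j) + (S x $ i ** G x ** S x $ j) ** transpose (Gam g \<mu> x)
        = (if i = j then - (Gam g \<mu> x ** g x + g x ** transpose (Gam g \<mu> x)) else 0)
          + (\<Sum>k\<in>UNIV. eps3 i j k *\<^sub>R (X \<mu> k + Gam g \<mu> x ** S x $ k + S x $ k ** transpose (Gam g \<mu> x)))"
      unfolding X pd_G[OF x] pd_g[OF x]
      by (simp add: matrix_linear_simps matrix_mul_assoc algebra_simps)
    then show ?thesis
      unfolding S_products[OF x]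
      by (simp add: matrix_linear_simps sum_3 algebra_simps split: if_splits)
  qed
  have quatY: "Y a i ** eta j + eta i ** Y a j = (\<Sum>k\<in>UNIV. eps3 i j k *\<^sub>R Y a k)" for a i j
  proof -
    have fr: "e ** (P ** G x ** Q) ** transpose e = (e ** P ** transpose e) ** (e ** Q ** transpose e)" for P Q
      by (simp add: Ge matrix_mul_assoc)
    have "(e ** X \<mu> i ** transpose e) ** eta j + eta i ** (e ** X \<mu> j ** transpose e)
        = (\<Sum>k\<in>UNIV. eps3 i j k *\<^sub>R (e ** X \<mu> k ** transpose e))" for \<mu>
      using arg_cong[OF quatX[of \<mu> i j], of "\<lambda>Z. e ** Z ** transpose e"]
      by (simp add: matrix_linear_simps fr a.frame_eqs sum_3)
    then have "(\<Sum>\<mu>\<in>UNIV. e$a$\<mu> *\<^sub>R ((e ** X \<mu> i ** transpose e) ** eta j + eta i ** (e ** X \<mu> j ** transpose e)))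
        = (\<Sum>\<mu>\<in>UNIV. e$a$\<mu> *\<^sub>R (\<Sum>k\<in>UNIV. eps3 i j k *\<^sub>R (e ** X \<mu> k ** transpose e)))" by simp
    then show ?thesis
      by (simp add: Y_def frame3_def sum_4 sum_3 matrix_linear_simps scaleR_add_right algebra_simps)
  qed
  have "Y a i $ b $ c + Y b i $ c $ a + Y c i $ a $ b = 0" for i a b c
    unfolding Y_def
  proof (rule frame3_cyclic)
    fix \<alpha> \<beta> \<gamma>
    have n: "pd \<alpha> (\<lambda>y. S y $ i) x $ \<beta> $ \<gamma> = pd \<alpha> (\<lambda>y. S y $ i $ \<beta> $ \<gamma>) x" for \<alpha> \<beta> \<gamma>
      by (simp add: pd_nth[OF differentiable_nth[OF dS]] pd_nth[OF dS])
    have l: "(Gam g \<alpha> x ** S x $ i) $ \<beta> $ \<gamma> = (Gam g \<beta> x ** S x $ i) $ \<alpha> $ \<gamma>" for \<alpha> \<beta> \<gamma>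
      by (simp add: row_matrix_mult Gam_sym[OF x, of \<alpha>])
    have r: "(S x $ i ** transpose (Gam g \<alpha> x)) $ \<beta> $ \<gamma> = - (Gam g \<alpha> x ** S x $ i) $ \<gamma> $ \<beta>" for \<alpha> \<beta> \<gamma>
    proof -
      have "S x $ i ** transpose (Gam g \<alpha> x) = - transpose (Gam g \<alpha> x ** S x $ i)"
        by (simp add: matrix_transpose_mul S_anti[OF x] matrix_linear_simps)
      then show ?thesis by (simp add: transpose_def)
    qed
    show "X \<alpha> i $ \<beta> $ \<gamma> + X \<beta> i $ \<gamma> $ \<alpha> + X \<gamma> i $ \<alpha> $ \<beta> = 0"
      using closed[OF x, of \<alpha> i \<beta> \<gamma>] l[of \<alpha> \<beta> \<gamma>] l[of \<beta> \<gamma> \<alpha>] l[of \<gamma> \<alpha> \<beta>]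
      by (simp add: X_def n r)
  qed
  then have Y0: "Y a i = 0" for a i
    by (rule parallel_flat[OF antiY quatY])
  have "X \<mu> i = (\<Sum>a\<in>UNIV. a.B $ \<mu> $ a *\<^sub>R (a.B ** Y a i ** transpose a.B))"
  proof -
    have "(\<Sum>a\<in>UNIV. a.B $ \<mu> $ a *\<^sub>R (a.B ** Y a i ** transpose a.B))
        = (\<Sum>a\<in>UNIV. \<Sum>\<alpha>\<in>UNIV. (a.B $ \<mu> $ a * e $ a $ \<alpha>) *\<^sub>R X \<alpha> i)"
      by (simp add: Y_def frame3_def sum_4 matrix_linear_simps scaleR_add_right a.frame_congruence[symmetric])
    also have "\<dots> = (\<Sum>\<alpha>\<in>UNIV. \<Sum>a\<in>UNIV. (a.B $ \<mu> $ a * e $ a $ \<alpha>) *\<^sub>R X \<alpha> i)" by (rule sum.swap)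
    also have "\<dots> = (\<Sum>\<alpha>\<in>UNIV. (a.B ** e) $ \<mu> $ \<alpha> *\<^sub>R X \<alpha> i)"
      by (simp add: matrix_matrix_mult_def scaleR_sum_left)
    also have "\<dots> = X \<mu> i"
      by (simp add: a.e_B mat_1_nth if_distrib[of "\<lambda>c. c *\<^sub>R _"] cong: if_cong)
    finally show ?thesis by simp
  qed
  then have "X \<mu> i = 0" by (simp add: Y0)
  then show ?thesis by (simp add: X_def algebra_simps)
qed

lemma smooth_Si: "smooth_on U (\<lambda>y. S y $ i)"
  by (intro smooth_rules smS)

lemma pd_M:
  assumes x: "x \<in> U"
  shows "pd \<mu> (M i) x = Gam g \<mu> x ** M i x - M i x ** Gam g \<mu> x"
proof -
  have "pd \<mu> (M i) x = pd \<mu> (\<lambda>y. S y $ i ** G y) x" by (rule pd_cong[OF x S_M_K(2)])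
  then show ?thesis
    by (simp add: pd_matrix_mult[OF diff[OF smooth_Si x] diff[OF smooth_G x]] pd_S[OF x] pd_G[OF x] S_M_K(2)[OF x]
        matrix_linear_simps matrix_mul_assoc)
qed

lemma pd_K:
  assumes x: "x \<in> U"
  shows "pd \<mu> (K i) x = - (transpose (Gam g \<mu> x) ** K i x) - K i x ** Gam g \<mu> x"
proof -
  have "pd \<mu> (K i) x = pd \<mu> (\<lambda>y. G y ** M i y) x" by (rule pd_cong[OF x S_M_K(3)])
  then show ?thesis
    by (simp add: pd_matrix_mult[OF diff[OF smooth_G x] diff[OF smooth_M x]] pd_M[OF x] pd_G[OF x] S_M_K(3)[OF x]
        matrix_linear_simps matrix_mul_assoc)
qed


subsection \<open>The volume form and the divergence theorem\<close>

definition vol :: "real^4 \<Rightarrow> real" where "vol x = \<bar>vS (S x)\<bar>"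

lemma smooth_vS: "smooth_on U (\<lambda>y. vS (S y))"
  unfolding vS_def by (intro smooth_rules smooth_on_bilinear[OF opn bounded_bilinear_wedge22] smS)

lemma pd_vS:
  assumes x: "x \<in> U"
  shows "pd \<mu> (\<lambda>y. vS (S y)) x = trace (Gam g \<mu> x) * vS (S x)"
proof -
  have dw: "(\<lambda>y. wedge22 (S y $ k) (S y $ k)) differentiable (at x)" for k
    by (rule differentiable_bilinear[OF bounded_bilinear_wedge22 diff[OF smooth_Si x] diff[OF smooth_Si x]])
  have pw: "pd \<mu> (\<lambda>y. wedge22 (S y $ k) (S y $ k)) x = trace (Gam g \<mu> x) * wedge22 (S x $ k) (S x $ k)" for k
    using wedge22_derivation[of "Gam g \<mu> x" "S x $ k" "S x $ k"]
    by (simp add: pd_bilinear[OF bounded_bilinear_wedge22 diff[OF smooth_Si x] diff[OF smooth_Si x]] pd_S[OF x])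
  have "pd \<mu> (\<lambda>y. vS (S y)) x = (1/6) * (\<Sum>k\<in>UNIV. pd \<mu> (\<lambda>y. wedge22 (S y $ k) (S y $ k)) x)"
    unfolding vS_def
    by (subst pd_bounded_linear[OF bounded_linear_mult_right differentiable_sum])
       (auto intro: dw simp: pd_sum[OF dw])
  then show ?thesis by (simp add: pw vS_def sum_distrib_left ac_simps)
qed

text \<open>The density \<open>\<bar>vS\<bar>\<close> is smooth, since \<open>vS\<close> has a constant sign
  near each point.\<close>

lemma vol_local:
  assumes x: "x \<in> U"
  obtains V c where "open V" "x \<in> V" "V \<subseteq> U" "\<And>y. y \<in> V \<Longrightarrow> c * vS (S y) = vol y"
proof -
  have c: "continuous_on U (\<lambda>y. vS (S x) * vS (S y))"
    using diff[OF smooth_vS] by (intro continuous_intros)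
      (auto simp: continuous_on_eq_continuous_at[OF opn] intro: differentiable_imp_continuous_within)
  define V where "V = {y \<in> U. 0 < vS (S x) * vS (S y)}"
  have "open V" unfolding V_def
    using continuous_open_preimage[OF c opn open_greaterThan[of 0]] by (simp add: vimage_def Int_def)
  moreover have "x \<in> V" using x vS_nz[OF x] by (auto simp: V_def zero_less_mult_iff linorder_neq_iff)
  moreover have "sgn (vS (S x)) * vS (S y) = vol y" if "y \<in> V" for y
    using that unfolding V_def vol_def by (auto simp: zero_less_mult_iff sgn_if)
  ultimately show ?thesis using that[of V "sgn (vS (S x))"] by (auto simp: V_def)
qed

lemma smooth_vol: "smooth_on U vol"
  unfolding smooth_on_def
proof
  fix ms
  have "foldr pd ms vol differentiable (at x)" if x: "x \<in> U" for x
  proof -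
    obtain V c where V: "open V" "x \<in> V" "V \<subseteq> U" "\<And>y. y \<in> V \<Longrightarrow> c * vS (S y) = vol y"
      using vol_local[OF x] by blast
    have "smooth_on V (\<lambda>y. c * vS (S y))"
      using smooth_vS V(3) by (intro smooth_on_mult[OF V(1)] smooth_on_const[OF V(1)])
        (auto simp: smooth_on_def intro: differentiable_on_subset)
    then have "smooth_on V vol" by (rule smooth_on_cong[OF V(1), rotated]) (rule V(4))
    then show ?thesis
      using V(1,2) by (simp add: smooth_on_def differentiable_on_eq_differentiable_at)
  qed
  then show "foldr pd ms vol differentiable_on U"
    by (simp add: differentiable_on_eq_differentiable_at[OF opn])
qed

lemma pd_vol:
  assumes x: "x \<in> U"
  shows "pd \<mu> vol x = trace (Gam g \<mu> x) * vol x"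
proof -
  obtain V c where V: "open V" "x \<in> V" "V \<subseteq> U" "\<And>y. y \<in> V \<Longrightarrow> c * vS (S y) = vol y"
    using vol_local[OF x] by blast
  have "pd \<mu> vol x = pd \<mu> (\<lambda>y. c * vS (S y)) x"
    by (rule pd_cong_open[OF V(1,2)]) (simp add: V(4))
  also have "\<dots> = c * pd \<mu> (\<lambda>y. vS (S y)) x"
    by (rule pd_bounded_linear[OF bounded_linear_mult_right diff[OF smooth_vS x]])
  also have "\<dots> = trace (Gam g \<mu> x) * vol x"
    using V(4)[OF V(2)] by (simp add: pd_vS[OF x])
  finally show ?thesis .
qed

text \<open>The trace of the connection that comes from differentiating the volume form compensates that from
  raising an index.\<close>

lemma divergence_density:
  assumes x: "x \<in> U" and w: "w differentiable (at x)"
  shows "(\<Sum>\<mu>\<in>UNIV. pd \<mu> (\<lambda>y. vol y * (G y *v w y) $ \<mu>) x) = vol x * (G x \<bullet> cov1 g w x)"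
proof -
  let ?u = "G x *v w x"
  note dG = diff[OF smooth_G x]
  have dGw: "(\<lambda>y. G y *v w y) differentiable (at x)"
    by (rule differentiable_matrix_vector_mult[OF dG w])
  have p: "pd \<mu> (\<lambda>y. vol y * (G y *v w y) $ \<mu>) x
      = vol x * (trace (Gam g \<mu> x) * ?u $ \<mu> - (transpose (Gam g \<mu> x) *v ?u) $ \<mu> + (G x *v cov1 g w x $ \<mu>) $ \<mu>)" for \<mu>
    by (simp add: pd_mult[OF diff[OF smooth_vol x] differentiable_nth[OF dGw]] pd_nth[OF dGw]
        pd_matrix_vector_mult[OF dG w] pd_vol[OF x] pd_G[OF x] cov1_def matrix_linear_simps
        matrix_vector_mul_assoc[symmetric] algebra_simps)
  have "(\<Sum>\<mu>\<in>UNIV. (transpose (Gam g \<mu> x) *v ?u) $ \<mu>) = (\<Sum>\<mu>\<in>UNIV. \<Sum>\<sigma>\<in>UNIV. Gam g \<mu> x $ \<sigma> $ \<mu> * ?u $ \<sigma>)"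
    by (simp add: matrix_vector_mult_def transpose_def)
  also have "\<dots> = (\<Sum>\<sigma>\<in>UNIV. \<Sum>\<mu>\<in>UNIV. Gam g \<sigma> x $ \<mu> $ \<mu> * ?u $ \<sigma>)"
    by (subst sum.swap) (intro sum.cong refl, metis Gam_sym[OF x])
  also have "\<dots> = (\<Sum>\<mu>\<in>UNIV. trace (Gam g \<mu> x) * ?u $ \<mu>)"
    by (simp add: trace_def sum_distrib_right)
  finally have t: "(\<Sum>\<mu>\<in>UNIV. (transpose (Gam g \<mu> x) *v ?u) $ \<mu>) = (\<Sum>\<mu>\<in>UNIV. trace (Gam g \<mu> x) * ?u $ \<mu>)" .
  have "(\<Sum>\<mu>\<in>UNIV. (G x *v cov1 g w x $ \<mu>) $ \<mu>) = G x \<bullet> cov1 g w x"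
    by (simp add: matrix_inner_sum matrix_vector_mult_def)
  then show ?thesis
    unfolding p by (simp add: sum_distrib_left[symmetric] sum.distrib sum_subtractf t)
qed

lemma integral_divergence:
  assumes w: "smooth_on U w" and C: "compact C" "C \<subseteq> U" and z: "\<And>x. x \<in> U \<Longrightarrow> x \<notin> C \<Longrightarrow> w x = 0"
  shows "((\<lambda>x. vol x * (G x \<bullet> cov1 g w x)) has_integral 0) U"
proof -
  have sm: "smooth_on U (\<lambda>y. vol y * (G y *v w y) $ \<mu>)" for \<mu>
    by (intro smooth_rules smooth_vol smooth_G w)
  have "(pd \<mu> (\<lambda>y. vol y * (G y *v w y) $ \<mu>) has_integral 0) U" for \<mu>
  proof (rule has_integral_pd_zero[OF opn C])
    show "continuous_on U (pd \<mu> (\<lambda>y. vol y * (G y *v w y) $ \<mu>))"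
      using diff[OF smooth_on_pd[OF sm]]
      by (auto simp: continuous_on_eq_continuous_at[OF opn] intro: differentiable_imp_continuous_within)
  qed (use diff[OF sm] z in auto)
  then have "((\<lambda>x. \<Sum>\<mu>\<in>UNIV. pd \<mu> (\<lambda>y. vol y * (G y *v w y) $ \<mu>) x) has_integral (\<Sum>\<mu>\<in>(UNIV::4 set). 0)) U"
    by (intro has_integral_sum) auto
  then have "((\<lambda>x. \<Sum>\<mu>\<in>UNIV. pd \<mu> (\<lambda>y. vol y * (G y *v w y) $ \<mu>) x) has_integral 0) U" by simp
  then show ?thesis
    by (rule has_integral_eq[rotated]) (use divergence_density[OF _ diff[OF w]] in auto)
qed


subsection \<open>Covariant derivatives of contractions\<close>

lemma cov1_M:
  assumes x: "x \<in> U" and a: "a differentiable (at x)"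
  shows "cov1 g (\<lambda>y. M i y *v a y) x = cov1 g a x ** transpose (M i x)"
proof -
  have "pd \<mu> (\<lambda>y. M i y *v a y) x - Gam g \<mu> x *v (M i x *v a x) = M i x *v (pd \<mu> a x - Gam g \<mu> x *v a x)" for \<mu>
    by (simp add: pd_matrix_vector_mult[OF diff[OF smooth_M x] a] pd_M[OF x] matrix_linear_simps
        matrix_vector_mul_assoc[symmetric] algebra_simps)
  then show ?thesis
    by (intro matrix_eq_rows) (simp add: cov1_def row_mult_transpose)
qed

lemma cov1_scaleR:
  assumes x: "x \<in> U" and f: "f differentiable (at x)" and a: "a differentiable (at x)"
  shows "cov1 g (\<lambda>y. f y *\<^sub>R a y) x = f x *\<^sub>R cov1 g a x + (\<chi> \<mu>. grad f x $ \<mu> *\<^sub>R a x)"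
  by (simp add: cov1_def vec_eq_iff pd_scaleR[OF f a] matrix_linear_simps grad_def algebra_simps)

lemma cov1_add:
  "a differentiable (at x) \<Longrightarrow> b differentiable (at x) \<Longrightarrow> cov1 g (\<lambda>y. a y + b y) x = cov1 g a x + cov1 g b x"
  by (simp add: cov1_def vec_eq_iff pd_add matrix_linear_simps)

lemma cov1_diff:
  "a differentiable (at x) \<Longrightarrow> b differentiable (at x) \<Longrightarrow> cov1 g (\<lambda>y. a y - b y) x = cov1 g a x - cov1 g b x"
  by (simp add: cov1_def vec_eq_iff pd_diff matrix_linear_simps)

lemma cov1_minus:
  "a differentiable (at x) \<Longrightarrow> cov1 g (\<lambda>y. - a y) x = - cov1 g a x"
  by (simp add: cov1_def vec_eq_iff pd_minus matrix_linear_simps)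

lemma cov1_const_scaleR:
  "a differentiable (at x) \<Longrightarrow> cov1 g (\<lambda>y. c *\<^sub>R a y) x = c *\<^sub>R cov1 g a x"
  by (simp add: cov1_def vec_eq_iff pd_bounded_linear[OF bounded_linear_scaleR_right] matrix_linear_simps algebra_simps)

lemma cov1_sum:
  "(\<And>i. i \<in> I \<Longrightarrow> a i differentiable (at x)) \<Longrightarrow> cov1 g (\<lambda>y. \<Sum>i\<in>I. a i y) x = (\<Sum>i\<in>I. cov1 g (a i) x)"
  by (simp add: cov1_def vec_eq_iff pd_sum sum_subtractf linear_sum[OF matrix_vector_mul_linear])

lemma cov1_cong: "x \<in> U \<Longrightarrow> (\<And>y. y \<in> U \<Longrightarrow> a y = b y) \<Longrightarrow> cov1 g a x = cov1 g b x"
  by (simp add: cov1_def pd_cong[of x a b])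

lemma cov1_tensor:
  assumes x: "x \<in> U" and h: "h differentiable (at x)" and w: "w differentiable (at x)"
  shows "cov1 g (\<lambda>y. h y *v (G y *v w y)) x
    = (\<chi> \<mu>. cov2 g h x \<mu> *v (G x *v w x)) + cov1 g w x ** G x ** transpose (h x)"
proof -
  note dG = diff[OF smooth_G x]
  have "pd \<mu> (\<lambda>y. h y *v (G y *v w y)) x - Gam g \<mu> x *v (h x *v (G x *v w x))
      = cov2 g h x \<mu> *v (G x *v w x) + h x *v (G x *v (pd \<mu> w x - Gam g \<mu> x *v w x))" for \<mu>
    by (simp add: pd_matrix_vector_mult[OF h differentiable_matrix_vector_mult[OF dG w]]
        pd_matrix_vector_mult[OF dG w] pd_G[OF x] cov2_def matrix_linear_simps
        matrix_vector_mul_assoc[symmetric] algebra_simps)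
  moreover have "cov1 g w x ** G x ** transpose (h x) = cov1 g w x ** transpose (G x) ** transpose (h x)"
    by (simp add: transpose_G[OF x])
  ultimately show ?thesis
    by (intro matrix_eq_rows) (simp add: cov1_def row_mult_transpose)
qed

end

lemma sum_reverse:
  "(\<Sum>a\<in>A. \<Sum>b\<in>B. \<Sum>c\<in>C. f a b c) = (\<Sum>c\<in>C. \<Sum>b\<in>B. \<Sum>a\<in>A. f a b c)" for f :: "_ \<Rightarrow> _ \<Rightarrow> _ \<Rightarrow> 'v::comm_monoid_add"
  unfolding sum_rotate[of f] by (intro sum.cong refl sum.swap)

lemma row_mult_sum: "(A ** C) $ i = (\<Sum>k\<in>UNIV. A $ i $ k *\<^sub>R C $ k)" for A :: "real^'n^'m" and C :: "real^'p^'n"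
  by (simp add: vec_eq_iff matrix_matrix_mult_def sum_component)

text \<open>With the index convention of \<open>Gam\<close>, the upper index of the curvature is the column and
  the quadratic terms change order.\<close>

lemma riemann_Riem:
  assumes "\<And>\<mu>. Gam g \<mu> differentiable (at x)"
  shows "riemann g x \<rho> \<sigma> \<mu> \<nu> = Riem g x \<mu> \<nu> $ \<sigma> $ \<rho>"
proof -
  have "pd \<mu> (\<lambda>y. christoffel g y \<rho> \<nu> \<sigma>) x = pd \<mu> (Gam g \<nu>) x $ \<sigma> $ \<rho>" for \<mu> \<nu> \<rho> \<sigma>
    using pd_nth[OF differentiable_nth[OF assms], of \<mu> \<nu> \<sigma> \<rho>] pd_nth[OF assms, of \<mu> \<nu> \<sigma>]
    by (simp add: Gam_def)
  then show ?thesis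
    by (simp add: riemann_def Riem_def matrix_matrix_mult_def sum_subtractf Gam_def mult.commute)
qed

context triple_chart
begin

lemma smooth_cov1: "smooth_on U a \<Longrightarrow> smooth_on U (cov1 g a)"
  unfolding cov1_def[abs_def] by (intro smooth_rules smooth_Gam)

lemma smooth_cov2: "smooth_on U h \<Longrightarrow> smooth_on U (\<lambda>y. cov2 g h y \<mu>)"
  unfolding cov2_def by (intro smooth_rules smooth_Gam)

lemma smooth_grad: "smooth_on U f \<Longrightarrow> smooth_on U (grad f)"
  unfolding grad_def[abs_def] by (intro smooth_rules)

lemma smooth_contract3:
  "smooth_on U k \<Longrightarrow> smooth_on U h \<Longrightarrow> smooth_on U (\<lambda>y. contract3 (k y) (cov2 g h y))"
  unfolding contract3_def by (intro smooth_rules smooth_cov2)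

lemma cov1_contract3:
  assumes x: "x \<in> U" and k: "smooth_on U k"
    and pdk: "\<And>\<mu>. pd \<mu> k x = - (transpose (Gam g \<mu> x) ** k x) - k x ** Gam g \<mu> x"
    and h: "smooth_on U h"
  shows "cov1 g (\<lambda>y. contract3 (k y) (cov2 g h y)) x = (\<chi> \<mu>. contract3 (k x) (cov22 g h x \<mu>))"
proof (rule matrix_eq_rows)
  fix \<mu>
  let ?C = "Gam g \<mu> x" and ?T = "cov2 g h x"
  have dT: "(\<lambda>y. cov2 g h y \<alpha>) differentiable (at x)" for \<alpha>
    by (rule diff[OF smooth_cov2[OF h] x])
  have dk: "(\<lambda>y. k y $ \<alpha> $ \<beta>) differentiable (at x)" for \<alpha> \<beta>
    by (intro differentiable_nth diff[OF k x])
  have dt: "(\<lambda>y. k y $ \<alpha> $ \<beta> *\<^sub>R cov2 g h y \<alpha> $ \<beta>) differentiable (at x)" for \<alpha> \<beta>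
    by (rule differentiable_scaleR'[OF dk differentiable_nth[OF dT]])
  have "pd \<mu> (\<lambda>y. contract3 (k y) (cov2 g h y)) x
      = (\<Sum>\<alpha>\<in>UNIV. \<Sum>\<beta>\<in>UNIV. pd \<mu> (\<lambda>y. k y $ \<alpha> $ \<beta> *\<^sub>R cov2 g h y \<alpha> $ \<beta>) x)"
    unfolding contract3_def
    by (subst pd_sum) (auto intro!: differentiable_sum dt sum.cong simp: pd_sum[OF dt])
  also have "\<dots> = (\<Sum>\<alpha>\<in>UNIV. \<Sum>\<beta>\<in>UNIV. pd \<mu> k x $ \<alpha> $ \<beta> *\<^sub>R ?T \<alpha> $ \<beta> + k x $ \<alpha> $ \<beta> *\<^sub>R pd \<mu> (\<lambda>y. cov2 g h y \<alpha>) x $ \<beta>)"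
    by (simp add: pd_scaleR[OF dk differentiable_nth[OF dT]] pd_nth[OF dT]
        pd_nth[OF differentiable_nth[OF diff[OF k x]]] pd_nth[OF diff[OF k x]])
  also have "\<dots> = (\<Sum>\<alpha>\<in>UNIV. \<Sum>\<beta>\<in>UNIV. pd \<mu> k x $ \<alpha> $ \<beta> *\<^sub>R ?T \<alpha> $ \<beta>) + contract3 (k x) (\<lambda>\<alpha>. pd \<mu> (\<lambda>y. cov2 g h y \<alpha>) x)"
    by (simp add: sum.distrib contract3_def)
  finally have 1: "pd \<mu> (\<lambda>y. contract3 (k y) (cov2 g h y)) x
    = (\<Sum>\<alpha>\<in>UNIV. \<Sum>\<beta>\<in>UNIV. pd \<mu> k x $ \<alpha> $ \<beta> *\<^sub>R ?T \<alpha> $ \<beta>) + contract3 (k x) (\<lambda>\<alpha>. pd \<mu> (\<lambda>y. cov2 g h y \<alpha>) x)" .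
  have "(\<Sum>\<alpha>\<in>UNIV. \<Sum>\<beta>\<in>UNIV. (transpose ?C ** k x) $ \<alpha> $ \<beta> *\<^sub>R ?T \<alpha> $ \<beta>)
      = (\<Sum>\<alpha>\<in>UNIV. \<Sum>\<beta>\<in>UNIV. \<Sum>\<sigma>\<in>UNIV. (?C $ \<sigma> $ \<alpha> * k x $ \<sigma> $ \<beta>) *\<^sub>R ?T \<alpha> $ \<beta>)"
    by (simp add: matrix_matrix_mult_def transpose_def scaleR_sum_left)
  also have "\<dots> = contract3 (k x) (\<lambda>\<alpha>. \<Sum>\<kappa>\<in>UNIV. ?C $ \<alpha> $ \<kappa> *\<^sub>R ?T \<kappa>)"
    by (subst sum_reverse) (simp add: contract3_def scaleR_sum_right sum_component mult.commute)
  finally have 2: "(\<Sum>\<alpha>\<in>UNIV. \<Sum>\<beta>\<in>UNIV. (transpose ?C ** k x) $ \<alpha> $ \<beta> *\<^sub>R ?T \<alpha> $ \<beta>)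
      = contract3 (k x) (\<lambda>\<alpha>. \<Sum>\<kappa>\<in>UNIV. ?C $ \<alpha> $ \<kappa> *\<^sub>R ?T \<kappa>)" .
  have "(\<Sum>\<alpha>\<in>UNIV. \<Sum>\<beta>\<in>UNIV. (k x ** ?C) $ \<alpha> $ \<beta> *\<^sub>R ?T \<alpha> $ \<beta>)
      = (\<Sum>\<alpha>\<in>UNIV. \<Sum>\<beta>\<in>UNIV. \<Sum>\<sigma>\<in>UNIV. (k x $ \<alpha> $ \<sigma> * ?C $ \<sigma> $ \<beta>) *\<^sub>R ?T \<alpha> $ \<beta>)"
    by (simp add: matrix_matrix_mult_def scaleR_sum_left)
  also have "\<dots> = (\<Sum>\<alpha>\<in>UNIV. \<Sum>\<sigma>\<in>UNIV. \<Sum>\<beta>\<in>UNIV. (k x $ \<alpha> $ \<sigma> * ?C $ \<sigma> $ \<beta>) *\<^sub>R ?T \<alpha> $ \<beta>)"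
    by (intro sum.cong refl sum.swap)
  also have "\<dots> = contract3 (k x) (\<lambda>\<alpha>. ?C ** ?T \<alpha>)"
    by (simp add: contract3_def row_mult_sum scaleR_sum_right)
  finally have 3: "(\<Sum>\<alpha>\<in>UNIV. \<Sum>\<beta>\<in>UNIV. (k x ** ?C) $ \<alpha> $ \<beta> *\<^sub>R ?T \<alpha> $ \<beta>) = contract3 (k x) (\<lambda>\<alpha>. ?C ** ?T \<alpha>)" .
  have 4: "?C *v contract3 (k x) ?T = contract3 (k x) (\<lambda>\<alpha>. ?T \<alpha> ** transpose ?C)"
    by (simp add: contract3_def row_mult_transpose linear_sum[OF matrix_vector_mul_linear] matrix_vector_scaleR_right)
  show "cov1 g (\<lambda>y. contract3 (k y) (cov2 g h y)) x $ \<mu> = (\<chi> \<mu>. contract3 (k x) (cov22 g h x \<mu>)) $ \<mu>"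
    using 2 3 unfolding cov1_def
    by (simp add: 1 4 pdk scaleR_diff_left sum_subtractf sum_negf)
       (simp add: contract3_def cov22_def scaleR_diff_right sum_subtractf)
qed

lemma cov1_J1:
  assumes x: "x \<in> U" and a: "a differentiable (at x)"
  shows "cov1 g (\<lambda>y. J1_flat (\<lambda>j. M j y) (a y) $ i) x = JN (\<lambda>j. M j x) (\<lambda>k. cov1 g (\<lambda>y. a y $ k) x) i"
proof -
  have d: "(\<lambda>y. M j y *v a y $ k) differentiable (at x)" for j k
    by (rule differentiable_matrix_vector_mult[OF diff[OF smooth_M x] differentiable_nth[OF a]])
  have d': "(\<lambda>y. eps3 i j k *\<^sub>R (M j y *v a y $ k)) differentiable (at x)" for j k
    by (rule differentiable_linear[OF bounded_linear_scaleR_right d])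
  show ?thesis
    unfolding J1_flat_def JN_def
    by (simp add: cov1_sum differentiable_sum d' cov1_const_scaleR[OF d] cov1_M[OF x differentiable_nth[OF a]])
qed

lemma hessian_sym:
  assumes x: "x \<in> U" and f: "smooth_on U f"
  shows "transpose (cov1 g (grad f) x) = cov1 g (grad f) x"
proof -
  have p: "pd \<mu> (grad f) x $ \<nu> = pd \<mu> (pd \<nu> f) x" for \<mu> \<nu>
    using pd_nth[OF diff[OF smooth_grad[OF f] x], of \<mu> \<nu>] by (simp add: grad_def[abs_def])
  have "cov1 g (grad f) x $ \<mu> $ \<nu> = cov1 g (grad f) x $ \<nu> $ \<mu>" for \<mu> \<nu>
    by (simp add: cov1_def p pd_commute[OF opn x f, of \<mu> \<nu>] matrix_vector_mul_component Gam_sym[OF x, of \<mu> \<nu>])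
  then show ?thesis by (simp add: vec_eq_iff transpose_def)
qed

lemma laplace_ten0:
  assumes x: "x \<in> U" and f: "smooth_on U f"
  shows "laplace g (ten0 f) x [] = G x \<bullet> cov1 g (grad f) x"
proof -
  have d: "grad f differentiable (at x)" by (rule diff[OF smooth_grad[OF f] x])
  have n: "nabla g (nabla g (ten0 f)) x [\<mu>, \<nu>] = cov1 g (grad f) x $ \<mu> $ \<nu>" for \<mu> \<nu>
    using pd_nth[OF d, of \<mu> \<nu>]
    by (simp add: nabla_def[of g "nabla g (ten0 f)"] nabla_ten0 cov1_def Gam_def matrix_vector_mult_def grad_def)
  show ?thesis
    by (simp add: laplace_def n matrix_inner_sum G_def)
qed

lemma laplace_ten2:
  assumes x: "x \<in> U" and h: "smooth_on U h"
  shows "laplace g (ten2 h) x [\<alpha>, \<beta>] = (\<Sum>\<mu>\<in>UNIV. \<Sum>\<nu>\<in>UNIV. G x $ \<mu> $ \<nu> * cov22 g h x \<mu> \<nu> $ \<alpha> $ \<beta>)"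
proof -
  have n2: "nabla g (ten2 h) y [\<nu>, \<alpha>, \<beta>] = cov2 g h y \<nu> $ \<alpha> $ \<beta>" if "y \<in> U" for y \<nu> \<alpha> \<beta>
    by (rule nabla_ten2[OF diff[OF h that]])
  have p: "pd \<mu> (\<lambda>y. nabla g (ten2 h) y [\<nu>, \<alpha>, \<beta>]) x = pd \<mu> (\<lambda>y. cov2 g h y \<nu>) x $ \<alpha> $ \<beta>" for \<mu> \<nu> \<alpha> \<beta>
    using pd_cong[OF x n2, where \<mu> = \<mu>] pd_nth[OF differentiable_nth[OF diff[OF smooth_cov2[OF h] x]], of \<mu> \<nu> \<alpha> \<beta>]
      pd_nth[OF diff[OF smooth_cov2[OF h] x], of \<mu> \<nu> \<alpha>] by simp
  have n: "nabla g (nabla g (ten2 h)) x [\<mu>, \<nu>, \<alpha>, \<beta>] = cov22 g h x \<mu> \<nu> $ \<alpha> $ \<beta>" for \<mu> \<nu> \<alpha> \<beta>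
    by (simp add: nabla_def[of g "nabla g (ten2 h)"] p n2[OF x] cov22_def sum_component Gam_def
        matrix_matrix_mult_def transpose_def lessThan_Suc numeral_3_eq_3 mult.commute)
  show ?thesis by (simp add: laplace_def n G_def)
qed


subsection \<open>Curvature\<close>

lemma Riem_anti: "Riem g x \<nu> \<mu> = - Riem g x \<mu> \<nu>"
  by (simp add: Riem_def)

text \<open>Second derivatives of a parallel tensor commute, so the curvature annihilates it.\<close>

lemma Riem_parallel:
  assumes x: "x \<in> U" and X: "smooth_on U X"
    and par: "\<And>y \<mu>. y \<in> U \<Longrightarrow> pd \<mu> X y = Gam g \<mu> y ** X y + X y ** transpose (Gam g \<mu> y)"
  shows "Riem g x \<mu> \<nu> ** X x + X x ** transpose (Riem g x \<mu> \<nu>) = 0"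
proof -
  note dX = diff[OF X x] and dC = diff[OF smooth_Gam x]
  note dCt = differentiable_transpose[OF dC]
  have s: "pd \<mu> (pd \<nu> X) x = pd \<mu> (Gam g \<nu>) x ** X x + Gam g \<nu> x ** pd \<mu> X x
      + (pd \<mu> X x ** transpose (Gam g \<nu> x) + X x ** transpose (pd \<mu> (Gam g \<nu>) x))" for \<mu> \<nu>
  proof -
    have "pd \<mu> (pd \<nu> X) x = pd \<mu> (\<lambda>y. Gam g \<nu> y ** X y + X y ** transpose (Gam g \<nu> y)) x"
      by (rule pd_cong[OF x par])
    then show ?thesis
      by (simp add: pd_add[OF differentiable_matrix_mult[OF dC dX] differentiable_matrix_mult[OF dX dCt]]
          pd_matrix_mult[OF dC dX] pd_matrix_mult[OF dX dCt] pd_transpose[OF dC])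
  qed
  show ?thesis
    using pd_commute[OF opn x X, of \<mu> \<nu>] unfolding s par[OF x] Riem_def
    by (simp add: matrix_linear_simps matrix_transpose_mul matrix_mul_assoc algebra_simps)
qed

text \<open>The symmetric connection coefficients cancel in pairs under the cyclic sum.\<close>

lemma Riem_bianchi:
  assumes x: "x \<in> U"
  shows "Riem g x \<mu> \<nu> $ \<sigma> + Riem g x \<nu> \<sigma> $ \<mu> + Riem g x \<sigma> \<mu> $ \<nu> = 0"
proof -
  have p: "pd \<mu> (Gam g \<nu>) x $ \<sigma> = pd \<mu> (Gam g \<sigma>) x $ \<nu>" for \<mu> \<nu> \<sigma>
    using pd_cong[OF x Gam_sym[of _ \<nu> \<sigma>], where \<mu> = \<mu>] pd_nth[OF diff[OF smooth_Gam x], of \<mu> \<nu> \<sigma>]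
      pd_nth[OF diff[OF smooth_Gam x], of \<mu> \<sigma> \<nu>] by simp
  show ?thesis
    by (simp add: Riem_def row_matrix_mult p[of \<mu> \<nu> \<sigma>] p[of \<nu> \<mu> \<sigma>] p[of \<sigma> \<mu> \<nu>]
        Gam_sym[OF x, of \<nu> \<sigma>] Gam_sym[OF x, of \<mu> \<sigma>] Gam_sym[OF x, of \<mu> \<nu>])
qed

text \<open>Antisymmetrizing in the two derivatives leaves only the terms in which the connection is
  differentiated or appears quadratically; the second partial derivatives and the torsion terms cancel.\<close>

lemma Ricci_identity:
  assumes x: "x \<in> U" and h: "smooth_on U h"
  shows "cov22 g h x \<mu> \<nu> - cov22 g h x \<nu> \<mu> = - (Riem g x \<mu> \<nu> ** h x) - h x ** transpose (Riem g x \<mu> \<nu>)"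
proof -
  note dh = diff[OF h x] and dC = diff[OF smooth_Gam x]
  note dCt = differentiable_transpose[OF dC] and dp = diff[OF smooth_on_pd[OF h] x]
  have p: "pd \<mu> (\<lambda>y. cov2 g h y \<nu>) x = pd \<mu> (pd \<nu> h) x - (pd \<mu> (Gam g \<nu>) x ** h x + Gam g \<nu> x ** pd \<mu> h x)
     - (pd \<mu> h x ** transpose (Gam g \<nu> x) + h x ** transpose (pd \<mu> (Gam g \<nu>) x))" for \<mu> \<nu>
    unfolding cov2_def
    by (simp add: pd_diff[OF differentiable_diff[OF dp differentiable_matrix_mult[OF dC dh]] differentiable_matrix_mult[OF dh dCt]]
        pd_diff[OF dp differentiable_matrix_mult[OF dC dh]]
        pd_matrix_mult[OF dC dh] pd_matrix_mult[OF dh dCt] pd_transpose[OF dC])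
  show ?thesis
    using pd_commute[OF opn x h, of \<mu> \<nu>] unfolding cov22_def p Riem_def Gam_sym[OF x, of \<mu> \<nu>]
    by (simp add: cov2_def matrix_linear_simps matrix_transpose_mul matrix_mul_assoc algebra_simps)
qed

end

section \<open>The square of the operator at a point\<close>

lemma transpose_nth: "transpose A $ i $ j = A $ j $ i"
  by (simp add: transpose_def)

lemma vector_matrix_sum_left: "(\<Sum>i\<in>I. f i) v* A = (\<Sum>i\<in>I. f i v* A)" for A :: "real^'n^'m"
  by (induction I rule: infinite_finite_induct) (auto simp: vector_matrix_mult_def vec_eq_iff sum.distrib algebra_simps)

lemma matrix_sum_left: "(\<Sum>i\<in>I. f i) ** A = (\<Sum>i\<in>I. f i ** A)" for f :: "'i \<Rightarrow> real^'n^'m" and A :: "real^'p^'n"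
  by (induction I rule: infinite_finite_induct) (auto simp: matrix_add_rdistrib')

lemma matrix_sum_right: "A ** (\<Sum>i\<in>I. f i) = (\<Sum>i\<in>I. A ** f i)" for f :: "'i \<Rightarrow> real^'p^'n" and A :: "real^'n^'m"
  by (induction I rule: infinite_finite_induct) (auto simp: matrix_add_ldistrib)

lemma transpose_sum: "transpose (\<Sum>i\<in>I. f i) = (\<Sum>i\<in>I. transpose (f i))" for f :: "'i \<Rightarrow> real^'n^'m"
  by (induction I rule: infinite_finite_induct) (auto simp: transpose_add)

lemmas matrix_sum_simps = matrix_sum_left matrix_sum_right transpose_sum scaleR_sum_right

definition frame22 :: "real^4^4 \<Rightarrow> (4 \<Rightarrow> 4 \<Rightarrow> real^4^4) \<Rightarrow> 4 \<Rightarrow> 4 \<Rightarrow> real^4^4" where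
  "frame22 e Q a b = (\<Sum>\<mu>\<in>UNIV. \<Sum>\<nu>\<in>UNIV. (e$a$\<mu> * e$b$\<nu>) *\<^sub>R (e ** Q \<mu> \<nu> ** transpose e))"

text \<open>The term \<open>2 R\<^sub>\<mu>\<^sub>\<alpha>\<^sub>\<nu>\<^sub>\<beta>
  k\<^sup>\<alpha>\<^sup>\<beta>\<close> as a matrix, for a curvature given by the endomorphisms \<open>R \<nu>
  \<beta>\<close>.\<close>

definition curvature_term :: "(4 \<Rightarrow> 4 \<Rightarrow> real^4^4) \<Rightarrow> real^4^4 \<Rightarrow> real^4^4 \<Rightarrow> real^4^4" where
  "curvature_term R g k = transpose (\<chi> \<nu>. 2 *\<^sub>R (\<Sum>\<beta>\<in>UNIV. k $ \<beta> v* (R \<nu> \<beta> ** g)))"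

lemma frame3_frame22: "(\<Sum>\<mu>\<in>UNIV. e$a$\<mu> *\<^sub>R frame3 e (Q \<mu>) b) = frame22 e Q a b"
  by (simp add: frame3_def frame22_def scaleR_sum_right)

lemma contract3_sum: "contract3 k (\<lambda>\<alpha>. \<Sum>i\<in>I. c i *\<^sub>R T i \<alpha>) = (\<Sum>i\<in>I. c i *\<^sub>R contract3 k (T i))"
proof (induction I rule: infinite_finite_induct)
  case (insert i I)
  then show ?case by (simp add: contract3_def scaleR_add_right sum.distrib scaleR_sum_right mult.commute)
qed (auto simp: contract3_def)

lemma frame_rows: "(e ** (\<chi> \<mu>. v \<mu>) ** transpose e) $ n = (\<Sum>\<mu>\<in>UNIV. e$n$\<mu> *\<^sub>R (e *v v \<mu>))" for e :: "real^4^4"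
  by (simp add: row_mult_transpose row_mult_sum[of e] linear_sum[OF matrix_vector_mul_linear] matrix_vector_scaleR_right)

context adapted
begin

lemma frame_contract3:
  "e *v contract3 (transpose e ** k ** e) T = contract3 k (frame3 e T)"
proof -
  have row: "frame3 e T a $ b = (\<Sum>\<alpha>\<in>UNIV. \<Sum>\<beta>\<in>UNIV. (e$a$\<alpha> * e$b$\<beta>) *\<^sub>R (e *v T \<alpha> $ \<beta>))" for a b
    by (simp add: frame3_def sum_component row_mult_transpose row_mult_sum[of e] linear_sum[OF matrix_vector_mul_linear]
        matrix_vector_scaleR_right scaleR_sum_right)
  have "(transpose e ** k ** e) $ \<alpha> $ \<beta> = (\<Sum>a\<in>UNIV. \<Sum>b\<in>UNIV. e$a$\<alpha> * k$a$b * e$b$\<beta>)" for \<alpha> \<beta>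
    using congruence_nth[of "transpose e" k \<alpha> \<beta>] by (simp add: transpose_def)
  then have "e *v contract3 (transpose e ** k ** e) T
      = (\<Sum>\<alpha>\<in>UNIV. \<Sum>\<beta>\<in>UNIV. \<Sum>a\<in>UNIV. \<Sum>b\<in>UNIV. (e$a$\<alpha> * k$a$b * e$b$\<beta>) *\<^sub>R (e *v T \<alpha> $ \<beta>))"
    by (simp add: contract3_def linear_sum[OF matrix_vector_mul_linear] matrix_vector_scaleR_right scaleR_sum_left)
  also have "\<dots> = (\<Sum>a\<in>UNIV. \<Sum>b\<in>UNIV. \<Sum>\<alpha>\<in>UNIV. \<Sum>\<beta>\<in>UNIV. (e$a$\<alpha> * k$a$b * e$b$\<beta>) *\<^sub>R (e *v T \<alpha> $ \<beta>))"
    unfolding sum.cartesian_product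
    by (rule sum.reindex_bij_witness[of _ "\<lambda>(a, b, \<alpha>, \<beta>). (\<alpha>, \<beta>, a, b)" "\<lambda>(\<alpha>, \<beta>, a, b). (a, b, \<alpha>, \<beta>)"]) auto
  also have "\<dots> = contract3 k (frame3 e T)"
    by (simp add: contract3_def row scaleR_sum_right ac_simps)
  finally show ?thesis .
qed

lemma frame_contract3_rows:
  "e ** (\<chi> \<mu>. contract3 (transpose e ** k ** e) (Q \<mu>)) ** transpose e = (\<chi> n. contract3 k (frame22 e Q n))"
  by (rule matrix_eq_rows)
     (simp add: frame_rows frame_contract3 contract3_sum[symmetric] frame3_frame22)

lemma frame_JN: "e ** JN M N i ** transpose e = JN eta (\<lambda>k. e ** N k ** transpose e) i"
proof -
  have "e ** (N k ** transpose (M j)) ** transpose e = (e ** N k ** transpose e) ** transpose (eta j)" for k j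
    by (simp add: M_eq matrix_transpose_mul matrix_mul_assoc[symmetric] e_B_simps)
  then show ?thesis by (simp add: JN_def matrix_sum_simps matrix_linear_simps)
qed

lemma frame_adj_h:
  "adj_h r M G Nt Nb = adj_h r eta (mat 1) (e ** Nt ** transpose e) (\<lambda>i. e ** Nb i ** transpose e)"
proof -
  have "e ** (N ** transpose (M j)) ** transpose e = (e ** N ** transpose e) ** transpose (eta j)" for N j
    by (simp add: M_eq matrix_transpose_mul matrix_mul_assoc[symmetric] e_B_simps)
  then show ?thesis by (simp add: adj_h_def G_contract)
qed

lemma frame_adj_c:
  "adj_c r M G Nt Nb i = adj_c r eta (mat 1) (e ** Nt ** transpose e) (\<lambda>i. e ** Nb i ** transpose e) i"
proof -
  have "e ** (N ** transpose (M j)) ** transpose e = (e ** N ** transpose e) ** transpose (eta j)" for N j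
    by (simp add: M_eq matrix_transpose_mul matrix_mul_assoc[symmetric] e_B_simps)
  then show ?thesis by (simp add: adj_c_def G_contract frame_JN)
qed

lemma frame_symtf: "e ** symtf g G X ** transpose e = symtf (mat 1) (mat 1) (e ** X ** transpose e)"
proof -
  have "e ** g ** transpose e = mat 1" by (rule frame_eqs)
  then show ?thesis
    by (simp add: symtf_def matrix_linear_simps G_contract matrix_transpose_mul matrix_mul_assoc)
qed

lemma frame_adj_t:
  "e ** adj_t r M g G Nt Nb ** transpose e
    = adj_t r eta (mat 1) (mat 1) (e ** Nt ** transpose e) (\<lambda>i. e ** Nb i ** transpose e)"
proof -
  have "e ** (M j ** N) ** transpose e = eta j ** (e ** N ** transpose e)" for N j
    by (simp add: M_eq matrix_mul_assoc[symmetric] e_B_simps)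
  then show ?thesis by (simp add: adj_t_def frame_symtf matrix_linear_simps matrix_sum_simps)
qed

lemma frame_trace_22:
  "e ** (\<Sum>\<mu>\<in>UNIV. \<Sum>\<nu>\<in>UNIV. G$\<mu>$\<nu> *\<^sub>R Q \<mu> \<nu>) ** transpose e = (\<Sum>a\<in>UNIV. frame22 e Q a a)"
proof -
  have "G$\<mu>$\<nu> = (\<Sum>a\<in>UNIV. e$a$\<mu> * e$a$\<nu>)" for \<mu> \<nu>
    by (simp add: G_eq matrix_matrix_mult_def transpose_def)
  then have "e ** (\<Sum>\<mu>\<in>UNIV. \<Sum>\<nu>\<in>UNIV. G$\<mu>$\<nu> *\<^sub>R Q \<mu> \<nu>) ** transpose e
      = (\<Sum>\<mu>\<in>UNIV. \<Sum>\<nu>\<in>UNIV. \<Sum>a\<in>UNIV. (e$a$\<mu> * e$a$\<nu>) *\<^sub>R (e ** Q \<mu> \<nu> ** transpose e))"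
    by (simp add: matrix_sum_simps matrix_linear_simps scaleR_sum_left)
  also have "\<dots> = (\<Sum>a\<in>UNIV. frame22 e Q a a)"
    by (subst sum_rotate) (simp add: frame22_def)
  finally show ?thesis .
qed

lemma frame_curvature_term:
  assumes "transpose h = h"
  shows "e ** curvature_term R g (G ** h ** G) ** transpose e
    = (\<chi> m n. 2 * (\<Sum>a\<in>UNIV. \<Sum>b\<in>UNIV. frame22 e (\<lambda>\<mu> \<nu>. R \<mu> \<nu> ** g) n b $ a $ m * (e ** h ** transpose e) $ a $ b))"
proof -
  let ?h = "e ** h ** transpose e" and ?P = "\<lambda>\<mu> \<nu>. R \<mu> \<nu> ** g"
  have hs: "transpose ?h = ?h" by (simp add: matrix_transpose_mul assms matrix_mul_assoc)
  have "G ** h ** G = transpose e ** (?h ** e)" by (simp add: G_eq matrix_mul_assoc)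
  then have hup: "(G ** h ** G) $ \<beta> = (\<Sum>b\<in>UNIV. e$b$\<beta> *\<^sub>R (?h $ b v* e))" for \<beta>
    by (simp only: row_mult_sum[of "transpose e"] row_matrix_mult[of ?h e]) (simp add: transpose_def)
  have v: "e *v ((y v* e) v* X) = y v* (e ** X ** transpose e)" for y and X :: "real^4^4"
    by (simp only: matrix_vector_transpose[of e] vector_matrix_mul_assoc matrix_mul_assoc)
  have sc: "(c *\<^sub>R y) v* X = c *\<^sub>R (y v* X)" for c y and X :: "real^4^4"
    by (simp add: vector_matrix_mult_def vec_eq_iff sum_distrib_left ac_simps)
  have lin: "y v* (\<Sum>i\<in>I. f i) = (\<Sum>i\<in>I. y v* f i)" for y :: "real^4" and f :: "4 \<Rightarrow> real^4^4" and I
    by (induction I rule: infinite_finite_induct) (auto simp: vector_matrix_mult_def vec_eq_iff sum.distrib algebra_simps)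
  have sc2: "y v* (c *\<^sub>R X) = c *\<^sub>R (y v* X)" for c y and X :: "real^4^4"
    by (simp add: vector_matrix_mult_def vec_eq_iff sum_distrib_left ac_simps)
  have "transpose (e ** curvature_term R g (G ** h ** G) ** transpose e) $ n
      = 2 *\<^sub>R (\<Sum>b\<in>UNIV. ?h $ b v* frame22 e ?P n b)" for n
  proof -
    have "transpose (e ** curvature_term R g (G ** h ** G) ** transpose e)
        = e ** (\<chi> \<nu>. 2 *\<^sub>R (\<Sum>\<beta>\<in>UNIV. (G ** h ** G) $ \<beta> v* ?P \<nu> \<beta>)) ** transpose e"
      by (simp add: curvature_term_def matrix_transpose_mul matrix_mul_assoc)
    then have "transpose (e ** curvature_term R g (G ** h ** G) ** transpose e) $ n
        = 2 *\<^sub>R (\<Sum>\<nu>\<in>UNIV. \<Sum>\<beta>\<in>UNIV. \<Sum>b\<in>UNIV. (e$n$\<nu> * e$b$\<beta>) *\<^sub>R (?h $ b v* (e ** ?P \<nu> \<beta> ** transpose e)))"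
      by (simp add: frame_rows hup vector_matrix_sum_left sc linear_sum[OF matrix_vector_mul_linear]
          matrix_vector_scaleR_right v scaleR_sum_right ac_simps)
    also have "\<dots> = 2 *\<^sub>R (\<Sum>b\<in>UNIV. ?h $ b v* frame22 e ?P n b)"
      by (subst sum_rotate) (simp add: frame22_def lin sc2)
    finally show ?thesis .
  qed
  then have "(e ** curvature_term R g (G ** h ** G) ** transpose e) $ m $ n
      = (2 *\<^sub>R (\<Sum>b\<in>UNIV. ?h $ b v* frame22 e ?P n b)) $ m" for m n
    by (subst transpose_nth[symmetric]) (simp only:)
  then have 1: "(e ** curvature_term R g (G ** h ** G) ** transpose e) $ m $ n
      = 2 * (\<Sum>b\<in>UNIV. \<Sum>a\<in>UNIV. frame22 e ?P n b $ a $ m * ?h $ b $ a)" for m n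
    by (simp add: sum_component vector_matrix_mult_def mult.commute)
  have "(\<Sum>b\<in>UNIV. \<Sum>a\<in>UNIV. frame22 e ?P n b $ a $ m * ?h $ b $ a)
      = (\<Sum>a\<in>UNIV. \<Sum>b\<in>UNIV. frame22 e ?P n b $ a $ m * ?h $ a $ b)" for m n
    by (subst sum.swap) (intro sum.cong refl arg_cong2[where f = "(*)"] symmetric_nth[OF hs])
  then show ?thesis by (simp add: vec_eq_iff 1)
qed

lemma frame_transpose: "transpose (e ** X ** transpose e) = e ** transpose X ** transpose e"
  by (simp add: matrix_transpose_mul matrix_mul_assoc)

lemma trace_frame: "trace (e ** X ** transpose e) = G \<bullet> X"
  using trace_mult_inner[of "mat 1" "e ** X ** transpose e"] by (simp add: G_contract)

lemma frame22_sum: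
  assumes "linear F"
  shows "F (frame22 e Q a b) = (\<Sum>\<mu>\<in>UNIV. \<Sum>\<nu>\<in>UNIV. (e$a$\<mu> * e$b$\<nu>) *\<^sub>R F (e ** Q \<mu> \<nu> ** transpose e))"
  by (simp add: frame22_def linear_sum[OF assms] linear_scale[OF assms])

lemma frame22_swap: "frame22 e Q b a = frame22 e (\<lambda>\<mu> \<nu>. Q \<nu> \<mu>) a b"
  unfolding frame22_def by (subst sum.swap) (simp add: mult.commute)

lemma linear_transpose: "linear (transpose :: real^4^4 \<Rightarrow> real^4^4)"
  using bounded_linear_transpose by (rule bounded_linear.linear)

text \<open>\<open>D\<^sup>* D\<close> at one point. Here \<open>H\<close>, \<open>Hq\<close>, \<open>Hc\<close>
  are the Hessians of the scalar and of the two \<open>E\<close>-valued arguments, \<open>Q\<close> is the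
  second covariant derivative of the trace-free part \<open>h\<close>, and \<open>Nt\<close>, \<open>Nb\<close>
  are the derivatives of \<open>t\<close> and of the \<open>J1 a\<close>, where \<open>(t, a)\<close> is the
  image under \<open>D\<close>. Everything is linear in the four arguments, so each of them is treated
  separately in the model fibre.\<close>

lemma square_at_point:
  fixes H h :: "real^4^4" and Hq Hc :: "3 \<Rightarrow> real^4^4" and Q R :: "4 \<Rightarrow> 4 \<Rightarrow> real^4^4"
  assumes r: "r * r = 2"
    and H: "transpose H = H" and Hq: "\<And>i. transpose (Hq i) = Hq i" and Hc: "\<And>i. transpose (Hc i) = Hc i"
    and Qsym: "\<And>\<mu> \<nu>. transpose (Q \<mu> \<nu>) = Q \<mu> \<nu>" and Qtr: "\<And>\<mu> \<nu>. G \<bullet> Q \<mu> \<nu> = 0"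
    and hsym: "transpose h = h" and htr: "G \<bullet> h = 0"
    and Ricci: "\<And>\<mu> \<nu>. Q \<mu> \<nu> - Q \<nu> \<mu> = - (R \<mu> \<nu> ** h) - h ** transpose (R \<mu> \<nu>)"
    and Ranti: "\<And>\<mu> \<nu>. R \<nu> \<mu> = - R \<mu> \<nu>" and Rg: "\<And>\<mu> \<nu>. R \<mu> \<nu> ** g + g ** transpose (R \<mu> \<nu>) = 0"
    and RS: "\<And>\<mu> \<nu> i. R \<mu> \<nu> ** S$i + S$i ** transpose (R \<mu> \<nu>) = 0"
    and bianchi: "\<And>\<mu> \<nu> \<sigma>. R \<mu> \<nu> $ \<sigma> + R \<nu> \<sigma> $ \<mu> + R \<sigma> \<mu> $ \<nu> = 0"
  defines "Nt \<equiv> (r / 4) *\<^sub>R H - r *\<^sub>R (\<chi> \<mu>. contract3 G (Q \<mu>)) + (\<Sum>i\<in>UNIV. Hc i ** transpose (M i))"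
    and "Nb \<equiv> JN M (\<lambda>i. (1/4) *\<^sub>R (H ** transpose (M i)) + 2 *\<^sub>R Hq i - (\<chi> \<mu>. contract3 (K i) (Q \<mu>))
       - (r / 2) *\<^sub>R JN M Hc i)"
  shows "adj_h r M G Nt Nb = G \<bullet> H"
    "G \<bullet> Nb i = - (r * (G \<bullet> Hc i))"
    "adj_t r M g G Nt Nb = - (\<Sum>\<mu>\<in>UNIV. \<Sum>\<nu>\<in>UNIV. G$\<mu>$\<nu> *\<^sub>R Q \<mu> \<nu>) - curvature_term R g (G ** h ** G)"
    "adj_c r M G Nt Nb i = - (2 * r * (G \<bullet> Hq i))"
proof -
  let ?f = "\<lambda>X. e ** X ** transpose e"
  let ?P = "\<lambda>\<mu> \<nu>. R \<mu> \<nu> ** g"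
  define Qf where "Qf = frame22 e Q"
  define Rf where "Rf = frame22 e ?P"
  have Qf_sym: "transpose (Qf a b) = Qf a b" for a b
    by (simp add: Qf_def frame22_sum[OF linear_transpose] frame_transpose Qsym) (simp add: frame22_def)
  have "linear (\<lambda>X. trace (X::real^4^4))"
    by (rule linearI) (simp_all add: trace_def sum.distrib sum_distrib_left)
  then have Qf_tr: "trace (Qf a b) = 0" for a b
    unfolding Qf_def by (subst frame22_sum) (simp_all add: trace_frame Qtr)
  have RG: "e ** R \<mu> \<nu> ** B = ?f (?P \<mu> \<nu>)" for \<mu> \<nu>
    unfolding g_eq by (simp add: matrix_mul_assoc[symmetric] e_B_simps)
  have Rh: "?f (R \<mu> \<nu> ** h) = ?f (?P \<mu> \<nu>) ** ?f h" for \<mu> \<nu>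
    unfolding RG[symmetric] by (simp add: matrix_mul_assoc[symmetric] e_B_simps)
  have hR: "?f (h ** transpose (R \<mu> \<nu>)) = ?f h ** transpose (?f (?P \<mu> \<nu>))" for \<mu> \<nu>
    unfolding RG[symmetric] by (simp add: matrix_transpose_mul matrix_mul_assoc[symmetric] e_B_simps)
  have Qf_com: "Qf a b - Qf b a = - (Rf a b ** ?f h) - ?f h ** transpose (Rf a b)" for a b
  proof -
    have "Qf a b - Qf b a = (\<Sum>\<mu>\<in>UNIV. \<Sum>\<nu>\<in>UNIV. (e$a$\<mu> * e$b$\<nu>) *\<^sub>R ?f (Q \<mu> \<nu> - Q \<nu> \<mu>))"
      unfolding Qf_def frame22_swap[of Q b a]
      by (simp add: frame22_def matrix_linear_simps sum_subtractf scaleR_diff_right)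
    also have "\<dots> = (\<Sum>\<mu>\<in>UNIV. \<Sum>\<nu>\<in>UNIV. (e$a$\<mu> * e$b$\<nu>) *\<^sub>R (- (?f (?P \<mu> \<nu>) ** ?f h) - ?f h ** transpose (?f (?P \<mu> \<nu>))))"
      unfolding Ricci Rh[symmetric] hR[symmetric]
      by (simp add: matrix_linear_simps)
    also have "\<dots> = - (Rf a b ** ?f h) - ?f h ** transpose (Rf a b)"
      by (simp add: Rf_def frame22_def matrix_sum_simps matrix_linear_simps sum_subtractf scaleR_diff_right sum_negf)
    finally show ?thesis .
  qed
  have Rf_anti1: "Rf b a = - Rf a b" for a b
    unfolding Rf_def frame22_swap[of _ b a]
    by (subst Ranti) (simp add: frame22_def matrix_linear_simps sum_negf)
  have P_anti: "transpose (?P \<mu> \<nu>) = - ?P \<mu> \<nu>" for \<mu> \<nu>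
    using Rg[of \<mu> \<nu>] by (simp add: matrix_transpose_mul transpose_g eq_neg_iff_add_eq_0 add.commute)
  have Rf_anti2: "transpose (Rf a b) = - Rf a b" for a b
    by (simp add: Rf_def frame22_sum[OF linear_transpose] frame_transpose P_anti)
       (simp add: frame22_def matrix_linear_simps sum_negf)
  have "?f (?P \<mu> \<nu>) ** eta i = eta i ** ?f (?P \<mu> \<nu>)" for \<mu> \<nu> i
  proof -
    have "?f (R \<mu> \<nu> ** S$i) = ?f (?P \<mu> \<nu>) ** eta i"
      unfolding RG[symmetric] by (simp add: S_eq matrix_mul_assoc[symmetric] e_B_simps)
    moreover have "?f (S$i ** transpose (R \<mu> \<nu>)) = eta i ** transpose (?f (?P \<mu> \<nu>))"
      unfolding RG[symmetric] by (simp add: S_eq matrix_transpose_mul matrix_mul_assoc[symmetric] e_B_simps)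
    moreover have "?f (R \<mu> \<nu> ** S$i) + ?f (S$i ** transpose (R \<mu> \<nu>)) = 0"
      using arg_cong[OF RS[of \<mu> \<nu> i], of ?f] by (simp add: matrix_linear_simps)
    ultimately show ?thesis by (simp add: frame_transpose P_anti matrix_linear_simps)
  qed
  then have Rf_comm: "Rf a b ** eta i = eta i ** Rf a b" for a b i
    by (simp add: Rf_def frame22_def matrix_sum_simps matrix_linear_simps)
  have Rf_bianchi: "Rf a b $ c $ d + Rf b c $ a $ d + Rf c a $ b $ d = 0" for a b c d
  proof -
    let ?T = "\<lambda>\<mu> \<nu> \<sigma>. (R \<mu> \<nu> $ \<sigma> v* B) $ d"
    have n: "Rf a b $ c $ d = (\<Sum>\<mu>\<in>UNIV. \<Sum>\<nu>\<in>UNIV. \<Sum>\<sigma>\<in>UNIV. e$a$\<mu> * e$b$\<nu> * e$c$\<sigma> * ?T \<mu> \<nu> \<sigma>)" for a b c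
    proof -
      have "(e ** R \<mu> \<nu> ** B) $ c $ d = (\<Sum>\<sigma>\<in>UNIV. e$c$\<sigma> * ?T \<mu> \<nu> \<sigma>)" for \<mu> \<nu>
        by (simp add: matrix_mul_assoc[symmetric] row_mult_sum[of e] sum_component row_matrix_mult[of _ B])
      then show ?thesis
        by (simp add: Rf_def frame22_def RG[symmetric] sum_component sum_distrib_left ac_simps)
    qed
    have T: "?T \<mu> \<nu> \<sigma> + ?T \<nu> \<sigma> \<mu> + ?T \<sigma> \<mu> \<nu> = 0" for \<mu> \<nu> \<sigma>
      using arg_cong[OF bianchi[of \<mu> \<nu> \<sigma>], of "\<lambda>v. (v v* B) $ d"]
      by (simp add: vector_matrix_mult_def sum.distrib distrib_left distrib_right)
    have 1: "Rf b c $ a $ d = (\<Sum>\<mu>\<in>UNIV. \<Sum>\<nu>\<in>UNIV. \<Sum>\<sigma>\<in>UNIV. e$a$\<mu> * e$b$\<nu> * e$c$\<sigma> * ?T \<nu> \<sigma> \<mu>)"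
      unfolding n by (subst sum_rotate) (simp add: ac_simps)
    have 2: "Rf c a $ b $ d = (\<Sum>\<mu>\<in>UNIV. \<Sum>\<nu>\<in>UNIV. \<Sum>\<sigma>\<in>UNIV. e$a$\<mu> * e$b$\<nu> * e$c$\<sigma> * ?T \<sigma> \<mu> \<nu>)"
      unfolding n by (subst sum_rotate[symmetric]) (simp add: ac_simps)
    have "Rf a b $ c $ d + Rf b c $ a $ d + Rf c a $ b $ d
        = (\<Sum>\<mu>\<in>UNIV. \<Sum>\<nu>\<in>UNIV. \<Sum>\<sigma>\<in>UNIV. e$a$\<mu> * e$b$\<nu> * e$c$\<sigma> * (?T \<mu> \<nu> \<sigma> + ?T \<nu> \<sigma> \<mu> + ?T \<sigma> \<mu> \<nu>))"
      unfolding 1 2 unfolding n by (simp add: sum.distrib distrib_left)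
    then show ?thesis by (simp add: T)
  qed
  note sym_h = frame_transpose[of h, unfolded hsym]
  have tr_h: "trace (?f h) = 0" by (simp add: trace_frame htr)
  note Sym = square_Sym_flat[OF r Qf_sym Qf_tr sym_h tr_h Qf_com Rf_anti1 Rf_anti2 Rf_comm Rf_bianchi]
  note Sca = square_scalar_flat[OF r frame_transpose[of H, unfolded H]]
  note EE = square_E_flat[OF r, of "\<lambda>i. ?f (Hq i)", OF frame_transpose[of "Hq _", unfolded Hq]]
  note Chi = square_chi_flat[OF r, of "\<lambda>i. ?f (Hc i)", OF frame_transpose[of "Hc _", unfolded Hc]]
  have MT: "?f (N ** transpose (M j)) = ?f N ** transpose (eta j)" for N j
    by (simp add: M_eq matrix_transpose_mul matrix_mul_assoc[symmetric] e_B_simps)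
  have cG: "?f (\<chi> \<mu>. contract3 G (Q \<mu>)) = (\<chi> n. contract3 (mat 1) (Qf n))"
    using frame_contract3_rows[of "mat 1" Q] by (simp add: Qf_def G_eq)
  have cK: "?f (\<chi> \<mu>. contract3 (K i) (Q \<mu>)) = (\<chi> n. contract3 (eta i) (Qf n))" for i
    using frame_contract3_rows[of "eta i" Q] by (simp add: Qf_def K_eq)
  define t1 t2 t3 where "t1 = (r / 4) *\<^sub>R ?f H" and "t2 = - r *\<^sub>R (\<chi> n. contract3 (mat 1) (Qf n))"
    and "t3 = (\<Sum>i\<in>UNIV. ?f (Hc i) ** transpose (eta i))"
  define b1 b2 b3 b4 where "b1 = JN eta (\<lambda>i. (1/4) *\<^sub>R (?f H ** transpose (eta i)))" and "b2 = JN eta (\<lambda>i. 2 *\<^sub>R ?f (Hq i))"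
    and "b3 = JN eta (\<lambda>i. - (\<chi> n. contract3 (eta i) (Qf n)))" and "b4 = JN eta (\<lambda>i. - (r / 2) *\<^sub>R JN eta (\<lambda>i. ?f (Hc i)) i)"
  have t: "?f Nt = t1 + t2 + t3"
    by (simp add: Nt_def t1_def t2_def t3_def matrix_linear_simps matrix_sum_simps cG MT)
  have b: "?f (Nb i) = b1 i + b2 i + b3 i + b4 i" for i
    unfolding Nb_def frame_JN b1_def b2_def b3_def b4_def
    by (simp add: matrix_linear_simps MT cK frame_JN) (simp add: JN_def sum_3 matrix_linear_simps algebra_simps)
  note folds = t1_def[symmetric] t2_def[symmetric] t3_def[symmetric] b1_def[symmetric] b2_def[symmetric] b3_def[symmetric] b4_def[symmetric]
  note Sym' = Sym[folded t2_def b3_def] and Sca' = Sca[folded t1_def b1_def] and EE' = EE[folded b2_def] and Chi' = Chi[folded t3_def b4_def]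
  have JNadd: "JN eta (\<lambda>i. b1 i + b2 i + b3 i + b4 i) i = JN eta b1 i + JN eta b2 i + JN eta b3 i + JN eta b4 i" for i
    by (simp add: JN_def sum_3 matrix_linear_simps algebra_simps)
  have "adj_h r eta (mat 1) (t1 + t2 + t3) (\<lambda>i. b1 i + b2 i + b3 i + b4 i)
      = adj_h r eta (mat 1) t1 b1 + adj_h r eta (mat 1) 0 b2 + adj_h r eta (mat 1) t2 b3 + adj_h r eta (mat 1) t3 b4"
    by (simp add: adj_h_def matrix_linear_simps inner_add_right sum.distrib algebra_simps)
  then show "adj_h r M G Nt Nb = G \<bullet> H"
    unfolding frame_adj_h t b by (simp add: Sym' Sca' EE' Chi' G_contract)
  show "G \<bullet> Nb i = - (r * (G \<bullet> Hc i))"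
    unfolding G_contract b inner_add_right by (simp add: Sym' Sca' EE' Chi')
  have "adj_t r eta (mat 1) (mat 1) (t1 + t2 + t3) (\<lambda>i. b1 i + b2 i + b3 i + b4 i)
      = adj_t r eta (mat 1) (mat 1) t1 b1 + adj_t r eta (mat 1) (mat 1) 0 b2 + adj_t r eta (mat 1) (mat 1) t2 b3
        + adj_t r eta (mat 1) (mat 1) t3 b4"
    by (simp add: adj_t_def symtf_def matrix_linear_simps inner_add_right sum.distrib algebra_simps add_divide_distrib)
  then have "?f (adj_t r M g G Nt Nb)
      = - (\<Sum>a\<in>UNIV. Qf a a) - (\<chi> m n. 2 * (\<Sum>a\<in>UNIV. \<Sum>b\<in>UNIV. Rf n b $ a $ m * ?f h $ a $ b))"
    unfolding frame_adj_t t b by (simp add: Sym' Sca' EE' Chi')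
  also have "\<dots> = ?f (- (\<Sum>\<mu>\<in>UNIV. \<Sum>\<nu>\<in>UNIV. G$\<mu>$\<nu> *\<^sub>R Q \<mu> \<nu>) - curvature_term R g (G ** h ** G))"
    unfolding matrix_diff_ldistrib matrix_diff_rdistrib matrix_mult_minus_left matrix_mult_minus_right
      frame_trace_22 frame_curvature_term[OF hsym] Qf_def Rf_def by simp
  finally show "adj_t r M g G Nt Nb = - (\<Sum>\<mu>\<in>UNIV. \<Sum>\<nu>\<in>UNIV. G$\<mu>$\<nu> *\<^sub>R Q \<mu> \<nu>) - curvature_term R g (G ** h ** G)"
    by (rule frame_eqI2)
  have "adj_c r eta (mat 1) (t1 + t2 + t3) (\<lambda>i. b1 i + b2 i + b3 i + b4 i) i
      = adj_c r eta (mat 1) t1 b1 i + adj_c r eta (mat 1) 0 b2 i + adj_c r eta (mat 1) t2 b3 i + adj_c r eta (mat 1) t3 b4 i"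
    unfolding adj_c_def JNadd by (simp add: matrix_linear_simps inner_add_right algebra_simps)
  then show "adj_c r M G Nt Nb i = - (2 * r * (G \<bullet> Hq i))"
    unfolding frame_adj_c t b by (simp add: Sym' Sca' EE' Chi' G_contract)
qed

end

section \<open>Formulas for the operators of the complex\<close>

lemma J1_fib_flat: "J1_fib S g a = J1_flat (mixS S g) a"
  by (simp add: J1_fib_def J1_flat_def vec_eq_iff sum_component matrix_vector_mult_def sum_distrib_left mult.assoc)

lemma J1_flat_inj:
  assumes "quaternion_relations M"
  shows "inj (J1_flat M)"
proof (rule injI)
  fix a b assume ab: "J1_flat M a = J1_flat M b"
  have "J1_flat M b + 2 *\<^sub>R a = J1_flat M (J1_flat M b)"
    using J1_flat_square[OF assms, of a] by (simp only: ab)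
  also have "\<dots> = J1_flat M b + 2 *\<^sub>R b" by (rule J1_flat_square[OF assms])
  finally show "a = b" by simp
qed

lemma J1_flat_scaleR: "J1_flat M (c *\<^sub>R a) = c *\<^sub>R J1_flat M a"
proof -
  have "\<forall>i. J1_flat M (c *\<^sub>R a) $ i = (c *\<^sub>R J1_flat M a) $ i"
    by (simp add: forall_3 J1_flat_nth matrix_vector_scaleR_right scaleR_diff_right)
  then show ?thesis by (simp only: vec_eq_iff[of "J1_flat M (c *\<^sub>R a)"] simp_thms)
qed

lemma sigma_sigma_form:
  assumes "transpose ht = ht" "transpose g = g" "transpose (matrix_inv g) = matrix_inv g" "\<And>i. transpose (S$i) = - (S$i)"
  shows "sigma S g (h, hi, ht) $ i = sigma_form (\<lambda>j. S$j) (matrix_inv g) hi (ht + (h / 4) *\<^sub>R g) i"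
proof -
  let ?X = "ht + (h / 4) *\<^sub>R g"
  have "transpose ?X = ?X" using assms by (simp add: transpose_add transpose_scaleR)
  then have t: "S$i ** matrix_inv g ** ?X = - transpose (?X ** matrix_inv g ** S$i)"
    by (simp add: matrix_transpose_mul assms matrix_linear_simps matrix_mul_assoc)
  show ?thesis
    unfolding sigma_form_def t
    by (simp add: sigma_def Let_def vec_eq_iff sum_component matrix_matrix_mult_def[of "?X ** matrix_inv g" "S$i"] transpose_def
        sum_subtractf sum_distrib_left ac_simps)
qed

lemma linear_sigma_form:
  "sigma_form S G (\<Sum>\<alpha>\<in>I. c \<alpha> *\<^sub>R q \<alpha>) (\<Sum>\<alpha>\<in>I. c \<alpha> *\<^sub>R X \<alpha>) i = (\<Sum>\<alpha>\<in>I. c \<alpha> *\<^sub>R sigma_form S G (q \<alpha>) (X \<alpha>) i)"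
proof (induction I rule: infinite_finite_induct)
  case (insert a I)
  have "sigma_form S G (c a *\<^sub>R q a + q') (c a *\<^sub>R X a + X') i = c a *\<^sub>R sigma_form S G (q a) (X a) i + sigma_form S G q' X' i" for q' X'
    by (simp add: sigma_form_def sum_3 matrix_linear_simps algebra_simps)
  then show ?case using insert by simp
qed (simp_all add: sigma_form_def)

context adapted
begin

text \<open>The Hodge dual of a 3-form in frame components; the sign is that of \<open>vS eta = -1\<close>.\<close>

lemma eps4_raised:
  "(\<Sum>\<alpha>\<in>UNIV. \<Sum>\<beta>\<in>UNIV. \<Sum>\<gamma>\<in>UNIV. vS S * eps4 \<mu> \<alpha> \<beta> \<gamma> * (e$b$\<alpha> * e$c$\<beta> * e$d$\<gamma>))
    = - (\<Sum>a\<in>UNIV. B$\<mu>$a * eps4 a b c d)"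
proof -
  have "(\<Sum>\<nu>\<in>UNIV. \<Sum>\<alpha>\<in>UNIV. \<Sum>\<beta>\<in>UNIV. \<Sum>\<gamma>\<in>UNIV. eps4 \<nu> \<alpha> \<beta> \<gamma> * ((axis \<mu> 1 :: real^4)$\<nu> * e$b$\<alpha> * e$c$\<beta> * e$d$\<gamma>))
      = det (vector [axis \<mu> 1, e$b, e$c, e$d] :: real^4^4)"
    by (rule eps4_contract)
  moreover have "(\<Sum>\<nu>\<in>UNIV. \<Sum>\<alpha>\<in>UNIV. \<Sum>\<beta>\<in>UNIV. \<Sum>\<gamma>\<in>UNIV. eps4 \<nu> \<alpha> \<beta> \<gamma> * ((axis \<mu> 1 :: real^4)$\<nu> * e$b$\<alpha> * e$c$\<beta> * e$d$\<gamma>))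
      = (\<Sum>\<alpha>\<in>UNIV. \<Sum>\<beta>\<in>UNIV. \<Sum>\<gamma>\<in>UNIV. eps4 \<mu> \<alpha> \<beta> \<gamma> * (e$b$\<alpha> * e$c$\<beta> * e$d$\<gamma>))"
    by (subst sum.remove[of UNIV \<mu>]) (auto simp: axis_def mult.assoc intro!: sum.neutral)
  moreover have "(vector [axis \<mu> 1, e$b, e$c, e$d] :: real^4^4) = vector [B$\<mu>, axis b 1, axis c 1, axis d 1] ** e"
  proof -
    have 1: "B$\<mu> v* e = axis \<mu> 1"
    proof -
      have "(mat 1 :: real^4^4) $ \<mu> = axis \<mu> 1" by (auto simp: vec_eq_iff axis_def mat_1_nth)
      then show ?thesis using row_matrix_mult[of B e \<mu>] by (simp add: e_B)
    qed
    have 2: "axis b 1 v* e = e$b" for b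
      by (simp add: vec_eq_iff vector_matrix_mult_def axis_def mult_delta_left mult_delta_right)
    show ?thesis
    proof -
      have "\<forall>i. (vector [axis \<mu> 1, e$b, e$c, e$d] :: real^4^4) $ i = (vector [B$\<mu>, axis b 1, axis c 1, axis d 1] ** e) $ i"
        by (simp add: forall_4 row_matrix_mult[of _ e] 1 2)
      then show ?thesis by (simp only: vec_eq_iff[of "vector _"] simp_thms)
    qed
  qed
  moreover have "det (vector [B$\<mu>, axis b 1, axis c 1, axis d 1] :: real^4^4) = (\<Sum>a\<in>UNIV. B$\<mu>$a * eps4 a b c d)"
  proof -
    have "(\<Sum>\<alpha>\<in>UNIV. \<Sum>\<beta>\<in>UNIV. \<Sum>\<gamma>\<in>UNIV. eps4 a \<alpha> \<beta> \<gamma> * (B$\<mu>$a * (axis b 1::real^4)$\<alpha> * (axis c 1::real^4)$\<beta> * (axis d 1::real^4)$\<gamma>)) = B$\<mu>$a * eps4 a b c d" for a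
      by (simp add: axis_def mult_delta_left mult_delta_right if_distrib[of "\<lambda>x. _ * x"] cong: if_cong)
    then show ?thesis by (simp add: eps4_contract[symmetric])
  qed
  ultimately have "(\<Sum>\<alpha>\<in>UNIV. \<Sum>\<beta>\<in>UNIV. \<Sum>\<gamma>\<in>UNIV. eps4 \<mu> \<alpha> \<beta> \<gamma> * (e$b$\<alpha> * e$c$\<beta> * e$d$\<gamma>))
      = (\<Sum>a\<in>UNIV. B$\<mu>$a * eps4 a b c d) * det e"
    by (simp add: det_mul)
  then have "vS S * (\<Sum>\<alpha>\<in>UNIV. \<Sum>\<beta>\<in>UNIV. \<Sum>\<gamma>\<in>UNIV. eps4 \<mu> \<alpha> \<beta> \<gamma> * (e$b$\<alpha> * e$c$\<beta> * e$d$\<gamma>))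
      = (vS S * det e) * (\<Sum>a\<in>UNIV. B$\<mu>$a * eps4 a b c d)" by simp
  then show ?thesis unfolding vS_frame(2) by (simp add: sum_distrib_left mult.assoc sum_negf)
qed

lemma frame_star:
  "e *v (\<chi> \<mu>. \<Sum>\<alpha>\<in>UNIV. \<Sum>\<beta>\<in>UNIV. \<Sum>\<gamma>\<in>UNIV. \<Sum>\<alpha>'\<in>UNIV. \<Sum>\<beta>'\<in>UNIV. \<Sum>\<gamma>'\<in>UNIV.
     vS S * eps4 \<mu> \<alpha>' \<beta>' \<gamma>' * G$\<alpha>'$\<alpha> * G$\<beta>'$\<beta> * G$\<gamma>'$\<gamma> * W \<alpha> $ \<beta> $ \<gamma>)
    = (\<chi> a. - (\<Sum>b\<in>UNIV. \<Sum>c\<in>UNIV. \<Sum>d\<in>UNIV. eps4 a b c d * frame3 e W b $ c $ d))"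
proof -
  have Gn: "G$\<alpha>'$\<alpha> = (\<Sum>b\<in>UNIV. e$b$\<alpha>' * e$b$\<alpha>)" for \<alpha>' \<alpha>
    by (simp add: G_eq matrix_matrix_mult_def transpose_def)
  have main: "(\<Sum>\<alpha>\<in>UNIV. \<Sum>\<beta>\<in>UNIV. \<Sum>\<gamma>\<in>UNIV. \<Sum>\<alpha>'\<in>UNIV. \<Sum>\<beta>'\<in>UNIV. \<Sum>\<gamma>'\<in>UNIV.
     vS S * eps4 \<mu> \<alpha>' \<beta>' \<gamma>' * G$\<alpha>'$\<alpha> * G$\<beta>'$\<beta> * G$\<gamma>'$\<gamma> * W \<alpha> $ \<beta> $ \<gamma>)
    = (\<Sum>b\<in>UNIV. \<Sum>c\<in>UNIV. \<Sum>d\<in>UNIV. (\<Sum>\<alpha>'\<in>UNIV. \<Sum>\<beta>'\<in>UNIV. \<Sum>\<gamma>'\<in>UNIV. vS S * eps4 \<mu> \<alpha>' \<beta>' \<gamma>' * (e$b$\<alpha>' * e$c$\<beta>' * e$d$\<gamma>'))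
        * frame3 e W b $ c $ d)" for \<mu>
  proof -
    let ?F = "\<lambda>\<alpha> \<beta> \<gamma> \<alpha>' \<beta>' \<gamma>' b c d. vS S * eps4 \<mu> \<alpha>' \<beta>' \<gamma>' * (e$b$\<alpha>' * e$c$\<beta>' * e$d$\<gamma>') * (e$b$\<alpha> * e$c$\<beta> * e$d$\<gamma> * W \<alpha> $ \<beta> $ \<gamma>)"
    have "vS S * eps4 \<mu> \<alpha>' \<beta>' \<gamma>' * G$\<alpha>'$\<alpha> * G$\<beta>'$\<beta> * G$\<gamma>'$\<gamma> * W \<alpha> $ \<beta> $ \<gamma>
        = (\<Sum>b\<in>UNIV. \<Sum>c\<in>UNIV. \<Sum>d\<in>UNIV. ?F \<alpha> \<beta> \<gamma> \<alpha>' \<beta>' \<gamma>' b c d)" for \<alpha> \<beta> \<gamma> \<alpha>' \<beta>' \<gamma>'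
    proof -
      have "G$\<alpha>'$\<alpha> * G$\<beta>'$\<beta> * G$\<gamma>'$\<gamma> = (\<Sum>b\<in>UNIV. \<Sum>c\<in>UNIV. \<Sum>d\<in>UNIV. (e$b$\<alpha>' * e$b$\<alpha>) * (e$c$\<beta>' * e$c$\<beta>) * (e$d$\<gamma>' * e$d$\<gamma>))"
        unfolding Gn by (simp add: sum_distrib_left sum_distrib_right) (subst sum_reverse, simp)
      then have "vS S * eps4 \<mu> \<alpha>' \<beta>' \<gamma>' * (G$\<alpha>'$\<alpha> * G$\<beta>'$\<beta> * G$\<gamma>'$\<gamma>) * W \<alpha> $ \<beta> $ \<gamma>
        = (\<Sum>b\<in>UNIV. \<Sum>c\<in>UNIV. \<Sum>d\<in>UNIV. ?F \<alpha> \<beta> \<gamma> \<alpha>' \<beta>' \<gamma>' b c d)"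
        by (simp only:) (simp add: sum_distrib_left sum_distrib_right ac_simps)
      then show ?thesis by (simp only: mult.assoc)
    qed
    then have "(\<Sum>\<alpha>\<in>UNIV. \<Sum>\<beta>\<in>UNIV. \<Sum>\<gamma>\<in>UNIV. \<Sum>\<alpha>'\<in>UNIV. \<Sum>\<beta>'\<in>UNIV. \<Sum>\<gamma>'\<in>UNIV.
       vS S * eps4 \<mu> \<alpha>' \<beta>' \<gamma>' * G$\<alpha>'$\<alpha> * G$\<beta>'$\<beta> * G$\<gamma>'$\<gamma> * W \<alpha> $ \<beta> $ \<gamma>)
      = (\<Sum>\<alpha>\<in>UNIV. \<Sum>\<beta>\<in>UNIV. \<Sum>\<gamma>\<in>UNIV. \<Sum>\<alpha>'\<in>UNIV. \<Sum>\<beta>'\<in>UNIV. \<Sum>\<gamma>'\<in>UNIV. \<Sum>b\<in>UNIV. \<Sum>c\<in>UNIV. \<Sum>d\<in>UNIV.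
          ?F \<alpha> \<beta> \<gamma> \<alpha>' \<beta>' \<gamma>' b c d)" by simp
    also have "\<dots> = (\<Sum>b\<in>UNIV. \<Sum>c\<in>UNIV. \<Sum>d\<in>UNIV. \<Sum>\<alpha>'\<in>UNIV. \<Sum>\<beta>'\<in>UNIV. \<Sum>\<gamma>'\<in>UNIV. \<Sum>\<alpha>\<in>UNIV. \<Sum>\<beta>\<in>UNIV. \<Sum>\<gamma>\<in>UNIV.
          ?F \<alpha> \<beta> \<gamma> \<alpha>' \<beta>' \<gamma>' b c d)"
      unfolding sum.cartesian_product
      by (rule sum.reindex_bij_witness[of _ "\<lambda>(b, c, d, \<alpha>', \<beta>', \<gamma>', \<alpha>, \<beta>, \<gamma>). (\<alpha>, \<beta>, \<gamma>, \<alpha>', \<beta>', \<gamma>', b, c, d)"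
          "\<lambda>(\<alpha>, \<beta>, \<gamma>, \<alpha>', \<beta>', \<gamma>', b, c, d). (b, c, d, \<alpha>', \<beta>', \<gamma>', \<alpha>, \<beta>, \<gamma>)"]) auto
    finally show ?thesis
      unfolding frame3_nth sum_distrib_right unfolding sum_distrib_left by simp
  qed
  have s: "(\<Sum>\<alpha>\<in>UNIV. \<Sum>\<beta>\<in>UNIV. \<Sum>\<gamma>\<in>UNIV. \<Sum>\<alpha>'\<in>UNIV. \<Sum>\<beta>'\<in>UNIV. \<Sum>\<gamma>'\<in>UNIV.
     vS S * eps4 \<mu> \<alpha>' \<beta>' \<gamma>' * G$\<alpha>'$\<alpha> * G$\<beta>'$\<beta> * G$\<gamma>'$\<gamma> * W \<alpha> $ \<beta> $ \<gamma>)
    = (B *v (\<chi> a. - (\<Sum>b\<in>UNIV. \<Sum>c\<in>UNIV. \<Sum>d\<in>UNIV. eps4 a b c d * frame3 e W b $ c $ d))) $ \<mu>" for \<mu>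
  proof -
    have "(\<Sum>b\<in>UNIV. \<Sum>c\<in>UNIV. \<Sum>d\<in>UNIV. - (\<Sum>a\<in>UNIV. B$\<mu>$a * eps4 a b c d) * frame3 e W b $ c $ d)
        = (\<Sum>b\<in>UNIV. \<Sum>c\<in>UNIV. \<Sum>d\<in>UNIV. \<Sum>a\<in>UNIV. B$\<mu>$a * (- (eps4 a b c d * frame3 e W b $ c $ d)))"
      by (simp add: sum_distrib_right sum_negf mult.assoc)
    also have "\<dots> = (\<Sum>a\<in>UNIV. \<Sum>b\<in>UNIV. \<Sum>c\<in>UNIV. \<Sum>d\<in>UNIV. B$\<mu>$a * (- (eps4 a b c d * frame3 e W b $ c $ d)))"
      unfolding sum.cartesian_product
      by (rule sum.reindex_bij_witness[of _ "\<lambda>(a, b, c, d). (b, c, d, a)" "\<lambda>(b, c, d, a). (a, b, c, d)"]) auto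
    finally show ?thesis
      unfolding main eps4_raised
      by (simp add: matrix_vector_mult_def sum_distrib_left sum_negf)
  qed
  then have "(\<chi> \<mu>. \<Sum>\<alpha>\<in>UNIV. \<Sum>\<beta>\<in>UNIV. \<Sum>\<gamma>\<in>UNIV. \<Sum>\<alpha>'\<in>UNIV. \<Sum>\<beta>'\<in>UNIV. \<Sum>\<gamma>'\<in>UNIV.
     vS S * eps4 \<mu> \<alpha>' \<beta>' \<gamma>' * G$\<alpha>'$\<alpha> * G$\<beta>'$\<beta> * G$\<gamma>'$\<gamma> * W \<alpha> $ \<beta> $ \<gamma>)
    = B *v (\<chi> a. - (\<Sum>b\<in>UNIV. \<Sum>c\<in>UNIV. \<Sum>d\<in>UNIV. eps4 a b c d * frame3 e W b $ c $ d))"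
    by (simp add: vec_eq_iff)
  then show ?thesis by (simp only: e_B_vector)
qed

lemma frame_sigma_form:
  "e ** sigma_form (\<lambda>j. S$j) G q X i ** transpose e = sigma_form eta (mat 1) q (e ** X ** transpose e) i"
proof -
  have "e ** (X ** G ** S$i) ** transpose e = (e ** X ** transpose e) ** eta i"
    "e ** (S$i ** G ** X) ** transpose e = eta i ** (e ** X ** transpose e)"
    by (simp_all add: frame_eqs(2)[symmetric] G_eq matrix_mul_assoc)
  then show ?thesis
    by (simp add: sigma_form_def matrix_linear_simps matrix_sum_simps frame_eqs)
qed

lemma sigma_form_inj:
  assumes "transpose X = X" "\<And>i. sigma_form (\<lambda>j. S$j) G q X i = 0"
  shows "q = 0 \<and> X = 0"
proof -
  have "sigma_form eta (mat 1) q (e ** X ** transpose e) i = 0" for i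
    unfolding frame_sigma_form[symmetric] using assms(2) by simp
  then have "q = 0 \<and> e ** X ** transpose e = 0"
    by (intro sigma_form_flat_inj) (simp_all add: frame_transpose assms(1))
  then show ?thesis using frame_eqI2[of X 0] by simp
qed

lemma lie_sigma_form:
  "N ** G ** S$i + S$i ** G ** transpose N
    = sigma_form (\<lambda>j. S$j) G (\<chi> k. (1/4) * (K k \<bullet> N)) ((1/2) *\<^sub>R (N + transpose N)) i"
proof (rule frame_eqI2)
  have "e ** (N ** G ** S$i) ** transpose e = (e ** N ** transpose e) ** eta i"
    "e ** (S$i ** G ** transpose N) ** transpose e = eta i ** transpose (e ** N ** transpose e)"
    by (simp_all add: frame_eqs(2)[symmetric] G_eq matrix_transpose_mul matrix_mul_assoc)
  moreover have "e ** ((1/2) *\<^sub>R (N + transpose N)) ** transpose e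
      = (1/2) *\<^sub>R (e ** N ** transpose e + transpose (e ** N ** transpose e))"
    by (simp add: matrix_linear_simps frame_transpose)
  ultimately show "e ** (N ** G ** S$i + S$i ** G ** transpose N) ** transpose e
      = e ** sigma_form (\<lambda>j. S$j) G (\<chi> k. (1/4) * (K k \<bullet> N)) ((1/2) *\<^sub>R (N + transpose N)) i ** transpose e"
    by (simp only: matrix_add_ldistrib matrix_add_rdistrib' frame_sigma_form K_contract lie_sigma_flat)
qed

lemma frame_J1: "e *v (J1_flat M a $ i) = J1_flat eta (\<chi> i. e *v (a $ i)) $ i"
  by (simp add: J1_flat_def linear_sum[OF matrix_vector_mul_linear] matrix_vector_scaleR_right frame_M)

lemma Phi_curl:
  assumes "\<And>\<mu>. transpose (T \<mu>) = T \<mu>" and "\<And>\<mu>. G \<bullet> T \<mu> = 0"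
  shows "(\<Sum>i\<in>UNIV. M i *v contract3 (K i) T) = - contract3 G T"
proof (rule frame_eqI)
  have l: "linear (\<lambda>X. trace (X::real^4^4))"
    by (rule linearI) (simp_all add: trace_def sum.distrib sum_distrib_left)
  have "transpose (frame3 e T b) = frame3 e T b" "trace (frame3 e T b) = 0" for b
    unfolding frame3_def
    by (simp_all add: transpose_sum transpose_scaleR frame_transpose assms linear_sum[OF l] linear_scale[OF l] trace_frame)
  then have "(\<Sum>i\<in>UNIV. eta i *v contract3 (eta i) (frame3 e T)) = - contract3 (mat 1) (frame3 e T)"
    by (rule Phi_curl_flat)
  moreover have "e *v contract3 (K i) T = contract3 (eta i) (frame3 e T)" for i
    using frame_contract3[of "eta i" T] by (simp add: K_eq)
  moreover have "e *v contract3 G T = contract3 (mat 1) (frame3 e T)"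
    using frame_contract3[of "mat 1" T] by (simp add: G_eq)
  ultimately show "e *v (\<Sum>i\<in>UNIV. M i *v contract3 (K i) T) = e *v (- contract3 G T)"
    by (simp add: linear_sum[OF matrix_vector_mul_linear] frame_M matrix_vector_minus_right)
qed

end

lemma matrix_inner_mult_transpose: "A \<bullet> (N ** transpose C) = (A ** C) \<bullet> N" for A N C :: "real^4^4"
  by (simp add: matrix_inner_mult_right)

lemma sym0_iff: "t \<in> sym0 g \<longleftrightarrow> transpose t = t \<and> transpose (matrix_inv g) \<bullet> t = 0"
  by (simp add: sym0_def trace_mult_inner)

context triple_chart
begin

abbreviation "Mx x \<equiv> (\<lambda>i. M i x)"

lemma adapted_eqs:
  assumes "adapted (S x) (g x) e"
  shows "adapted.G (g x) = G x" "adapted.M (S x) (g x) = Mx x" "adapted.K (S x) (g x) i = K i x"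
proof -
  interpret a: adapted "S x" "g x" e by fact
  show "adapted.G (g x) = G x" "adapted.M (S x) (g x) = Mx x" "adapted.K (S x) (g x) i = K i x"
    by (simp_all add: a.G_def G_def a.M_def M_def[abs_def] a.K_def K_def fun_eq_iff)
qed

lemma sym0_iff': "x \<in> U \<Longrightarrow> t \<in> sym0 (g x) \<longleftrightarrow> transpose t = t \<and> G x \<bullet> t = 0"
  by (simp add: sym0_iff transpose_G[unfolded G_def] G_def)

text \<open>Symmetric connection coefficients drop out of an exterior derivative.\<close>

lemma cov1_antisym_ext:
  assumes x: "x \<in> U" and a: "a differentiable (at x)"
  shows "ext1 a x = cov1 g a x - transpose (cov1 g a x)"
  by (simp add: ext1_def cov1_def vec_eq_iff transpose_def pd_nth[OF a] matrix_vector_mul_component Gam_sym[OF x])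

lemma op_dt1:
  assumes "\<xi> differentiable (at x)"
  shows "dt1 a1 a2 a3 S g \<xi> x = (a1 * (G x \<bullet> cov1 g \<xi> x), \<chi> i. a2 * (K i x \<bullet> cov1 g \<xi> x),
     a3 *\<^sub>R (cov1 g \<xi> x + transpose (cov1 g \<xi> x) - ((G x \<bullet> cov1 g \<xi> x) / 2) *\<^sub>R g x))"
proof -
  have "(\<chi> \<mu> \<nu>. nabla g (ten1 \<xi>) x [\<mu>, \<nu>]) = cov1 g \<xi> x"
    by (simp add: vec_eq_iff nabla_ten1[OF assms])
  then show ?thesis
    by (simp add: dt1_def Let_def matrix_inner_sum G_def K_def)
qed

lemma op_JN:
  assumes x: "x \<in> U"
  shows "G x \<bullet> JN (Mx x) N i = (\<Sum>j\<in>UNIV. \<Sum>k\<in>UNIV. eps3 i j k * (K j x \<bullet> N k))"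
  by (simp add: JN_def inner_sum_right matrix_inner_mult_transpose S_M_K(3)[OF x])

lemma op_dt3:
  assumes x: "x \<in> U" and a: "a differentiable (at x)"
  shows "dt3 c1 c2 S g a x = (\<chi> i. c1 * (G x \<bullet> cov1 g (\<lambda>y. a y $ i) x)
     + c2 * (G x \<bullet> JN (Mx x) (\<lambda>k. cov1 g (\<lambda>y. a y $ k) x) i))"
  unfolding op_JN[OF x]
  by (simp add: dt3_def nabla_ten1[OF differentiable_nth[OF a]] matrix_inner_sum G_def K_def
      sum_distrib_left mult.assoc)

lemma wedge22_S:
  assumes x: "x \<in> U"
  shows "wedge22 (S x $ i) (N - transpose N) / vS (S x) = K i x \<bullet> N"
proof -
  obtain e where "adapted (S x) (g x) e" using ex_adapted[OF x] by blast
  then interpret a: adapted "S x" "g x" e .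
  show ?thesis using a.wedge22_S adapted_eqs[OF a.adapted_axioms] by simp
qed

lemma op_d3:
  assumes x: "x \<in> U" and a: "a differentiable (at x)"
  shows "d3 S g a x = (\<chi> i. G x \<bullet> JN (Mx x) (\<lambda>k. cov1 g (\<lambda>y. a y $ k) x) i)"
proof -
  have "wedge22 (S x $ j) (ext1 (\<lambda>y. a y $ k) x) / vS (S x) = K j x \<bullet> cov1 g (\<lambda>y. a y $ k) x" for j k
    by (simp add: cov1_antisym_ext[OF x differentiable_nth[OF a]] wedge22_S[OF x])
  then have "eps3 i j k * wedge22 (S x $ j) (ext1 (\<lambda>y. a y $ k) x) / vS (S x) = eps3 i j k * (K j x \<bullet> cov1 g (\<lambda>y. a y $ k) x)" for i j k
    by (metis times_divide_eq_right)
  then show ?thesis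
    by (simp add: d3_def op_JN[OF x] sum_divide_distrib)
qed

lemma op_J1: "J1 S g a x = J1_flat (Mx x) (a x)"
  by (simp add: J1_def J1_fib_flat M_def[abs_def])

lemma op_Phi: "Phi S g a x = (\<Sum>i\<in>UNIV. M i x *v (a x $ i))"
  by (simp add: Phi_def M_def vec_eq_iff sum_component matrix_vector_mult_def)

lemma op_dt4: "dt4 f S g \<chi>' x = f *\<^sub>R (\<Sum>i\<in>UNIV. M i x *v grad (\<lambda>y. \<chi>' y $ i) x)"
  by (simp add: dt4_def M_def grad_def vec_eq_iff sum_component matrix_vector_mult_def)

lemma op_D4: "D4 S g u x = - (1 / sqrt 2) *\<^sub>R (grad (\<lambda>y. fst (u y)) x
    - 2 *\<^sub>R (\<Sum>i\<in>UNIV. M i x *v grad (\<lambda>y. snd (u y) $ i) x))"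
  by (simp add: D4_def M_def grad_def vec_eq_iff sum_component matrix_vector_mult_def)

lemma cov2_sym:
  assumes x: "x \<in> U" and h: "smooth_on U h" and sym: "\<And>y. y \<in> U \<Longrightarrow> transpose (h y) = h y"
  shows "transpose (cov2 g h x \<mu>) = cov2 g h x \<mu>"
proof -
  have "transpose (pd \<mu> h x) = pd \<mu> (\<lambda>y. transpose (h y)) x"
    by (rule pd_transpose[OF diff[OF h x], symmetric])
  also have "\<dots> = pd \<mu> h x" by (rule pd_cong[OF x sym])
  finally show ?thesis
    by (simp add: cov2_def transpose_diff matrix_transpose_mul sym[OF x])
qed

lemma inner_connection_terms:
  assumes x: "x \<in> U"
  shows "pd \<mu> G x \<bullet> X = - (G x \<bullet> (Gam g \<mu> x ** X)) - G x \<bullet> (X ** transpose (Gam g \<mu> x))"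
  by (simp add: pd_G[OF x] inner_diff_left matrix_inner_mult_left[of "transpose (Gam g \<mu> x)" "G x"]
      matrix_inner_mult_right[of "G x" "Gam g \<mu> x"])

lemma bounded_bilinear_matrix_inner: "bounded_bilinear ((\<bullet>) :: real^4^4 \<Rightarrow> _)"
  by (rule bounded_bilinear_inner)

lemma cov2_trace_free:
  assumes x: "x \<in> U" and h: "smooth_on U h" and tr: "\<And>y. y \<in> U \<Longrightarrow> G y \<bullet> h y = 0"
  shows "G x \<bullet> cov2 g h x \<mu> = 0"
proof -
  have "pd \<mu> (\<lambda>y. G y \<bullet> h y) x = pd \<mu> (\<lambda>y. 0) x" by (rule pd_cong[OF x tr])
  then have "pd \<mu> G x \<bullet> h x + G x \<bullet> pd \<mu> h x = 0"
    by (simp add: pd_bilinear[OF bounded_bilinear_inner diff[OF smooth_G x] diff[OF h x]])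
  then show ?thesis
    by (simp add: inner_connection_terms[OF x] cov2_def inner_diff_right)
qed

lemma cov22_sym:
  assumes x: "x \<in> U" and h: "smooth_on U h" and sym: "\<And>y. y \<in> U \<Longrightarrow> transpose (h y) = h y"
  shows "transpose (cov22 g h x \<mu> \<nu>) = cov22 g h x \<mu> \<nu>"
proof -
  have s: "transpose (cov2 g h y \<nu>) = cov2 g h y \<nu>" if "y \<in> U" for y \<nu>
    by (rule cov2_sym[OF that h sym])
  have "transpose (pd \<mu> (\<lambda>y. cov2 g h y \<nu>) x) = pd \<mu> (\<lambda>y. transpose (cov2 g h y \<nu>)) x"
    by (rule pd_transpose[OF diff[OF smooth_cov2[OF h] x], symmetric])
  also have "\<dots> = pd \<mu> (\<lambda>y. cov2 g h y \<nu>) x" by (rule pd_cong[OF x s])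
  finally show ?thesis
    by (simp add: cov22_def transpose_diff transpose_sum transpose_scaleR matrix_transpose_mul s[OF x])
qed

lemma cov22_trace_free:
  assumes x: "x \<in> U" and h: "smooth_on U h" and tr: "\<And>y. y \<in> U \<Longrightarrow> G y \<bullet> h y = 0"
  shows "G x \<bullet> cov22 g h x \<mu> \<nu> = 0"
proof -
  have t: "G y \<bullet> cov2 g h y \<nu> = 0" if "y \<in> U" for y \<nu>
    by (rule cov2_trace_free[OF that h tr])
  have "pd \<mu> (\<lambda>y. G y \<bullet> cov2 g h y \<nu>) x = pd \<mu> (\<lambda>y. 0) x" by (rule pd_cong[OF x t])
  then have "pd \<mu> G x \<bullet> cov2 g h x \<nu> + G x \<bullet> pd \<mu> (\<lambda>y. cov2 g h y \<nu>) x = 0"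
    by (simp add: pd_bilinear[OF bounded_bilinear_inner diff[OF smooth_G x] diff[OF smooth_cov2[OF h] x]])
  then show ?thesis
    by (simp add: inner_connection_terms[OF x] cov22_def inner_diff_right inner_sum_right t[OF x])
qed

lemma op_D12:
  assumes x: "x \<in> U" and w: "smooth_on U (\<lambda>y. snd (w y))" and sym: "\<And>y. y \<in> U \<Longrightarrow> transpose (snd (w y)) = snd (w y)"
  shows "D12 S g w x = (\<chi> i. grad (\<lambda>y. fst (w y) $ i) x + M i x *v contract3 (G x) (cov2 g (\<lambda>y. snd (w y)) x)
     - contract3 (K i x) (cov2 g (\<lambda>y. snd (w y)) x))"
proof -
  let ?T = "cov2 g (\<lambda>y. snd (w y)) x"
  have n: "nabla g (ten2 (\<lambda>y. snd (w y))) x [\<rho>, \<mu>, \<nu>] = ?T \<rho> $ \<nu> $ \<mu>" for \<rho> \<mu> \<nu>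
    using nabla_ten2[OF diff[OF w x]] symmetric_nth[OF cov2_sym[OF x w sym]] by metis
  have 1: "(\<Sum>\<alpha>\<in>UNIV. \<Sum>\<beta>\<in>UNIV. \<Sum>\<gamma>\<in>UNIV. M i x $ \<mu> $ \<alpha> * G x $ \<beta> $ \<gamma> * ?T \<gamma> $ \<beta> $ \<alpha>)
     = (M i x *v contract3 (G x) ?T) $ \<mu>" for i \<mu>
  proof -
    have "contract3 (G x) ?T $ \<alpha> = (\<Sum>\<beta>\<in>UNIV. \<Sum>\<gamma>\<in>UNIV. G x $ \<beta> $ \<gamma> * ?T \<gamma> $ \<beta> $ \<alpha>)" for \<alpha>
      unfolding contract3_def sum_component
      by (subst sum.swap) (simp add: symmetric_nth[OF transpose_G[OF x]])
    then show ?thesis by (simp add: matrix_vector_mult_def sum_distrib_left mult.assoc)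
  qed
  have 2: "(\<Sum>\<alpha>\<in>UNIV. \<Sum>\<beta>\<in>UNIV. K i x $ \<alpha> $ \<beta> * ?T \<alpha> $ \<beta> $ \<mu>) = contract3 (K i x) ?T $ \<mu>" for i \<mu>
    by (simp add: contract3_def sum_component)
  show ?thesis
    unfolding D12_def n M_def[symmetric] K_def[symmetric] G_def[symmetric] 1 2
    by (simp add: vec_eq_iff grad_def)
qed

lemma smooth_sigma_form:
  "smooth_on U q \<Longrightarrow> smooth_on U X \<Longrightarrow> smooth_on U (\<lambda>y. sigma_form (\<lambda>j. S y $ j) (G y) (q y) (X y) i)"
  unfolding sigma_form_def by (intro smooth_rules smooth_G smS)

lemma pd_sigma_form:
  assumes x: "x \<in> U" and q: "q differentiable (at x)" and X: "X differentiable (at x)"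
  shows "pd \<mu> (\<lambda>y. sigma_form (\<lambda>j. S y $ j) (G y) (q y) (X y) i) x
    = (let w = sigma_form (\<lambda>j. S x $ j) (G x) (q x) (X x) i in Gam g \<mu> x ** w + w ** transpose (Gam g \<mu> x))
      + sigma_form (\<lambda>j. S x $ j) (G x) (pd \<mu> q x) (cov2 g X x \<mu>) i"
proof -
  note dS = diff[OF smooth_Si x] and dG = diff[OF smooth_G x]
  have dq: "(\<lambda>y. c * q y $ k) differentiable (at x)" for c k
    by (intro differentiable_mult differentiable_nth q) simp
  have pq: "pd \<mu> (\<lambda>y. c * q y $ k) x = c * pd \<mu> q x $ k" for c k
    by (simp add: pd_bounded_linear[OF bounded_linear_mult_right differentiable_nth[OF q]] pd_nth[OF q])
  have d1: "(\<lambda>y. (c * q y $ k) *\<^sub>R S y $ j) differentiable (at x)" for c k j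
    by (rule differentiable_scaleR'[OF dq dS])
  have d2: "(\<lambda>y. \<Sum>j\<in>UNIV. \<Sum>k\<in>UNIV. (eps3 i j k * q y $ k) *\<^sub>R S y $ j) differentiable (at x)"
    by (intro differentiable_sum ballI d1 finite)
  have p2: "pd \<mu> (\<lambda>y. \<Sum>j\<in>UNIV. \<Sum>k\<in>UNIV. (eps3 i j k * q y $ k) *\<^sub>R S y $ j) x
      = (\<Sum>j\<in>UNIV. \<Sum>k\<in>UNIV. (eps3 i j k * pd \<mu> q x $ k) *\<^sub>R S x $ j
          + (eps3 i j k * q x $ k) *\<^sub>R (Gam g \<mu> x ** S x $ j + S x $ j ** transpose (Gam g \<mu> x)))"
    by (subst pd_sum, auto intro!: differentiable_sum d1 sum.cong simp: pd_sum[OF d1] pd_scaleR[OF dq dS] pq pd_S[OF x])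
  have d3: "(\<lambda>y. 2 *\<^sub>R (\<Sum>j\<in>UNIV. \<Sum>k\<in>UNIV. (eps3 i j k * q y $ k) *\<^sub>R S y $ j)) differentiable (at x)"
    by (rule differentiable_linear[OF bounded_linear_scaleR_right d2])
  note dXG = differentiable_matrix_mult[OF X dG] and dSG = differentiable_matrix_mult[OF dS dG]
  note dXGS = differentiable_matrix_mult[OF dXG dS] and dSGX = differentiable_matrix_mult[OF dSG X]
  have Xe: "pd \<mu> X x = cov2 g X x \<mu> + Gam g \<mu> x ** X x + X x ** transpose (Gam g \<mu> x)"
    by (simp add: cov2_def)
  have 1: "pd \<mu> (\<lambda>y. X y ** G y ** S y $ i) x = Gam g \<mu> x ** (X x ** G x ** S x $ i) + (X x ** G x ** S x $ i) ** transpose (Gam g \<mu> x)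
      + cov2 g X x \<mu> ** G x ** S x $ i"
    by (simp add: pd_matrix_mult[OF dXG dS] pd_matrix_mult[OF X dG] Xe pd_G[OF x] pd_S[OF x] matrix_linear_simps matrix_mul_assoc)
  have 2: "pd \<mu> (\<lambda>y. S y $ i ** G y ** X y) x = Gam g \<mu> x ** (S x $ i ** G x ** X x) + (S x $ i ** G x ** X x) ** transpose (Gam g \<mu> x)
      + S x $ i ** G x ** cov2 g X x \<mu>"
    by (simp add: pd_matrix_mult[OF dSG X] pd_matrix_mult[OF dS dG] Xe pd_G[OF x] pd_S[OF x] matrix_linear_simps matrix_mul_assoc)
  have 3: "pd \<mu> (\<lambda>y. 2 *\<^sub>R (\<Sum>j\<in>UNIV. \<Sum>k\<in>UNIV. (eps3 i j k * q y $ k) *\<^sub>R S y $ j)) x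
      = 2 *\<^sub>R (\<Sum>j\<in>UNIV. \<Sum>k\<in>UNIV. (eps3 i j k * pd \<mu> q x $ k) *\<^sub>R S x $ j)
        + Gam g \<mu> x ** (2 *\<^sub>R (\<Sum>j\<in>UNIV. \<Sum>k\<in>UNIV. (eps3 i j k * q x $ k) *\<^sub>R S x $ j))
        + (2 *\<^sub>R (\<Sum>j\<in>UNIV. \<Sum>k\<in>UNIV. (eps3 i j k * q x $ k) *\<^sub>R S x $ j)) ** transpose (Gam g \<mu> x)"
    unfolding pd_bounded_linear[OF bounded_linear_scaleR_right d2] p2
    by (simp add: sum.distrib scaleR_add_right matrix_linear_simps matrix_sum_simps)
  show ?thesis
    unfolding sigma_form_def Let_def
    by (simp add: pd_add[OF differentiable_add[OF d3 dXGS] dSGX] pd_add[OF d3 dXGS] 1 2 3)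
       (simp add: matrix_linear_simps)
qed

lemma sigma_on_chart:
  assumes x: "x \<in> U" and t: "transpose t = t"
  shows "sigma (S x) (g x) (h, q, t) $ i = sigma_form (\<lambda>j. S x $ j) (G x) q (t + (h / 4) *\<^sub>R g x) i"
  using sigma_sigma_form[OF t g_sym[OF x] _ S_anti[OF x]] transpose_G[OF x] by (simp add: G_def)

text \<open>In \<open>d2\<close> the Hodge dual kills the connection terms, and inverting \<open>J1\<close> turns what is left into
  the gradient and curl terms.\<close>

lemma op_d2:
  assumes x: "x \<in> U" and s: "smooth_on U s" and t: "\<And>y. y \<in> U \<Longrightarrow> snd (snd (s y)) \<in> sym0 (g y)"
  shows "d2 S g s x = (\<chi> i. (1/4) *\<^sub>R (M i x *v grad (\<lambda>y. fst (s y)) x) + 2 *\<^sub>R grad (\<lambda>y. fst (snd (s y)) $ i) x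
     - contract3 (K i x) (cov2 g (\<lambda>y. snd (snd (s y))) x))"
    (is "_ = ?X")
proof -
  obtain e where "adapted (S x) (g x) e" using ex_adapted[OF x] by blast
  then interpret a: adapted "S x" "g x" e .
  note eqs = adapted_eqs[OF a.adapted_axioms]
  define h q T where "h = (\<lambda>y. fst (s y))" and "q = (\<lambda>y. fst (snd (s y)))" and "T = (\<lambda>y. snd (snd (s y)))"
  have sm: "smooth_on U h" "smooth_on U q" "smooth_on U T"
    unfolding h_def q_def T_def by (intro smooth_rules s)+
  have Tsym: "transpose (T y) = T y" and Ttr: "G y \<bullet> T y = 0" if "y \<in> U" for y
    using t[OF that] sym0_iff'[OF that] by (auto simp: T_def)
  define X where "X = (\<lambda>y. T y + (h y / 4) *\<^sub>R g y)"
  have smX: "smooth_on U X"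
    unfolding X_def divide_inverse by (intro smooth_rules sm smg)
  have sig: "sigma (S y) (g y) (s y) $ i = sigma_form (\<lambda>j. S y $ j) (G y) (q y) (X y) i" if "y \<in> U" for y i
    using sigma_on_chart[OF that Tsym[OF that], of "h y" "q y" i] by (simp add: h_def q_def T_def X_def)
  define w where "w = (\<lambda>i. sigma_form (\<lambda>j. S x $ j) (G x) (q x) (X x) i)"
  define W where "W = (\<lambda>i \<alpha>. Gam g \<alpha> x ** w i + w i ** transpose (Gam g \<alpha> x)
      + sigma_form (\<lambda>j. S x $ j) (G x) (pd \<alpha> q x) (cov2 g X x \<alpha>) i)"
  have p: "pd \<alpha> (\<lambda>y. sigma (S y) (g y) (s y) $ i $ \<beta> $ \<gamma>) x = W i \<alpha> $ \<beta> $ \<gamma>" for i \<alpha> \<beta> \<gamma>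
  proof -
    have d: "(\<lambda>y. sigma_form (\<lambda>j. S y $ j) (G y) (q y) (X y) i) differentiable (at x)"
      by (rule diff[OF smooth_sigma_form[OF sm(2) smX] x])
    have "pd \<alpha> (\<lambda>y. sigma (S y) (g y) (s y) $ i $ \<beta> $ \<gamma>) x
        = pd \<alpha> (\<lambda>y. sigma_form (\<lambda>j. S y $ j) (G y) (q y) (X y) i $ \<beta> $ \<gamma>) x"
      by (rule pd_cong[OF x]) (simp add: sig)
    also have "\<dots> = pd \<alpha> (\<lambda>y. sigma_form (\<lambda>j. S y $ j) (G y) (q y) (X y) i) x $ \<beta> $ \<gamma>"
      by (simp add: pd_nth[OF differentiable_nth[OF d]] pd_nth[OF d])
    finally show ?thesis
      by (simp add: pd_sigma_form[OF x diff[OF sm(2) x] diff[OF smX x]] W_def w_def Let_def)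
  qed
  define dt dq dh where "dt = frame3 e (cov2 g T x)" and "dq = (\<lambda>b. \<Sum>\<alpha>\<in>UNIV. e$b$\<alpha> *\<^sub>R pd \<alpha> q x)"
    and "dh = (1/4) *\<^sub>R (e *v grad h x)"
  have cX: "cov2 g X x \<alpha> = cov2 g T x \<alpha> + (grad h x $ \<alpha> / 4) *\<^sub>R g x" for \<alpha>
  proof -
    have dhg: "(\<lambda>y. (h y / 4) *\<^sub>R g y) differentiable (at x)"
      and dh4: "(\<lambda>y. h y / 4) differentiable (at x)"
      unfolding divide_inverse by (intro diff[OF _ x] smooth_rules sm smg)+
    have p4: "pd \<alpha> (\<lambda>y. h y / 4) x = pd \<alpha> h x / 4"
      unfolding divide_inverse by (rule pd_bounded_linear[OF bounded_linear_mult_left diff[OF sm(1) x]])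
    show ?thesis
      unfolding X_def cov2_def pd_add[OF diff[OF sm(3) x] dhg] pd_scaleR[OF dh4 diff[OF smg x]] p4 pd_g[OF x]
      by (simp add: matrix_linear_simps grad_def algebra_simps)
  qed
  \<comment> \<open>The connection in the frame; it is symmetric, so \<open>star_symmetric_flat\<close> removes it from the Hodge dual.\<close>
  define C where "C = (\<lambda>b. \<Sum>\<alpha>\<in>UNIV. e$b$\<alpha> *\<^sub>R (e ** Gam g \<alpha> x ** a.B))"
  have Csym: "C b $ c = C c $ b" for b c
  proof -
    have r: "(e ** Gam g \<alpha> x ** a.B) $ c = (\<Sum>\<nu>\<in>UNIV. e$c$\<nu> *\<^sub>R (Gam g \<alpha> x $ \<nu> v* a.B))" for \<alpha> c
      by (simp add: matrix_mul_assoc[symmetric] row_mult_sum[of e] row_matrix_mult[of _ a.B])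
    have "C b $ c = (\<Sum>\<alpha>\<in>UNIV. \<Sum>\<nu>\<in>UNIV. (e$b$\<alpha> * e$c$\<nu>) *\<^sub>R (Gam g \<alpha> x $ \<nu> v* a.B))" for b c
      by (simp add: C_def sum_component r scaleR_sum_right)
    moreover have "(\<Sum>\<alpha>\<in>UNIV. \<Sum>\<nu>\<in>UNIV. (e$b$\<alpha> * e$c$\<nu>) *\<^sub>R (Gam g \<alpha> x $ \<nu> v* a.B))
        = (\<Sum>\<nu>\<in>UNIV. \<Sum>\<alpha>\<in>UNIV. (e$c$\<nu> * e$b$\<alpha>) *\<^sub>R (Gam g \<nu> x $ \<alpha> v* a.B))"
      by (subst sum.swap, intro sum.cong refl) (subst Gam_sym[OF x], simp add: mult.commute)
    ultimately show ?thesis by simp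
  qed
  have frW: "frame3 e (W i) b = C b ** (e ** w i ** transpose e) + (e ** w i ** transpose e) ** transpose (C b)
      + sigma_form eta (mat 1) (dq b) (dt b + dh $ b *\<^sub>R mat 1) i" for i b
  proof -
    have 1: "e ** (Gam g \<alpha> x ** w i) ** transpose e = (e ** Gam g \<alpha> x ** a.B) ** (e ** w i ** transpose e)" for \<alpha>
      by (simp add: matrix_mul_assoc[symmetric] a.e_B_simps)
    have 2: "e ** (w i ** transpose (Gam g \<alpha> x)) ** transpose e = (e ** w i ** transpose e) ** transpose (e ** Gam g \<alpha> x ** a.B)" for \<alpha>
      by (simp add: matrix_transpose_mul matrix_mul_assoc[symmetric] a.e_B_simps)
    have 3: "e ** sigma_form (\<lambda>j. S x $ j) (G x) (pd \<alpha> q x) (cov2 g X x \<alpha>) i ** transpose e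
        = sigma_form eta (mat 1) (pd \<alpha> q x) (e ** cov2 g T x \<alpha> ** transpose e + (grad h x $ \<alpha> / 4) *\<^sub>R mat 1) i" for \<alpha>
      using a.frame_sigma_form[of "pd \<alpha> q x" "cov2 g X x \<alpha>" i]
      by (simp add: eqs cX matrix_linear_simps a.frame_eqs)
    have "frame3 e (W i) b = (\<Sum>\<alpha>\<in>UNIV. e$b$\<alpha> *\<^sub>R ((e ** Gam g \<alpha> x ** a.B) ** (e ** w i ** transpose e)))
      + (\<Sum>\<alpha>\<in>UNIV. e$b$\<alpha> *\<^sub>R ((e ** w i ** transpose e) ** transpose (e ** Gam g \<alpha> x ** a.B)))
      + (\<Sum>\<alpha>\<in>UNIV. e$b$\<alpha> *\<^sub>R sigma_form eta (mat 1) (pd \<alpha> q x) (e ** cov2 g T x \<alpha> ** transpose e + (grad h x $ \<alpha> / 4) *\<^sub>R mat 1) i)"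
      by (simp only: frame3_def W_def matrix_add_ldistrib matrix_add_rdistrib' 1 2 3 scaleR_add_right sum.distrib)
    also have "(\<Sum>\<alpha>\<in>UNIV. e$b$\<alpha> *\<^sub>R ((e ** Gam g \<alpha> x ** a.B) ** (e ** w i ** transpose e))) = C b ** (e ** w i ** transpose e)"
      by (simp only: C_def matrix_sum_left matrix_scaleR_left)
    also have "(\<Sum>\<alpha>\<in>UNIV. e$b$\<alpha> *\<^sub>R ((e ** w i ** transpose e) ** transpose (e ** Gam g \<alpha> x ** a.B))) = (e ** w i ** transpose e) ** transpose (C b)"
      by (simp only: C_def matrix_sum_right transpose_sum transpose_scaleR matrix_scaleR_right)
    also have "(\<Sum>\<alpha>\<in>UNIV. e$b$\<alpha> *\<^sub>R sigma_form eta (mat 1) (pd \<alpha> q x) (e ** cov2 g T x \<alpha> ** transpose e + (grad h x $ \<alpha> / 4) *\<^sub>R mat 1) i)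
        = sigma_form eta (mat 1) (dq b) (dt b + dh $ b *\<^sub>R mat 1) i"
      unfolding linear_sigma_form[symmetric] dq_def dt_def frame3_def dh_def
      by (simp add: scaleR_add_right sum.distrib matrix_vector_mult_def scaleR_sum_left[symmetric] sum_divide_distrib)
    finally show ?thesis .
  qed
  have dt_sym: "transpose (dt b) = dt b" and dt_tr: "trace (dt b) = 0" for b
  proof -
    have l: "linear (\<lambda>X. trace (X::real^4^4))"
      by (rule linearI) (simp_all add: trace_def sum.distrib sum_distrib_left)
    show "transpose (dt b) = dt b" "trace (dt b) = 0"
      unfolding dt_def frame3_def
      by (simp_all add: transpose_sum transpose_scaleR a.frame_transpose cov2_sym[OF x sm(3) Tsym]
          linear_sum[OF l] linear_scale[OF l] a.trace_frame eqs cov2_trace_free[OF x sm(3) Ttr])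
  qed
  define Z where "Z = star_d S g (\<lambda>y. sigma (S y) (g y) (s y)) x"
  have "Z $ i = (2 *\<^sub>R J1_flat (Mx x) ?X) $ i" for i
  proof (rule a.frame_eqI)
    have "Z $ i = (\<chi> \<mu>. \<Sum>\<alpha>\<in>UNIV. \<Sum>\<beta>\<in>UNIV. \<Sum>\<gamma>\<in>UNIV. \<Sum>\<alpha>'\<in>UNIV. \<Sum>\<beta>'\<in>UNIV. \<Sum>\<gamma>'\<in>UNIV.
      vS (S x) * eps4 \<mu> \<alpha>' \<beta>' \<gamma>' * G x$\<alpha>'$\<alpha> * G x$\<beta>'$\<beta> * G x$\<gamma>'$\<gamma> * W i \<alpha> $ \<beta> $ \<gamma>)"
      by (simp add: Z_def star_d_def p G_def)
    then have "e *v (Z $ i) = (\<chi> a. - (\<Sum>b\<in>UNIV. \<Sum>c\<in>UNIV. \<Sum>d\<in>UNIV. eps4 a b c d * frame3 e (W i) b $ c $ d))"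
      using a.frame_star[of "W i"] by (simp only: eqs)
    also have "\<dots> = (\<chi> a. - (\<Sum>b\<in>UNIV. \<Sum>c\<in>UNIV. \<Sum>d\<in>UNIV. eps4 a b c d * sigma_form eta (mat 1) (dq b) (dt b + dh $ b *\<^sub>R mat 1) i $ c $ d))"
      using star_symmetric_flat[of C, OF Csym, where w = "e ** w i ** transpose e"]
      by (simp add: frW distrib_left sum.distrib vec_eq_iff)
    also have "\<dots> = 2 *\<^sub>R (J1_flat eta (\<chi> i. eta i *v dh + 2 *\<^sub>R (\<chi> b. dq b $ i) - contract3 (eta i) dt) $ i)"
      by (simp add: star_sigma_flat[OF dt_sym dt_tr] vec_eq_iff)
    also have "(\<chi> i. eta i *v dh + 2 *\<^sub>R (\<chi> b. dq b $ i) - contract3 (eta i) dt) = (\<chi> i. e *v (?X $ i))"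
    proof -
      have "(\<chi> b. dq b $ i) = e *v grad (\<lambda>y. q y $ i) x" for i
        by (simp add: vec_eq_iff dq_def sum_component matrix_vector_mult_def grad_def pd_nth[OF diff[OF sm(2) x]])
      moreover have "contract3 (eta i) dt = e *v contract3 (K i x) (cov2 g T x)" for i
        using a.frame_contract3[of "eta i" "cov2 g T x"] a.K_eq[of i] by (simp add: eqs dt_def)
      moreover have "eta i *v dh = e *v ((1/4) *\<^sub>R (M i x *v grad h x))" for i
        using a.frame_M[of i "grad h x"] by (simp add: eqs dh_def matrix_vector_scaleR_right)
      ultimately show ?thesis
        by (simp add: vec_eq_iff[of "\<chi> i. _"] matrix_linear_simps h_def q_def T_def)
    qed
    finally show "e *v (Z $ i) = e *v ((2 *\<^sub>R J1_flat (Mx x) ?X) $ i)"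
      using a.frame_J1[of ?X i] by (simp only: eqs vector_scaleR_component matrix_vector_scaleR_right)
  qed
  then have "Z = J1_fib (S x) (g x) (2 *\<^sub>R ?X)"
    unfolding J1_fib_flat M_def[abs_def, symmetric] J1_flat_scaleR by (intro matrix_eq_rows) (simp add: M_def[abs_def])
  then have "inv (J1_fib (S x) (g x)) Z = 2 *\<^sub>R ?X"
    using inv_f_f[OF J1_flat_inj[OF quat[OF x]], of "2 *\<^sub>R ?X"]
    by (simp add: J1_fib_flat[abs_def])
  then show ?thesis by (simp add: d2_def Z_def)
qed

lemma G_inner_g: "x \<in> U \<Longrightarrow> G x \<bullet> g x = 4"
proof -
  assume x: "x \<in> U"
  have "G x \<bullet> g x = transpose (G x) \<bullet> g x" by (simp add: transpose_G[OF x])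
  also have "\<dots> = trace (G x ** g x)" by (simp add: trace_mult_inner)
  also have "\<dots> = 4" by (simp add: G_g[OF x] trace_def mat_1_nth)
  finally show ?thesis .
qed

lemma symtf_sym0: "x \<in> U \<Longrightarrow> symtf (g x) (G x) X \<in> sym0 (g x)"
proof -
  assume x: "x \<in> U"
  have "G x \<bullet> transpose X = G x \<bullet> X" using matrix_inner_transpose[of "G x" X] by (simp add: transpose_G[OF x])
  then show ?thesis
    by (simp add: sym0_iff'[OF x] symtf_def transpose_scaleR transpose_diff transpose_add g_sym[OF x] inner_diff_right
        inner_add_right G_inner_g[OF x] add.commute)
qed

text \<open>Since the triple is parallel, \<open>d (\<xi> \<lrcorner> \<Sigma>\<^sup>i)\<close> is an algebraic
  expression in \<open>\<nabla> \<xi>\<close>: the symmetric part deforms the metric and the self-dual part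
  rotates the triple. The definition by a unique description is resolved by
  \<open>sigma_form_inj\<close>.\<close>

lemma op_d1:
  assumes x: "x \<in> U" and \<xi>: "smooth_on U \<xi>"
  shows "d1 S g \<xi> x = (G x \<bullet> cov1 g \<xi> x, \<chi> k. (1/4) * (K k x \<bullet> cov1 g \<xi> x), symtf (g x) (G x) (cov1 g \<xi> x))"
    (is "_ = ?s")
proof -
  obtain e where "adapted (S x) (g x) e" using ex_adapted[OF x] by blast
  then interpret a: adapted "S x" "g x" e .
  note eqs = adapted_eqs[OF a.adapted_axioms]
  let ?N = "cov1 g \<xi> x"
  have d: "\<xi> differentiable (at x)" by (rule diff[OF \<xi> x])
  have hook: "hook (S y) (g y) (\<xi> y) i = - (M i y *v \<xi> y)" if "y \<in> U" for y i
  proof -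
    have "hook (S y) (g y) (\<xi> y) i = transpose (S y $ i) *v (G y *v \<xi> y)"
      by (simp add: hook_def matrix_vector_transpose[of "transpose _"] transpose_transpose G_def)
    then show ?thesis by (simp add: S_anti[OF that] matrix_linear_simps matrix_vector_mul_assoc S_M_K(2)[OF that])
  qed
  have dM: "(\<lambda>y. M i y *v \<xi> y) differentiable (at x)" for i
    by (rule differentiable_matrix_vector_mult[OF diff[OF smooth_M x] d])
  have "ext1 (\<lambda>y. hook (S y) (g y) (\<xi> y) i) x = ?N ** G x ** S x $ i + S x $ i ** G x ** transpose ?N" for i
  proof -
    have "ext1 (\<lambda>y. hook (S y) (g y) (\<xi> y) i) x = ext1 (\<lambda>y. - (M i y *v \<xi> y)) x"
      unfolding ext1_def using pd_cong[OF x, of "\<lambda>y. hook (S y) (g y) (\<xi> y) i $ _" "\<lambda>y. (- (M i y *v \<xi> y)) $ _"]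
      by (simp add: hook vec_eq_iff)
    also have "\<dots> = cov1 g (\<lambda>y. - (M i y *v \<xi> y)) x - transpose (cov1 g (\<lambda>y. - (M i y *v \<xi> y)) x)"
      by (rule cov1_antisym_ext[OF x differentiable_minus[OF dM]])
    also have "cov1 g (\<lambda>y. - (M i y *v \<xi> y)) x = ?N ** G x ** S x $ i"
      by (simp add: cov1_minus[OF dM] cov1_M[OF x d] transpose_M[OF x] matrix_linear_simps matrix_mul_assoc)
    finally show ?thesis
      by (simp add: matrix_transpose_mul S_anti[OF x] transpose_G[OF x] matrix_linear_simps matrix_mul_assoc)
  qed
  then have rhs: "(\<chi> i. ext1 (\<lambda>y. hook (S y) (g y) (\<xi> y) i) x)
      = (\<chi> i. sigma_form (\<lambda>j. S x $ j) (G x) (\<chi> k. (1/4) * (K k x \<bullet> ?N)) ((1/2) *\<^sub>R (?N + transpose ?N)) i)"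
    using a.lie_sigma_form[of ?N] by (simp add: eqs)
  have Gg: "G x \<bullet> g x = 4" by (rule G_inner_g[OF x])
  have GN: "G x \<bullet> transpose ?N = G x \<bullet> ?N"
    using matrix_inner_transpose[of "G x" ?N] by (simp add: transpose_G[OF x])
  have sy: "symtf (g x) (G x) ?N \<in> sym0 (g x)" by (rule symtf_sym0[OF x])
  have ex: "sigma (S x) (g x) ?s = (\<chi> i. ext1 (\<lambda>y. hook (S y) (g y) (\<xi> y) i) x)"
  proof -
    have "sigma (S x) (g x) ?s $ i = sigma_form (\<lambda>j. S x $ j) (G x) (\<chi> k. (1/4) * (K k x \<bullet> ?N)) ((1/2) *\<^sub>R (?N + transpose ?N)) i" for i
      using sigma_on_chart[OF x, of "symtf (g x) (G x) ?N" "G x \<bullet> ?N"] sy sym0_iff'[OF x]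
      by (simp add: symtf_def)
    then show ?thesis unfolding rhs by (simp add: vec_eq_iff)
  qed
  have un: "s = ?s" if s: "snd (snd s) \<in> sym0 (g x)" "sigma (S x) (g x) s = (\<chi> i. ext1 (\<lambda>y. hook (S y) (g y) (\<xi> y) i) x)" for s
  proof -
    obtain h q t where st: "s = (h, q, t)" by (metis surj_pair)
    have t: "transpose t = t" "G x \<bullet> t = 0" using s(1) sym0_iff'[OF x] by (auto simp: st)
    let ?q = "\<chi> k. (1/4) * (K k x \<bullet> ?N)" and ?X = "(1/2) *\<^sub>R (?N + transpose ?N)"
    let ?Y = "t + (h / 4) *\<^sub>R g x"
    have "sigma_form (\<lambda>j. S x $ j) (G x) (q - ?q) (?Y - ?X) i = 0" for i
    proof -
      have "sigma_form (\<lambda>j. S x $ j) (G x) q ?Y i = sigma_form (\<lambda>j. S x $ j) (G x) ?q ?X i"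
        using arg_cong[OF s(2), of "\<lambda>w. w $ i"] unfolding rhs st by (simp add: sigma_on_chart[OF x t(1)])
      then show ?thesis
        by (simp add: sigma_form_def sum_3 matrix_linear_simps algebra_simps)
    qed
    moreover have "transpose (?Y - ?X) = ?Y - ?X"
      by (simp add: transpose_diff transpose_scaleR transpose_add transpose_transpose g_sym[OF x] t add.commute)
    ultimately have z: "q - ?q = 0" "?Y - ?X = 0"
      using a.sigma_form_inj[of "?Y - ?X" "q - ?q"] by (simp_all add: eqs)
    have "G x \<bullet> ?Y = G x \<bullet> ?X" using z(2) by simp
    then have h: "h = G x \<bullet> ?N" by (simp add: inner_add_right t Gg GN)
    have "t = ?X - (h / 4) *\<^sub>R g x" using z(2) by (simp add: algebra_simps)
    then show ?thesis using z(1) by (simp add: st h symtf_def)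
  qed
  show ?thesis
    unfolding d1_def by (rule the_equality) (use ex sy un in auto)
qed

end

section \<open>Green identities\<close>

text \<open>\<open>JN\<close> is \<open>J1\<close> acting on rows, so it satisfies the same quadratic
  equation.\<close>

lemma JN_square:
  assumes "quaternion_relations M"
  shows "JN M (JN M N) i = JN M N i + 2 *\<^sub>R N i"
proof -
  have tq: "X ** transpose (M j) ** transpose (M k) = X ** transpose (M k ** M j)" for X :: "real^4^4" and j k
    by (simp add: matrix_transpose_mul matrix_mul_assoc)
  have "\<forall>i. JN M (JN M N) i = JN M N i + 2 *\<^sub>R N i"
    by (simp add: forall_3 JN_def sum_3 matrix_linear_simps tq quaternion_products[OF assms] scaleR_2)
  then show ?thesis by blast
qed

context triple_chart
begin

lemma M_G: "x \<in> U \<Longrightarrow> transpose (M i x) ** G x = - (G x ** M i x)"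
  unfolding transpose_M unfolding S_M_K(2) by (simp add: matrix_linear_simps matrix_mul_assoc)

lemma M_skew:
  assumes x: "x \<in> U"
  shows "(M i x *v a) \<bullet> (G x *v b) = - (a \<bullet> (G x *v (M i x *v b)))"
proof -
  have "(M i x *v a) \<bullet> (G x *v b) = a \<bullet> (transpose (M i x) *v (G x *v b))" by (rule vector_inner_mult)
  also have "\<dots> = - (a \<bullet> (G x *v (M i x *v b)))"
    by (simp add: M_G[OF x] matrix_linear_simps matrix_vector_mul_assoc)
  finally show ?thesis .
qed

lemma G_symmetric:
  assumes x: "x \<in> U"
  shows "a \<bullet> (G x *v b) = b \<bullet> (G x *v a)"
  using vector_inner_mult[of "G x" b a] by (simp add: transpose_G[OF x] inner_commute)

text \<open>By \<open>wedge22_S\<close> the 4-form \<open>\<epsilon>\<^sup>i\<^sup>j\<^sup>k \<Sigma>\<^sup>i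
  \<and> a\<^sup>j \<and> b\<^sup>k\<close> contracts \<open>a\<^sup>j\<close> and \<open>b\<^sup>k\<close> with
  \<open>\<Sigma>\<^sup>i\<close>, which is \<open>J1\<close>; with the eigenvalues \<open>2\<close> and
  \<open>-1\<close> of \<open>J1\<close> this explains why the pairing is indefinite.\<close>

lemma EL_pairing:
  assumes x: "x \<in> U"
  shows "(\<Sum>i\<in>UNIV. \<Sum>j\<in>UNIV. \<Sum>k\<in>UNIV. eps3 i j k * wedge22 (S x $ i) (wedge11 (a$j) (b$k))) / vS (S x)
    = - (\<Sum>i\<in>UNIV. a$i \<bullet> (G x *v (J1_flat (Mx x) b $ i)))"
proof -
  have w: "wedge22 (S x $ i) (wedge11 u v) / vS (S x) = u \<bullet> (G x *v (M i x *v v))" for i u v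
  proof -
    let ?N = "\<chi> \<mu> \<nu>. u$\<mu> * v$\<nu>"
    have "wedge11 u v = ?N - transpose ?N"
      by (simp add: wedge11_def transpose_def vec_eq_iff mult.commute)
    then have "wedge22 (S x $ i) (wedge11 u v) / vS (S x) = K i x \<bullet> ?N" by (simp add: wedge22_S[OF x])
    also have "\<dots> = u \<bullet> (K i x *v v)"
      by (simp add: matrix_inner_sum inner_vec_def matrix_vector_mult_def sum_distrib_left ac_simps)
    finally show ?thesis by (simp add: S_M_K(3)[OF x] matrix_vector_mul_assoc)
  qed
  show ?thesis
    by (simp add: sum_divide_distrib sum_3 J1_flat_nth matrix_linear_simps inner_diff_right w add_divide_distrib diff_divide_distrib)
qed

lemma J1_selfadjoint:
  assumes x: "x \<in> U"
  shows "(\<Sum>i\<in>UNIV. J1_flat (Mx x) a $ i \<bullet> (G x *v b$i)) = (\<Sum>i\<in>UNIV. a$i \<bullet> (G x *v (J1_flat (Mx x) b $ i)))"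
  by (simp add: sum_3 J1_flat_nth matrix_linear_simps inner_diff_left inner_diff_right M_skew[OF x])

lemma J1_M:
  assumes x: "x \<in> U"
  shows "J1_flat (Mx x) (\<chi> i. M i x *v v) $ j = 2 *\<^sub>R (M j x *v v)"
proof -
  have "\<forall>j. J1_flat (Mx x) (\<chi> i. M i x *v v) $ j = 2 *\<^sub>R (M j x *v v)"
    by (simp add: forall_3 J1_flat_nth quaternion_products_vector[OF M_quaternion[OF x]] scaleR_2)
  then show ?thesis by blast
qed

lemma inner2_eq: "inner2 (g x) h k = h \<bullet> (G x ** k ** G x)"
  by (simp add: inner2_def matrix_inner_sum G_def)

lemma smooth_J1: "smooth_on U a \<Longrightarrow> smooth_on U (\<lambda>y. J1_flat (Mx y) (a y))"
  unfolding J1_flat_def by (intro smooth_rules smooth_M)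

lemma G_inner_outer: "G x \<bullet> (\<chi> \<mu>. u $ \<mu> *\<^sub>R v) = u \<bullet> (G x *v v)"
  by (simp add: matrix_inner_sum inner_vec_def matrix_vector_mult_def sum_distrib_left ac_simps)

lemma contract3_inner: "k \<bullet> (\<chi> \<mu>. T \<mu> *v v) = contract3 k T \<bullet> v"
  by (simp add: matrix_inner_sum contract3_def inner_sum_left matrix_vector_mul_component)

lemma div_scaleR:
  assumes x: "x \<in> U" and f: "smooth_on U f" and a: "smooth_on U a"
  shows "G x \<bullet> cov1 g (\<lambda>y. f y *\<^sub>R a y) x = f x * (G x \<bullet> cov1 g a x) + grad f x \<bullet> (G x *v a x)"
  by (simp add: cov1_scaleR[OF x diff[OF f x] diff[OF a x]] inner_add_right G_inner_outer)

lemma div_tensor: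
  assumes x: "x \<in> U" and T: "smooth_on U T" and v: "smooth_on U v" and Tsym: "transpose (T x) = T x"
  shows "G x \<bullet> cov1 g (\<lambda>y. T y *v (G y *v v y)) x = contract3 (G x) (cov2 g T x) \<bullet> (G x *v v x)
     + cov1 g v x \<bullet> (G x ** T x ** G x)"
proof -
  have "G x \<bullet> (cov1 g v x ** G x ** T x) = cov1 g v x \<bullet> (G x ** T x ** G x)"
    using matrix_inner_mult_right[of "cov1 g v x" "G x ** T x" "G x"]
    by (simp add: inner_commute matrix_mul_assoc matrix_transpose_mul Tsym transpose_G[OF x])
  then show ?thesis
    by (simp add: cov1_tensor[OF x diff[OF T x] diff[OF v x]] inner_add_right contract3_inner Tsym)
qed

text \<open>The potentials pair the two arguments through the symbol of the operator. Their divergence splits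
  into the two pairings because the tensors in the symbol are parallel.\<close>

lemma green_dt1:
  assumes x: "x \<in> U" and \<xi>: "smooth_on U \<xi>" and h: "smooth_on U h" and T: "smooth_on U T"
    and T0: "T x \<in> sym0 (g x)"
  shows "G x \<bullet> cov1 g (\<lambda>y. - (r / 4) *\<^sub>R (h y *\<^sub>R \<xi> y) + r *\<^sub>R (T y *v (G y *v \<xi> y))) x
    = (1/4) * (- r * (G x \<bullet> cov1 g \<xi> x)) * h x
      + inner2 (g x) (r *\<^sub>R symtf (g x) (G x) (cov1 g \<xi> x)) (T x)
      - \<xi> x \<bullet> (G x *v ((r / 4) *\<^sub>R grad h x - r *\<^sub>R contract3 (G x) (cov2 g T x)))"
proof -
  have Ts: "transpose (T x) = T x" "G x \<bullet> T x = 0" using T0 sym0_iff'[OF x] by auto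
  have s1: "smooth_on U (\<lambda>y. h y *\<^sub>R \<xi> y)" and s2: "smooth_on U (\<lambda>y. T y *v (G y *v \<xi> y))"
    by (intro smooth_rules h \<xi> T smooth_G)+
  have s3: "smooth_on U (\<lambda>y. - (r / 4) *\<^sub>R (h y *\<^sub>R \<xi> y))" and s4: "smooth_on U (\<lambda>y. r *\<^sub>R (T y *v (G y *v \<xi> y)))"
    by (intro smooth_rules s1 s2)+
  let ?N = "cov1 g \<xi> x" and ?H = "G x ** T x ** G x"
  have Hs: "transpose ?H = ?H" by (simp add: matrix_transpose_mul Ts transpose_G[OF x] matrix_mul_assoc)
  have Nt: "transpose ?N \<bullet> ?H = ?N \<bullet> ?H" using matrix_inner_transpose[of ?N ?H] by (simp add: Hs)
  have gH: "g x \<bullet> ?H = 0"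
  proof -
    have "g x \<bullet> ?H = (g x ** G x) \<bullet> (G x ** T x)"
      using matrix_inner_mult_right[of "G x ** T x" "G x" "g x"] by (simp add: transpose_G[OF x] inner_commute)
    also have "\<dots> = G x \<bullet> T x"
      using matrix_inner_mult_left[of "G x" "T x" "mat 1"] by (simp add: G_g[OF x] transpose_G[OF x] inner_commute)
    finally show ?thesis using Ts by simp
  qed
  have i2: "inner2 (g x) (r *\<^sub>R symtf (g x) (G x) ?N) (T x) = r * (?N \<bullet> ?H)"
    by (simp add: inner2_eq symtf_def inner_diff_left inner_add_left Nt gH)
  have e: "cov1 g (\<lambda>y. - (r / 4) *\<^sub>R (h y *\<^sub>R \<xi> y) + r *\<^sub>R (T y *v (G y *v \<xi> y))) x
      = - (r / 4) *\<^sub>R cov1 g (\<lambda>y. h y *\<^sub>R \<xi> y) x + r *\<^sub>R cov1 g (\<lambda>y. T y *v (G y *v \<xi> y)) x"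
    unfolding cov1_add[OF diff[OF s3 x] diff[OF s4 x]] cov1_const_scaleR[OF diff[OF s1 x]] cov1_const_scaleR[OF diff[OF s2 x]] ..
  show ?thesis
    using i2 unfolding e
    by (simp add: inner_add_right div_scaleR[OF x h \<xi>] div_tensor[OF x T \<xi> Ts(1)]
        matrix_linear_simps inner_diff_right G_symmetric[OF x, of "\<xi> x"] algebra_simps)
qed

lemma green_gradient:
  fixes \<chi>' :: "real^4 \<Rightarrow> real^3" and b :: "real^4 \<Rightarrow> real^4^3"
  assumes x: "x \<in> U" and \<chi>: "smooth_on U \<chi>'" and b: "smooth_on U b"
  shows "G x \<bullet> cov1 g (\<lambda>y. \<Sum>i\<in>UNIV. (\<chi>' y $ i) *\<^sub>R (b y $ i)) x
    = (\<Sum>i\<in>UNIV. \<chi>' x $ i * (G x \<bullet> cov1 g (\<lambda>y. b y $ i) x))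
      + (\<Sum>i\<in>UNIV. b x $ i \<bullet> (G x *v grad (\<lambda>y. \<chi>' y $ i) x))"
proof -
  have s: "smooth_on U (\<lambda>y. \<chi>' y $ i)" "smooth_on U (\<lambda>y. b y $ i)" for i
    by (intro smooth_rules \<chi> b)+
  have sp: "smooth_on U (\<lambda>y. (\<chi>' y $ i) *\<^sub>R (b y $ i))" for i by (intro smooth_rules \<chi> b)
  show ?thesis
    by (simp add: cov1_sum[OF diff[OF sp x]] inner_sum_right div_scaleR[OF x s] sum.distrib G_symmetric[OF x, of "b x $ _"])
qed

lemma green_d2:
  assumes x: "x \<in> U" and h: "smooth_on U h" and q: "smooth_on U q" and T: "smooth_on U T"
    and T0: "T x \<in> sym0 (g x)" and b: "smooth_on U b"
  defines "N \<equiv> \<lambda>i. cov1 g (\<lambda>y. b y $ i) x"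
  shows "G x \<bullet> cov1 g (\<lambda>y. (1/4) *\<^sub>R (h y *\<^sub>R (\<Sum>i\<in>UNIV. M i y *v (b y $ i))) - 2 *\<^sub>R (\<Sum>i\<in>UNIV. (q y $ i) *\<^sub>R (b y $ i))
        + (\<Sum>i\<in>UNIV. M i y *v (T y *v (G y *v (b y $ i))))) x
    = - (\<Sum>i\<in>UNIV. ((1/4) *\<^sub>R (M i x *v grad h x) + 2 *\<^sub>R grad (\<lambda>y. q y $ i) x - contract3 (K i x) (cov2 g T x)) \<bullet> (G x *v (b x $ i)))
      - ((1/4) * h x * (- (\<Sum>i\<in>UNIV. G x \<bullet> (N i ** transpose (M i x)))) + 8 * (\<Sum>i\<in>UNIV. q x $ i * ((1/4) * (G x \<bullet> N i)))
         + inner2 (g x) (T x) (symtf (g x) (G x) (\<Sum>i\<in>UNIV. M i x ** N i)))"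
proof -
  have Ts: "transpose (T x) = T x" "G x \<bullet> T x = 0" using T0 sym0_iff'[OF x] by auto
  have sb: "smooth_on U (\<lambda>y. b y $ i)" for i by (intro smooth_rules b)
  have sm: "smooth_on U (\<lambda>y. \<Sum>i\<in>UNIV. M i y *v (b y $ i))" by (intro smooth_rules smooth_M b)
  have smi: "smooth_on U (\<lambda>y. M i y *v (b y $ i))" for i by (intro smooth_rules smooth_M b)
  have s1: "smooth_on U (\<lambda>y. h y *\<^sub>R (\<Sum>i\<in>UNIV. M i y *v (b y $ i)))" by (intro smooth_rules h sm)
  have s2: "smooth_on U (\<lambda>y. \<Sum>i\<in>UNIV. (q y $ i) *\<^sub>R (b y $ i))" by (intro smooth_rules q b)
  have s3: "smooth_on U (\<lambda>y. T y *v (G y *v (b y $ i)))" for i by (intro smooth_rules T smooth_G b)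
  have s4: "smooth_on U (\<lambda>y. M i y *v (T y *v (G y *v (b y $ i))))" for i by (intro smooth_rules smooth_M s3)
  have s5: "smooth_on U (\<lambda>y. \<Sum>i\<in>UNIV. M i y *v (T y *v (G y *v (b y $ i))))" by (intro smooth_rules s4)
  have s6: "smooth_on U (\<lambda>y. (1/4) *\<^sub>R (h y *\<^sub>R (\<Sum>i\<in>UNIV. M i y *v (b y $ i))))" "smooth_on U (\<lambda>y. 2 *\<^sub>R (\<Sum>i\<in>UNIV. (q y $ i) *\<^sub>R (b y $ i)))"
    by (intro smooth_rules s1 s2)+
  have t1: "G x \<bullet> cov1 g (\<lambda>y. h y *\<^sub>R (\<Sum>i\<in>UNIV. M i y *v (b y $ i))) x
      = h x * (\<Sum>i\<in>UNIV. G x \<bullet> (N i ** transpose (M i x))) - (\<Sum>i\<in>UNIV. (M i x *v grad h x) \<bullet> (G x *v (b x $ i)))"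
    by (simp add: div_scaleR[OF x h sm] cov1_sum[OF diff[OF smi x]] cov1_M[OF x diff[OF sb x]] N_def inner_sum_right
        linear_sum[OF matrix_vector_mul_linear] M_skew[OF x] sum_negf)
  have t2: "G x \<bullet> cov1 g (\<lambda>y. \<Sum>i\<in>UNIV. (q y $ i) *\<^sub>R (b y $ i)) x
      = (\<Sum>i\<in>UNIV. q x $ i * (G x \<bullet> N i)) + (\<Sum>i\<in>UNIV. grad (\<lambda>y. q y $ i) x \<bullet> (G x *v (b x $ i)))"
    by (simp add: green_gradient[OF x q b] N_def G_symmetric[OF x, of "b x $ _"])
  have t3: "G x \<bullet> cov1 g (\<lambda>y. M i y *v (T y *v (G y *v (b y $ i)))) x
      = contract3 (K i x) (cov2 g T x) \<bullet> (G x *v (b x $ i)) - (G x ** T x ** G x) \<bullet> (M i x ** N i)" for i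
  proof -
    have "G x \<bullet> cov1 g (\<lambda>y. M i y *v (T y *v (G y *v (b y $ i)))) x = K i x \<bullet> cov1 g (\<lambda>y. T y *v (G y *v (b y $ i))) x"
      by (simp add: cov1_M[OF x diff[OF s3 x]] matrix_inner_mult_transpose S_M_K(3)[OF x])
    also have "\<dots> = contract3 (K i x) (cov2 g T x) \<bullet> (G x *v (b x $ i)) + K i x \<bullet> (N i ** G x ** T x)"
      by (simp add: cov1_tensor[OF x diff[OF T x] diff[OF sb x]] inner_add_right contract3_inner Ts N_def)
    also have "K i x \<bullet> (N i ** G x ** T x) = (K i x ** T x ** G x) \<bullet> N i"
      using matrix_inner_mult_right[of "N i" "G x ** T x" "K i x"]
      by (simp add: inner_commute matrix_mul_assoc matrix_transpose_mul Ts transpose_G[OF x])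
    also have "\<dots> = - ((G x ** T x ** G x) \<bullet> (M i x ** N i))"
      using matrix_inner_mult_left[of "M i x" "N i" "G x ** T x ** G x"]
      by (simp add: inner_commute matrix_mul_assoc M_G[OF x] matrix_linear_simps S_M_K(3)[OF x])
    finally show ?thesis by simp
  qed
  let ?X = "\<Sum>i\<in>UNIV. M i x ** N i"
  have "inner2 (g x) (T x) (symtf (g x) (G x) ?X) = (G x ** T x ** G x) \<bullet> ?X"
  proof -
    have e: "T x \<bullet> (G x ** Y ** G x) = (G x ** T x ** G x) \<bullet> Y" for Y
      using matrix_inner_mult_right[of "G x ** Y" "G x" "T x"] matrix_inner_mult_left[of "G x" Y "T x ** G x"]
      by (simp add: inner_commute matrix_mul_assoc transpose_G[OF x])
    have Hs: "transpose (G x ** T x ** G x) = G x ** T x ** G x"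
      by (simp add: matrix_transpose_mul Ts transpose_G[OF x] matrix_mul_assoc)
    have "(G x ** T x ** G x) \<bullet> transpose ?X = (G x ** T x ** G x) \<bullet> ?X"
      using matrix_inner_transpose[of "G x ** T x ** G x" ?X] by (simp add: Hs)
    moreover have "(G x ** T x ** G x) \<bullet> g x = 0"
      using e[of "g x"] Ts by (simp add: matrix_mul_assoc[symmetric] G_g[OF x] inner_commute)
    ultimately show ?thesis
      by (simp add: inner2_eq e symtf_def inner_diff_right inner_add_right)
  qed
  moreover have "G x \<bullet> cov1 g (\<lambda>y. \<Sum>i\<in>UNIV. M i y *v (T y *v (G y *v (b y $ i)))) x
      = (\<Sum>i\<in>UNIV. contract3 (K i x) (cov2 g T x) \<bullet> (G x *v (b x $ i))) - (G x ** T x ** G x) \<bullet> ?X"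
    by (simp add: cov1_sum[OF diff[OF s4 x]] inner_sum_right t3 sum_subtractf)
  moreover have "cov1 g (\<lambda>y. (1/4) *\<^sub>R (h y *\<^sub>R (\<Sum>i\<in>UNIV. M i y *v (b y $ i))) - 2 *\<^sub>R (\<Sum>i\<in>UNIV. (q y $ i) *\<^sub>R (b y $ i))
        + (\<Sum>i\<in>UNIV. M i y *v (T y *v (G y *v (b y $ i))))) x
      = (1/4) *\<^sub>R cov1 g (\<lambda>y. h y *\<^sub>R (\<Sum>i\<in>UNIV. M i y *v (b y $ i))) x - 2 *\<^sub>R cov1 g (\<lambda>y. \<Sum>i\<in>UNIV. (q y $ i) *\<^sub>R (b y $ i)) x
        + cov1 g (\<lambda>y. \<Sum>i\<in>UNIV. M i y *v (T y *v (G y *v (b y $ i)))) x"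
    unfolding cov1_add[OF differentiable_diff[OF diff[OF s6(1) x] diff[OF s6(2) x]] diff[OF s5 x]]
        cov1_diff[OF diff[OF s6(1) x] diff[OF s6(2) x]] cov1_const_scaleR[OF diff[OF s1 x]] cov1_const_scaleR[OF diff[OF s2 x]] ..
  ultimately show ?thesis
    by (simp add: inner_add_right inner_diff_right t1 t2 inner_add_left inner_diff_left sum.distrib sum_subtractf sum_distrib_left[symmetric])
       (simp add: sum_divide_distrib[symmetric] field_simps)
qed

lemma green_dt4:
  fixes \<chi>' :: "real^4 \<Rightarrow> real^3"
  assumes x: "x \<in> U" and \<chi>: "smooth_on U \<chi>'" and t: "smooth_on U t"
  shows "G x \<bullet> cov1 g (\<lambda>y. - (\<Sum>i\<in>UNIV. (\<chi>' y $ i) *\<^sub>R (M i y *v t y))) x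
    = (\<Sum>i\<in>UNIV. M i x *v grad (\<lambda>y. \<chi>' y $ i) x) \<bullet> (G x *v t x)
      - (\<Sum>i\<in>UNIV. \<chi>' x $ i * (G x \<bullet> (cov1 g t x ** transpose (M i x))))"
proof -
  have sb: "smooth_on U (\<lambda>y. \<chi> i. M i y *v t y)" by (intro smooth_rules smooth_M t)
  have s: "smooth_on U (\<lambda>y. \<Sum>i\<in>UNIV. (\<chi>' y $ i) *\<^sub>R (M i y *v t y))" by (intro smooth_rules \<chi> smooth_M t)
  have "(M i x *v u) \<bullet> (G x *v t x) = - ((M i x *v t x) \<bullet> (G x *v u))" for i u
    using M_skew[OF x, of i u "t x"] G_symmetric[OF x, of u "M i x *v t x"] by simp
  then show ?thesis
    using green_gradient[OF x \<chi> sb]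
    by (simp add: cov1_minus[OF diff[OF s x]] cov1_M[OF x diff[OF t x]] inner_sum_left sum_negf)
qed

lemma integral_adjoint:
  assumes w: "smooth_on U w" and C: "compact C" "C \<subseteq> U" and z: "\<And>x. x \<in> U \<Longrightarrow> x \<notin> C \<Longrightarrow> w x = 0"
    and eq: "\<And>x. x \<in> U \<Longrightarrow> P x - Q x = G x \<bullet> cov1 g w x"
  shows "integral U (\<lambda>x. P x * \<bar>vS (S x)\<bar>) = integral U (\<lambda>x. Q x * \<bar>vS (S x)\<bar>)"
proof -
  have D: "((\<lambda>x. P x * vol x - Q x * vol x) has_integral 0) U"
    by (rule has_integral_eq[OF _ integral_divergence[OF w C z]]) (simp add: eq[symmetric] algebra_simps)
  \<comment> \<open>If one side is not integrable, neither is the other, and both integrals are zero by convention.\<close>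
  have "((\<lambda>x. P x * vol x) has_integral k) U \<longleftrightarrow> ((\<lambda>x. Q x * vol x) has_integral k) U" for k
    using has_integral_diff[OF _ D, of "\<lambda>x. P x * vol x" k] has_integral_add[OF _ D, of "\<lambda>x. Q x * vol x" k] by auto
  then have "integral U (\<lambda>x. P x * vol x) = integral U (\<lambda>x. Q x * vol x)"
    by (cases "(\<lambda>x. P x * vol x) integrable_on U")
       (auto simp: integrable_on_def not_integrable_integral dest: integral_unique)
  then show ?thesis by (simp add: vol_def)
qed

end

section \<open>The adjoint operators on a chart\<close>

definition gradE :: "(real^4 \<Rightarrow> real^3) \<Rightarrow> real^4 \<Rightarrow> real^4^3" where
  "gradE q x = (\<chi> i. grad (\<lambda>y. q y $ i) x)"

definition dt1_adjoint :: "(sfib, real^4) local_op" where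
  "dt1_adjoint S g s x = (sqrt 2 / 4) *\<^sub>R grad (\<lambda>y. fst (s y)) x
     - sqrt 2 *\<^sub>R contract3 (matrix_inv (g x)) (cov2 g (\<lambda>y. snd (snd (s y))) x)"

definition dt3_adjoint :: "(real^3, real^4^3) local_op" where
  "dt3_adjoint S g \<chi>' x = - (sqrt 2 / 2) *\<^sub>R J1_flat (mixS (S x) (g x)) (gradE \<chi>' x)"

definition d3_adjoint :: "(real^3, real^4^3) local_op" where
  "d3_adjoint S g \<chi>' x = gradE \<chi>' x"

definition Phi_adjoint :: "(real^4, real^4^3) local_op" where
  "Phi_adjoint S g \<xi> x = (\<chi> i. (1/2) *\<^sub>R (mixS (S x) (g x) i *v \<xi> x))"

text \<open>The formal adjoint of the whole operator in terms of the derivatives of \<open>t\<close> and of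
  \<open>J1 a\<close>. The adjoint of \<open>d2\<close> is its \<open>S\<close>-component at \<open>t =
  0\<close>.\<close>

definition D_adjoint :: "((real^4) \<times> (real^4^3), sfib \<times> (real^3)) local_op" where
  "D_adjoint S g p x = (let M = mixS (S x) (g x); G = matrix_inv (g x); N = cov1 g (\<lambda>y. fst (p y)) x;
       Nb = (\<lambda>i. cov1 g (\<lambda>y. J1_flat (mixS (S y) (g y)) (snd (p y)) $ i) x) in
     ((adj_h (sqrt 2) M G N Nb, \<chi> i. (1/4) * (G \<bullet> Nb i), adj_t (sqrt 2) M (g x) G N Nb),
      \<chi> i. adj_c (sqrt 2) M G N Nb i))"

definition d2_adjoint :: "(real^4^3, sfib) local_op" where
  "d2_adjoint S g a x = fst (D_adjoint S g (\<lambda>y. (0, a y)) x)"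

lemma symtf_add: "symtf g G (X + Y) = symtf g G X + symtf g G Y"
  by (simp add: symtf_def inner_add_right transpose_add algebra_simps add_divide_distrib)

lemma symtf_scaleR: "symtf g G (c *\<^sub>R X) = c *\<^sub>R symtf g G X"
  by (simp add: symtf_def transpose_scaleR algebra_simps)

context triple_chart
begin

lemma mixS_M: "mixS (S x) (g x) = Mx x"
  by (simp add: M_def fun_eq_iff)

text \<open>The condition \<open>Z\<close> records where the potential vanishes. It will say that one of the two
  arguments of a pairing is zero, so that the potential has compact support as soon as one of them has.\<close>

definition divergence :: "(real^4 \<Rightarrow> real) \<Rightarrow> (real^4 \<Rightarrow> bool) \<Rightarrow> bool" where
  "divergence f Z \<longleftrightarrow> (\<exists>w. smooth_on U w \<and> (\<forall>x\<in>U. f x = G x \<bullet> cov1 g w x) \<and> (\<forall>x\<in>U. Z x \<longrightarrow> w x = 0))"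

lemma divergenceI:
  "smooth_on U w \<Longrightarrow> (\<And>x. x \<in> U \<Longrightarrow> f x = G x \<bullet> cov1 g w x) \<Longrightarrow> (\<And>x. x \<in> U \<Longrightarrow> Z x \<Longrightarrow> w x = 0) \<Longrightarrow> divergence f Z"
  unfolding divergence_def by blast

lemma divergence_mono: "divergence f Z \<Longrightarrow> (\<And>x. Z' x \<Longrightarrow> Z x) \<Longrightarrow> divergence f Z'"
  unfolding divergence_def by blast

lemma divergence_scale:
  assumes "divergence f Z" "\<And>x. x \<in> U \<Longrightarrow> h x = c * f x"
  shows "divergence h Z"
proof -
  obtain w where w: "smooth_on U w" "\<forall>x\<in>U. f x = G x \<bullet> cov1 g w x" "\<forall>x\<in>U. Z x \<longrightarrow> w x = 0"
    using assms(1) unfolding divergence_def by blast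
  have "smooth_on U (\<lambda>y. c *\<^sub>R w y)" by (intro smooth_rules w)
  moreover have "h x = G x \<bullet> cov1 g (\<lambda>y. c *\<^sub>R w y) x" if "x \<in> U" for x
    using assms(2)[OF that] w(2) that by (simp add: cov1_const_scaleR[OF diff[OF w(1) that]])
  ultimately show ?thesis unfolding divergence_def using w(3) by (intro exI[of _ "\<lambda>y. c *\<^sub>R w y"]) simp
qed

lemma divergence_add:
  assumes "divergence f1 Z1" "divergence f2 Z2" "\<And>x. x \<in> U \<Longrightarrow> h x = f1 x + f2 x"
    "\<And>x. Z x \<Longrightarrow> Z1 x" "\<And>x. Z x \<Longrightarrow> Z2 x"
  shows "divergence h Z"
proof -
  obtain w1 where w1: "smooth_on U w1" "\<forall>x\<in>U. f1 x = G x \<bullet> cov1 g w1 x" "\<forall>x\<in>U. Z1 x \<longrightarrow> w1 x = 0"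
    using assms(1) unfolding divergence_def by blast
  obtain w2 where w2: "smooth_on U w2" "\<forall>x\<in>U. f2 x = G x \<bullet> cov1 g w2 x" "\<forall>x\<in>U. Z2 x \<longrightarrow> w2 x = 0"
    using assms(2) unfolding divergence_def by blast
  have "smooth_on U (\<lambda>y. w1 y + w2 y)" by (intro smooth_rules w1 w2)
  moreover have "h x = G x \<bullet> cov1 g (\<lambda>y. w1 y + w2 y) x" if "x \<in> U" for x
    using assms(3)[OF that] w1(2) w2(2) that
    by (simp add: cov1_add[OF diff[OF w1(1) that] diff[OF w2(1) that]] inner_add_right)
  ultimately show ?thesis unfolding divergence_def using w1(3) w2(3) assms(4,5)
    by (intro exI[of _ "\<lambda>y. w1 y + w2 y"]) simp
qed

lemma divergence_integral:
  assumes "divergence (\<lambda>x. P x - Q x) Z" "compact C" "C \<subseteq> U" "\<And>x. x \<in> U \<Longrightarrow> x \<notin> C \<Longrightarrow> Z x"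
  shows "integral U (\<lambda>x. P x * \<bar>vS (S x)\<bar>) = integral U (\<lambda>x. Q x * \<bar>vS (S x)\<bar>)"
proof -
  obtain w where w: "smooth_on U w" "\<forall>x\<in>U. P x - Q x = G x \<bullet> cov1 g w x" "\<forall>x\<in>U. Z x \<longrightarrow> w x = 0"
    using assms(1) unfolding divergence_def by blast
  show ?thesis by (rule integral_adjoint[OF w(1) assms(2,3)]) (use w assms(4) in auto)
qed

abbreviation "ipS x s t \<equiv> (1/4) * fst s * fst t + 8 * (fst (snd s) \<bullet> fst (snd t)) + inner2 (g x) (snd (snd s)) (snd (snd t))"

abbreviation "ipEL x a b \<equiv> - (\<Sum>i\<in>UNIV. a$i \<bullet> (G x *v (J1_flat (Mx x) b $ i)))"

lemma op_dt1': "\<xi> differentiable (at x) \<Longrightarrow> dt1 (- sqrt 2) 0 (sqrt 2 / 2) S g \<xi> x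
   = (- sqrt 2 * (G x \<bullet> cov1 g \<xi> x), 0, sqrt 2 *\<^sub>R symtf (g x) (G x) (cov1 g \<xi> x))"
  by (simp add: op_dt1 symtf_def algebra_simps zero_vec_def)

lemma G_inv: "matrix_inv (g x) = G x"
  by (simp add: G_def)

lemma D_adjoint_eq: "D_adjoint S g p x = (let N = cov1 g (\<lambda>y. fst (p y)) x;
       Nb = (\<lambda>i. cov1 g (\<lambda>y. J1_flat (Mx y) (snd (p y)) $ i) x) in
     ((adj_h (sqrt 2) (Mx x) (G x) N Nb, \<chi> i. (1/4) * (G x \<bullet> Nb i), adj_t (sqrt 2) (Mx x) (g x) (G x) N Nb),
      \<chi> i. adj_c (sqrt 2) (Mx x) (G x) N Nb i))"
  by (simp add: D_adjoint_def mixS_M G_inv Let_def)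

lemma cov1_zero [simp]: "cov1 g (\<lambda>y. 0) x = 0"
  by (simp add: cov1_def vec_eq_iff)

lemma d2_adjoint_eq: "d2_adjoint S g a x = (let Nb = (\<lambda>i. cov1 g (\<lambda>y. J1_flat (Mx y) (a y) $ i) x) in
     (- (\<Sum>i\<in>UNIV. G x \<bullet> (Nb i ** transpose (M i x))), \<chi> i. (1/4) * (G x \<bullet> Nb i),
      symtf (g x) (G x) (\<Sum>i\<in>UNIV. M i x ** Nb i)))"
  by (simp add: d2_adjoint_def D_adjoint_eq Let_def adj_h_def adj_t_def)

text \<open>By \<open>JN_square\<close>, \<open>dt3\<close> applied to \<open>a\<close> is a first-order
  expression in \<open>J1 a\<close>, so both components of the adjoint depend on \<open>a\<close> through
  \<open>J1 a\<close> only.\<close>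

lemma D_adjoint_split:
  assumes p: "smooth_on U p" and x: "x \<in> U"
  shows "fst (D_adjoint S g p x) = dt1 (- sqrt 2) 0 (sqrt 2 / 2) S g (\<lambda>y. fst (p y)) x + d2_adjoint S g (\<lambda>y. snd (p y)) x"
    and "snd (D_adjoint S g p x) = (\<chi> i. G x \<bullet> (cov1 g (\<lambda>y. fst (p y)) x ** transpose (M i x)))
      + dt3 (- sqrt 2) (- sqrt 2 / 2) S g (\<lambda>y. snd (p y)) x"
proof -
  have t: "smooth_on U (\<lambda>y. fst (p y))" and a: "smooth_on U (\<lambda>y. snd (p y))" by (intro smooth_rules p)+
  show "fst (D_adjoint S g p x) = dt1 (- sqrt 2) 0 (sqrt 2 / 2) S g (\<lambda>y. fst (p y)) x + d2_adjoint S g (\<lambda>y. snd (p y)) x"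
    by (simp add: D_adjoint_eq d2_adjoint_eq Let_def op_dt1'[OF diff[OF t x]] adj_h_def adj_t_def symtf_add symtf_scaleR)
  show "snd (D_adjoint S g p x) = (\<chi> i. G x \<bullet> (cov1 g (\<lambda>y. fst (p y)) x ** transpose (M i x)))
      + dt3 (- sqrt 2) (- sqrt 2 / 2) S g (\<lambda>y. snd (p y)) x"
    by (simp add: D_adjoint_eq Let_def op_dt3[OF x diff[OF a x]] adj_c_def cov1_J1[OF x diff[OF a x]]
        JN_square[OF M_quaternion[OF x]] vec_eq_iff inner_add_right algebra_simps)
qed

lemma divergence_dt1:
  assumes \<xi>: "smooth_on U \<xi>" and s: "smooth_on U s" and s0: "\<And>x. x \<in> U \<Longrightarrow> snd (snd (s x)) \<in> sym0 (g x)"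
  shows "divergence (\<lambda>x. ipS x (dt1 (- sqrt 2) 0 (sqrt 2 / 2) S g \<xi> x) (s x) - \<xi> x \<bullet> (G x *v dt1_adjoint S g s x))
    (\<lambda>x. \<xi> x = 0 \<or> s x = 0)"
proof -
  have h: "smooth_on U (\<lambda>y. fst (s y))" and T: "smooth_on U (\<lambda>y. snd (snd (s y)))" by (intro smooth_rules s)+
  have w: "smooth_on U (\<lambda>y. - (sqrt 2 / 4) *\<^sub>R (fst (s y) *\<^sub>R \<xi> y) + sqrt 2 *\<^sub>R (snd (snd (s y)) *v (G y *v \<xi> y)))"
    by (intro smooth_rules h T \<xi> smooth_G)
  show ?thesis
  proof (rule divergenceI[OF w])
    fix x assume x: "x \<in> U"
    show "ipS x (dt1 (- sqrt 2) 0 (sqrt 2 / 2) S g \<xi> x) (s x) - \<xi> x \<bullet> (G x *v dt1_adjoint S g s x)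
      = G x \<bullet> cov1 g (\<lambda>y. - (sqrt 2 / 4) *\<^sub>R (fst (s y) *\<^sub>R \<xi> y) + sqrt 2 *\<^sub>R (snd (snd (s y)) *v (G y *v \<xi> y))) x"
      unfolding green_dt1[OF x \<xi> h T s0[OF x]] op_dt1'[OF diff[OF \<xi> x]] dt1_adjoint_def G_inv fst_conv snd_conv by simp
  qed auto
qed

lemma divergence_gradient:
  assumes \<chi>: "smooth_on U \<chi>'" and b: "smooth_on U b"
  shows "divergence (\<lambda>x. (\<chi> i. G x \<bullet> cov1 g (\<lambda>y. b y $ i) x) \<bullet> \<chi>' x + (\<Sum>i\<in>UNIV. b x $ i \<bullet> (G x *v (gradE \<chi>' x $ i))))
    (\<lambda>x. b x = 0 \<or> \<chi>' x = 0)"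
proof -
  have w: "smooth_on U (\<lambda>y. \<Sum>i\<in>UNIV. (\<chi>' y $ i) *\<^sub>R (b y $ i))" by (intro smooth_rules \<chi> b)
  show ?thesis unfolding divergence_def
    by (rule exI[of _ "\<lambda>y. \<Sum>i\<in>UNIV. (\<chi>' y $ i) *\<^sub>R (b y $ i)"], intro conjI w ballI impI)
       (auto simp: green_gradient[OF _ \<chi> b] gradE_def inner_vec_def[of "vec_lambda _"] mult.commute)
qed

lemma J1_flat_zero [simp]: "J1_flat Q 0 = 0"
  by (simp add: J1_flat_def vec_eq_iff)

lemma divergence_d3:
  assumes \<chi>: "smooth_on U \<chi>'" and a: "smooth_on U a"
  shows "divergence (\<lambda>x. d3 S g a x \<bullet> \<chi>' x - ipEL x (a x) (d3_adjoint S g \<chi>' x)) (\<lambda>x. a x = 0 \<or> \<chi>' x = 0)"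
  by (rule divergence_mono[OF divergence_scale[OF divergence_gradient[OF \<chi> smooth_J1[OF a]], of _ 1]])
     (auto simp: op_d3[OF _ diff[OF a]] d3_adjoint_def cov1_J1[OF _ diff[OF a]] J1_selfadjoint)

lemma divergence_dt3:
  assumes \<chi>: "smooth_on U \<chi>'" and a: "smooth_on U a"
  shows "divergence (\<lambda>x. dt3 (- sqrt 2) (- sqrt 2 / 2) S g a x \<bullet> \<chi>' x - ipEL x (a x) (dt3_adjoint S g \<chi>' x))
    (\<lambda>x. a x = 0 \<or> \<chi>' x = 0)"
proof -
  note b = smooth_J1[OF a]
  have e: "dt3 (- sqrt 2) (- sqrt 2 / 2) S g a x = - (sqrt 2 / 2) *\<^sub>R (\<chi> i. G x \<bullet> cov1 g (\<lambda>y. J1_flat (Mx y) (J1_flat (Mx y) (a y)) $ i) x)"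
    if x: "x \<in> U" for x
    by (simp add: op_dt3[OF x diff[OF a x]] cov1_J1[OF x diff[OF b x]] cov1_J1[OF x diff[OF a x]]
        JN_square[OF M_quaternion[OF x]] vec_eq_iff inner_add_right algebra_simps)
  have k: "ipEL x (a x) (dt3_adjoint S g \<chi>' x) = (sqrt 2 / 2) * (\<Sum>i\<in>UNIV. J1_flat (Mx x) (J1_flat (Mx x) (a x)) $ i \<bullet> (G x *v (gradE \<chi>' x $ i)))"
    if x: "x \<in> U" for x
  proof -
    have "(\<Sum>i\<in>UNIV. a x $ i \<bullet> (G x *v (J1_flat (Mx x) (J1_flat (Mx x) (gradE \<chi>' x)) $ i)))
        = (\<Sum>i\<in>UNIV. J1_flat (Mx x) (J1_flat (Mx x) (a x)) $ i \<bullet> (G x *v (gradE \<chi>' x $ i)))"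
      by (simp only: J1_selfadjoint[OF x, symmetric])
    then show ?thesis
      unfolding dt3_adjoint_def mixS_M J1_flat_scaleR
      by (simp add: matrix_linear_simps sum_distrib_left[symmetric] sum_negf sum_divide_distrib[symmetric])
  qed
  have "divergence (\<lambda>x. dt3 (- sqrt 2) (- sqrt 2 / 2) S g a x \<bullet> \<chi>' x - ipEL x (a x) (dt3_adjoint S g \<chi>' x))
    (\<lambda>x. J1_flat (Mx x) (J1_flat (Mx x) (a x)) = 0 \<or> \<chi>' x = 0)"
    by (rule divergence_scale[OF divergence_gradient[OF \<chi> smooth_J1[OF b]], of _ "- (sqrt 2 / 2)"])
       (simp only: k e inner_scaleR_left distrib_left mult_minus_left diff_conv_add_uminus)
  then show ?thesis by (rule divergence_mono) auto
qed

lemma divergence_d2: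
  assumes s: "smooth_on U s" and s0: "\<And>x. x \<in> U \<Longrightarrow> snd (snd (s x)) \<in> sym0 (g x)" and a: "smooth_on U a"
  shows "divergence (\<lambda>x. ipEL x (d2 S g s x) (a x) - ipS x (s x) (d2_adjoint S g a x)) (\<lambda>x. s x = 0 \<or> a x = 0)"
proof -
  have h: "smooth_on U (\<lambda>y. fst (s y))" and q: "smooth_on U (\<lambda>y. fst (snd (s y)))" and T: "smooth_on U (\<lambda>y. snd (snd (s y)))"
    by (intro smooth_rules s)+
  note b = smooth_J1[OF a]
  let ?b = "\<lambda>y. J1_flat (Mx y) (a y)"
  let ?w = "\<lambda>y. (1/4) *\<^sub>R (fst (s y) *\<^sub>R (\<Sum>i\<in>UNIV. M i y *v (?b y $ i))) - 2 *\<^sub>R (\<Sum>i\<in>UNIV. (fst (snd (s y)) $ i) *\<^sub>R (?b y $ i))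
        + (\<Sum>i\<in>UNIV. M i y *v (snd (snd (s y)) *v (G y *v (?b y $ i))))"
  have w: "smooth_on U ?w" by (intro smooth_rules smooth_M smooth_G h q T b)
  have i3: "q \<bullet> (\<chi> i. c * f i) = (\<Sum>i\<in>UNIV. q $ i * (c * f i))" for q :: "real^3" and c f
    by (simp add: inner_vec_def)
  show ?thesis
  proof (rule divergenceI[OF w])
    fix x assume x: "x \<in> U"
    have d: "d2 S g s x = (\<chi> i. (1/4) *\<^sub>R (M i x *v grad (\<lambda>y. fst (s y)) x) + 2 *\<^sub>R grad (\<lambda>y. fst (snd (s y)) $ i) x
       - contract3 (K i x) (cov2 g (\<lambda>y. snd (snd (s y))) x))"
      by (rule op_d2[OF x s s0])
    show "ipEL x (d2 S g s x) (a x) - ipS x (s x) (d2_adjoint S g a x) = G x \<bullet> cov1 g ?w x"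
      unfolding green_d2[OF x h q T s0[OF x] b] d d2_adjoint_eq Let_def fst_conv snd_conv i3
      by simp
  qed auto
qed

lemma divergence_dt4:
  fixes \<chi>' :: "real^4 \<Rightarrow> real^3"
  assumes \<chi>: "smooth_on U \<chi>'" and t: "smooth_on U t"
  shows "divergence (\<lambda>x. dt4 1 S g \<chi>' x \<bullet> (G x *v t x) - \<chi>' x \<bullet> (\<chi> i. G x \<bullet> (cov1 g t x ** transpose (M i x))))
    (\<lambda>x. \<chi>' x = 0 \<or> t x = 0)"
proof -
  let ?w = "\<lambda>y. - (\<Sum>i\<in>UNIV. (\<chi>' y $ i) *\<^sub>R (M i y *v t y))"
  have w: "smooth_on U ?w" by (intro smooth_rules smooth_M \<chi> t)
  show ?thesis unfolding divergence_def
    by (rule exI[of _ ?w], intro conjI w ballI impI)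
       (auto simp: green_dt4[OF _ \<chi> t] op_dt4 inner_vec_def[of _ "vec_lambda _"])
qed

lemma Phi_pairing:
  assumes x: "x \<in> U"
  shows "Phi S g a x \<bullet> (G x *v \<xi> x) = ipEL x (a x) (Phi_adjoint S g \<xi> x)"
proof -
  have "Phi_adjoint S g \<xi> x = (1/2) *\<^sub>R (\<chi> i. M i x *v \<xi> x)"
    by (simp add: Phi_adjoint_def mixS_M vec_eq_iff)
  then show ?thesis
    by (simp add: op_Phi J1_flat_scaleR J1_M[OF x] inner_sum_left M_skew[OF x] sum_negf matrix_linear_simps)
qed

lemma divergence_D:
  assumes u: "smooth_on U u" and u0: "\<And>x. x \<in> U \<Longrightarrow> snd (snd (fst (u x))) \<in> sym0 (g x)" and p: "smooth_on U p"
  shows "divergence (\<lambda>x. (dt1_adjoint S g (\<lambda>y. fst (u y)) x + dt4 1 S g (\<lambda>y. snd (u y)) x) \<bullet> (G x *v fst (p x))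
      + ipEL x (d2 S g (\<lambda>y. fst (u y)) x + dt3_adjoint S g (\<lambda>y. snd (u y)) x) (snd (p x))
      - (ipS x (fst (u x)) (fst (D_adjoint S g p x)) + snd (u x) \<bullet> snd (D_adjoint S g p x)))
    (\<lambda>x. u x = 0 \<or> p x = 0)"
proof -
  have s: "smooth_on U (\<lambda>y. fst (u y))" and \<chi>: "smooth_on U (\<lambda>y. snd (u y))"
    and t: "smooth_on U (\<lambda>y. fst (p y))" and a: "smooth_on U (\<lambda>y. snd (p y))"
    by (intro smooth_rules u p)+
  have dd: "divergence (\<lambda>x. (-1) * (ipS x (dt1 (- sqrt 2) 0 (sqrt 2 / 2) S g (\<lambda>y. fst (p y)) x) (fst (u x)) - fst (p x) \<bullet> (G x *v dt1_adjoint S g (\<lambda>y. fst (u y)) x))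
      + (-1) * (dt3 (- sqrt 2) (- sqrt 2 / 2) S g (\<lambda>y. snd (p y)) x \<bullet> snd (u x) - ipEL x (snd (p x)) (dt3_adjoint S g (\<lambda>y. snd (u y)) x))) (\<lambda>x. u x = 0 \<or> p x = 0)"
    by (rule divergence_add[OF divergence_scale[OF divergence_dt1[OF t s u0], of _ "-1"] divergence_scale[OF divergence_dt3[OF \<chi> a], of _ "-1"]])
       (auto simp: zero_prod_def)
  have ee: "divergence (\<lambda>x. (ipEL x (d2 S g (\<lambda>y. fst (u y)) x) (snd (p x)) - ipS x (fst (u x)) (d2_adjoint S g (\<lambda>y. snd (p y)) x))
      + (dt4 1 S g (\<lambda>y. snd (u y)) x \<bullet> (G x *v fst (p x)) - snd (u x) \<bullet> (\<chi> i. G x \<bullet> (cov1 g (\<lambda>y. fst (p y)) x ** transpose (M i x))))) (\<lambda>x. u x = 0 \<or> p x = 0)"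
    by (rule divergence_add[OF divergence_d2[OF s u0 a] divergence_dt4[OF \<chi> t]]) (auto simp: zero_prod_def)
  have sw: "ipEL x A B = ipEL x B A" if "x \<in> U" for x A B
  proof -
    have "(\<Sum>i\<in>UNIV. A$i \<bullet> (G x *v (J1_flat (Mx x) B $ i))) = (\<Sum>i\<in>UNIV. J1_flat (Mx x) A $ i \<bullet> (G x *v B$i))"
      by (rule J1_selfadjoint[OF that, symmetric])
    also have "\<dots> = (\<Sum>i\<in>UNIV. B$i \<bullet> (G x *v (J1_flat (Mx x) A $ i)))"
      by (intro sum.cong refl G_symmetric[OF that])
    finally show ?thesis by simp
  qed
  have swS: "ipS x A B = ipS x B A" if x: "x \<in> U" for x and A B :: sfib
  proof -
    have "h \<bullet> (G x ** k ** G x) = (G x ** h ** G x) \<bullet> k" for h k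
      using matrix_inner_mult_right[of "G x ** k" "G x" h] matrix_inner_mult_left[of "G x" k "h ** G x"]
      by (simp add: inner_commute matrix_mul_assoc transpose_G[OF x])
    then have "inner2 (g x) h k = inner2 (g x) k h" for h k
      unfolding inner2_eq by (metis inner_commute)
    then show ?thesis by (simp only: inner_commute mult.commute mult.left_commute)
  qed
  have ipS_add: "ipS x A (B + C) = ipS x A B + ipS x A C" for x and A B C :: sfib
    by (simp add: inner2_eq matrix_linear_simps inner_add_right distrib_left)
  have ipEL_add: "ipEL x (A + B) C = ipEL x A C + ipEL x B C" for x A B C
    by (simp add: inner_add_left sum.distrib)
  show ?thesis
  proof (rule divergence_add[OF dd ee])
    fix x assume x: "x \<in> U"
    show "(dt1_adjoint S g (\<lambda>y. fst (u y)) x + dt4 1 S g (\<lambda>y. snd (u y)) x) \<bullet> (G x *v fst (p x))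
      + ipEL x (d2 S g (\<lambda>y. fst (u y)) x + dt3_adjoint S g (\<lambda>y. snd (u y)) x) (snd (p x))
      - (ipS x (fst (u x)) (fst (D_adjoint S g p x)) + snd (u x) \<bullet> snd (D_adjoint S g p x))
      = (-1) * (ipS x (dt1 (- sqrt 2) 0 (sqrt 2 / 2) S g (\<lambda>y. fst (p y)) x) (fst (u x)) - fst (p x) \<bullet> (G x *v dt1_adjoint S g (\<lambda>y. fst (u y)) x))
      + (-1) * (dt3 (- sqrt 2) (- sqrt 2 / 2) S g (\<lambda>y. snd (p y)) x \<bullet> snd (u x) - ipEL x (snd (p x)) (dt3_adjoint S g (\<lambda>y. snd (u y)) x))
      + ((ipEL x (d2 S g (\<lambda>y. fst (u y)) x) (snd (p x)) - ipS x (fst (u x)) (d2_adjoint S g (\<lambda>y. snd (p y)) x))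
      + (dt4 1 S g (\<lambda>y. snd (u y)) x \<bullet> (G x *v fst (p x)) - snd (u x) \<bullet> (\<chi> i. G x \<bullet> (cov1 g (\<lambda>y. fst (p y)) x ** transpose (M i x)))))"
      unfolding D_adjoint_split[OF p x] ipS_add ipEL_add inner_add_left inner_add_right
        swS[OF x, of "dt1 _ _ _ _ _ _ _"] sw[OF x, of "snd (p x)"]
        G_symmetric[OF x, of "fst (p x)"] inner_commute[of "dt3 _ _ _ _ _ _"]
      by (simp only: diff_conv_add_uminus minus_add_distrib minus_minus mult_minus_left mult_1_left add_ac)
  qed auto
qed

end

section \<open>Changes of coordinates\<close>

text \<open>The map \<open>T\<close> is a transition map on the overlap \<open>W\<close> of two charts;
  \<open>L\<close> below is the transpose of its Jacobian, so that covariant components in the first chart are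
  obtained by multiplying with \<open>L\<close>.\<close>

locale chart_change = c: triple_chart U S g + c': triple_chart U' S' g'
  for U S g U' S' g' +
  fixes W :: "(real^4) set" and T :: "real^4 \<Rightarrow> real^4"
  assumes W_open: "open W" and W_U: "W \<subseteq> U" and smT: "smooth_on W T" and T_U': "\<And>x. x \<in> W \<Longrightarrow> T x \<in> U'"
    and S_pull: "\<And>x i. x \<in> W \<Longrightarrow> S x $ i = (\<chi> \<mu>. pd \<mu> T x) ** S' (T x) $ i ** transpose (\<chi> \<mu>. pd \<mu> T x)"
    and g_pull: "\<And>x. x \<in> W \<Longrightarrow> g x = (\<chi> \<mu>. pd \<mu> T x) ** g' (T x) ** transpose (\<chi> \<mu>. pd \<mu> T x)"
begin

definition L :: "real^4 \<Rightarrow> real^4^4" where "L x = (\<chi> \<mu>. pd \<mu> T x)"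

lemma L_nth: "L x $ \<mu> = pd \<mu> T x"
  by (simp add: L_def)

lemma smooth_L: "smooth_on W L"
  unfolding L_def[abs_def] by (intro smooth_on_vec_lambda[OF W_open] smooth_on_pd smT)

lemma xU: "x \<in> W \<Longrightarrow> x \<in> U"
  using W_U by blast

lemma L_inverse:
  assumes x: "x \<in> W"
  shows "L x ** matrix_inv (L x) = mat 1" "matrix_inv (L x) ** L x = mat 1"
proof -
  have "L x ** (g' (T x) ** transpose (L x) ** c.G x) = mat 1"
    using c.G_g(2)[OF xU[OF x]] g_pull[OF x] by (simp add: L_def matrix_mul_assoc)
  then have "invertible (L x)" unfolding invertible_right_inverse by blast
  then show "L x ** matrix_inv (L x) = mat 1" "matrix_inv (L x) ** L x = mat 1"
    by (simp_all add: matrix_inv_right_left)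
qed

lemma diff_T: "x \<in> W \<Longrightarrow> T differentiable (at x)" and diff_L: "x \<in> W \<Longrightarrow> L differentiable (at x)"
  using smooth_on_differentiable[OF W_open smT] smooth_on_differentiable[OF W_open smooth_L] by blast+

lemma pd_T:
  assumes "x \<in> W" "f differentiable (at (T x))"
  shows "pd \<mu> (\<lambda>y. f (T y)) x = (\<Sum>\<alpha>\<in>UNIV. L x $ \<mu> $ \<alpha> *\<^sub>R pd \<alpha> f (T x))"
  using pd_compose[OF assms(2) diff_T[OF assms(1)]] by (simp add: L_nth)

lemma diff_compose:
  assumes "x \<in> W" "f differentiable (at (T x))"
  shows "(\<lambda>y. f (T y)) differentiable (at x)"
  using differentiable_chain_at[OF diff_T[OF assms(1)] assms(2)] by (simp add: o_def)

definition GamT :: "4 \<Rightarrow> real^4 \<Rightarrow> real^4^4" where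
  "GamT \<mu> x = (\<Sum>\<alpha>\<in>UNIV. L x $ \<mu> $ \<alpha> *\<^sub>R Gam g' \<alpha> (T x))"

text \<open>The transformed Christoffel symbols are torsion-free, as second derivatives of the transition
  map commute, and compatible with the metric.\<close>

lemma Gam_change:
  assumes x: "x \<in> W"
  shows "Gam g \<mu> x ** L x = L x ** GamT \<mu> x + pd \<mu> L x"
proof -
  let ?Li = "matrix_inv (L x)"
  have tLi: "transpose (L x) ** transpose ?Li = mat 1"
    by (simp add: matrix_transpose_mul[symmetric] L_inverse[OF x])
  let ?C = "\<lambda>\<mu>. (L x ** GamT \<mu> x + pd \<mu> L x) ** ?Li"
  note dg' = c'.diff[OF c'.smg T_U'[OF x]]
  have "Gam g \<mu> x = ?C \<mu>"
  proof (rule c.Gam_unique[OF xU[OF x]])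
    fix \<mu> \<nu>
    have e: "(L x ** GamT \<mu> x) $ \<nu> = (\<Sum>\<beta>\<in>UNIV. \<Sum>\<alpha>\<in>UNIV. (L x $ \<nu> $ \<beta> * L x $ \<mu> $ \<alpha>) *\<^sub>R Gam g' \<alpha> (T x) $ \<beta>)" for \<mu> \<nu>
      by (simp add: row_mult_sum GamT_def sum_component scaleR_sum_right)
    have "(L x ** GamT \<mu> x) $ \<nu> = (L x ** GamT \<nu> x) $ \<mu>"
      unfolding e by (subst sum.swap, intro sum.cong refl) (simp add: mult.commute c'.Gam_sym[OF T_U'[OF x], of _ "_ :: 4"])
    moreover have "pd \<mu> L x $ \<nu> = pd \<nu> L x $ \<mu>"
      unfolding pd_nth[OF diff_L[OF x], symmetric] L_nth by (rule pd_commute[OF W_open x smT])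
    ultimately show "?C \<mu> $ \<nu> = ?C \<nu> $ \<mu>" by (simp add: row_matrix_mult)
  next
    fix \<mu>
    have "pd \<mu> g x = pd \<mu> (\<lambda>y. L y ** g' (T y) ** transpose (L y)) x"
      by (rule pd_cong_open[OF W_open x]) (simp add: g_pull L_def)
    also have "\<dots> = (pd \<mu> L x ** g' (T x) + L x ** pd \<mu> (\<lambda>y. g' (T y)) x) ** transpose (L x)
        + L x ** g' (T x) ** transpose (pd \<mu> L x)"
      using pd_matrix_mult[OF differentiable_matrix_mult[OF diff_L[OF x] diff_compose[OF x dg']] differentiable_transpose[OF diff_L[OF x]], of \<mu>]
        pd_matrix_mult[OF diff_L[OF x] diff_compose[OF x dg'], of \<mu>] pd_transpose[OF diff_L[OF x], of \<mu>] by simp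
    also have "pd \<mu> (\<lambda>y. g' (T y)) x = GamT \<mu> x ** g' (T x) + g' (T x) ** transpose (GamT \<mu> x)"
      by (simp add: pd_T[OF x dg'] c'.pd_g[OF T_U'[OF x]] GamT_def matrix_sum_simps scaleR_add_right sum.distrib
          matrix_scaleR_left matrix_scaleR_right transpose_scaleR)
    finally have p: "pd \<mu> g x = (pd \<mu> L x ** g' (T x) + L x ** (GamT \<mu> x ** g' (T x) + g' (T x) ** transpose (GamT \<mu> x))) ** transpose (L x)
        + L x ** g' (T x) ** transpose (pd \<mu> L x)" .
    have l: "X ** ?Li ** g x = X ** g' (T x) ** transpose (L x)" for X
      using L_inverse[OF x] by (simp add: g_pull[OF x] L_def[symmetric] matrix_mul_assoc)
         (simp add: matrix_mul_assoc[symmetric])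
    have r: "g x ** transpose (X ** ?Li) = L x ** g' (T x) ** transpose X" for X
      by (simp add: g_pull[OF x] L_def[symmetric] matrix_transpose_mul matrix_mul_assoc[symmetric])
         (simp add: matrix_mul_assoc tLi)
    show "pd \<mu> g x = ?C \<mu> ** g x + g x ** transpose (?C \<mu>)"
      unfolding l r p by (simp add: matrix_linear_simps matrix_mul_assoc matrix_transpose_mul)
  qed
  then show ?thesis by (simp add: matrix_mul_assoc[symmetric] L_inverse[OF x])
qed

lemma cov1_change:
  assumes x: "x \<in> W" and a: "\<And>y. y \<in> W \<Longrightarrow> a y = L y *v a' (T y)" and d: "a' differentiable (at (T x))"
  shows "cov1 g a x = L x ** cov1 g' a' (T x) ** transpose (L x)"
proof (rule matrix_eq_rows)
  fix \<mu>
  have "pd \<mu> a x = pd \<mu> (\<lambda>y. L y *v a' (T y)) x" by (rule pd_cong_open[OF W_open x a])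
  also have "\<dots> = pd \<mu> L x *v a' (T x) + L x *v (\<Sum>\<alpha>\<in>UNIV. L x $ \<mu> $ \<alpha> *\<^sub>R pd \<alpha> a' (T x))"
    using pd_matrix_vector_mult[OF diff_L[OF x] diff_compose[OF x d], of \<mu>] by (simp add: pd_T[OF x d])
  finally have p: "pd \<mu> a x = pd \<mu> L x *v a' (T x) + L x *v (\<Sum>\<alpha>\<in>UNIV. L x $ \<mu> $ \<alpha> *\<^sub>R pd \<alpha> a' (T x))" .
  have q: "Gam g \<mu> x *v a x = L x *v (\<Sum>\<alpha>\<in>UNIV. L x $ \<mu> $ \<alpha> *\<^sub>R (Gam g' \<alpha> (T x) *v a' (T x))) + pd \<mu> L x *v a' (T x)"
  proof -
    have "GamT \<mu> x *v a' (T x) = (\<Sum>\<alpha>\<in>UNIV. L x $ \<mu> $ \<alpha> *\<^sub>R (Gam g' \<alpha> (T x) *v a' (T x)))"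
      unfolding GamT_def sum_4 by (simp add: matrix_linear_simps)
    then show ?thesis
      by (simp add: a[OF x] matrix_vector_mul_assoc Gam_change[OF x] matrix_linear_simps)
         (simp add: matrix_vector_mul_assoc[symmetric])
  qed
  show "cov1 g a x $ \<mu> = (L x ** cov1 g' a' (T x) ** transpose (L x)) $ \<mu>"
    unfolding row_mult_transpose unfolding row_mult_sum[of "L x"]
    by (simp add: cov1_def p q scaleR_diff_right sum_subtractf matrix_vector_mult_diff_distrib)
qed

definition frame_change :: "real^4 \<Rightarrow> (4 \<Rightarrow> real^4^4) \<Rightarrow> 4 \<Rightarrow> real^4^4" where
  "frame_change x Q \<mu> = (\<Sum>\<alpha>\<in>UNIV. L x $ \<mu> $ \<alpha> *\<^sub>R (L x ** Q \<alpha> ** transpose (L x)))"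

lemma cov2_change:
  assumes x: "x \<in> W" and h: "\<And>y. y \<in> W \<Longrightarrow> h y = L y ** h' (T y) ** transpose (L y)" and d: "h' differentiable (at (T x))"
  shows "cov2 g h x = frame_change x (cov2 g' h' (T x))"
proof
  fix \<mu>
  have "pd \<mu> h x = pd \<mu> (\<lambda>y. L y ** h' (T y) ** transpose (L y)) x" by (rule pd_cong_open[OF W_open x h])
  also have "\<dots> = (pd \<mu> L x ** h' (T x) + L x ** pd \<mu> (\<lambda>y. h' (T y)) x) ** transpose (L x)
      + L x ** h' (T x) ** transpose (pd \<mu> L x)"
    using pd_matrix_mult[OF differentiable_matrix_mult[OF diff_L[OF x] diff_compose[OF x d]] differentiable_transpose[OF diff_L[OF x]], of \<mu>]
      pd_matrix_mult[OF diff_L[OF x] diff_compose[OF x d], of \<mu>] pd_transpose[OF diff_L[OF x], of \<mu>] by simp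
  finally have p: "pd \<mu> h x = (pd \<mu> L x ** h' (T x) + L x ** pd \<mu> (\<lambda>y. h' (T y)) x) ** transpose (L x)
      + L x ** h' (T x) ** transpose (pd \<mu> L x)" .
  have l: "Gam g \<mu> x ** h x = (L x ** GamT \<mu> x + pd \<mu> L x) ** h' (T x) ** transpose (L x)"
    by (simp add: h[OF x] matrix_mul_assoc Gam_change[OF x])
  have r: "h x ** transpose (Gam g \<mu> x) = L x ** h' (T x) ** transpose (L x ** GamT \<mu> x + pd \<mu> L x)"
    by (simp add: h[OF x] matrix_mul_assoc[symmetric] matrix_transpose_mul[symmetric] Gam_change[OF x])
  have "cov2 g h x \<mu> = L x ** (pd \<mu> (\<lambda>y. h' (T y)) x - GamT \<mu> x ** h' (T x) - h' (T x) ** transpose (GamT \<mu> x)) ** transpose (L x)"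
    unfolding cov2_def p l r by (simp add: matrix_linear_simps matrix_transpose_mul matrix_mul_assoc)
  also have "\<dots> = frame_change x (cov2 g' h' (T x)) \<mu>"
    unfolding frame_change_def cov2_def pd_T[OF x d] GamT_def sum_4
    by (simp add: matrix_linear_simps algebra_simps)
  finally show "cov2 g h x \<mu> = frame_change x (cov2 g' h' (T x)) \<mu>" .
qed

lemma grad_change:
  assumes x: "x \<in> W" and f: "\<And>y. y \<in> W \<Longrightarrow> f y = f' (T y)" and d: "f' differentiable (at (T x))"
  shows "grad f x = L x *v grad f' (T x)"
proof -
  have "pd \<mu> f x = (\<Sum>\<alpha>\<in>UNIV. L x $ \<mu> $ \<alpha> *\<^sub>R pd \<alpha> f' (T x))" for \<mu>
  proof -
    have "pd \<mu> f x = pd \<mu> (\<lambda>y. f' (T y)) x" by (rule pd_cong_open[OF W_open x f])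
    then show ?thesis by (simp only: pd_T[OF x d])
  qed
  then show ?thesis by (simp add: grad_def vec_eq_iff matrix_vector_mult_def)
qed

text \<open>A frame at a point has components in both charts, and contractions can be computed in it.\<close>

lemma common_frame:
  assumes x: "x \<in> W"
  obtains e where "adapted (S x) (g x) e" "adapted (S' (T x)) (g' (T x)) (e ** L x)"
proof -
  obtain e' where a': "adapted (S' (T x)) (g' (T x)) e'" using c'.ex_adapted[OF T_U'[OF x]] by blast
  let ?e = "e' ** matrix_inv (L x)"
  have k: "?e ** L x = e'" by (simp add: matrix_mul_assoc[symmetric] L_inverse[OF x])
  have kk: "?e ** (L x ** X ** transpose (L x)) ** transpose ?e = e' ** X ** transpose e'" for X
  proof -
    have "?e ** (L x ** X ** transpose (L x)) ** transpose ?e = (?e ** L x) ** X ** transpose (?e ** L x)"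
      by (simp only: matrix_mul_assoc matrix_transpose_mul)
    then show ?thesis by (simp only: k)
  qed
  have "adapted (S x) (g x) ?e"
    using a' unfolding adapted_def adapted_frame_def
    by (simp only: S_pull[OF x] g_pull[OF x] L_def[symmetric] kk simp_thms)
  then show ?thesis using a' that k by metis
qed

lemma M_change:
  assumes x: "x \<in> W"
  shows "c.M i x *v (L x *v v) = L x *v (c'.M i (T x) *v v)"
proof -
  have Lt: "transpose (L x) ** c.G x ** L x = c'.G (T x)"
  proof -
    have "g' (T x) ** (transpose (L x) ** c.G x ** L x) = mat 1"
    proof -
      have "L x ** (g' (T x) ** transpose (L x) ** c.G x) = mat 1"
        using c.G_g(2)[OF xU[OF x]] g_pull[OF x] by (simp add: L_def matrix_mul_assoc)
      then have "(g' (T x) ** transpose (L x) ** c.G x) ** L x = mat 1"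
        by (simp add: matrix_left_right_inverse)
      then show ?thesis by (simp add: matrix_mul_assoc)
    qed
    then show ?thesis using matrix_inv_eqI unfolding c'.G_def by metis
  qed
  have "c.M i x ** L x = L x ** (S' (T x) $ i ** (transpose (L x) ** c.G x ** L x))"
    by (simp only: c.S_M_K(2)[OF xU[OF x]] S_pull[OF x] L_def[symmetric] matrix_mul_assoc)
  also have "\<dots> = L x ** c'.M i (T x)" by (simp only: Lt c'.S_M_K(2)[OF T_U'[OF x]])
  finally show ?thesis by (simp add: matrix_vector_mul_assoc)
qed

lemma J1_change:
  assumes x: "x \<in> W"
  shows "J1_flat (c.Mx x) (\<chi> i. L x *v (a $ i)) $ i = L x *v (J1_flat (c'.Mx (T x)) a $ i)"
proof -
  have "\<forall>i. J1_flat (c.Mx x) (\<chi> i. L x *v (a $ i)) $ i = L x *v (J1_flat (c'.Mx (T x)) a $ i)"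
    by (simp add: forall_3 J1_flat_nth M_change[OF x] matrix_vector_mult_diff_distrib)
  then show ?thesis by blast
qed

lemma div_change:
  assumes x: "x \<in> W"
  shows "contract3 (c.G x) (frame_change x Q) = L x *v contract3 (c'.G (T x)) Q"
proof -
  obtain e where e: "adapted (S x) (g x) e" "adapted (S' (T x)) (g' (T x)) (e ** L x)" using common_frame[OF x] by blast
  interpret a: adapted "S x" "g x" e by (rule e)
  interpret a': adapted "S' (T x)" "g' (T x)" "e ** L x" by (rule e)
  have "frame3 e (frame_change x Q) a = frame3 (e ** L x) Q a" for a
  proof -
    have "(e ** L x) ** Q \<alpha> ** transpose (e ** L x) = e ** (L x ** Q \<alpha> ** transpose (L x)) ** transpose e" for \<alpha>
      by (simp only: matrix_transpose_mul matrix_mul_assoc)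
    then have "frame3 (e ** L x) Q a = (\<Sum>\<alpha>\<in>UNIV. (\<Sum>\<mu>\<in>UNIV. e $ a $ \<mu> * L x $ \<mu> $ \<alpha>) *\<^sub>R (e ** (L x ** Q \<alpha> ** transpose (L x)) ** transpose e))"
      by (simp add: frame3_def matrix_matrix_mult_def[of e "L x"])
    also have "\<dots> = (\<Sum>\<mu>\<in>UNIV. \<Sum>\<alpha>\<in>UNIV. (e $ a $ \<mu> * L x $ \<mu> $ \<alpha>) *\<^sub>R (e ** (L x ** Q \<alpha> ** transpose (L x)) ** transpose e))"
      unfolding scaleR_sum_left by (rule sum.swap)
    also have "\<dots> = frame3 e (frame_change x Q) a"
      by (simp add: frame3_def frame_change_def matrix_sum_simps matrix_scaleR_left matrix_scaleR_right)
    finally show ?thesis ..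
  qed
  then have "frame3 e (frame_change x Q) = frame3 (e ** L x) Q" by blast
  moreover have "e *v contract3 (c.G x) (frame_change x Q) = contract3 (mat 1) (frame3 e (frame_change x Q))"
    using a.frame_contract3[of "mat 1"] a.G_eq by (simp add: c.adapted_eqs(1)[OF a.adapted_axioms])
  moreover have "(e ** L x) *v contract3 (c'.G (T x)) Q = contract3 (mat 1) (frame3 (e ** L x) Q)"
    using a'.frame_contract3[of "mat 1"] a'.G_eq by (simp add: c'.adapted_eqs(1)[OF a'.adapted_axioms])
  ultimately show ?thesis
    by - (rule a.frame_eqI, simp add: matrix_vector_mul_assoc)
qed

lemma adj_change:
  assumes x: "x \<in> W" and Nt: "Nt = L x ** Nt' ** transpose (L x)" and Nb: "\<And>i. Nb i = L x ** Nb' i ** transpose (L x)"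
  shows "adj_h r (c.Mx x) (c.G x) Nt Nb = adj_h r (c'.Mx (T x)) (c'.G (T x)) Nt' Nb'"
    "c.G x \<bullet> Nb i = c'.G (T x) \<bullet> Nb' i"
    "adj_c r (c.Mx x) (c.G x) Nt Nb i = adj_c r (c'.Mx (T x)) (c'.G (T x)) Nt' Nb' i"
    "adj_t r (c.Mx x) (g x) (c.G x) Nt Nb = L x ** adj_t r (c'.Mx (T x)) (g' (T x)) (c'.G (T x)) Nt' Nb' ** transpose (L x)"
proof -
  obtain e where e: "adapted (S x) (g x) e" "adapted (S' (T x)) (g' (T x)) (e ** L x)" using common_frame[OF x] by blast
  interpret a: adapted "S x" "g x" e by (rule e)
  interpret a': adapted "S' (T x)" "g' (T x)" "e ** L x" by (rule e)
  have f: "(e ** L x) ** X ** transpose (e ** L x) = e ** (L x ** X ** transpose (L x)) ** transpose e" for X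
    by (simp only: matrix_transpose_mul matrix_mul_assoc)
  note eqs = c.adapted_eqs[OF a.adapted_axioms] c'.adapted_eqs[OF a'.adapted_axioms]
  show "adj_h r (c.Mx x) (c.G x) Nt Nb = adj_h r (c'.Mx (T x)) (c'.G (T x)) Nt' Nb'"
    using a.frame_adj_h[of r Nt Nb] a'.frame_adj_h[of r Nt' Nb'] by (simp only: eqs f Nt Nb)
  show "c.G x \<bullet> Nb i = c'.G (T x) \<bullet> Nb' i"
    using a.G_contract[of "Nb i"] a'.G_contract[of "Nb' i"] by (simp only: eqs f Nb)
  show "adj_c r (c.Mx x) (c.G x) Nt Nb i = adj_c r (c'.Mx (T x)) (c'.G (T x)) Nt' Nb' i"
    using a.frame_adj_c[of r Nt Nb i] a'.frame_adj_c[of r Nt' Nb' i] by (simp only: eqs f Nt Nb)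
  show "adj_t r (c.Mx x) (g x) (c.G x) Nt Nb = L x ** adj_t r (c'.Mx (T x)) (g' (T x)) (c'.G (T x)) Nt' Nb' ** transpose (L x)"
    using a.frame_adj_t[of r Nt Nb] a'.frame_adj_t[of r Nt' Nb']
    by - (rule a.frame_eqI2, simp only: eqs f Nt Nb)
qed

text \<open>The adjoint operators are built from covariant derivatives and from contractions with the metric and
  the triple, each of which is compatible with changes of coordinates.\<close>

lemma dt1_adjoint_change:
  assumes x: "x \<in> W" and s: "\<And>y. y \<in> W \<Longrightarrow> s y = (fst (s' (T y)), fst (snd (s' (T y))), L y ** snd (snd (s' (T y))) ** transpose (L y))"
    and s': "smooth_on U' s'"
  shows "dt1_adjoint S g s x = L x *v dt1_adjoint S' g' s' (T x)"
proof -
  have "smooth_on U' (\<lambda>y. fst (s' y))" "smooth_on U' (\<lambda>y. snd (snd (s' y)))" by (intro c'.smooth_rules s')+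
  note d = this[THEN c'.diff, OF T_U'[OF x]]
  have "grad (\<lambda>y. fst (s y)) x = L x *v grad (\<lambda>y. fst (s' y)) (T x)"
    by (rule grad_change[OF x _ d(1)]) (simp add: s)
  moreover have "cov2 g (\<lambda>y. snd (snd (s y))) x = frame_change x (cov2 g' (\<lambda>y. snd (snd (s' y))) (T x))"
    by (rule cov2_change[OF x _ d(2)]) (simp add: s)
  ultimately show ?thesis
    by (simp add: dt1_adjoint_def c.G_inv c'.G_inv div_change[OF x] matrix_linear_simps matrix_vector_mult_diff_distrib)
qed

lemma gradE_change:
  assumes x: "x \<in> W" and q: "\<And>y. y \<in> W \<Longrightarrow> q y = q' (T y)" and q': "smooth_on U' q'"
  shows "gradE q x = (\<chi> i. L x *v (gradE q' (T x) $ i))"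
proof -
  have "smooth_on U' (\<lambda>y. q' y $ i)" for i by (intro c'.smooth_rules q')
  note d = this[THEN c'.diff, OF T_U'[OF x]]
  show ?thesis by (simp add: gradE_def vec_eq_iff grad_change[OF x _ d] q)
qed

lemma dt3_adjoint_change:
  assumes x: "x \<in> W" and q: "\<And>y. y \<in> W \<Longrightarrow> q y = q' (T y)" and q': "smooth_on U' q'"
  shows "dt3_adjoint S g q x = (\<chi> i. L x *v (dt3_adjoint S' g' q' (T x) $ i))"
  by (rule matrix_eq_rows)
     (simp add: dt3_adjoint_def c.mixS_M c'.mixS_M gradE_change[OF assms] J1_change[OF x] matrix_linear_simps)

lemma D_adjoint_change:
  assumes x: "x \<in> W" and p: "\<And>y. y \<in> W \<Longrightarrow> p y = (L y *v fst (p' (T y)), \<chi> i. L y *v (snd (p' (T y)) $ i))"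
    and p': "smooth_on U' p'"
  shows "D_adjoint S g p x = (let d = D_adjoint S' g' p' (T x) in
    ((fst (fst d), fst (snd (fst d)), L x ** snd (snd (fst d)) ** transpose (L x)), snd d))"
proof -
  have b: "smooth_on U' (\<lambda>y. J1_flat (c'.Mx y) (snd (p' y)) $ i)" for i
    by (intro c'.smooth_rules c'.smooth_J1 p')
  have t: "smooth_on U' (\<lambda>y. fst (p' y))" by (intro c'.smooth_rules p')
  note d = t[THEN c'.diff, OF T_U'[OF x]] b[THEN c'.diff, OF T_U'[OF x]]
  have 1: "cov1 g (\<lambda>y. fst (p y)) x = L x ** cov1 g' (\<lambda>y. fst (p' y)) (T x) ** transpose (L x)"
    by (rule cov1_change[OF x _ d(1)]) (simp add: p)
  have 2: "cov1 g (\<lambda>y. J1_flat (c.Mx y) (snd (p y)) $ i) x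
      = L x ** cov1 g' (\<lambda>y. J1_flat (c'.Mx y) (snd (p' y)) $ i) (T x) ** transpose (L x)" for i
    by (rule cov1_change[OF x _ d(2)]) (simp add: p J1_change)
  note ac = adj_change[where Nb = "\<lambda>i. cov1 g (\<lambda>y. J1_flat (c.Mx y) (snd (p y)) $ i) x"
      and Nb' = "\<lambda>i. cov1 g' (\<lambda>y. J1_flat (c'.Mx y) (snd (p' y)) $ i) (T x)", OF x 1 2]
  show ?thesis
    unfolding c.D_adjoint_eq c'.D_adjoint_eq Let_def ac by simp
qed

end

section \<open>The adjoint operators on the manifold\<close>

context triple_chart
begin

lemma smooth_inner: "smooth_on U X \<Longrightarrow> smooth_on U Y \<Longrightarrow> smooth_on U (\<lambda>y. X y \<bullet> Y y)" for X Y :: "real^4 \<Rightarrow> real^4^4"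
  by (rule smooth_on_bilinear[OF opn bounded_bilinear_matrix_inner])

lemma smooth_gradE: "smooth_on U q \<Longrightarrow> smooth_on U (gradE q)"
  unfolding gradE_def[abs_def] by (intro smooth_rules smooth_grad)

lemma smooth_dt1_adjoint: "smooth_on U s \<Longrightarrow> smooth_on U (dt1_adjoint S g s)"
  unfolding dt1_adjoint_def[abs_def] G_inv
  by (intro smooth_rules smooth_grad[unfolded eta_contract_eq] smooth_contract3 smooth_G)

lemma smooth_dt3_adjoint: "smooth_on U q \<Longrightarrow> smooth_on U (dt3_adjoint S g q)"
  unfolding dt3_adjoint_def[abs_def] mixS_M by (intro smooth_rules smooth_J1 smooth_gradE)

lemma smooth_D_adjoint:
  assumes "smooth_on U p"
  shows "smooth_on U (D_adjoint S g p)"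
proof -
  have N: "smooth_on U (cov1 g (\<lambda>y. fst (p y)))" by (intro smooth_cov1 smooth_rules assms)
  have b: "smooth_on U (cov1 g (\<lambda>y. J1_flat (Mx y) (snd (p y)) $ i))" for i
    by (intro smooth_cov1 smooth_rules smooth_J1 assms)
  show ?thesis
    unfolding D_adjoint_eq[abs_def] Let_def adj_h_def adj_t_def adj_c_def symtf_def JN_def divide_inverse
    by (intro smooth_rules smooth_inner smooth_G smooth_M smg N b)
qed

end

definition trL :: "'m chart \<Rightarrow> 'm chart \<Rightarrow> real^4 \<Rightarrow> real^4^4" where
  "trL c c' x = (\<chi> \<mu>. pd \<mu> (transition c c') x)"

lemma jacobian_trL: "jacobian c c' x = transpose (trL c c' x)"
  by (simp add: jacobian_def trL_def transpose_def)

lemma pull_trL: "pull1 (jacobian c c' x) a = trL c c' x *v a"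
  "pull2 (jacobian c c' x) t = trL c c' x ** t ** transpose (trL c c' x)"
  by (simp_all add: pull1_def pull2_def jacobian_trL)

locale triple_manifold =
  fixes A :: "'m::{t2_space,second_countable_topology} chart set"
    and Sg :: "('m, triple) field" and g :: "('m, real^4^4) field"
  assumes atlas: "smooth_atlas A" and perfect: "perfect_triple A Sg" and metric: "triple_metric A Sg g"
begin

lemma chart_homeo: "c \<in> A \<Longrightarrow> homeomorphism (fst c) (cdom c) (snd c) (cinv c)" and chart_open: "c \<in> A \<Longrightarrow> open (cdom c)"
  "c \<in> A \<Longrightarrow> open (fst c)"
  using atlas unfolding smooth_atlas_def by blast+

lemma on_chart: "c \<in> A \<Longrightarrow> triple_chart (cdom c) (Sg c) (g c)"
proof -
  assume c: "c \<in> A"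
  have p: "is_section A (\<lambda>c x. {S. \<forall>i. transpose (S$i) = - (S$i)}) (\<lambda>J S. \<chi> i. pull2 J (S$i)) Sg"
    and m: "is_section A (\<lambda>c x. {h. transpose h = h}) pull2 g"
    using perfect metric unfolding perfect_triple_def triple_metric_def by blast+
  show ?thesis
  proof
    show "open (cdom c)" by (rule chart_open[OF c])
    show "smooth_on (cdom c) (Sg c)" "smooth_on (cdom c) (g c)"
      using p m c unfolding is_section_def by blast+
    show "transpose (Sg c x $ i) = - (Sg c x $ i)" if "x \<in> cdom c" for x i
      using p c that unfolding is_section_def by blast
    show "transpose (g c x) = g c x" if "x \<in> cdom c" for x
      using m c that unfolding is_section_def by blast
    show "w \<bullet> (g c x *v w) > 0" if "x \<in> cdom c" "w \<noteq> 0" for x w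
      using metric c that unfolding triple_metric_def by blast
    show "quaternion_relations (mixS (Sg c x) (g c x))" if "x \<in> cdom c" for x
      using metric c that unfolding triple_metric_def quaternion_relations_def by blast
    show "pd \<mu> (\<lambda>y. Sg c y $ i $ \<nu> $ \<rho>) x + pd \<nu> (\<lambda>y. Sg c y $ i $ \<rho> $ \<mu>) x + pd \<rho> (\<lambda>y. Sg c y $ i $ \<mu> $ \<nu>) x = 0"
      if "x \<in> cdom c" for x i \<mu> \<nu> \<rho>
      using perfect c that unfolding perfect_triple_def by blast
  qed
qed

lemma cinv_chart: "c \<in> A \<Longrightarrow> m \<in> fst c \<Longrightarrow> cinv c (snd c m) = m"
  using chart_homeo[of c] unfolding homeomorphism_def by auto

lemma on_overlap:
  assumes c: "c \<in> A" "c' \<in> A"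
  shows "chart_change (cdom c) (Sg c) (g c) (cdom c') (Sg c') (g c') (overlap c c') (transition c c')"
proof -
  interpret c: triple_chart "cdom c" "Sg c" "g c" by (rule on_chart[OF c(1)])
  interpret c': triple_chart "cdom c'" "Sg c'" "g c'" by (rule on_chart[OF c(2)])
  have p: "is_section A (\<lambda>c x. {S. \<forall>i. transpose (S$i) = - (S$i)}) (\<lambda>J S. \<chi> i. pull2 J (S$i)) Sg"
    and m: "is_section A (\<lambda>c x. {h. transpose h = h}) pull2 g"
    using perfect metric unfolding perfect_triple_def triple_metric_def by blast+
  show ?thesis
  proof
    have "openin (top_of_set (fst c)) (fst c \<inter> fst c')"
      using chart_open(2)[OF c(2)] by (rule openin_open_Int)
    then have "openin (top_of_set (cdom c)) (overlap c c')"
      unfolding overlap_def by (rule homeomorphism_imp_open_map[OF chart_homeo[OF c(1)]])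
    then show "open (overlap c c')" using openin_open_trans chart_open(1)[OF c(1)] by blast
    show "overlap c c' \<subseteq> cdom c" unfolding overlap_def cdom_def by blast
    show "smooth_on (overlap c c') (transition c c')"
      using atlas c unfolding smooth_atlas_def by blast
    show "transition c c' x \<in> cdom c'" if "x \<in> overlap c c'" for x
      using that cinv_chart[OF c(1)] unfolding overlap_def transition_def cdom_def by auto
    show "Sg c x $ i = (\<chi> \<mu>. pd \<mu> (transition c c') x) ** Sg c' (transition c c' x) $ i ** transpose (\<chi> \<mu>. pd \<mu> (transition c c') x)"
      if "x \<in> overlap c c'" for x i
    proof -
      have "Sg c x = (\<chi> i. pull2 (jacobian c c' x) (Sg c' (transition c c' x) $ i))"
        using p c that unfolding is_section_def by blast
      then show ?thesis by (simp add: pull_trL trL_def)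
    qed
    show "g c x = (\<chi> \<mu>. pd \<mu> (transition c c') x) ** g c' (transition c c' x) ** transpose (\<chi> \<mu>. pd \<mu> (transition c c') x)"
      if "x \<in> overlap c c'" for x
      using m c that unfolding is_section_def pull_trL trL_def by blast
  qed
qed

lemma L_trL: "c \<in> A \<Longrightarrow> c' \<in> A \<Longrightarrow> chart_change.L (transition c c') x = trL c c' x"
  using chart_change.L_def[OF on_overlap] by (simp add: trL_def)

text \<open>A test section supported in the compact set \<open>K\<close> of one chart vanishes at the points of
  that chart outside \<open>K\<close>, as the chart is injective; so the potential in the Green identity has
  compact support.\<close>

lemma formal_adjointI:
  assumes sec: "\<And>t. t \<in> sections A B2 \<Longrightarrow> Q t \<in> sections A B1"
    and div: "\<And>s t c. s \<in> sections A B1 \<Longrightarrow> t \<in> sections A B2 \<Longrightarrow> c \<in> A \<Longrightarrow>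
      triple_chart.divergence (cdom c) (g c) (\<lambda>x. ip B2 c x (P s c x) (t c x) - ip B1 c x (s c x) (Q t c x)) (\<lambda>x. s c x = 0 \<or> t c x = 0)"
  shows "formal_adjoint A Sg B1 B2 P Q"
  unfolding formal_adjoint_def
proof (intro conjI ballI allI impI)
  fix s t c K
  assume s: "s \<in> sections A B1" and t: "t \<in> sections A B2" and c: "c \<in> A"
    and K: "compact K \<and> K \<subseteq> cdom c \<and> (supported_in A c K s \<or> supported_in A c K t)"
  interpret triple_chart "cdom c" "Sg c" "g c" by (rule on_chart[OF c])
  have inj: "cinv c x \<notin> cinv c ` K" if "x \<in> cdom c" "x \<notin> K" for x
  proof
    have "snd c (cinv c y) = y" if "y \<in> cdom c" for y
      using chart_homeo[OF c] that unfolding homeomorphism_def by auto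
    moreover assume "cinv c x \<in> cinv c ` K"
    ultimately show False using that K by (metis imageE subsetD)
  qed
  show "integral (cdom c) (\<lambda>x. ip B2 c x (P s c x) (t c x) * \<bar>vS (Sg c x)\<bar>)
      = integral (cdom c) (\<lambda>x. ip B1 c x (s c x) (Q t c x) * \<bar>vS (Sg c x)\<bar>)"
    by (rule divergence_integral[OF div[OF s t c], of K]) (use K inj c in \<open>auto simp: supported_in_def\<close>)
qed (rule sec)

abbreviation "SB \<equiv> S_bundle g (1/4) 8 1"
abbreviation "EB \<equiv> E_bundle :: ('m, real^3) vbundle"
abbreviation "TB \<equiv> T_bundle g"
abbreviation "ELB \<equiv> EL_bundle Sg"

lemmas bundle_defs = sections_def is_section_def S_bundle_def E_bundle_def T_bundle_def EL_bundle_def L0_bundle_def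
  Sym_bundle_def bundle_sum_def pull_trL case_prod_beta mem_Times_iff

lemma sections_S: "s \<in> sections A SB \<longleftrightarrow> (\<forall>c\<in>A. smooth_on (cdom c) (s c)) \<and> (\<forall>c\<in>A. \<forall>x\<in>cdom c. snd (snd (s c x)) \<in> sym0 (g c x))
    \<and> (\<forall>c\<in>A. \<forall>c'\<in>A. \<forall>x\<in>overlap c c'. s c x = (fst (s c' (transition c c' x)), fst (snd (s c' (transition c c' x))),
        trL c c' x ** snd (snd (s c' (transition c c' x))) ** transpose (trL c c' x)))"
  by (simp add: bundle_defs)

lemma sections_E: "q \<in> sections A EB \<longleftrightarrow> (\<forall>c\<in>A. smooth_on (cdom c) (q c))
    \<and> (\<forall>c\<in>A. \<forall>c'\<in>A. \<forall>x\<in>overlap c c'. q c x = q c' (transition c c' x))"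
  by (simp add: bundle_defs)

lemma sections_T: "t \<in> sections A TB \<longleftrightarrow> (\<forall>c\<in>A. smooth_on (cdom c) (t c))
    \<and> (\<forall>c\<in>A. \<forall>c'\<in>A. \<forall>x\<in>overlap c c'. t c x = trL c c' x *v t c' (transition c c' x))"
  by (simp add: bundle_defs)

lemma sections_EL: "a \<in> sections A ELB \<longleftrightarrow> (\<forall>c\<in>A. smooth_on (cdom c) (a c))
    \<and> (\<forall>c\<in>A. \<forall>c'\<in>A. \<forall>x\<in>overlap c c'. a c x = (\<chi> i. trL c c' x *v (a c' (transition c c' x) $ i)))"
  by (simp add: bundle_defs)

lemma sections_SE: "u \<in> sections A (SB \<oplus>\<^sub>b EB) \<longleftrightarrow> (\<forall>c\<in>A. smooth_on (cdom c) (u c)) \<and> (\<forall>c\<in>A. \<forall>x\<in>cdom c. snd (snd (fst (u c x))) \<in> sym0 (g c x))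
    \<and> (\<forall>c\<in>A. \<forall>c'\<in>A. \<forall>x\<in>overlap c c'. u c x = ((fst (fst (u c' (transition c c' x))), fst (snd (fst (u c' (transition c c' x)))),
        trL c c' x ** snd (snd (fst (u c' (transition c c' x)))) ** transpose (trL c c' x)), snd (u c' (transition c c' x))))"
  by (simp add: bundle_defs)

lemma sections_TEL: "p \<in> sections A (TB \<oplus>\<^sub>b ELB) \<longleftrightarrow> (\<forall>c\<in>A. smooth_on (cdom c) (p c))
    \<and> (\<forall>c\<in>A. \<forall>c'\<in>A. \<forall>x\<in>overlap c c'. p c x = (trL c c' x *v fst (p c' (transition c c' x)), \<chi> i. trL c c' x *v (snd (p c' (transition c c' x)) $ i)))"
  by (simp add: bundle_defs)

lemma dt1_adjoint_section:
  assumes s: "s \<in> sections A SB"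
  shows "glob dt1_adjoint Sg g s \<in> sections A TB"
  unfolding sections_T glob_def
proof (intro conjI ballI)
  show "smooth_on (cdom c) (dt1_adjoint (Sg c) (g c) (s c))" if "c \<in> A" for c
    using s that by (intro triple_chart.smooth_dt1_adjoint on_chart) (auto simp: sections_S)
  fix c c' x assume c: "c \<in> A" "c' \<in> A" and x: "x \<in> overlap c c'"
  interpret chart_change "cdom c" "Sg c" "g c" "cdom c'" "Sg c'" "g c'" "overlap c c'" "transition c c'"
    by (rule on_overlap[OF c])
  show "dt1_adjoint (Sg c) (g c) (s c) x = trL c c' x *v dt1_adjoint (Sg c') (g c') (s c') (transition c c' x)"
    using dt1_adjoint_change[OF x, of "s c" "s c'"] s c unfolding sections_S L_trL[OF c] by blast
qed

lemma dt3_adjoint_section: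
  assumes q: "q \<in> sections A EB"
  shows "glob dt3_adjoint Sg g q \<in> sections A ELB"
  unfolding sections_EL glob_def
proof (intro conjI ballI)
  have sm: "smooth_on (cdom c) (q c)" if "c \<in> A" for c
    using q that by (auto simp: sections_E)
  show "smooth_on (cdom c) (dt3_adjoint (Sg c) (g c) (q c))" if "c \<in> A" for c
    using sm that by (intro triple_chart.smooth_dt3_adjoint on_chart)
  fix c c' x assume c: "c \<in> A" "c' \<in> A" and x: "x \<in> overlap c c'"
  interpret chart_change "cdom c" "Sg c" "g c" "cdom c'" "Sg c'" "g c'" "overlap c c'" "transition c c'"
    by (rule on_overlap[OF c])
  show "dt3_adjoint (Sg c) (g c) (q c) x = (\<chi> i. trL c c' x *v (dt3_adjoint (Sg c') (g c') (q c') (transition c c' x) $ i))"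
    using dt3_adjoint_change[OF x, of "q c" "q c'"] q c unfolding sections_E L_trL[OF c] by blast
qed

lemma d3_adjoint_section:
  assumes q: "q \<in> sections A EB"
  shows "glob d3_adjoint Sg g q \<in> sections A ELB"
  unfolding sections_EL glob_def
proof (intro conjI ballI)
  have sm: "smooth_on (cdom c) (q c)" if "c \<in> A" for c
    using q that by (auto simp: sections_E)
  have e: "d3_adjoint S g' q' = gradE q'" for S g' q' by (simp add: d3_adjoint_def fun_eq_iff)
  show "smooth_on (cdom c) (d3_adjoint (Sg c) (g c) (q c))" if "c \<in> A" for c
    unfolding e by (rule triple_chart.smooth_gradE[OF on_chart[OF that] sm[OF that]])
  fix c c' x assume c: "c \<in> A" "c' \<in> A" and x: "x \<in> overlap c c'"
  interpret chart_change "cdom c" "Sg c" "g c" "cdom c'" "Sg c'" "g c'" "overlap c c'" "transition c c'"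
    by (rule on_overlap[OF c])
  show "d3_adjoint (Sg c) (g c) (q c) x = (\<chi> i. trL c c' x *v (d3_adjoint (Sg c') (g c') (q c') (transition c c' x) $ i))"
    using gradE_change[OF x, of "q c" "q c'"] q c unfolding e sections_E L_trL[OF c] by blast
qed

lemma M_change_trL:
  assumes "c \<in> A" "c' \<in> A" "x \<in> overlap c c'"
  shows "mixS (Sg c x) (g c x) i *v (trL c c' x *v v)
    = trL c c' x *v (mixS (Sg c' (transition c c' x)) (g c' (transition c c' x)) i *v v)"
proof -
  interpret chart_change "cdom c" "Sg c" "g c" "cdom c'" "Sg c'" "g c'" "overlap c c'" "transition c c'"
    by (rule on_overlap[OF assms(1,2)])
  show ?thesis using M_change[OF assms(3), of i v] unfolding L_trL[OF assms(1,2)] c.mixS_M c'.mixS_M .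
qed

lemma smooth_mixS: "c \<in> A \<Longrightarrow> smooth_on (cdom c) (\<lambda>y. mixS (Sg c y) (g c y) i)"
  using triple_chart.smooth_M[OF on_chart] triple_chart.M_def[OF on_chart] by (metis (no_types, lifting) ext)

lemma Phi_adjoint_section:
  assumes t: "t \<in> sections A TB"
  shows "glob Phi_adjoint Sg g t \<in> sections A ELB"
  unfolding sections_EL glob_def
proof (intro conjI ballI)
  show "smooth_on (cdom c) (Phi_adjoint (Sg c) (g c) (t c))" if c: "c \<in> A" for c
  proof -
    interpret triple_chart "cdom c" "Sg c" "g c" by (rule on_chart[OF c])
    show ?thesis
      unfolding Phi_adjoint_def[abs_def]
      by (intro smooth_rules smooth_mixS c) (use t c in \<open>auto simp: sections_T\<close>)
  qed
  fix c c' x assume c: "c \<in> A" "c' \<in> A" and x: "x \<in> overlap c c'"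
  have "t c x = trL c c' x *v t c' (transition c c' x)" using t c x unfolding sections_T by blast
  then show "Phi_adjoint (Sg c) (g c) (t c) x = (\<chi> i. trL c c' x *v (Phi_adjoint (Sg c') (g c') (t c') (transition c c' x) $ i))"
    by (simp add: Phi_adjoint_def M_change_trL[OF c x] matrix_linear_simps)
qed

lemma D_adjoint_section:
  assumes p: "p \<in> sections A (TB \<oplus>\<^sub>b ELB)"
  shows "glob D_adjoint Sg g p \<in> sections A (SB \<oplus>\<^sub>b EB)"
  unfolding sections_SE glob_def
proof (intro conjI ballI)
  have sm: "smooth_on (cdom c) (p c)" if "c \<in> A" for c using p that by (simp add: sections_TEL)
  show "smooth_on (cdom c) (D_adjoint (Sg c) (g c) (p c))" if "c \<in> A" for c
    using sm that by (intro triple_chart.smooth_D_adjoint on_chart)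
  show "snd (snd (fst (D_adjoint (Sg c) (g c) (p c) x))) \<in> sym0 (g c x)" if "c \<in> A" "x \<in> cdom c" for c x
    unfolding triple_chart.D_adjoint_eq[OF on_chart[OF that(1)]] Let_def adj_t_def
    using triple_chart.symtf_sym0[OF on_chart[OF that(1)] that(2)] by simp
  fix c c' x assume c: "c \<in> A" "c' \<in> A" and x: "x \<in> overlap c c'"
  interpret chart_change "cdom c" "Sg c" "g c" "cdom c'" "Sg c'" "g c'" "overlap c c'" "transition c c'"
    by (rule on_overlap[OF c])
  have "p c y = (L y *v fst (p c' (transition c c' y)), \<chi> i. L y *v (snd (p c' (transition c c' y)) $ i))"
    if "y \<in> overlap c c'" for y
    using p c that unfolding sections_TEL L_trL[OF c] by blast
  from D_adjoint_change[OF x this sm[OF c(2)]]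
  show "D_adjoint (Sg c) (g c) (p c) x = ((fst (fst (D_adjoint (Sg c') (g c') (p c') (transition c c' x))),
      fst (snd (fst (D_adjoint (Sg c') (g c') (p c') (transition c c' x)))),
      trL c c' x ** snd (snd (fst (D_adjoint (Sg c') (g c') (p c') (transition c c' x)))) ** transpose (trL c c' x)),
      snd (D_adjoint (Sg c') (g c') (p c') (transition c c' x)))"
    unfolding L_trL[OF c] Let_def .
qed

lemma d2_adjoint_section:
  assumes a: "a \<in> sections A ELB"
  shows "glob d2_adjoint Sg g a \<in> sections A SB"
proof -
  have "(\<lambda>c x. (0, a c x)) \<in> sections A (TB \<oplus>\<^sub>b ELB)"
    using a unfolding sections_TEL sections_EL
    by (auto intro!: smooth_on_Pair[OF chart_open(1)] smooth_on_const[OF chart_open(1)])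
  from D_adjoint_section[OF this] show ?thesis
    unfolding sections_SE sections_S glob_def d2_adjoint_def[abs_def]
    by (auto intro!: smooth_on_fst[OF chart_open(1)] simp: Let_def)
qed

lemma adjoints:
  shows "formal_adjoint A Sg TB SB (glob (dt1 (- sqrt 2) 0 (sqrt 2 / 2)) Sg g) (glob dt1_adjoint Sg g)"
    and "formal_adjoint A Sg ELB EB (glob (dt3 (- sqrt 2) (- sqrt 2 / 2)) Sg g) (glob dt3_adjoint Sg g)"
    and "formal_adjoint A Sg SB ELB (glob d2 Sg g) (glob d2_adjoint Sg g)"
    and "formal_adjoint A Sg ELB EB (glob d3 Sg g) (glob d3_adjoint Sg g)"
    and "formal_adjoint A Sg ELB TB (glob Phi Sg g) (glob Phi_adjoint Sg g)"
    and "formal_adjoint A Sg (SB \<oplus>\<^sub>b EB) (TB \<oplus>\<^sub>b ELB) (Dt (glob dt1_adjoint Sg g) (glob dt3_adjoint Sg g) 1 Sg g) (glob D_adjoint Sg g)"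
proof -
  have d: "triple_chart.divergence (cdom c) (g c) f Z"
    if "c \<in> A" "triple_chart.divergence (cdom c) (g c) f' Z" "\<And>x. x \<in> cdom c \<Longrightarrow> f x = f' x" for c f f' Z
    using triple_chart.divergence_scale[OF on_chart[OF that(1)] that(2), of f 1] that(3) by simp
  have iS: "ip SB c x s t = (1/4) * fst s * fst t + 8 * (fst (snd s) \<bullet> fst (snd t)) + inner2 (g c x) (snd (snd s)) (snd (snd t))" for c x s t
    by (simp add: S_bundle_def case_prod_beta)
  have iT: "ip TB c x s t = s \<bullet> (triple_chart.G (g c) x *v t)" if "c \<in> A" for c x s t
    by (simp add: T_bundle_def triple_chart.G_def[OF on_chart[OF that]])
  have iEL: "ip ELB c x a b = - (\<Sum>i\<in>UNIV. a$i \<bullet> (triple_chart.G (g c) x *v (J1_flat (\<lambda>i. triple_chart.M (Sg c) (g c) i x) b $ i)))"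
    if "c \<in> A" "x \<in> cdom c" for c x a b
    using triple_chart.EL_pairing[OF on_chart[OF that(1)] that(2)] by (simp add: EL_bundle_def)
  have iE: "ip EB c x s t = s \<bullet> t" for c x s t by (simp add: E_bundle_def)
  have isum: "ip (B1 \<oplus>\<^sub>b B2) c x p q = ip B1 c x (fst p) (fst q) + ip B2 c x (snd p) (snd q)" for B1 B2 c x p q
    by (simp add: bundle_sum_def)
  show "formal_adjoint A Sg TB SB (glob (dt1 (- sqrt 2) 0 (sqrt 2 / 2)) Sg g) (glob dt1_adjoint Sg g)"
  proof (rule formal_adjointI[OF dt1_adjoint_section])
    fix s t c assume st: "s \<in> sections A TB" "t \<in> sections A SB" and c: "c \<in> A"
    interpret triple_chart "cdom c" "Sg c" "g c" by (rule on_chart[OF c])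
    show "divergence (\<lambda>x. ip SB c x (glob (dt1 (- sqrt 2) 0 (sqrt 2 / 2)) Sg g s c x) (t c x)
        - ip TB c x (s c x) (glob dt1_adjoint Sg g t c x)) (\<lambda>x. s c x = 0 \<or> t c x = 0)"
      unfolding iS iT[OF c] glob_def
      by (rule divergence_dt1) (use st c in \<open>auto simp: sections_S sections_T\<close>)
  qed
  show "formal_adjoint A Sg ELB EB (glob (dt3 (- sqrt 2) (- sqrt 2 / 2)) Sg g) (glob dt3_adjoint Sg g)"
  proof (rule formal_adjointI[OF dt3_adjoint_section])
    fix s t c assume st: "s \<in> sections A ELB" "t \<in> sections A EB" and c: "c \<in> A"
    interpret triple_chart "cdom c" "Sg c" "g c" by (rule on_chart[OF c])
    show "divergence (\<lambda>x. ip EB c x (glob (dt3 (- sqrt 2) (- sqrt 2 / 2)) Sg g s c x) (t c x)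
        - ip ELB c x (s c x) (glob dt3_adjoint Sg g t c x)) (\<lambda>x. s c x = 0 \<or> t c x = 0)"
      by (rule d[OF c divergence_dt3[of "t c" "s c"]])
         (use st c in \<open>auto simp: sections_E sections_EL iE iEL[OF c] glob_def\<close>)
  qed
  show "formal_adjoint A Sg SB ELB (glob d2 Sg g) (glob d2_adjoint Sg g)"
  proof (rule formal_adjointI[OF d2_adjoint_section])
    fix s t c assume st: "s \<in> sections A SB" "t \<in> sections A ELB" and c: "c \<in> A"
    interpret triple_chart "cdom c" "Sg c" "g c" by (rule on_chart[OF c])
    show "divergence (\<lambda>x. ip ELB c x (glob d2 Sg g s c x) (t c x)
        - ip SB c x (s c x) (glob d2_adjoint Sg g t c x)) (\<lambda>x. s c x = 0 \<or> t c x = 0)"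
      by (rule d[OF c divergence_d2[of "s c" "t c"]])
         (use st c in \<open>auto simp: sections_S sections_EL iS iEL[OF c] glob_def\<close>)
  qed
  show "formal_adjoint A Sg ELB EB (glob d3 Sg g) (glob d3_adjoint Sg g)"
  proof (rule formal_adjointI[OF d3_adjoint_section])
    fix s t c assume st: "s \<in> sections A ELB" "t \<in> sections A EB" and c: "c \<in> A"
    interpret triple_chart "cdom c" "Sg c" "g c" by (rule on_chart[OF c])
    show "divergence (\<lambda>x. ip EB c x (glob d3 Sg g s c x) (t c x)
        - ip ELB c x (s c x) (glob d3_adjoint Sg g t c x)) (\<lambda>x. s c x = 0 \<or> t c x = 0)"
      by (rule d[OF c divergence_d3[of "t c" "s c"]])
         (use st c in \<open>auto simp: sections_E sections_EL iE iEL[OF c] glob_def\<close>)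
  qed
  show "formal_adjoint A Sg ELB TB (glob Phi Sg g) (glob Phi_adjoint Sg g)"
  proof (rule formal_adjointI[OF Phi_adjoint_section])
    fix s t c assume c: "c \<in> A"
    interpret triple_chart "cdom c" "Sg c" "g c" by (rule on_chart[OF c])
    show "divergence (\<lambda>x. ip TB c x (glob Phi Sg g s c x) (t c x)
        - ip ELB c x (s c x) (glob Phi_adjoint Sg g t c x)) (\<lambda>x. s c x = 0 \<or> t c x = 0)"
      by (rule divergenceI[of "\<lambda>x. 0"]) (simp_all add: iT[OF c] iEL[OF c] glob_def Phi_pairing smooth_rules(1))
  qed
  show "formal_adjoint A Sg (SB \<oplus>\<^sub>b EB) (TB \<oplus>\<^sub>b ELB) (Dt (glob dt1_adjoint Sg g) (glob dt3_adjoint Sg g) 1 Sg g) (glob D_adjoint Sg g)"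
  proof (rule formal_adjointI[OF D_adjoint_section])
    fix u p c assume up: "u \<in> sections A (SB \<oplus>\<^sub>b EB)" "p \<in> sections A (TB \<oplus>\<^sub>b ELB)" and c: "c \<in> A"
    interpret triple_chart "cdom c" "Sg c" "g c" by (rule on_chart[OF c])
    show "divergence (\<lambda>x. ip (TB \<oplus>\<^sub>b ELB) c x (Dt (glob dt1_adjoint Sg g) (glob dt3_adjoint Sg g) 1 Sg g u c x) (p c x)
        - ip (SB \<oplus>\<^sub>b EB) c x (u c x) (glob D_adjoint Sg g p c x)) (\<lambda>x. u c x = 0 \<or> p c x = 0)"
      by (rule d[OF c divergence_D[of "u c" "p c"]])
         (use up c in \<open>auto simp: sections_SE sections_TEL isum iS iT[OF c] iE iEL[OF c] glob_def Dt_def Let_def\<close>)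
  qed
qed

end

section \<open>The square of the operator and its intertwiners\<close>

text \<open>The maps \<open>X \<mapsto> eta i X (eta i)\<^sup>T\<close> act on trace-free symmetric tensors,
  that is on \<open>S\<^sub>+\<^sup>2 \<otimes> S\<^sub>-\<^sup>2\<close>, through the first factor, where their
  sum is the scalar \<open>-1\<close>.\<close>

lemma symtf_sandwich_flat:
  "symtf (mat 1) (mat 1) (\<Sum>i\<in>UNIV. eta i ** X ** transpose (eta i)) = - symtf (mat 1) (mat 1) X"
proof -
  have "(mat 1 :: real^4^4) \<bullet> Y = Y$1$1 + Y$2$2 + Y$3$3 + Y$4$4" for Y
    by (simp add: matrix_inner_sum mat_1_nth sum_4)
  then show ?thesis
    by (simp add: vec_eq_iff forall_4 symtf_def transpose_eta matrix_linear_simps sum_3 mat_1_nth transpose_nth)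
       (auto simp: field_simps)
qed

lemma (in adapted) symtf_sandwich: "symtf g G (\<Sum>i\<in>UNIV. M i ** X ** transpose (M i)) = - symtf g G X"
proof (rule frame_eqI2)
  have "e ** (M i ** X ** transpose (M i)) ** transpose e = eta i ** (e ** X ** transpose e) ** transpose (eta i)" for i
    by (simp add: M_eq matrix_transpose_mul matrix_mul_assoc[symmetric] e_B_simps)
  then have "e ** (\<Sum>i\<in>UNIV. M i ** X ** transpose (M i)) ** transpose e
      = (\<Sum>i\<in>UNIV. eta i ** (e ** X ** transpose e) ** transpose (eta i))"
    by (simp add: matrix_sum_simps)
  then show "e ** symtf g G (\<Sum>i\<in>UNIV. M i ** X ** transpose (M i)) ** transpose e = e ** (- symtf g G X) ** transpose e"
    by (simp add: frame_symtf symtf_sandwich_flat matrix_linear_simps)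
qed

lemma curvature_term_nth:
  assumes "transpose g = g" "transpose k = k"
  shows "curvature_term R g k $ \<mu> $ \<nu> = 2 * (\<Sum>\<rho>\<in>UNIV. \<Sum>\<alpha>\<in>UNIV. \<Sum>\<beta>\<in>UNIV. g $ \<mu> $ \<rho> * R \<nu> \<beta> $ \<alpha> $ \<rho> * k $ \<alpha> $ \<beta>)"
proof -
  have "(k $ \<beta> v* (R \<nu> \<beta> ** g)) $ \<mu> = (\<Sum>\<alpha>\<in>UNIV. \<Sum>\<rho>\<in>UNIV. g $ \<mu> $ \<rho> * R \<nu> \<beta> $ \<alpha> $ \<rho> * k $ \<alpha> $ \<beta>)" for \<beta>
    by (simp add: vector_matrix_mult_def matrix_matrix_mult_def sum_distrib_left sum_distrib_right
        symmetric_nth[OF assms(1), of _ \<mu>] symmetric_nth[OF assms(2), of \<beta>] ac_simps)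
  then have "curvature_term R g k $ \<mu> $ \<nu> = 2 * (\<Sum>\<beta>\<in>UNIV. \<Sum>\<alpha>\<in>UNIV. \<Sum>\<rho>\<in>UNIV. g $ \<mu> $ \<rho> * R \<nu> \<beta> $ \<alpha> $ \<rho> * k $ \<alpha> $ \<beta>)"
    by (simp add: curvature_term_def transpose_nth sum_component)
  then show ?thesis by (subst sum_reverse) simp
qed

text \<open>The map on the targets. It first subtracts from \<open>a\<close> the part of \<open>t\<close> that
  \<open>Phi\<^sup>*\<close> embeds into \<open>E \<otimes> \<Lambda>\<^sup>1\<close>, which removes
  \<open>h\<close> and \<open>h\<^sub>+\<close> from the second component, and then subtracts \<open>Phi\<close>
  of the result from \<open>t\<close>, which removes \<open>h\<^sub>-\<close> and the trace-free tensor from the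
  first.\<close>

definition intertwiner :: "triple \<Rightarrow> real^4^4 \<Rightarrow> (real^4) \<times> (real^4^3) \<Rightarrow> (real^4) \<times> (real^4^3)" where
  "intertwiner S g p = (let a = (\<chi> i. snd p $ i - (sqrt 2 / 2) *\<^sub>R (mixS S g i *v fst p)) in
     (fst p - (sqrt 2 / 2) *\<^sub>R (\<Sum>i\<in>UNIV. mixS S g i *v (a $ i)), a))"

text \<open>Its arguments are \<open>(h, h\<^sub>+, t)\<close> and \<open>h\<^sub>-\<close>, the variables of
  the two Dirac operators regrouped according to \<open>S \<oplus> E\<close>.\<close>

definition mixing :: "sfib \<times> (real^3) \<Rightarrow> sfib \<times> (real^3)" where
  "mixing u = ((- 2 * fst (fst u), (1/4) *\<^sub>R snd u - (1/2) *\<^sub>R fst (snd (fst u)), snd (snd (fst u))),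
     sqrt 2 *\<^sub>R fst (snd (fst u)) + (sqrt 2 / 2) *\<^sub>R snd u)"

text \<open>The projection to \<open>t = 0\<close>, \<open>\<chi> = - 2 sqrt 2 q\<close> along \<open>h =
  0\<close>, \<open>\<chi> = 2 sqrt 2 q\<close>.\<close>

definition positive_part :: "sfib \<times> (real^3) \<Rightarrow> sfib \<times> (real^3)" where
  "positive_part u = ((fst (fst u), (1/2) *\<^sub>R (fst (snd (fst u)) - (sqrt 2 / 4) *\<^sub>R snd u), 0),
     (1/2) *\<^sub>R (snd u - (2 * sqrt 2) *\<^sub>R fst (snd (fst u))))"

lemma intertwine_at_point:
  fixes gh dv :: "real^4" and gp gm c :: "real^4^3"
  assumes Q: "quaternion_relations (mixS S g)" and c: "(\<Sum>i\<in>UNIV. mixS S g i *v (c$i)) = - dv"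
  shows "intertwiner S g
      ((sqrt 2 / 4) *\<^sub>R ((-2) *\<^sub>R gh) - sqrt 2 *\<^sub>R dv + (\<Sum>i\<in>UNIV. mixS S g i *v (sqrt 2 *\<^sub>R gp$i + (sqrt 2 / 2) *\<^sub>R gm$i)),
       (\<chi> i. (1/4) *\<^sub>R (mixS S g i *v ((-2) *\<^sub>R gh)) + 2 *\<^sub>R ((1/4) *\<^sub>R gm$i - (1/2) *\<^sub>R gp$i) - c$i)
        + (- (sqrt 2 / 2)) *\<^sub>R J1_flat (mixS S g) (\<chi> i. sqrt 2 *\<^sub>R gp$i + (sqrt 2 / 2) *\<^sub>R gm$i))
    = (- (sqrt 2 / 2) *\<^sub>R (gh - 2 *\<^sub>R (\<Sum>i\<in>UNIV. mixS S g i *v (gp$i))), \<chi> i. gm$i + mixS S g i *v dv - c$i)"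
    (is "intertwiner S g (?t, ?a) = _")
proof -
  note q = quaternion_products_vector[OF Q]
  have ss: "sqrt 2 * (sqrt 2 * z) = 2 * z" for z :: real
    by (simp add: mult.assoc[symmetric])
  have "\<forall>i. ?a $ i - (sqrt 2 / 2) *\<^sub>R (mixS S g i *v ?t) = gm$i + mixS S g i *v dv - c$i"
    unfolding forall_3
    by (simp add: J1_flat_nth sum_3 q matrix_linear_simps matrix_vector_mult_diff_distrib)
       (simp add: vec_eq_iff field_simps ss)
  then have a: "(\<chi> i. ?a $ i - (sqrt 2 / 2) *\<^sub>R (mixS S g i *v ?t)) = (\<chi> i. gm$i + mixS S g i *v dv - c$i)"
    by (simp add: vec_eq_iff)
  have b: "(\<Sum>i\<in>UNIV. mixS S g i *v (gm$i + mixS S g i *v dv - c$i)) = (\<Sum>i\<in>UNIV. mixS S g i *v (gm$i)) - 2 *\<^sub>R dv"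
    using c by (simp add: sum_3 q matrix_linear_simps matrix_vector_mult_diff_distrib algebra_simps scaleR_2)
  have "?t - (sqrt 2 / 2) *\<^sub>R (\<Sum>i\<in>UNIV. mixS S g i *v (gm$i + mixS S g i *v dv - c$i))
      = - (sqrt 2 / 2) *\<^sub>R (gh - 2 *\<^sub>R (\<Sum>i\<in>UNIV. mixS S g i *v (gp$i)))"
    unfolding b by (simp add: sum_3 matrix_linear_simps) (simp add: vec_eq_iff field_simps ss)
  then show ?thesis
    unfolding intertwiner_def fst_conv snd_conv Let_def a by simp
qed

context triple_chart
begin

text \<open>As \<open>J1 (Phi\<^sup>* \<xi>)\<^sup>i = \<Sigma>\<^sup>i \<xi>\<close>, the components of
  \<open>d2\<^sup>* Phi\<^sup>* \<xi>\<close> are \<open>3\<close>, \<open>1\<close> and \<open>-1\<close> times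
  those of \<open>d1 \<xi>\<close>; the difference has no component in \<open>E\<close>.\<close>

lemma dt1_expression:
  assumes x: "x \<in> U" and \<xi>: "smooth_on U \<xi>"
  shows "dt1 (- sqrt 2) 0 (sqrt 2 / 2) S g \<xi> x
    = (sqrt 2 / 2) *\<^sub>R d1 S g \<xi> x + (- (sqrt 2 / 2)) *\<^sub>R d2_adjoint S g (Phi_adjoint S g \<xi>) x"
proof -
  obtain e where "adapted (S x) (g x) e" using ex_adapted[OF x] by blast
  then interpret a: adapted "S x" "g x" e .
  note eqs = adapted_eqs[OF a.adapted_axioms]
  have J: "J1_flat (Mx y) (Phi_adjoint S g \<xi> y) $ i = M i y *v \<xi> y" if "y \<in> U" for y i
  proof -
    have "Phi_adjoint S g \<xi> y = (1/2) *\<^sub>R (\<chi> i. M i y *v \<xi> y)"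
      by (simp add: Phi_adjoint_def mixS_M vec_eq_iff)
    then show ?thesis by (simp add: J1_flat_scaleR J1_M[OF that])
  qed
  have Nb: "cov1 g (\<lambda>y. J1_flat (Mx y) (Phi_adjoint S g \<xi> y) $ i) x = cov1 g \<xi> x ** transpose (M i x)" for i
    unfolding cov1_M[OF x diff[OF \<xi> x], symmetric] by (rule cov1_cong[OF x J])
  have tr: "G x \<bullet> (N ** transpose (M i x) ** transpose (M i x)) = - (G x \<bullet> N)" for N i
  proof -
    have "\<forall>i. N ** transpose (M i x) ** transpose (M i x) = - N"
      unfolding forall_3 using quaternion_products[OF M_quaternion[OF x]]
      by (simp add: matrix_mul_assoc[symmetric] matrix_transpose_mul[symmetric] matrix_linear_simps)
    then show ?thesis by simp
  qed
  have K: "G x \<bullet> (N ** transpose (M i x)) = K i x \<bullet> N" for N i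
    by (simp add: matrix_inner_mult_transpose S_M_K(3)[OF x])
  have sw: "symtf (g x) (G x) (\<Sum>i\<in>UNIV. M i x ** (N ** transpose (M i x))) = - symtf (g x) (G x) N" for N
    using a.symtf_sandwich[of N] unfolding eqs by (simp add: matrix_mul_assoc)
  show ?thesis
    unfolding d2_adjoint_eq Nb Let_def op_d1[OF x \<xi>] op_dt1'[OF diff[OF \<xi> x]] sw tr
    by (simp add: K zero_vec_def scaleR_left_distrib[symmetric])
qed

lemma dt3_expression:
  assumes x: "x \<in> U" and a: "smooth_on U a"
  shows "dt3 (- sqrt 2) (- sqrt 2 / 2) S g a x = (- (sqrt 2 / 2)) *\<^sub>R d3 S g (J1 S g a) x"
proof -
  have J: "J1 S g a = (\<lambda>y. J1_flat (Mx y) (a y))" by (simp add: fun_eq_iff op_J1)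
  show ?thesis
    unfolding J
    by (simp add: op_d3[OF x diff[OF smooth_J1[OF a] x]] op_dt3[OF x diff[OF a x]] cov1_J1[OF x diff[OF a x]]
        JN_square[OF M_quaternion[OF x]] vec_eq_iff inner_add_right algebra_simps)
qed

lemma dt4_expression: "dt4 1 S g \<chi>' x = 1 *\<^sub>R Phi S g (d3_adjoint S g \<chi>') x"
  by (simp add: op_dt4 op_Phi d3_adjoint_def gradE_def)

lemma grad_linear:
  assumes x: "x \<in> U" and f: "smooth_on U f" and f': "smooth_on U f'"
  shows "grad (\<lambda>y. c * f y + c' * f' y) x = c *\<^sub>R grad f x + c' *\<^sub>R grad f' x"
proof -
  have "smooth_on U (\<lambda>y. c * f y)" "smooth_on U (\<lambda>y. c' * f' y)" by (intro smooth_rules f f')+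
  note d = this[THEN diff, OF x]
  have "pd \<mu> (\<lambda>y. c * f y + c' * f' y) x = c * pd \<mu> f x + c' * pd \<mu> f' x" for \<mu>
    using pd_bounded_linear[OF bounded_linear_mult_right[of c] diff[OF f x], of \<mu>]
      pd_bounded_linear[OF bounded_linear_mult_right[of c'] diff[OF f' x], of \<mu>]
    by (simp add: pd_add[OF d])
  then show ?thesis by (simp add: grad_def vec_eq_iff)
qed

abbreviation "Dloc u \<equiv> (\<lambda>y. (dt1_adjoint S g (\<lambda>y. fst (u y)) y + dt4 1 S g (\<lambda>y. snd (u y)) y,
   d2 S g (\<lambda>y. fst (u y)) y + dt3_adjoint S g (\<lambda>y. snd (u y)) y))"

lemma Dloc_eq:
  assumes x: "x \<in> U" and u: "smooth_on U u" and u0: "\<forall>y\<in>U. snd (snd (fst (u y))) \<in> sym0 (g y)"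
  shows "Dloc u x = ((sqrt 2 / 4) *\<^sub>R grad (\<lambda>y. fst (fst (u y))) x - sqrt 2 *\<^sub>R contract3 (G x) (cov2 g (\<lambda>y. snd (snd (fst (u y)))) x)
      + (\<Sum>i\<in>UNIV. M i x *v grad (\<lambda>y. snd (u y) $ i) x),
    (\<chi> i. (1/4) *\<^sub>R (M i x *v grad (\<lambda>y. fst (fst (u y))) x) + 2 *\<^sub>R grad (\<lambda>y. fst (snd (fst (u y))) $ i) x
      - contract3 (K i x) (cov2 g (\<lambda>y. snd (snd (fst (u y)))) x)) + (- (sqrt 2 / 2)) *\<^sub>R J1_flat (Mx x) (gradE (\<lambda>y. snd (u y)) x))"
proof -
  have s: "smooth_on U (\<lambda>y. fst (u y))" by (intro smooth_rules u)
  have "d2 S g (\<lambda>y. fst (u y)) x = (\<chi> i. (1/4) *\<^sub>R (M i x *v grad (\<lambda>y. fst (fst (u y))) x) + 2 *\<^sub>R grad (\<lambda>y. fst (snd (fst (u y))) $ i) x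
      - contract3 (K i x) (cov2 g (\<lambda>y. snd (snd (fst (u y)))) x))"
    using u0 by (intro op_d2[OF x s]) blast
  then show ?thesis by (simp add: dt1_adjoint_def dt3_adjoint_def op_dt4 G_inv mixS_M)
qed

lemma square:
  assumes x: "x \<in> U" and u: "smooth_on U u" and u0: "\<forall>y\<in>U. snd (snd (fst (u y))) \<in> sym0 (g y)"
  shows "D_adjoint S g (Dloc u) x = (let l = Lap S g u x + Curv S g u x in
    ((fst (fst l), - (sqrt 2 / 4) *\<^sub>R snd l, - snd (snd (fst l))), - (2 * sqrt 2) *\<^sub>R fst (snd (fst l))))"
proof -
  define h q T \<chi>' where "h = (\<lambda>y. fst (fst (u y)))" and "q = (\<lambda>y. fst (snd (fst (u y))))"
    and "T = (\<lambda>y. snd (snd (fst (u y))))" and "\<chi>' = (\<lambda>y. snd (u y))"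
  have sm: "smooth_on U h" "smooth_on U T" "smooth_on U (\<lambda>y. q y $ i)" "smooth_on U (\<lambda>y. \<chi>' y $ i)" "smooth_on U \<chi>'" for i
    unfolding h_def q_def T_def \<chi>'_def by (intro smooth_rules u)+
  have T: "transpose (T y) = T y" "G y \<bullet> T y = 0" if "y \<in> U" for y
    using bspec[OF u0 that] sym0_iff'[OF that] by (auto simp: T_def)
  define H Hq Hc Q where "H = cov1 g (grad h) x" and "Hq = (\<lambda>i. cov1 g (grad (\<lambda>y. q y $ i)) x)"
    and "Hc = (\<lambda>i. cov1 g (grad (\<lambda>y. \<chi>' y $ i)) x)" and "Q = cov22 g T x"
  define t where "t = (\<lambda>y. (sqrt 2 / 4) *\<^sub>R grad h y - sqrt 2 *\<^sub>R contract3 (G y) (cov2 g T y)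
      + (\<Sum>i\<in>UNIV. M i y *v grad (\<lambda>y. \<chi>' y $ i) y))"
  define a where "a = (\<lambda>y. (\<chi> i. (1/4) *\<^sub>R (M i y *v grad h y) + 2 *\<^sub>R grad (\<lambda>y. q y $ i) y
      - contract3 (K i y) (cov2 g T y)) + (- (sqrt 2 / 2)) *\<^sub>R J1_flat (Mx y) (gradE \<chi>' y))"
  have D: "Dloc u y = (t y, a y)" if "y \<in> U" for y
    unfolding t_def a_def h_def q_def T_def \<chi>'_def by (rule Dloc_eq[OF that u u0])
  have sh: "smooth_on U (grad h)" "smooth_on U (grad (\<lambda>y. q y $ i))" "smooth_on U (grad (\<lambda>y. \<chi>' y $ i))" for i
    by (intro smooth_grad sm)+
  have sg: "smooth_on U (gradE \<chi>')" by (rule smooth_gradE[OF sm(5)])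
  have sG: "smooth_on U (\<lambda>y. contract3 (G y) (cov2 g T y))" and sK: "smooth_on U (\<lambda>y. contract3 (K i y) (cov2 g T y))" for i
    by (intro smooth_contract3 smooth_G smooth_K sm)+
  have sMc: "smooth_on U (\<lambda>y. M i y *v grad (\<lambda>y. \<chi>' y $ i) y)" and sMh: "smooth_on U (\<lambda>y. M i y *v grad h y)" for i
    by (intro smooth_rules smooth_M sh)+
  have sJ: "smooth_on U (\<lambda>y. J1_flat (Mx y) (gradE \<chi>' y) $ i)" for i
    by (intro smooth_rules smooth_J1 sg)
  have st: "smooth_on U (\<lambda>y. (sqrt 2 / 4) *\<^sub>R grad h y)" "smooth_on U (\<lambda>y. sqrt 2 *\<^sub>R contract3 (G y) (cov2 g T y))"
    "smooth_on U (\<lambda>y. \<Sum>i\<in>UNIV. M i y *v grad (\<lambda>y. \<chi>' y $ i) y)"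
    by (intro smooth_rules sh sG sMc)+
  have sa: "smooth_on U (\<lambda>y. (1/4) *\<^sub>R (M i y *v grad h y))" "smooth_on U (\<lambda>y. 2 *\<^sub>R grad (\<lambda>y. q y $ i) y)"
    "smooth_on U (\<lambda>y. (sqrt 2 / 2) *\<^sub>R (J1_flat (Mx y) (gradE \<chi>' y) $ i))" for i
    by (intro smooth_rules sMh sh sJ)+
  have sma: "smooth_on U a" unfolding a_def by (intro smooth_rules sMh sh sK smooth_J1 sg)
  note dst = st[THEN diff, OF x] and dsa = sa[THEN diff, OF x]
  have cG: "cov1 g (\<lambda>y. contract3 (G y) (cov2 g T y)) x = (\<chi> \<mu>. contract3 (G x) (Q \<mu>))"
    unfolding Q_def by (rule cov1_contract3[OF x smooth_G pd_G[OF x] sm(2)])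
  have cK: "cov1 g (\<lambda>y. contract3 (K i y) (cov2 g T y)) x = (\<chi> \<mu>. contract3 (K i x) (Q \<mu>))" for i
    unfolding Q_def by (rule cov1_contract3[OF x smooth_K pd_K[OF x] sm(2)])
  have Nt: "cov1 g t x = (sqrt 2 / 4) *\<^sub>R H - sqrt 2 *\<^sub>R (\<chi> \<mu>. contract3 (G x) (Q \<mu>)) + (\<Sum>i\<in>UNIV. Hc i ** transpose (M i x))"
    unfolding t_def cov1_add[OF differentiable_diff[OF dst(1,2)] dst(3)] cov1_diff[OF dst(1,2)]
      cov1_const_scaleR[OF diff[OF sh(1) x]] cov1_const_scaleR[OF diff[OF sG x]] cov1_sum[OF diff[OF sMc x]]
      cov1_M[OF x diff[OF sh(3) x]] cG H_def Hc_def ..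
  have Jg: "cov1 g (\<lambda>y. J1_flat (Mx y) (gradE \<chi>' y) $ i) x = JN (Mx x) Hc i" for i
    unfolding cov1_J1[OF x diff[OF sg x]] Hc_def by (simp add: gradE_def)
  have an: "(\<lambda>y. a y $ i) = (\<lambda>y. (1/4) *\<^sub>R (M i y *v grad h y) + 2 *\<^sub>R grad (\<lambda>y. q y $ i) y - contract3 (K i y) (cov2 g T y)
      - (sqrt 2 / 2) *\<^sub>R (J1_flat (Mx y) (gradE \<chi>' y) $ i))" for i
    by (simp add: a_def fun_eq_iff)
  have Na: "cov1 g (\<lambda>y. a y $ i) x = (1/4) *\<^sub>R (H ** transpose (M i x)) + 2 *\<^sub>R Hq i - (\<chi> \<mu>. contract3 (K i x) (Q \<mu>))
      - (sqrt 2 / 2) *\<^sub>R JN (Mx x) Hc i" for i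
    unfolding an cov1_diff[OF differentiable_diff[OF differentiable_add[OF dsa(1,2)] diff[OF sK x]] dsa(3)]
      cov1_diff[OF differentiable_add[OF dsa(1,2)] diff[OF sK x]] cov1_add[OF dsa(1,2)]
      cov1_const_scaleR[OF diff[OF sMh x]] cov1_const_scaleR[OF diff[OF sh(2) x]] cov1_const_scaleR[OF diff[OF sJ x]]
      cov1_M[OF x diff[OF sh(1) x]] cK Jg H_def Hq_def ..
  have Nb: "cov1 g (\<lambda>y. J1_flat (Mx y) (a y) $ i) x
      = JN (Mx x) (\<lambda>i. (1/4) *\<^sub>R (H ** transpose (M i x)) + 2 *\<^sub>R Hq i - (\<chi> \<mu>. contract3 (K i x) (Q \<mu>))
      - (sqrt 2 / 2) *\<^sub>R JN (Mx x) Hc i) i" for i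
    unfolding cov1_J1[OF x diff[OF sma x]] Na ..
  have DA: "D_adjoint S g (Dloc u) x = (let N = cov1 g t x; Nb = (\<lambda>i. cov1 g (\<lambda>y. J1_flat (Mx y) (a y) $ i) x) in
     ((adj_h (sqrt 2) (Mx x) (G x) N Nb, \<chi> i. (1/4) * (G x \<bullet> Nb i), adj_t (sqrt 2) (Mx x) (g x) (G x) N Nb),
      \<chi> i. adj_c (sqrt 2) (Mx x) (G x) N Nb i))"
  proof -
    have "cov1 g (\<lambda>y. fst (Dloc u y)) x = cov1 g t x" by (rule cov1_cong[OF x]) (simp only: D fst_conv)
    moreover have "cov1 g (\<lambda>y. J1_flat (Mx y) (snd (Dloc u y)) $ i) x = cov1 g (\<lambda>y. J1_flat (Mx y) (a y) $ i) x" for i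
      by (rule cov1_cong[OF x]) (simp only: D snd_conv)
    ultimately show ?thesis unfolding D_adjoint_eq by (simp only:)
  qed
  obtain e where "adapted (S x) (g x) e" using ex_adapted[OF x] by blast
  then interpret p: adapted "S x" "g x" e .
  note eqs = adapted_eqs[OF p.adapted_axioms]
  have Hs: "transpose H = H" "transpose (Hq i) = Hq i" "transpose (Hc i) = Hc i" for i
    unfolding H_def Hq_def Hc_def by (rule hessian_sym[OF x sm(1)] hessian_sym[OF x sm(3)] hessian_sym[OF x sm(4)])+
  have Qs: "transpose (Q \<mu> \<nu>) = Q \<mu> \<nu>" and Qt: "G x \<bullet> Q \<mu> \<nu> = 0" for \<mu> \<nu>
    unfolding Q_def using cov22_sym[OF x sm(2) T(1)] cov22_trace_free[OF x sm(2) T(2)] by blast+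
  have Ric: "Q \<mu> \<nu> - Q \<nu> \<mu> = - (Riem g x \<mu> \<nu> ** T x) - T x ** transpose (Riem g x \<mu> \<nu>)" for \<mu> \<nu>
    unfolding Q_def by (rule Ricci_identity[OF x sm(2)])
  have Rg: "Riem g x \<mu> \<nu> ** g x + g x ** transpose (Riem g x \<mu> \<nu>) = 0" for \<mu> \<nu>
    by (rule Riem_parallel[OF x smg pd_g])
  have RS: "Riem g x \<mu> \<nu> ** S x $ i + S x $ i ** transpose (Riem g x \<mu> \<nu>) = 0" for \<mu> \<nu> i
    by (rule Riem_parallel[OF x smooth_Si pd_S])
  have r2: "sqrt 2 * sqrt 2 = (2 :: real)" by simp
  note sq = p.square_at_point[where R = "Riem g x" and h = "T x" and H = H and Hq = Hq and Hc = Hc and Q = Q and r = "sqrt 2",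
      unfolded eqs, OF r2 Hs Qs Qt T(1)[OF x] T(2)[OF x] Ric Riem_anti Rg RS Riem_bianchi[OF x]]
  have L0: "laplace g (ten0 h) x [] = G x \<bullet> H" "laplace g (ten0 (\<lambda>y. q y $ i)) x [] = G x \<bullet> Hq i"
    "laplace g (ten0 (\<lambda>y. \<chi>' y $ i)) x [] = G x \<bullet> Hc i" for i
    unfolding H_def Hq_def Hc_def by (rule laplace_ten0[OF x sm(1)] laplace_ten0[OF x sm(3)] laplace_ten0[OF x sm(4)])+
  have L2: "(\<chi> \<mu> \<nu>. laplace g (ten2 T) x [\<mu>, \<nu>]) = (\<Sum>\<mu>\<in>UNIV. \<Sum>\<nu>\<in>UNIV. G x $ \<mu> $ \<nu> *\<^sub>R Q \<mu> \<nu>)"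
    by (simp add: vec_eq_iff laplace_ten2[OF x sm(2)] Q_def sum_component)
  have Lp: "Lap S g u x = ((G x \<bullet> H, \<chi> i. G x \<bullet> Hq i, \<Sum>\<mu>\<in>UNIV. \<Sum>\<nu>\<in>UNIV. G x $ \<mu> $ \<nu> *\<^sub>R Q \<mu> \<nu>), \<chi> i. G x \<bullet> Hc i)"
    unfolding Lap_def L0[symmetric] L2[symmetric] h_def q_def T_def \<chi>'_def ..
  have hup: "transpose (G x ** T x ** G x) = G x ** T x ** G x"
    by (simp add: matrix_transpose_mul transpose_G[OF x] T(1)[OF x] matrix_mul_assoc)
  have C: "Curv S g u x = ((0, 0, curvature_term (Riem g x) (g x) (G x ** T x ** G x)), 0)"
    unfolding Curv_def Let_def G_inv T_def[symmetric] riemann_Riem[OF diff[OF smooth_Gam x]]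
    by (simp add: vec_eq_iff curvature_term_nth[OF g_sym[OF x] hup[unfolded T_def]] T_def)
  show ?thesis
    unfolding DA Let_def Nt Nb sq Lp C
    by (simp add: vec_eq_iff)
qed

text \<open>The square is \<open>\<Delta>\<close> on \<open>h\<close>, \<open>- \<Delta>\<close> on the
  trace-free part, and exchanges the two copies of \<open>E\<close>; on the two summands defined by
  \<open>positive_part\<close> the copies are proportional, and so are their Laplacians.\<close>

lemma laplace_proportional:
  assumes x: "x \<in> U" and f: "smooth_on U f" and e': "\<forall>y\<in>U. f' y = c * f y"
  shows "laplace g (ten0 f') x [] = c * laplace g (ten0 f) x []"
proof -
  note e = bspec[OF e']
  have sf': "smooth_on U f'" by (rule smooth_on_cong[OF opn e[symmetric]]) (auto intro: smooth_rules f)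
  have "grad f' y = c *\<^sub>R grad f y" if "y \<in> U" for y
  proof -
    have "pd \<mu> f' y = pd \<mu> (\<lambda>y. c * f y) y" for \<mu> by (rule pd_cong[OF that e])
    also have "pd \<mu> (\<lambda>y. c * f y) y = c * pd \<mu> f y" for \<mu>
      by (rule pd_bounded_linear[OF bounded_linear_mult_right diff[OF f that]])
    finally show ?thesis by (simp add: grad_def vec_eq_iff)
  qed
  then have "cov1 g (grad f') x = cov1 g (\<lambda>y. c *\<^sub>R grad f y) x" by (rule cov1_cong[OF x])
  then show ?thesis
    by (simp add: laplace_ten0[OF x] sf' f cov1_const_scaleR[OF diff[OF smooth_grad[OF f] x]])
qed

lemma laplace_zero:
  assumes x: "x \<in> U" and z': "\<forall>y\<in>U. T y = 0"
  shows "laplace g (ten2 T) x [\<mu>, \<nu>] = 0"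
proof -
  note z = bspec[OF z']
  have s: "smooth_on U T" by (rule smooth_on_cong[OF opn z[symmetric]]) (auto intro: smooth_rules)
  have 1: "cov2 g T y \<nu> = 0" if "y \<in> U" for y \<nu>
  proof -
    have "pd \<nu> T y = pd \<nu> (\<lambda>y. 0) y" by (rule pd_cong[OF that z])
    then show ?thesis by (simp add: cov2_def z[OF that])
  qed
  have "pd \<mu> (\<lambda>y. cov2 g T y \<nu>) x = pd \<mu> (\<lambda>y. 0) x" for \<mu> \<nu> by (rule pd_cong[OF x 1])
  then have "cov22 g T x \<mu> \<nu> = 0" for \<mu> \<nu> by (simp add: cov22_def 1[OF x])
  then show ?thesis by (simp add: laplace_ten2[OF x s])
qed

lemma square_signs:
  assumes x: "x \<in> U" and u: "smooth_on U u" and u0: "\<forall>y\<in>U. snd (snd (fst (u y))) \<in> sym0 (g y)"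
  shows "(\<And>y. y \<in> U \<Longrightarrow> positive_part (u y) = u y) \<Longrightarrow> D_adjoint S g (Dloc u) x = Lap S g u x + Curv S g u x"
    and "(\<And>y. y \<in> U \<Longrightarrow> positive_part (u y) = 0) \<Longrightarrow> D_adjoint S g (Dloc u) x = - (Lap S g u x + Curv S g u x)"
proof -
  have sm: "smooth_on U (\<lambda>y. fst (snd (fst (u y))) $ i)" for i by (intro smooth_rules u)
  have ss: "sqrt 2 * (sqrt 2 * z) = 2 * z" for z :: real
    by (simp add: mult.assoc[symmetric])
  show "D_adjoint S g (Dloc u) x = Lap S g u x + Curv S g u x" if p: "\<And>y. y \<in> U \<Longrightarrow> positive_part (u y) = u y"
  proof -
    have T: "\<forall>y\<in>U. snd (snd (fst (u y))) = 0"
      using arg_cong[OF p, of _ "\<lambda>v. snd (snd (fst v))"] by (simp add: positive_part_def)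
    have "snd (u y) $ i = - (2 * sqrt 2) * fst (snd (fst (u y))) $ i" if "y \<in> U" for y i
      using arg_cong[OF p[OF that], of "\<lambda>v. snd v $ i"] by (simp add: positive_part_def field_simps)
    then have "\<forall>y\<in>U. snd (u y) $ i = - (2 * sqrt 2) * fst (snd (fst (u y))) $ i" for i by blast
    note l = laplace_proportional[OF x sm this]
    show ?thesis
      unfolding square[OF x u u0] Lap_def Curv_def Let_def l laplace_zero[OF x T] bspec[OF T x]
      by (simp add: vec_eq_iff prod_eq_iff ss)
  qed
  show "D_adjoint S g (Dloc u) x = - (Lap S g u x + Curv S g u x)" if p: "\<And>y. y \<in> U \<Longrightarrow> positive_part (u y) = 0"
  proof -
    have h: "\<forall>y\<in>U. fst (fst (u y)) = 0 * fst (snd (fst (u y))) $ 1"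
      using arg_cong[OF p, of _ "\<lambda>v. fst (fst v)"] by (simp add: positive_part_def)
    have "snd (u y) $ i = (2 * sqrt 2) * fst (snd (fst (u y))) $ i" if "y \<in> U" for y i
      using arg_cong[OF p[OF that], of "\<lambda>v. snd v $ i"] by (simp add: positive_part_def field_simps)
    then have "\<forall>y\<in>U. snd (u y) $ i = (2 * sqrt 2) * fst (snd (fst (u y))) $ i" for i by blast
    note l = laplace_proportional[OF x sm this] laplace_proportional[OF x sm h]
    show ?thesis
      unfolding square[OF x u u0] Lap_def Curv_def Let_def l
      by (simp add: vec_eq_iff prod_eq_iff ss)
  qed
qed

text \<open>At a point this is \<open>intertwine_at_point\<close>: the products \<open>\<Sigma>\<^sup>i
  \<Sigma>\<^sup>j\<close> that the change of variables creates reduce to \<open>J1\<close> and cancel the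
  \<open>J1\<close> in the adjoint of \<open>dt3\<close>; \<open>Phi_curl\<close> disposes of the curl of the
  trace-free part.\<close>

lemma intertwining:
  assumes x: "x \<in> U" and u: "smooth_on U u" and w: "smooth_on U w" and w0: "\<And>y. y \<in> U \<Longrightarrow> snd (w y) \<in> sym0 (g y)"
  shows "intertwiner (S x) (g x) (Dloc (\<lambda>y. mixing ((fst (u y), snd (u y), snd (w y)), fst (w y))) x)
    = (D4 S g u x, D12 S g w x)"
proof -
  define h p m T where "h = (\<lambda>y. fst (u y))" and "p = (\<lambda>y. snd (u y))" and "m = (\<lambda>y. fst (w y))" and "T = (\<lambda>y. snd (w y))"
  have sm: "smooth_on U h" "smooth_on U (\<lambda>y. p y $ i)" "smooth_on U (\<lambda>y. m y $ i)" "smooth_on U T" for i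
    unfolding h_def p_def m_def T_def by (intro smooth_rules u w)+
  have T: "transpose (T y) = T y" "G y \<bullet> T y = 0" "T y \<in> sym0 (g y)" if "y \<in> U" for y
    using w0[OF that] sym0_iff'[OF that] by (auto simp: T_def)
  let ?v = "\<lambda>y. mixing ((h y, p y, T y), m y)"
  have v: "smooth_on U ?v"
    unfolding mixing_def fst_conv snd_conv h_def p_def m_def T_def by (intro smooth_rules u w)
  have v0: "\<forall>y\<in>U. snd (snd (fst (?v y))) \<in> sym0 (g y)"
    using T(3) by (simp add: mixing_def)
  obtain e where "adapted (S x) (g x) e" using ex_adapted[OF x] by blast
  then interpret f: adapted "S x" "g x" e .
  note eqs = adapted_eqs[OF f.adapted_axioms]
  let ?c = "\<chi> i. contract3 (K i x) (cov2 g T x)" and ?dv = "contract3 (G x) (cov2 g T x)"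
  have c: "(\<Sum>i\<in>UNIV. mixS (S x) (g x) i *v (?c $ i)) = - ?dv"
    using f.Phi_curl[of "cov2 g T x", unfolded eqs] cov2_sym[OF x sm(4) T(1)] cov2_trace_free[OF x sm(4) T(2)]
    by (simp add: mixS_M)
  have g1: "grad (\<lambda>y. fst (fst (?v y))) x = (-2) *\<^sub>R grad h x"
    using grad_linear[OF x sm(1) sm(1), of "-2" 0] by (simp add: mixing_def)
  have g2: "grad (\<lambda>y. fst (snd (fst (?v y))) $ i) x = (1/4) *\<^sub>R (gradE m x $ i) - (1/2) *\<^sub>R (gradE p x $ i)" for i
    using grad_linear[OF x sm(3) sm(2), of "1/4" i "-1/2" i] by (simp add: mixing_def gradE_def)
  have g3: "grad (\<lambda>y. snd (?v y) $ i) x = sqrt 2 *\<^sub>R (gradE p x $ i) + (sqrt 2 / 2) *\<^sub>R (gradE m x $ i)" for i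
    using grad_linear[OF x sm(2) sm(3), of "sqrt 2" i "sqrt 2 / 2" i] by (simp add: mixing_def gradE_def)
  have g4: "(\<lambda>y. snd (snd (fst (?v y)))) = T" by (simp add: mixing_def)
  have g5: "gradE (\<lambda>y. snd (?v y)) x = (\<chi> i. sqrt 2 *\<^sub>R (gradE p x $ i) + (sqrt 2 / 2) *\<^sub>R (gradE m x $ i))"
    unfolding gradE_def[of "\<lambda>y. snd (?v y)"] g3 ..
  have "Dloc ?v x = ((sqrt 2 / 4) *\<^sub>R ((-2) *\<^sub>R grad h x) - sqrt 2 *\<^sub>R ?dv
        + (\<Sum>i\<in>UNIV. mixS (S x) (g x) i *v (sqrt 2 *\<^sub>R gradE p x $ i + (sqrt 2 / 2) *\<^sub>R gradE m x $ i)),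
       (\<chi> i. (1/4) *\<^sub>R (mixS (S x) (g x) i *v ((-2) *\<^sub>R grad h x)) + 2 *\<^sub>R ((1/4) *\<^sub>R gradE m x $ i - (1/2) *\<^sub>R gradE p x $ i) - ?c $ i)
        + (- (sqrt 2 / 2)) *\<^sub>R J1_flat (mixS (S x) (g x)) (\<chi> i. sqrt 2 *\<^sub>R gradE p x $ i + (sqrt 2 / 2) *\<^sub>R gradE m x $ i))"
    unfolding Dloc_eq[OF x v v0] g1 g2 g3 g4 g5 mixS_M by simp
  then have "intertwiner (S x) (g x) (Dloc ?v x)
      = (- (sqrt 2 / 2) *\<^sub>R (grad h x - 2 *\<^sub>R (\<Sum>i\<in>UNIV. mixS (S x) (g x) i *v (gradE p x $ i))),
         \<chi> i. gradE m x $ i + mixS (S x) (g x) i *v ?dv - ?c $ i)"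
    using intertwine_at_point[OF quat[OF x] c] by simp
  moreover have "D12 S g w x = (\<chi> i. gradE m x $ i + mixS (S x) (g x) i *v ?dv - ?c $ i)"
    using op_D12[OF x sm(4)[unfolded T_def], OF T(1)[unfolded T_def]] by (simp add: mixS_M gradE_def m_def T_def)
  moreover have "D4 S g u x = - (sqrt 2 / 2) *\<^sub>R (grad h x - 2 *\<^sub>R (\<Sum>i\<in>UNIV. mixS (S x) (g x) i *v (gradE p x $ i)))"
  proof -
    have "1 / sqrt 2 = sqrt 2 / (2 :: real)" by (simp add: field_simps)
    then show ?thesis by (simp only: op_D4 mixS_M) (simp add: gradE_def h_def p_def)
  qed
  ultimately show ?thesis by (simp add: h_def p_def m_def T_def)
qed

end

section \<open>Spinors\<close>

text \<open>A map \<open>P\<close> that extracts the real part recovers both parts of \<open>t = \<tau> v + \<i>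
  \<tau> w\<close>, the second one from \<open>- \<i> t\<close>.\<close>

lemma real_formI:
  fixes \<tau> :: "'v::real_vector \<Rightarrow> complex^'n"
  assumes \<tau>: "linear \<tau>" "\<tau> ` V \<subseteq> W" and neg: "\<And>v. v \<in> V \<Longrightarrow> - v \<in> V" and W: "\<And>t. t \<in> W \<Longrightarrow> (- \<i>) *s t \<in> W"
    and P: "\<And>t. t \<in> W \<Longrightarrow> P t \<in> V" "\<And>t. t \<in> W \<Longrightarrow> t = \<tau> (P t) + \<i> *s \<tau> (P ((- \<i>) *s t))"
    "\<And>v w. v \<in> V \<Longrightarrow> w \<in> V \<Longrightarrow> P (\<tau> v + \<i> *s \<tau> w) = v"
  shows "real_form \<tau> V W"
  unfolding real_form_def
proof (intro conjI \<tau> ballI)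
  fix t assume t: "t \<in> W"
  show "\<exists>!(v, w). v \<in> V \<and> w \<in> V \<and> t = \<tau> v + \<i> *s \<tau> w"
  proof (rule ex1I[of _ "(P t, P ((- \<i>) *s t))"])
    show "case (P t, P ((- \<i>) *s t)) of (v, w) \<Rightarrow> v \<in> V \<and> w \<in> V \<and> t = \<tau> v + \<i> *s \<tau> w"
      using P(1,2)[OF t] P(1)[OF W[OF t]] by simp
    fix p assume "case p of (v, w) \<Rightarrow> v \<in> V \<and> w \<in> V \<and> t = \<tau> v + \<i> *s \<tau> w"
    then obtain v w where p: "p = (v, w)" and vw: "v \<in> V" "w \<in> V" "t = \<tau> v + \<i> *s \<tau> w" by (cases p) auto
    have "(- \<i>) *s t = \<tau> w + \<i> *s \<tau> (- v)"
      by (simp add: vw(3) linear_neg[OF \<tau>(1)] vec_eq_iff algebra_simps)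
    then show "p = (P t, P ((- \<i>) *s t))"
      using P(3)[OF vw(1,2)] P(3)[OF vw(2) neg[OF vw(1)]] by (simp add: p vw(3)[symmetric])
  qed
qed

text \<open>The invariant form of \<open>SU(2)\<close>. It turns \<open>Hom (S\<^sub>+, S\<^sub>-)\<close> into
  \<open>S\<^sub>- \<otimes> S\<^sub>+\<close> and endomorphisms of \<open>S\<^sub>+\<close> into
  \<open>S\<^sub>+ \<otimes> S\<^sub>+\<close>.\<close>

definition symplectic :: "complex^2^2" where
  "symplectic = vector [vector [0, 1], vector [-1, 0]]"

definition tensor2 :: "complex^2^2 \<Rightarrow> spin2" where
  "tensor2 X = (\<chi> p. X $ fst p $ snd p)"

text \<open>In \<open>S \<otimes> S' \<otimes> S\<^sub>+\<^sup>2\<close> one matrix carries the first two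
  indices and the other the last two, or one carries the first and the third and the other the second and the
  fourth.\<close>

definition pair_tensor :: "complex^2^2 \<Rightarrow> complex^2^2 \<Rightarrow> spin4" where
  "pair_tensor X Y = (\<chi> p. case p of (a, b, c, d) \<Rightarrow> X $ a $ b * Y $ c $ d)"

definition cross_tensor :: "complex^2^2 \<Rightarrow> complex^2^2 \<Rightarrow> spin4" where
  "cross_tensor X Y = (\<chi> p. case p of (a, b, c, d) \<Rightarrow> X $ a $ c * Y $ b $ d)"

text \<open>The relative factor \<open>-2\<close> between the scalar and the imaginary quaternion is the
  coefficient in \<open>D4\<close>; the common factor normalizes its target to \<open>tau2\<close>.\<close>

definition tau1 :: "real \<times> (real^3) \<Rightarrow> spin2" where
  "tau1 p = tensor2 (((- (fst p) / sqrt 2) *\<^sub>R mat 1 + sqrt 2 *\<^sub>R quat3 (snd p)) ** symplectic)"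

definition tau2 :: "real^4 \<Rightarrow> spin2" where
  "tau2 k = tensor2 (quat k ** symplectic)"

text \<open>The summand \<open>E\<close> sits in the antisymmetric part of \<open>S\<^sub>- \<otimes>
  S\<^sub>-\<close>, and a trace-free symmetric tensor in \<open>S\<^sub>-\<^sup>2 \<otimes>
  S\<^sub>+\<^sup>2\<close>: both of its covector indices are split into an index of \<open>S\<^sub>-\<close>
  and one of \<open>S\<^sub>+\<close>.\<close>

definition tau3 :: "(real^3) \<times> (real^4^4) \<Rightarrow> spin4" where
  "tau3 p = - pair_tensor symplectic (quat3 (fst p) ** symplectic)
     + (\<Sum>m\<in>UNIV. cross_tensor (quat (axis m 1) ** symplectic) (quat (snd p $ m) ** symplectic))"

definition tau4 :: "real^4^3 \<Rightarrow> spin4" where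
  "tau4 a = - (\<Sum>i\<in>UNIV. pair_tensor (hconj (quat (a $ i)) ** symplectic) (quat3 (axis i 1) ** symplectic))"

text \<open>The inverses of \<open>tau3\<close> and \<open>tau4\<close> on the real parts of their targets; on \<open>\<tau> v + \<i> \<tau> w\<close> they return \<open>v\<close>.\<close>

definition tau3_real_part :: "spin4 \<Rightarrow> (real^3) \<times> (real^4^4)" where
  "tau3_real_part t = (let R = (\<lambda>a b c d. Re (t $ (a, b, c, d))); I = (\<lambda>a b c d. Im (t $ (a, b, c, d))) in
    (vector [(I 1 2 1 1 - I 1 2 2 2 - I 2 1 1 1 + I 2 1 2 2) / 4, (R 1 2 1 1 + R 1 2 2 2 - R 2 1 1 1 - R 2 1 2 2) / 4, (- 2 * I 1 2 1 2 + 2 * I 2 1 1 2) / 4],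
     vector
      [vector [ (- 2 * R 1 1 1 1 + 2 * R 1 2 1 2 + 2 * R 2 1 1 2 - 2 * R 2 2 2 2) / 8, (2 * I 1 1 1 1 - 2 * I 2 2 2 2) / 8, (2 * R 1 1 1 2 + R 1 2 1 1 - R 1 2 2 2 + R 2 1 1 1 - R 2 1 2 2 - 2 * R 2 2 1 2) / 8, (- 2 * I 1 1 1 2 + I 1 2 1 1 + I 1 2 2 2 + I 2 1 1 1 + I 2 1 2 2 - 2 * I 2 2 1 2) / 8 ],
       vector [ (2 * I 1 1 1 1 - 2 * I 2 2 2 2) / 8, (2 * R 1 1 1 1 + 2 * R 1 2 1 2 + 2 * R 2 1 1 2 + 2 * R 2 2 2 2) / 8, (- 2 * I 1 1 1 2 - I 1 2 1 1 - I 1 2 2 2 - I 2 1 1 1 - I 2 1 2 2 - 2 * I 2 2 1 2) / 8, (- 2 * R 1 1 1 2 + R 1 2 1 1 - R 1 2 2 2 + R 2 1 1 1 - R 2 1 2 2 + 2 * R 2 2 1 2) / 8 ],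
       vector [ (2 * R 1 1 1 2 + R 1 2 1 1 - R 1 2 2 2 + R 2 1 1 1 - R 2 1 2 2 - 2 * R 2 2 1 2) / 8, (- 2 * I 1 1 1 2 - I 1 2 1 1 - I 1 2 2 2 - I 2 1 1 1 - I 2 1 2 2 - 2 * I 2 2 1 2) / 8, (- 2 * R 1 1 2 2 - 2 * R 1 2 1 2 - 2 * R 2 1 1 2 - 2 * R 2 2 1 1) / 8, (2 * I 1 1 2 2 - 2 * I 2 2 1 1) / 8 ],
       vector [ (- 2 * I 1 1 1 2 + I 1 2 1 1 + I 1 2 2 2 + I 2 1 1 1 + I 2 1 2 2 - 2 * I 2 2 1 2) / 8, (- 2 * R 1 1 1 2 + R 1 2 1 1 - R 1 2 2 2 + R 2 1 1 1 - R 2 1 2 2 + 2 * R 2 2 1 2) / 8, (2 * I 1 1 2 2 - 2 * I 2 2 1 1) / 8, (- 2 * R 1 2 1 2 - 2 * R 2 1 1 2 + 2 * R 1 1 2 2 + 2 * R 2 2 1 1) / 8 ]]))"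

definition tau4_real_part :: "spin4 \<Rightarrow> real^4^3" where
  "tau4_real_part t = (let R = (\<lambda>a b c d. Re (t $ (a, b, c, d))); I = (\<lambda>a b c d. Im (t $ (a, b, c, d))) in
     vector
      [vector [ (- R 1 1 1 1 + R 1 1 2 2 + R 2 2 1 1 - R 2 2 2 2) / 4, (I 1 1 1 1 - I 1 1 2 2 + I 2 2 1 1 - I 2 2 2 2) / 4, (R 1 2 1 1 - R 1 2 2 2 + R 2 1 1 1 - R 2 1 2 2) / 4, (I 1 2 1 1 - I 1 2 2 2 - I 2 1 1 1 + I 2 1 2 2) / 4 ],
       vector [ (I 1 1 1 1 + I 1 1 2 2 - I 2 2 1 1 - I 2 2 2 2) / 4, (R 1 1 1 1 + R 1 1 2 2 + R 2 2 1 1 + R 2 2 2 2) / 4, (- I 1 2 1 1 - I 1 2 2 2 - I 2 1 1 1 - I 2 1 2 2) / 4, (R 1 2 1 1 + R 1 2 2 2 - R 2 1 1 1 - R 2 1 2 2) / 4 ],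
       vector [ (2 * R 1 1 1 2 - 2 * R 2 2 1 2) / 4, (- 2 * I 1 1 1 2 - 2 * I 2 2 1 2) / 4, (- 2 * R 1 2 1 2 - 2 * R 2 1 1 2) / 4, (- 2 * I 1 2 1 2 + 2 * I 2 1 1 2) / 4 ]])"

lemma vector_2_nth [simp]: "(vector [x, y] :: 'a::zero^2) $ 1 = x" "(vector [x, y] :: 'a::zero^2) $ 2 = y"
  by (simp_all add: vector_2)

lemma quat_nth:
  "quat k $ 1 $ 1 = Complex (k$4) (k$3)" "quat k $ 1 $ 2 = Complex (k$2) (k$1)"
  "quat k $ 2 $ 1 = Complex (- (k$2)) (k$1)" "quat k $ 2 $ 2 = Complex (k$4) (- (k$3))"
  by (simp_all add: quat_def)

lemma quat3_nth:
  "quat3 q $ 1 $ 1 = Complex 0 (q$3)" "quat3 q $ 1 $ 2 = Complex (q$2) (q$1)"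
  "quat3 q $ 2 $ 1 = Complex (- (q$2)) (q$1)" "quat3 q $ 2 $ 2 = Complex 0 (- (q$3))"
  by (simp_all add: quat3_def quat_nth vector_4_nth)

lemma symplectic_mult_nth: "(X ** symplectic) $ a $ 1 = - X $ a $ 2" "(X ** symplectic) $ a $ 2 = X $ a $ 1"
  by (simp_all add: matrix_matrix_mult_def sum_2 symplectic_def)

lemma symplectic_nth: "symplectic $ 1 $ 1 = 0" "symplectic $ 1 $ 2 = 1" "symplectic $ 2 $ 1 = -1" "symplectic $ 2 $ 2 = 0"
  by (simp_all add: symplectic_def)

lemma hconj_nth: "hconj X $ a $ b = cnj (X $ b $ a)"
  by (simp add: hconj_def)

lemma axis_nth: "axis m (1::real) $ n = (if n = m then 1 else 0)"
  by (simp add: axis_def)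

lemma forall_spin4: "(\<forall>p :: 2 \<times> 2 \<times> 2 \<times> 2. Q p) \<longleftrightarrow> (\<forall>a b c d. Q (a, b, c, d))"
  by auto

lemmas spin_nth = quat_nth quat3_nth symplectic_mult_nth symplectic_nth hconj_nth axis_nth

lemma tau3_nth:
  "tau3 (q, h) $ (1,1,1,1) = Complex (- h$1$1 + h$2$2) (h$1$2 + h$2$1)"
  "tau3 (q, h) $ (1,1,1,2) = Complex (h$1$3 - h$2$4) (- h$1$4 - h$2$3)"
  "tau3 (q, h) $ (1,1,2,1) = Complex (h$3$1 - h$4$2) (- h$3$2 - h$4$1)"
  "tau3 (q, h) $ (1,1,2,2) = Complex (- h$3$3 + h$4$4) (h$3$4 + h$4$3)"
  "tau3 (q, h) $ (1,2,1,1) = Complex (q$2 + h$1$3 + h$2$4) (q$1 + h$1$4 - h$2$3)"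
  "tau3 (q, h) $ (1,2,1,2) = Complex (h$1$1 + h$2$2) (- q$3 + h$1$2 - h$2$1)"
  "tau3 (q, h) $ (1,2,2,1) = Complex (- h$3$3 - h$4$4) (- q$3 - h$3$4 + h$4$3)"
  "tau3 (q, h) $ (1,2,2,2) = Complex (q$2 - h$3$1 - h$4$2) (- q$1 - h$3$2 + h$4$1)"
  "tau3 (q, h) $ (2,1,1,1) = Complex (- q$2 + h$3$1 + h$4$2) (- q$1 - h$3$2 + h$4$1)"
  "tau3 (q, h) $ (2,1,1,2) = Complex (- h$3$3 - h$4$4) (q$3 + h$3$4 - h$4$3)"
  "tau3 (q, h) $ (2,1,2,1) = Complex (h$1$1 + h$2$2) (q$3 - h$1$2 + h$2$1)"
  "tau3 (q, h) $ (2,1,2,2) = Complex (- q$2 - h$1$3 - h$2$4) (q$1 + h$1$4 - h$2$3)"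
  "tau3 (q, h) $ (2,2,1,1) = Complex (- h$3$3 + h$4$4) (- h$3$4 - h$4$3)"
  "tau3 (q, h) $ (2,2,1,2) = Complex (- h$3$1 + h$4$2) (- h$3$2 - h$4$1)"
  "tau3 (q, h) $ (2,2,2,1) = Complex (- h$1$3 + h$2$4) (- h$1$4 - h$2$3)"
  "tau3 (q, h) $ (2,2,2,2) = Complex (- h$1$1 + h$2$2) (- h$1$2 - h$2$1)"
  by (simp_all add: tau3_def pair_tensor_def cross_tensor_def spin_nth sum_4 complex_eq_iff)

lemma tau4_nth:
  "tau4 a $ (1,1,1,1) = Complex (- a$1$1 + a$2$2) (a$1$2 + a$2$1)"
  "tau4 a $ (1,1,1,2) = Complex (a$3$1) (- a$3$2)"
  "tau4 a $ (1,1,2,1) = Complex (a$3$1) (- a$3$2)"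
  "tau4 a $ (1,1,2,2) = Complex (a$1$1 + a$2$2) (- a$1$2 + a$2$1)"
  "tau4 a $ (1,2,1,1) = Complex (a$1$3 + a$2$4) (a$1$4 - a$2$3)"
  "tau4 a $ (1,2,1,2) = Complex (- a$3$3) (- a$3$4)"
  "tau4 a $ (1,2,2,1) = Complex (- a$3$3) (- a$3$4)"
  "tau4 a $ (1,2,2,2) = Complex (- a$1$3 + a$2$4) (- a$1$4 - a$2$3)"
  "tau4 a $ (2,1,1,1) = Complex (a$1$3 - a$2$4) (- a$1$4 - a$2$3)"
  "tau4 a $ (2,1,1,2) = Complex (- a$3$3) (a$3$4)"
  "tau4 a $ (2,1,2,1) = Complex (- a$3$3) (a$3$4)"
  "tau4 a $ (2,1,2,2) = Complex (- a$1$3 - a$2$4) (a$1$4 - a$2$3)"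
  "tau4 a $ (2,2,1,1) = Complex (a$1$1 + a$2$2) (a$1$2 - a$2$1)"
  "tau4 a $ (2,2,1,2) = Complex (- a$3$1) (- a$3$2)"
  "tau4 a $ (2,2,2,1) = Complex (- a$3$1) (- a$3$2)"
  "tau4 a $ (2,2,2,2) = Complex (- a$1$1 + a$2$2) (- a$1$2 - a$2$1)"
  by (simp_all add: tau4_def pair_tensor_def spin_nth sum_3 complex_eq_iff)

lemma tau2_nth: "tau2 k $ (1,1) = Complex (- (k$2)) (- (k$1))" "tau2 k $ (1,2) = Complex (k$4) (k$3)"
  "tau2 k $ (2,1) = Complex (- (k$4)) (k$3)" "tau2 k $ (2,2) = Complex (- (k$2)) (k$1)"
  by (simp_all add: tau2_def tensor2_def spin_nth complex_eq_iff)

lemma tau1_nth: "tau1 (h, q) $ (1,1) = Complex (- (sqrt 2 * q$2)) (- (sqrt 2 * q$1))" "tau1 (h, q) $ (1,2) = Complex (- (h / sqrt 2)) (sqrt 2 * q$3)"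
  "tau1 (h, q) $ (2,1) = Complex (h / sqrt 2) (sqrt 2 * q$3)" "tau1 (h, q) $ (2,2) = Complex (- (sqrt 2 * q$2)) (sqrt 2 * q$1)"
  by (simp_all add: tau1_def tensor2_def spin_nth mat_def complex_eq_iff)

lemma real_form_tau2: "real_form tau2 UNIV UNIV"
proof (rule real_formI[where P = "\<lambda>t. let R = (\<lambda>a b. Re (t $ (a, b))); I = (\<lambda>a b. Im (t $ (a, b))) in
    vector [(I 2 2 - I 1 1) / 2, - (R 1 1 + R 2 2) / 2, (I 1 2 + I 2 1) / 2, (R 1 2 - R 2 1) / 2]"])
  show "linear tau2"
    by (rule linearI) (simp_all add: vec_eq_iff split_paired_All forall_2 tau2_nth complex_eq_iff)
qed (simp_all add: vec_eq_iff split_paired_All forall_2 forall_4 tau2_nth complex_eq_iff vector_4_nth field_simps)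

lemma real_form_tau1: "real_form tau1 UNIV UNIV"
proof (rule real_formI[where P = "\<lambda>t. let R = (\<lambda>a b. Re (t $ (a, b))); I = (\<lambda>a b. Im (t $ (a, b))) in
    ((R 2 1 - R 1 2) / sqrt 2, (1 / sqrt 2) *\<^sub>R vector [(I 2 2 - I 1 1) / 2, - (R 1 1 + R 2 2) / 2, (I 1 2 + I 2 1) / 2])"])
  show "linear tau1"
    by (rule linearI) (auto simp: vec_eq_iff split_paired_All forall_2 tau1_nth complex_eq_iff field_simps)
qed (auto simp: vec_eq_iff split_paired_All forall_2 forall_3 tau1_nth complex_eq_iff vector_3 field_simps)

lemma sym_last_nth: "t \<in> sym_last \<Longrightarrow> t $ (a, b, 2, 1) = t $ (a, b, 1, 2)"
  unfolding sym_last_def by blast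

lemma real_form_tau4: "real_form tau4 UNIV sym_last"
proof (rule real_formI[where P = tau4_real_part])
  show "linear tau4"
    by (rule linearI) (simp_all add: vec_eq_iff forall_spin4 forall_2 tau4_nth complex_eq_iff algebra_simps)
  have "tau4 a \<in> sym_last" for a
    by (auto simp: sym_last_def forall_2 tau4_nth)
  then show "tau4 ` UNIV \<subseteq> sym_last" by blast
  show "t = tau4 (tau4_real_part t) + \<i> *s tau4 (tau4_real_part ((- \<i>) *s t))" if t: "t \<in> sym_last" for t
    by (simp add: vec_eq_iff forall_spin4 forall_2 tau4_nth tau4_real_part_def Let_def sym_last_nth[OF t] complex_eq_iff vector_3 vector_4_nth field_simps)
  show "tau4_real_part (tau4 v + \<i> *s tau4 w) = v" for v w
    by (simp add: vec_eq_iff forall_3 forall_4 tau4_nth tau4_real_part_def Let_def vector_3 vector_4_nth field_simps)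
qed (simp_all add: sym_last_def)

lemma sym0_flat:
  assumes "h \<in> sym0 (mat 1)"
  shows "h$2$1 = h$1$2" "h$3$1 = h$1$3" "h$4$1 = h$1$4" "h$3$2 = h$2$3" "h$4$2 = h$2$4" "h$4$3 = h$3$4"
    "h$4$4 = - (h$1$1) - h$2$2 - h$3$3"
proof -
  have "matrix_inv (mat 1 :: real^4^4) = mat 1" by (rule matrix_inv_eqI) simp
  then have "transpose h = h" "trace h = 0" using assms by (simp_all add: sym0_def)
  then show "h$2$1 = h$1$2" "h$3$1 = h$1$3" "h$4$1 = h$1$4" "h$3$2 = h$2$3" "h$4$2 = h$2$4" "h$4$3 = h$3$4"
    "h$4$4 = - (h$1$1) - h$2$2 - h$3$3"
    by (auto simp: trace_def sum_4 intro: symmetric_nth)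
qed

lemma sym0_flatI:
  assumes "transpose h = h" "h$1$1 + h$2$2 + h$3$3 + h$4$4 = 0"
  shows "h \<in> sym0 (mat 1)"
proof -
  have "matrix_inv (mat 1 :: real^4^4) = mat 1" by (rule matrix_inv_eqI) simp
  then show ?thesis using assms by (simp add: sym0_def trace_def sum_4)
qed

lemma real_form_tau3: "real_form tau3 (UNIV \<times> sym0 (mat 1)) sym_last"
proof (rule real_formI[where P = tau3_real_part])
  show "linear tau3"
    by (rule linearI) (auto simp: vec_eq_iff forall_spin4 forall_2 tau3_nth complex_eq_iff algebra_simps)
  have "tau3 (q, h) \<in> sym_last" if h: "h \<in> sym0 (mat 1)" for q h
    by (simp add: sym_last_def forall_2 tau3_nth sym0_flat[OF h])
  then show "tau3 ` (UNIV \<times> sym0 (mat 1)) \<subseteq> sym_last" by auto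
  have "snd (tau3_real_part t) \<in> sym0 (mat 1)" for t
    by (rule sym0_flatI) (simp_all add: tau3_real_part_def Let_def vec_eq_iff transpose_nth forall_4 vector_4_nth field_simps)
  then show "tau3_real_part t \<in> UNIV \<times> sym0 (mat 1)" for t
    by (simp add: mem_Times_iff)
  show "t = tau3 (tau3_real_part t) + \<i> *s tau3 (tau3_real_part ((- \<i>) *s t))" if t: "t \<in> sym_last" for t
    by (simp add: vec_eq_iff forall_spin4 forall_2 tau3_nth tau3_real_part_def sym_last_nth[OF t] complex_eq_iff vector_3 vector_4_nth Let_def)
       (auto simp: field_simps)
  show "- v \<in> UNIV \<times> sym0 (mat 1)" if "v \<in> UNIV \<times> sym0 (mat 1)" for v :: "(real^3) \<times> (real^4^4)"
    using that by (auto simp: mem_Times_iff sym0_def transpose_minus matrix_linear_simps trace_def sum_negf)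
  show "tau3_real_part (tau3 v + \<i> *s tau3 w) = v"
    if "v \<in> UNIV \<times> sym0 (mat 1)" "w \<in> UNIV \<times> sym0 (mat 1)" for v w
  proof -
    obtain q h q' h' where vw: "v = (q, h)" "w = (q', h')" and h: "h \<in> sym0 (mat 1)" and h': "h' \<in> sym0 (mat 1)"
      using \<open>v \<in> _\<close> \<open>w \<in> _\<close> by auto
    show ?thesis
      unfolding vw by (simp add: vec_eq_iff forall_3 forall_4 tau3_nth tau3_real_part_def vector_3 vector_4_nth sym0_flat[OF h] sym0_flat[OF h'] Let_def)
  qed
qed (simp_all add: sym_last_def)

lemma quat_add: "quat (k + l) = quat k + quat l" and quat_scaleR: "quat (c *\<^sub>R k) = c *\<^sub>R quat k"
  by (simp_all add: vec_eq_iff forall_2 quat_nth complex_eq_iff)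

lemma linear_quat: "linear quat"
  by (rule linearI) (rule quat_add quat_scaleR)+

lemma linear_quat3: "linear quat3"
  by (rule linearI) (simp_all add: vec_eq_iff forall_2 quat3_nth complex_eq_iff)

lemma linear_hconj: "linear hconj"
  by (rule linearI) (simp_all add: vec_eq_iff hconj_nth)

lemma hconj_mult: "hconj (X ** Y) = hconj Y ** hconj X"
  by (simp add: vec_eq_iff hconj_nth matrix_matrix_mult_def mult.commute)

lemma hconj_hconj: "hconj (hconj X) = X"
  by (simp add: vec_eq_iff hconj_nth)

lemma linear_mult_left: "linear (\<lambda>X. A ** X)" and linear_mult_right: "linear (\<lambda>X. X ** A)" for A :: "complex^2^2"
  by (rule linearI; simp add: vec_eq_iff matrix_matrix_mult_def distrib_left distrib_right scaleR_sum_right sum.distrib)+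

lemma linear_pair_left: "linear (\<lambda>X. pair_tensor X Y)" and linear_cross_left: "linear (\<lambda>X. cross_tensor X Y)"
  and linear_pair_right: "linear (\<lambda>Y. pair_tensor X Y)" and linear_cross_right: "linear (\<lambda>Y. cross_tensor X Y)"
  by (rule linearI; simp add: vec_eq_iff pair_tensor_def cross_tensor_def algebra_simps)+

lemma linear_act4: "linear (act4 A B C D)"
  by (rule linearI; simp add: vec_eq_iff act4_def sum.distrib scaleR_sum_right distrib_left)+

lemma act2_tensor: "act2 A B (tensor2 X) = tensor2 (A ** X ** transpose B)"
proof -
  have "act2 A B (tensor2 X) $ (a, b) = (A ** X ** transpose B) $ a $ b" for a b
    unfolding act2_def tensor2_def
    by (simp add: matrix_matrix_mult_def transpose_def sum_2 algebra_simps)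
  then show ?thesis by (simp add: vec_eq_iff tensor2_def)
qed

lemma act4_pair: "act4 A B C D (pair_tensor X Y) = pair_tensor (A ** X ** transpose B) (C ** Y ** transpose D)"
  by (simp add: vec_eq_iff act4_def pair_tensor_def matrix_matrix_mult_def transpose_def sum_2 algebra_simps)

lemma act4_cross: "act4 A B C D (cross_tensor X Y) = cross_tensor (A ** X ** transpose C) (B ** Y ** transpose D)"
  by (simp add: vec_eq_iff act4_def cross_tensor_def matrix_matrix_mult_def transpose_def sum_2 algebra_simps)

text \<open>For unitary \<open>U\<close> of determinant \<open>1\<close>, invariance of the symplectic form
  converts the right factor \<open>U\<^sup>*\<close> of an action by conjugation into the transpose that acts on
  a second tensor index.\<close>

lemma SU2_symplectic:
  assumes "U \<in> SU2"
  shows "U ** symplectic ** transpose U = symplectic" "symplectic ** transpose U = hconj U ** symplectic" "hconj U ** U = mat 1"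
proof -
  have u: "U ** hconj U = mat 1" "det U = 1" using assms by (simp_all add: SU2_def)
  then show h: "hconj U ** U = mat 1" by (simp add: matrix_left_right_inverse)
  have "U$1$1 * U$2$2 = 1 + U$1$2 * U$2$1" using u(2) by (simp add: det_2 algebra_simps)
  then show s: "U ** symplectic ** transpose U = symplectic"
    by (simp add: vec_eq_iff forall_2 matrix_matrix_mult_def transpose_def sum_2 symplectic_nth algebra_simps)
  have "hconj U ** (U ** symplectic ** transpose U) = symplectic ** transpose U"
    by (simp add: matrix_mul_assoc h)
  then show "symplectic ** transpose U = hconj U ** symplectic" by (simp add: s)
qed

text \<open>A change of basis in one factor of a tensor can be moved to the other factor; this is how the
  rotations on the two indices of \<open>E \<otimes> \<Lambda>\<^sup>1\<close> and \<open>Sym\<^sup>2\<close>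
  reach the fixed basis vectors in \<open>tau3\<close> and \<open>tau4\<close>.\<close>

lemma transfer_sum:
  fixes c :: "'i::finite \<Rightarrow> 'j::finite \<Rightarrow> real"
  assumes l: "\<And>Y. linear (\<lambda>X. B X Y)" and r: "\<And>X. linear (\<lambda>Y. B X Y)"
  shows "(\<Sum>i\<in>UNIV. B (X i) (\<Sum>k\<in>UNIV. c i k *\<^sub>R Y k)) = (\<Sum>k\<in>UNIV. B (\<Sum>i\<in>UNIV. c i k *\<^sub>R X i) (Y k))"
  unfolding linear_sum[OF l] linear_sum[OF r] linear_cmul[OF l] linear_cmul[OF r] by (rule sum.swap)

lemma quat_rows: "(\<Sum>i\<in>UNIV. R $ i $ k *\<^sub>R quat (axis i 1)) = quat (R *v axis k 1)"
proof -
  have "R *v axis k 1 = (\<Sum>i\<in>UNIV. R $ i $ k *\<^sub>R axis i 1)"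
    by (simp add: matrix_vector_mult_basis column_def vec_eq_iff forall_4 sum_4 axis_nth)
  then show ?thesis by (simp add: linear_sum[OF linear_quat] linear_cmul[OF linear_quat])
qed

lemma quat3_rows: "(\<Sum>i\<in>UNIV. R $ i $ k *\<^sub>R quat3 (axis i 1)) = quat3 (R *v axis k 1)"
proof -
  have "R *v axis k 1 = (\<Sum>i\<in>UNIV. R $ i $ k *\<^sub>R axis i 1)"
    by (simp add: matrix_vector_mult_basis column_def vec_eq_iff forall_3 sum_3 axis_nth)
  then show ?thesis by (simp add: linear_sum[OF linear_quat3] linear_cmul[OF linear_quat3])
qed

lemma spin_action_symplectic:
  assumes "spin_action U V R r"
  shows "quat (R *v k) ** symplectic = V ** (quat k ** symplectic) ** transpose U"
    "quat3 (r *v q) ** symplectic = U ** (quat3 q ** symplectic) ** transpose U"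
    "hconj (quat (R *v k)) ** symplectic = U ** (hconj (quat k) ** symplectic) ** transpose V"
proof -
  have UV: "U \<in> SU2" "V \<in> SU2" and q: "quat (R *v k) = V ** quat k ** hconj U" "quat3 (r *v q) = U ** quat3 q ** hconj U" for k q
    using assms by (auto simp: spin_action_def)
  show "quat (R *v k) ** symplectic = V ** (quat k ** symplectic) ** transpose U"
    by (simp only: q SU2_symplectic(2)[OF UV(1)] matrix_mul_assoc[symmetric])
  show "quat3 (r *v q) ** symplectic = U ** (quat3 q ** symplectic) ** transpose U"
    by (simp only: q SU2_symplectic(2)[OF UV(1)] matrix_mul_assoc[symmetric])
  show "hconj (quat (R *v k)) ** symplectic = U ** (hconj (quat k) ** symplectic) ** transpose V"
    by (simp only: q hconj_mult hconj_hconj SU2_symplectic(2)[OF UV(2)] matrix_mul_assoc[symmetric])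
qed

lemma tau1_equivariant:
  assumes s: "spin_action U V R r"
  shows "tau1 (h, r *v q) = act2 U U (tau1 (h, q))"
proof -
  have U: "U \<in> SU2" using s by (simp add: spin_action_def)
  have i: "(c *\<^sub>R mat 1 + d *\<^sub>R X) ** symplectic = c *\<^sub>R symplectic + d *\<^sub>R (X ** symplectic)" for c d and X :: "complex^2^2"
    by (simp add: linear_add[OF linear_mult_right] linear_cmul[OF linear_mult_right])
  have "U ** (c *\<^sub>R symplectic + d *\<^sub>R (quat3 q ** symplectic)) ** transpose U
      = c *\<^sub>R symplectic + d *\<^sub>R (quat3 (r *v q) ** symplectic)" for c d
    unfolding spin_action_symplectic(2)[OF s]
    by (simp add: linear_add[OF linear_mult_left] linear_add[OF linear_mult_right] linear_cmul[OF linear_mult_left]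
        linear_cmul[OF linear_mult_right] SU2_symplectic(1)[OF U])
  then show ?thesis by (simp only: tau1_def fst_conv snd_conv act2_tensor i)
qed

lemma tau2_equivariant: "spin_action U V R r \<Longrightarrow> tau2 (R *v k) = act2 V U (tau2 k)"
  by (simp add: tau2_def act2_tensor spin_action_symplectic(1))

lemma tau3_equivariant:
  assumes s: "spin_action U V R r"
  shows "tau3 (r *v q, R ** h ** transpose R) = act4 V V U U (tau3 (q, h))"
proof -
  have V: "V \<in> SU2" using s by (simp add: spin_action_def)
  let ?F = "\<lambda>k. V ** (quat k ** symplectic) ** transpose U"
  have F: "?F (\<Sum>k\<in>UNIV. c k *\<^sub>R y k) = (\<Sum>k\<in>UNIV. c k *\<^sub>R ?F (y k))" for c :: "4 \<Rightarrow> real" and y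
    by (simp add: linear_sum[OF linear_quat] linear_cmul[OF linear_quat] linear_sum[OF linear_mult_left]
        linear_sum[OF linear_mult_right] linear_cmul[OF linear_mult_left] linear_cmul[OF linear_mult_right])
  have "(R ** h ** transpose R) $ m = R *v (\<Sum>k\<in>UNIV. R $ m $ k *\<^sub>R h $ k)" for m
    unfolding row_mult_transpose unfolding row_mult_sum[where A = R] ..
  then have "(\<Sum>m\<in>UNIV. cross_tensor (quat (axis m 1) ** symplectic) (quat ((R ** h ** transpose R) $ m) ** symplectic))
      = (\<Sum>m\<in>UNIV. cross_tensor (quat (axis m 1) ** symplectic) (\<Sum>k\<in>UNIV. R $ m $ k *\<^sub>R ?F (h $ k)))"
    by (simp only: spin_action_symplectic(1)[OF s] F)
  also have "\<dots> = (\<Sum>k\<in>UNIV. cross_tensor (\<Sum>m\<in>UNIV. R $ m $ k *\<^sub>R (quat (axis m 1) ** symplectic)) (?F (h $ k)))"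
    by (rule transfer_sum[OF linear_cross_left linear_cross_right])
  also have "\<dots> = (\<Sum>k\<in>UNIV. cross_tensor (?F (axis k 1)) (?F (h $ k)))"
  proof -
    have "(\<Sum>m\<in>UNIV. R $ m $ k *\<^sub>R (quat (axis m 1) ** symplectic)) = quat (R *v axis k 1) ** symplectic" for k
      unfolding quat_rows[symmetric] linear_sum[OF linear_mult_right] linear_cmul[OF linear_mult_right] ..
    then show ?thesis by (simp only: spin_action_symplectic(1)[OF s])
  qed
  finally have "(\<Sum>m\<in>UNIV. cross_tensor (quat (axis m 1) ** symplectic) (quat ((R ** h ** transpose R) $ m) ** symplectic))
      = act4 V V U U (\<Sum>k\<in>UNIV. cross_tensor (quat (axis k 1) ** symplectic) (quat (h $ k) ** symplectic))"
    by (simp only: linear_sum[OF linear_act4] act4_cross)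
  moreover have "pair_tensor symplectic (quat3 (r *v q) ** symplectic) = act4 V V U U (pair_tensor symplectic (quat3 q ** symplectic))"
    by (simp only: act4_pair SU2_symplectic(1)[OF V] spin_action_symplectic(2)[OF s])
  ultimately show ?thesis
    unfolding tau3_def fst_conv snd_conv linear_add[OF linear_act4] linear_neg[OF linear_act4] by (simp only:)
qed

lemma tau4_equivariant:
  assumes s: "spin_action U V R r"
  shows "tau4 (r ** a ** transpose R) = act4 U V U U (tau4 a)"
proof -
  let ?F = "\<lambda>k. U ** (hconj (quat k) ** symplectic) ** transpose V" and ?E = "\<lambda>i. quat3 (axis i 1) ** symplectic"
  have F: "?F (\<Sum>k\<in>UNIV. c k *\<^sub>R y k) = (\<Sum>k\<in>UNIV. c k *\<^sub>R ?F (y k))" for c :: "3 \<Rightarrow> real" and y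
    by (simp add: linear_sum[OF linear_quat] linear_cmul[OF linear_quat] linear_sum[OF linear_mult_left]
        linear_sum[OF linear_hconj] linear_cmul[OF linear_hconj]
        linear_sum[OF linear_mult_right] linear_cmul[OF linear_mult_left] linear_cmul[OF linear_mult_right])
  have "(r ** a ** transpose R) $ i = R *v (\<Sum>k\<in>UNIV. r $ i $ k *\<^sub>R a $ k)" for i
    unfolding row_mult_transpose unfolding row_mult_sum[where A = r] ..
  then have "(\<Sum>i\<in>UNIV. pair_tensor (hconj (quat ((r ** a ** transpose R) $ i)) ** symplectic) (?E i))
      = (\<Sum>i\<in>UNIV. pair_tensor (\<Sum>k\<in>UNIV. r $ i $ k *\<^sub>R ?F (a $ k)) (?E i))"
    by (simp only: spin_action_symplectic(3)[OF s] F)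
  also have "\<dots> = (\<Sum>k\<in>UNIV. pair_tensor (?F (a $ k)) (\<Sum>i\<in>UNIV. r $ i $ k *\<^sub>R ?E i))"
    by (rule transfer_sum[of "\<lambda>X Y. pair_tensor Y X", OF linear_pair_right linear_pair_left])
  also have "\<dots> = (\<Sum>k\<in>UNIV. pair_tensor (?F (a $ k)) (U ** ?E k ** transpose U))"
  proof -
    have "(\<Sum>i\<in>UNIV. r $ i $ k *\<^sub>R ?E i) = quat3 (r *v axis k 1) ** symplectic" for k
      unfolding quat3_rows[symmetric] linear_sum[OF linear_mult_right] linear_cmul[OF linear_mult_right] ..
    then show ?thesis by (simp only: spin_action_symplectic(2)[OF s])
  qed
  finally show ?thesis
    unfolding tau4_def linear_neg[OF linear_act4] linear_sum[OF linear_act4] act4_pair by (simp only:)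
qed


text \<open>Since \<open>quat (eta i k) = quat k quat3 e\<^sub>i\<close>, the triple acts by right
  multiplication, which commutes with Clifford multiplication; in components both sides are the same linear
  forms.\<close>

lemma dirac_flat_1:
  fixes v :: "real^4" and w :: "real^4^3"
  shows "tau2 (- (1 / sqrt 2) *\<^sub>R (v - 2 *\<^sub>R (\<Sum>i\<in>UNIV. eta i *v (w $ i))))
    = (\<Sum>a\<in>UNIV. act2 (quat (axis a 1)) (mat 1) (tau1 (v $ a, \<chi> i. w $ i $ a)))"
proof -
  have s: "y / sqrt 2 = y * sqrt 2 / 2" for y :: real by (simp add: field_simps)
  have a: "act2 X (mat 1) t $ (a, b) = (\<Sum>c\<in>UNIV. X $ a $ c * t $ (c, b))" for X t a b
    by (simp add: act2_def sum_2 mat_def forall_2) (use exhaust_2[of b] in auto)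
  show ?thesis
    by (simp add: vec_eq_iff split_paired_All forall_2 tau2_nth tau1_nth a sum_2 sum_3 sum_4 spin_nth complex_eq_iff s)
       (simp add: field_simps)
qed

lemma dirac_flat_2:
  fixes v :: "4 \<Rightarrow> real^3" and T :: "4 \<Rightarrow> real^4^4"
  assumes T: "\<And>a. T a \<in> sym0 (mat 1)"
  shows "tau4 (\<chi> i. (\<chi> a. v a $ i) + eta i *v contract3 (mat 1) T - contract3 (eta i) T)
    = (\<Sum>a\<in>UNIV. act4 (hconj (quat (axis a 1))) (mat 1) (mat 1) (mat 1) (tau3 (v a, T a)))"
proof -
  have a: "act4 X (mat 1) (mat 1) (mat 1) t $ (a, b, c, d) = (\<Sum>a'\<in>UNIV. X $ a $ a' * t $ (a', b, c, d))" for X t a b c d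
    using exhaust_2[of b] exhaust_2[of c] exhaust_2[of d] by (auto simp: act4_def sum_2 mat_def)
  let ?A = "\<chi> i. (\<chi> a. v a $ i) + eta i *v contract3 (mat 1) T - contract3 (eta i) T"
  have c: "contract3 (mat 1) T $ m = T 1 $ 1 $ m + T 2 $ 2 $ m + T 3 $ 3 $ m + T 4 $ 4 $ m" for m
    by (simp add: contract3_def sum_4 mat_1_nth)
  have e: "contract3 (eta 1) T $ m = T 1 $ 4 $ m - T 2 $ 3 $ m + T 3 $ 2 $ m - T 4 $ 1 $ m"
    "contract3 (eta 2) T $ m = T 1 $ 3 $ m + T 2 $ 4 $ m - T 3 $ 1 $ m - T 4 $ 2 $ m"
    "contract3 (eta 3) T $ m = - T 1 $ 2 $ m + T 2 $ 1 $ m + T 3 $ 4 $ m - T 4 $ 3 $ m" for m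
    by (simp_all add: contract3_def sum_4)
  have h: "hconj (quat (axis 1 1)) $ 1 $ 1 = 0" "hconj (quat (axis 1 1)) $ 1 $ 2 = - \<i>" "hconj (quat (axis 1 1)) $ 2 $ 1 = - \<i>" "hconj (quat (axis 1 1)) $ 2 $ 2 = 0"
    "hconj (quat (axis 2 1)) $ 1 $ 1 = 0" "hconj (quat (axis 2 1)) $ 1 $ 2 = -1" "hconj (quat (axis 2 1)) $ 2 $ 1 = 1" "hconj (quat (axis 2 1)) $ 2 $ 2 = 0"
    "hconj (quat (axis 3 1)) $ 1 $ 1 = - \<i>" "hconj (quat (axis 3 1)) $ 1 $ 2 = 0" "hconj (quat (axis 3 1)) $ 2 $ 1 = 0" "hconj (quat (axis 3 1)) $ 2 $ 2 = \<i>"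
    "hconj (quat (axis 4 1)) $ 1 $ 1 = 1" "hconj (quat (axis 4 1)) $ 1 $ 2 = 0" "hconj (quat (axis 4 1)) $ 2 $ 1 = 0" "hconj (quat (axis 4 1)) $ 2 $ 2 = 1"
    by (simp_all add: spin_nth complex_eq_iff)
  have "(\<Sum>x\<in>UNIV. act4 (hconj (quat (axis x 1))) (mat 1) (mat 1) (mat 1) (tau3 (v x, T x))) $ (a, b, c, d)
      = tau4 ?A $ (a, b, c, d)" for a b c d
    unfolding sum_component unfolding a sum_2 sum_4
    using exhaust_2[of a] exhaust_2[of b] exhaust_2[of c] exhaust_2[of d]
    apply (elim disjE)
    apply (simp_all only: h tau3_nth tau4_nth)
    apply (simp_all add: complex_eq_iff c e sym0_flat[OF T])
    done
  then show ?thesis by (simp add: vec_eq_iff)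
qed

section \<open>The two Dirac operators\<close>

context triple_manifold
begin

lemma frame_pd_E:
  fixes q :: "real^4 \<Rightarrow> real^3"
  assumes "smooth_on U q" "open U" "x \<in> U"
  shows "frame_pd e a q x = (\<chi> i. (e *v grad (\<lambda>y. q y $ i) x) $ a)"
proof -
  have "q differentiable (at x)" by (rule smooth_on_differentiable[OF assms(2,1,3)])
  then show ?thesis
    by (simp add: frame_pd_def vec_eq_iff sum_component grad_def matrix_vector_mult_def pd_nth)
qed

lemma dirac_D4: "dirac_SpSp A Sg g D4"
  unfolding dirac_SpSp_def
proof (intro exI[of _ tau1] exI[of _ tau2] conjI real_form_tau1 real_form_tau2 allI impI ballI)
  fix U V R r assume s: "spin_action U V R r"
  show "tau1 (h, r *v q) = act2 U U (tau1 (h, q))" for h q by (rule tau1_equivariant[OF s])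
  show "tau2 (R *v k) = act2 V U (tau2 k)" for k by (rule tau2_equivariant[OF s])
next
  fix c x assume c: "c \<in> A" and x: "x \<in> cdom c"
  show "\<exists>e. adapted_frame (Sg c x) (g c x) e"
    using triple_chart.ex_adapted[OF on_chart[OF c] x] unfolding adapted_def .
next
  fix c x e and u :: "('m, real \<times> (real^3)) field"
  assume c: "c \<in> A" and x: "x \<in> cdom c" and e: "adapted_frame (Sg c x) (g c x) e"
    and u: "u \<in> sections A (L0_bundle \<oplus>\<^sub>b E_bundle)"
  interpret triple_chart "cdom c" "Sg c" "g c" by (rule on_chart[OF c])
  interpret a: adapted "Sg c x" "g c x" e by unfold_locales (rule e)
  note eqs = adapted_eqs[OF a.adapted_axioms]
  have sm: "smooth_on (cdom c) (u c)" using u c by (simp add: bundle_defs)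
  have sq: "smooth_on (cdom c) (\<lambda>y. snd (u c y))" by (intro smooth_rules sm)
  let ?w = "\<chi> i. e *v grad (\<lambda>y. snd (u c y) $ i) x"
  have "e *v D4 (Sg c) (g c) (u c) x
      = - (1 / sqrt 2) *\<^sub>R (e *v grad (\<lambda>y. fst (u c y)) x - 2 *\<^sub>R (\<Sum>i\<in>UNIV. eta i *v (?w $ i)))"
    using a.frame_M[unfolded eqs]
    by (simp add: op_D4 matrix_linear_simps matrix_vector_mult_diff_distrib linear_sum[OF matrix_vector_mul_linear])
  moreover have "frame_pd e a (\<lambda>y. fst (u c y)) x = (e *v grad (\<lambda>y. fst (u c y)) x) $ a" for a
    by (simp add: frame_pd_def grad_def matrix_vector_mult_def)
  moreover have "frame_pd e a (\<lambda>y. snd (u c y)) x = (\<chi> i. ?w $ i $ a)" for a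
    using frame_pd_E[OF sq opn x] by simp
  ultimately show "tau2 (e *v D4 (Sg c) (g c) (u c) x)
      = (\<Sum>a\<in>UNIV. act2 (quat (axis a 1)) (mat 1) (tau1 (frame_pd e a (\<lambda>y. fst (u c y)) x, frame_pd e a (\<lambda>y. snd (u c y)) x)))"
    by (simp only: dirac_flat_1)
qed

lemma dirac_D12: "dirac_SmSmSp2 A Sg g D12"
  unfolding dirac_SmSmSp2_def
proof (intro exI[of _ tau3] exI[of _ tau4] conjI real_form_tau3 real_form_tau4 allI impI ballI)
  fix U V R r assume s: "spin_action U V R r"
  show "tau3 (r *v q, R ** h ** transpose R) = act4 V V U U (tau3 (q, h))" for q h by (rule tau3_equivariant[OF s])
  show "tau4 (r ** a ** transpose R) = act4 U V U U (tau4 a)" for a by (rule tau4_equivariant[OF s])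
next
  fix c x assume c: "c \<in> A" and x: "x \<in> cdom c"
  show "\<exists>e. adapted_frame (Sg c x) (g c x) e"
    using triple_chart.ex_adapted[OF on_chart[OF c] x] unfolding adapted_def .
next
  fix c x e and u :: "('m, (real^3) \<times> (real^4^4)) field"
  assume c: "c \<in> A" and x: "x \<in> cdom c" and e: "adapted_frame (Sg c x) (g c x) e"
    and u: "u \<in> sections A (E_bundle \<oplus>\<^sub>b Sym_bundle g)"
  interpret triple_chart "cdom c" "Sg c" "g c" by (rule on_chart[OF c])
  interpret a: adapted "Sg c x" "g c x" e by unfold_locales (rule e)
  note eqs = adapted_eqs[OF a.adapted_axioms]
  have sm: "smooth_on (cdom c) (u c)" and u0: "snd (u c y) \<in> sym0 (g c y)" if "y \<in> cdom c" for y
    using u c that by (simp_all add: bundle_defs)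
  have sq: "smooth_on (cdom c) (\<lambda>y. fst (u c y))" and sT: "smooth_on (cdom c) (\<lambda>y. snd (u c y))"
    by (intro smooth_rules sm[OF x])+
  have T: "transpose (snd (u c y)) = snd (u c y)" "G y \<bullet> snd (u c y) = 0" if "y \<in> cdom c" for y
    using u0[OF that] sym0_iff'[OF that] by auto
  let ?T = "cov2 (g c) (\<lambda>y. snd (u c y)) x"
  have fr: "frame_nabla2 (g c) e a (\<lambda>y. snd (u c y)) x = frame3 e ?T a" for a
  proof -
    have "(\<chi> \<mu> \<nu>. \<Sum>\<rho>\<in>UNIV. e$a$\<rho> * nabla (g c) (ten2 (\<lambda>y. snd (u c y))) x [\<rho>, \<mu>, \<nu>]) = (\<Sum>\<rho>\<in>UNIV. e$a$\<rho> *\<^sub>R ?T \<rho>)"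
      by (simp add: vec_eq_iff sum_component nabla_ten2[OF diff[OF sT x]])
    then show ?thesis
      by (simp add: frame_nabla2_def frame3_def matrix_sum_simps matrix_scaleR_left matrix_scaleR_right)
  qed
  have f0: "frame3 e ?T a \<in> sym0 (mat 1)" for a
  proof (rule sym0_flatI)
    show "transpose (frame3 e ?T a) = frame3 e ?T a"
      by (simp add: frame3_def transpose_sum transpose_scaleR a.frame_transpose cov2_sym[OF x sT T(1)])
    have "trace (e ** ?T \<mu> ** transpose e) = 0" for \<mu>
      using a.trace_frame[of "?T \<mu>"] cov2_trace_free[OF x sT T(2)] by (simp add: eqs)
    moreover have "trace (k *\<^sub>R X) = k * trace X" for k and X :: "real^4^4"
      by (simp add: trace_def sum_distrib_left)
    ultimately have "trace (frame3 e ?T a) = 0"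
      by (simp add: frame3_def sum_4 trace_add)
    then show "frame3 e ?T a $ 1 $ 1 + frame3 e ?T a $ 2 $ 2 + frame3 e ?T a $ 3 $ 3 + frame3 e ?T a $ 4 $ 4 = 0"
      by (simp add: trace_def sum_4)
  qed
  have cG: "e *v contract3 (G x) ?T = contract3 (mat 1) (frame3 e ?T)"
    using a.frame_contract3[of "mat 1" ?T] a.G_eq by (simp add: eqs)
  have cK: "e *v contract3 (K i x) ?T = contract3 (eta i) (frame3 e ?T)" for i
    using a.frame_contract3[of "eta i" ?T] a.K_eq[of i] by (simp add: eqs)
  have "D12 (Sg c) (g c) (u c) x ** transpose e
      = (\<chi> i. (\<chi> a. frame_pd e a (\<lambda>y. fst (u c y)) x $ i) + eta i *v contract3 (mat 1) (frame3 e ?T) - contract3 (eta i) (frame3 e ?T))"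
  proof (rule matrix_eq_rows)
    fix i
    have "e *v (D12 (Sg c) (g c) (u c) x $ i)
        = e *v grad (\<lambda>y. fst (u c y) $ i) x + eta i *v contract3 (mat 1) (frame3 e ?T) - contract3 (eta i) (frame3 e ?T)"
      using op_D12[OF x sT T(1)] a.frame_M[unfolded eqs]
      by (simp add: matrix_linear_simps matrix_vector_mult_diff_distrib cG cK)
    then show "(D12 (Sg c) (g c) (u c) x ** transpose e) $ i
        = (\<chi> i. (\<chi> a. frame_pd e a (\<lambda>y. fst (u c y)) x $ i) + eta i *v contract3 (mat 1) (frame3 e ?T) - contract3 (eta i) (frame3 e ?T)) $ i"
      by (simp add: row_mult_transpose frame_pd_E[OF sq opn x])
  qed
  then show "tau4 (D12 (Sg c) (g c) (u c) x ** transpose e)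
      = (\<Sum>a\<in>UNIV. act4 (hconj (quat (axis a 1))) (mat 1) (mat 1) (mat 1)
          (tau3 (frame_pd e a (\<lambda>y. fst (u c y)) x, frame_nabla2 (g c) e a (\<lambda>y. snd (u c y)) x)))"
    by (simp only: fr dirac_flat_2[OF f0])
qed

section \<open>Bundle maps\<close>

lemma zero_sym0: "0 \<in> sym0 h"
  by (simp add: sym0_def trace_def transpose_def zero_vec_def matrix_matrix_mult_def)

lemma bundle_map_positive_part: "bundle_map A (SB \<oplus>\<^sub>b EB) (SB \<oplus>\<^sub>b EB) (\<lambda>c x. positive_part)"
  unfolding bundle_map_def
proof (intro conjI ballI)
  show "linear positive_part"
    by (rule linearI) (simp_all add: positive_part_def algebra_simps)
  show "positive_part ` fib (SB \<oplus>\<^sub>b EB) c x \<subseteq> fib (SB \<oplus>\<^sub>b EB) c x" for c x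
    by (auto simp: bundle_sum_def S_bundle_def E_bundle_def positive_part_def zero_sym0)
  fix s assume s: "s \<in> sections A (SB \<oplus>\<^sub>b EB)"
  show "(\<lambda>c x. positive_part (s c x)) \<in> sections A (SB \<oplus>\<^sub>b EB)"
    unfolding sections_SE
  proof (intro conjI ballI)
    show "smooth_on (cdom c) (\<lambda>x. positive_part (s c x))" if c: "c \<in> A" for c
    proof -
      interpret triple_chart "cdom c" "Sg c" "g c" by (rule on_chart[OF c])
      have "smooth_on (cdom c) (s c)" using s c by (simp add: sections_SE)
      then show ?thesis unfolding positive_part_def by (intro smooth_rules)
    qed
  next
    fix c c' x assume "c \<in> A" "c' \<in> A" "x \<in> overlap c c'"
    then have "s c x = ((fst (fst (s c' (transition c c' x))), fst (snd (fst (s c' (transition c c' x)))),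
        trL c c' x ** snd (snd (fst (s c' (transition c c' x)))) ** transpose (trL c c' x)), snd (s c' (transition c c' x)))"
      using s unfolding sections_SE by blast
    then show "positive_part (s c x) = ((fst (fst (positive_part (s c' (transition c c' x)))), fst (snd (fst (positive_part (s c' (transition c c' x))))),
        trL c c' x ** snd (snd (fst (positive_part (s c' (transition c c' x))))) ** transpose (trL c c' x)), snd (positive_part (s c' (transition c c' x))))"
      by (simp add: positive_part_def)
  qed (simp add: positive_part_def zero_sym0)
qed

lemma bundle_map_mixing: "bundle_map A (SB \<oplus>\<^sub>b EB) (SB \<oplus>\<^sub>b EB) (\<lambda>c x. mixing)"
  unfolding bundle_map_def
proof (intro conjI ballI)
  show "linear mixing"
    by (rule linearI) (simp_all add: mixing_def algebra_simps)
  show "mixing ` fib (SB \<oplus>\<^sub>b EB) c x \<subseteq> fib (SB \<oplus>\<^sub>b EB) c x" for c x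
    by (auto simp: bundle_sum_def S_bundle_def E_bundle_def mixing_def)
  fix s assume s: "s \<in> sections A (SB \<oplus>\<^sub>b EB)"
  show "(\<lambda>c x. mixing (s c x)) \<in> sections A (SB \<oplus>\<^sub>b EB)"
    unfolding sections_SE
  proof (intro conjI ballI)
    show "smooth_on (cdom c) (\<lambda>x. mixing (s c x))" if c: "c \<in> A" for c
    proof -
      interpret triple_chart "cdom c" "Sg c" "g c" by (rule on_chart[OF c])
      have "smooth_on (cdom c) (s c)" using s c by (simp add: sections_SE)
      then show ?thesis unfolding mixing_def by (intro smooth_rules)
    qed
    show "snd (snd (fst (mixing (s c x)))) \<in> sym0 (g c x)" if "c \<in> A" "x \<in> cdom c" for c x
      using s that by (simp add: sections_SE mixing_def)
  next
    fix c c' x assume "c \<in> A" "c' \<in> A" "x \<in> overlap c c'"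
    then have "s c x = ((fst (fst (s c' (transition c c' x))), fst (snd (fst (s c' (transition c c' x)))),
        trL c c' x ** snd (snd (fst (s c' (transition c c' x)))) ** transpose (trL c c' x)), snd (s c' (transition c c' x)))"
      using s unfolding sections_SE by blast
    then show "mixing (s c x) = ((fst (fst (mixing (s c' (transition c c' x)))), fst (snd (fst (mixing (s c' (transition c c' x))))),
        trL c c' x ** snd (snd (fst (mixing (s c' (transition c c' x))))) ** transpose (trL c c' x)), snd (mixing (s c' (transition c c' x))))"
      by (simp add: mixing_def)
  qed
qed

lemma bundle_map_intertwiner: "bundle_map A (TB \<oplus>\<^sub>b ELB) (TB \<oplus>\<^sub>b ELB) (\<lambda>c x. intertwiner (Sg c x) (g c x))"
  unfolding bundle_map_def
proof (intro conjI ballI)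
  show "linear (intertwiner (Sg c x) (g c x))" for c x
    by (rule linearI)
       (simp_all add: intertwiner_def Let_def vec_eq_iff sum_3 matrix_linear_simps matrix_vector_mult_diff_distrib algebra_simps)
  show "intertwiner (Sg c x) (g c x) ` fib (TB \<oplus>\<^sub>b ELB) c x \<subseteq> fib (TB \<oplus>\<^sub>b ELB) c x" for c x
    by (auto simp: bundle_sum_def T_bundle_def EL_bundle_def)
  fix s assume s: "s \<in> sections A (TB \<oplus>\<^sub>b ELB)"
  show "(\<lambda>c x. intertwiner (Sg c x) (g c x) (s c x)) \<in> sections A (TB \<oplus>\<^sub>b ELB)"
    unfolding sections_TEL
  proof (intro conjI ballI)
    show "smooth_on (cdom c) (\<lambda>x. intertwiner (Sg c x) (g c x) (s c x))" if c: "c \<in> A" for c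
    proof -
      interpret triple_chart "cdom c" "Sg c" "g c" by (rule on_chart[OF c])
      have "smooth_on (cdom c) (s c)" using s c by (simp add: sections_TEL)
      then show ?thesis unfolding intertwiner_def Let_def by (intro smooth_rules smooth_mixS[OF c])
    qed
  next
    fix c c' x assume cx: "c \<in> A" "c' \<in> A" "x \<in> overlap c c'"
    then have "s c x = (trL c c' x *v fst (s c' (transition c c' x)), \<chi> i. trL c c' x *v (snd (s c' (transition c c' x)) $ i))"
      using s unfolding sections_TEL by blast
    then show "intertwiner (Sg c x) (g c x) (s c x)
        = (trL c c' x *v fst (intertwiner (Sg c' (transition c c' x)) (g c' (transition c c' x)) (s c' (transition c c' x))),
           \<chi> i. trL c c' x *v (snd (intertwiner (Sg c' (transition c c' x)) (g c' (transition c c' x)) (s c' (transition c c' x))) $ i))"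
      by (simp add: intertwiner_def Let_def M_change_trL[OF cx] matrix_linear_simps matrix_vector_mult_diff_distrib sum_3)
  qed
qed

lemma positive_part_idem: "positive_part (positive_part u) = positive_part u"
proof -
  have ss: "sqrt 2 * (sqrt 2 * z) = 2 * z" for z :: real
    by (simp add: mult.assoc[symmetric])
  show ?thesis by (auto simp: positive_part_def prod_eq_iff vec_eq_iff algebra_simps ss)
qed

abbreviation "Dop \<equiv> Dt (glob dt1_adjoint Sg g) (glob dt3_adjoint Sg g) 1 Sg g"

lemma Dop_local: "Dop u c = (\<lambda>y. (dt1_adjoint (Sg c) (g c) (\<lambda>y. fst (u c y)) y + dt4 1 (Sg c) (g c) (\<lambda>y. snd (u c y)) y,
   d2 (Sg c) (g c) (\<lambda>y. fst (u c y)) y + dt3_adjoint (Sg c) (g c) (\<lambda>y. snd (u c y)) y))"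
  by (simp add: Dt_def glob_def Let_def)

lemma square_global:
  assumes u: "u \<in> sections A (SB \<oplus>\<^sub>b EB)"
  shows "feq A (\<lambda>c x. positive_part (u c x)) u \<Longrightarrow>
      feq A (glob D_adjoint Sg g (Dop u)) (\<lambda>c x. glob Lap Sg g u c x + glob Curv Sg g u c x)"
    and "feq A (\<lambda>c x. positive_part (u c x)) (\<lambda>c x. 0) \<Longrightarrow>
      feq A (glob D_adjoint Sg g (Dop u)) (\<lambda>c x. - (glob Lap Sg g u c x + glob Curv Sg g u c x))"
proof -
  have sm: "smooth_on (cdom c) (u c)" "\<forall>y\<in>cdom c. snd (snd (fst (u c y))) \<in> sym0 (g c y)" if "c \<in> A" for c
    using u that by (auto simp: sections_SE)
  show "feq A (glob D_adjoint Sg g (Dop u)) (\<lambda>c x. glob Lap Sg g u c x + glob Curv Sg g u c x)"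
    if "feq A (\<lambda>c x. positive_part (u c x)) u"
    unfolding feq_def glob_def Dop_local[unfolded glob_def]
  proof (intro ballI)
    fix c x assume c: "c \<in> A" and x: "x \<in> cdom c"
    show "D_adjoint (Sg c) (g c) (\<lambda>y. (dt1_adjoint (Sg c) (g c) (\<lambda>y. fst (u c y)) y + dt4 1 (Sg c) (g c) (\<lambda>y. snd (u c y)) y,
        d2 (Sg c) (g c) (\<lambda>y. fst (u c y)) y + dt3_adjoint (Sg c) (g c) (\<lambda>y. snd (u c y)) y)) x
      = Lap (Sg c) (g c) (u c) x + Curv (Sg c) (g c) (u c) x"
      by (rule triple_chart.square_signs(1)[OF on_chart[OF c] x sm[OF c]]) (use that c in \<open>auto simp: feq_def\<close>)
  qed
  show "feq A (glob D_adjoint Sg g (Dop u)) (\<lambda>c x. - (glob Lap Sg g u c x + glob Curv Sg g u c x))"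
    if "feq A (\<lambda>c x. positive_part (u c x)) (\<lambda>c x. 0)"
    unfolding feq_def glob_def Dop_local[unfolded glob_def]
  proof (intro ballI)
    fix c x assume c: "c \<in> A" and x: "x \<in> cdom c"
    show "D_adjoint (Sg c) (g c) (\<lambda>y. (dt1_adjoint (Sg c) (g c) (\<lambda>y. fst (u c y)) y + dt4 1 (Sg c) (g c) (\<lambda>y. snd (u c y)) y,
        d2 (Sg c) (g c) (\<lambda>y. fst (u c y)) y + dt3_adjoint (Sg c) (g c) (\<lambda>y. snd (u c y)) y)) x
      = - (Lap (Sg c) (g c) (u c) x + Curv (Sg c) (g c) (u c) x)"
      by (rule triple_chart.square_signs(2)[OF on_chart[OF c] x sm[OF c]]) (use that c in \<open>auto simp: feq_def\<close>)
  qed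
qed

lemma expressions_global:
  shows "\<xi> \<in> sections A TB \<Longrightarrow> feq A (glob (dt1 (- sqrt 2) 0 (sqrt 2 / 2)) Sg g \<xi>)
      (\<lambda>c x. (sqrt 2 / 2) *\<^sub>R glob d1 Sg g \<xi> c x + (- (sqrt 2 / 2)) *\<^sub>R glob d2_adjoint Sg g (glob Phi_adjoint Sg g \<xi>) c x)"
    and "a \<in> sections A ELB \<Longrightarrow> feq A (glob (dt3 (- sqrt 2) (- sqrt 2 / 2)) Sg g a)
      (\<lambda>c x. (- (sqrt 2 / 2)) *\<^sub>R glob d3 Sg g (glob J1 Sg g a) c x)"
    and "\<chi>' \<in> sections A EB \<Longrightarrow> feq A (glob (dt4 1) Sg g \<chi>') (\<lambda>c x. 1 *\<^sub>R glob Phi Sg g (glob d3_adjoint Sg g \<chi>') c x)"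
  unfolding feq_def glob_def
  by (intro ballI triple_chart.dt1_expression[OF on_chart], assumption+, simp add: sections_T)
     (intro ballI triple_chart.dt3_expression[OF on_chart], assumption+, simp add: sections_EL,
      intro ballI triple_chart.dt4_expression[OF on_chart])

lemma intertwining_global:
  assumes u: "u \<in> sections A (L0_bundle \<oplus>\<^sub>b E_bundle)" and w: "w \<in> sections A (E_bundle \<oplus>\<^sub>b Sym_bundle g)"
  shows "feq A (\<lambda>c x. intertwiner (Sg c x) (g c x) (Dop (\<lambda>c x. mixing ((fst (u c x), snd (u c x), snd (w c x)), fst (w c x))) c x))
    (\<lambda>c x. (glob D4 Sg g u c x, glob D12 Sg g w c x))"
  unfolding feq_def glob_def Dop_local[unfolded glob_def]
proof (intro ballI)
  fix c x assume c: "c \<in> A" and x: "x \<in> cdom c"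
  have "smooth_on (cdom c) (u c)" "smooth_on (cdom c) (w c)" "\<And>y. y \<in> cdom c \<Longrightarrow> snd (w c y) \<in> sym0 (g c y)"
    using u w c by (auto simp: bundle_defs)
  from triple_chart.intertwining[OF on_chart[OF c] x this]
  show "intertwiner (Sg c x) (g c x)
      (dt1_adjoint (Sg c) (g c) (\<lambda>y. fst (mixing ((fst (u c y), snd (u c y), snd (w c y)), fst (w c y)))) x
        + dt4 1 (Sg c) (g c) (\<lambda>y. snd (mixing ((fst (u c y), snd (u c y), snd (w c y)), fst (w c y)))) x,
       d2 (Sg c) (g c) (\<lambda>y. fst (mixing ((fst (u c y), snd (u c y), snd (w c y)), fst (w c y)))) x
        + dt3_adjoint (Sg c) (g c) (\<lambda>y. snd (mixing ((fst (u c y), snd (u c y), snd (w c y)), fst (w c y)))) x)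
    = (D4 (Sg c) (g c) (u c) x, D12 (Sg c) (g c) (w c) x)" by simp
qed

end

theorem theorem3:
  fixes A :: "'m::{t2_space,second_countable_topology} chart set"
    and Sg :: "('m, triple) field"
    and g :: "('m, real^4^4) field"
  assumes "smooth_atlas A" and "perfect_triple A Sg" and "triple_metric A Sg g"
  shows "\<exists>\<beta>1 \<beta>2 \<beta>3 a1 a2 a3 c1 c2 f :: real.
    \<exists>dt1_adj dt3_adj d2_adj d3_adj Phi_adj D_adj.
      let S = S_bundle g \<beta>1 \<beta>2 \<beta>3; T = T_bundle g; EL = EL_bundle Sg;
          SE = S \<oplus>\<^sub>b E_bundle; TEL = T \<oplus>\<^sub>b EL;
          D = Dt dt1_adj dt3_adj f Sg g
      in
        \<beta>1 > 0 \<and> \<beta>2 > 0 \<and> \<beta>3 > 0 \<and>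
        formal_adjoint A Sg T S (glob (dt1 a1 a2 a3) Sg g) dt1_adj \<and>
        formal_adjoint A Sg EL E_bundle (glob (dt3 c1 c2) Sg g) dt3_adj \<and>
        formal_adjoint A Sg S EL (glob d2 Sg g) d2_adj \<and>
        formal_adjoint A Sg EL E_bundle (glob d3 Sg g) d3_adj \<and>
        formal_adjoint A Sg EL T (glob Phi Sg g) Phi_adj \<and>
        formal_adjoint A Sg SE TEL D D_adj \<and>
        (\<exists>P. bundle_map A SE SE P \<and>
           (\<forall>c\<in>A. \<forall>x\<in>cdom c. \<forall>u\<in>fib SE c x. P c x (P c x u) = P c x u) \<and>
           (\<forall>u\<in>sections A SE. feq A (\<lambda>c x. P c x (u c x)) u \<longrightarrow>
              feq A (D_adj (D u)) (\<lambda>c x. glob Lap Sg g u c x + glob Curv Sg g u c x)) \<and>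
           (\<forall>u\<in>sections A SE. feq A (\<lambda>c x. P c x (u c x)) (\<lambda>c x. 0) \<longrightarrow>
              feq A (D_adj (D u)) (\<lambda>c x. - (glob Lap Sg g u c x + glob Curv Sg g u c x)))) \<and>
        (\<exists>p q r s :: real.
           (\<forall>\<xi>\<in>sections A T. feq A (glob (dt1 a1 a2 a3) Sg g \<xi>)
              (\<lambda>c x. p *\<^sub>R glob d1 Sg g \<xi> c x + q *\<^sub>R d2_adj (Phi_adj \<xi>) c x)) \<and>
           (\<forall>a\<in>sections A EL. feq A (glob (dt3 c1 c2) Sg g a)
              (\<lambda>c x. r *\<^sub>R glob d3 Sg g (glob J1 Sg g a) c x)) \<and>
           (\<forall>\<chi>'\<in>sections A E_bundle. feq A (glob (dt4 f) Sg g \<chi>')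
              (\<lambda>c x. s *\<^sub>R glob Phi Sg g (d3_adj \<chi>') c x))) \<and>
        (\<exists>T1 T2. bundle_map A SE SE T1 \<and> bundle_map A TEL TEL T2 \<and>
           (\<forall>u\<in>sections A (L0_bundle \<oplus>\<^sub>b E_bundle). \<forall>w\<in>sections A (E_bundle \<oplus>\<^sub>b Sym_bundle g).
              feq A
                (\<lambda>c x. T2 c x (D (\<lambda>c x. T1 c x
                   ((fst (u c x), snd (u c x), snd (w c x)), fst (w c x))) c x))
                (\<lambda>c x. (glob D4 Sg g u c x, glob D12 Sg g w c x)))) \<and>
        dirac_SpSp A Sg g D4 \<and>
        dirac_SmSmSp2 A Sg g D12"
proof -
  interpret triple_manifold A Sg g by (rule triple_manifold.intro[OF assms])
  \<comment> \<open>The constants are those for which the mixed terms of \<open>D\<^sup>* D\<close> cancel in \<open>square_at_point\<close>; the weights on \<open>S\<close> enter through the adjoints.\<close>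
  show ?thesis
    unfolding Let_def
  proof (rule exI[of _ "1/4"], rule exI[of _ 8], rule exI[of _ 1], rule exI[of _ "- sqrt 2"], rule exI[of _ 0],
      rule exI[of _ "sqrt 2 / 2"], rule exI[of _ "- sqrt 2"], rule exI[of _ "- sqrt 2 / 2"], rule exI[of _ 1],
      rule exI[of _ "glob dt1_adjoint Sg g"], rule exI[of _ "glob dt3_adjoint Sg g"], rule exI[of _ "glob d2_adjoint Sg g"],
      rule exI[of _ "glob d3_adjoint Sg g"], rule exI[of _ "glob Phi_adjoint Sg g"], rule exI[of _ "glob D_adjoint Sg g"],
      intro conjI adjoints dirac_D4 dirac_D12)
    show "\<exists>P. bundle_map A (SB \<oplus>\<^sub>b EB) (SB \<oplus>\<^sub>b EB) P \<and>
       (\<forall>c\<in>A. \<forall>x\<in>cdom c. \<forall>u\<in>fib (SB \<oplus>\<^sub>b EB) c x. P c x (P c x u) = P c x u) \<and>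
       (\<forall>u\<in>sections A (SB \<oplus>\<^sub>b EB). feq A (\<lambda>c x. P c x (u c x)) u \<longrightarrow>
          feq A (glob D_adjoint Sg g (Dop u)) (\<lambda>c x. glob Lap Sg g u c x + glob Curv Sg g u c x)) \<and>
       (\<forall>u\<in>sections A (SB \<oplus>\<^sub>b EB). feq A (\<lambda>c x. P c x (u c x)) (\<lambda>c x. 0) \<longrightarrow>
          feq A (glob D_adjoint Sg g (Dop u)) (\<lambda>c x. - (glob Lap Sg g u c x + glob Curv Sg g u c x)))"
      using bundle_map_positive_part positive_part_idem square_global by blast
    show "\<exists>p q r s :: real.
       (\<forall>\<xi>\<in>sections A TB. feq A (glob (dt1 (- sqrt 2) 0 (sqrt 2 / 2)) Sg g \<xi>)
          (\<lambda>c x. p *\<^sub>R glob d1 Sg g \<xi> c x + q *\<^sub>R glob d2_adjoint Sg g (glob Phi_adjoint Sg g \<xi>) c x)) \<and>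
       (\<forall>a\<in>sections A ELB. feq A (glob (dt3 (- sqrt 2) (- sqrt 2 / 2)) Sg g a)
          (\<lambda>c x. r *\<^sub>R glob d3 Sg g (glob J1 Sg g a) c x)) \<and>
       (\<forall>\<chi>'\<in>sections A E_bundle. feq A (glob (dt4 1) Sg g \<chi>')
          (\<lambda>c x. s *\<^sub>R glob Phi Sg g (glob d3_adjoint Sg g \<chi>') c x))"
      using expressions_global by blast
    show "\<exists>T1 T2. bundle_map A (SB \<oplus>\<^sub>b EB) (SB \<oplus>\<^sub>b EB) T1 \<and> bundle_map A (TB \<oplus>\<^sub>b ELB) (TB \<oplus>\<^sub>b ELB) T2 \<and>
       (\<forall>u\<in>sections A (L0_bundle \<oplus>\<^sub>b E_bundle). \<forall>w\<in>sections A (E_bundle \<oplus>\<^sub>b Sym_bundle g).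
          feq A (\<lambda>c x. T2 c x (Dop (\<lambda>c x. T1 c x ((fst (u c x), snd (u c x), snd (w c x)), fst (w c x))) c x))
            (\<lambda>c x. (glob D4 Sg g u c x, glob D12 Sg g w c x)))"
      using bundle_map_mixing bundle_map_intertwiner intertwining_global by blast
  qed simp_all
qed

end
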